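(* Assume the hypotheses [Convexity], [Dynamics], [Running cost], [Terminal cost] and [Inner ball] stated in the context, that $g$ is locally semiconcave and that the value function $V$ is continuous. Let $x\in(\mathrm{int}\,\mathcal R)\setminus\mathcal S$. (i) If $H$ is $C^1$ on $\mathbb{R}^d\times(\mathbb{R}^d\setminus\{0\})$, then $\partial^{*}V(x)\subseteq N_1^{\dagger}(x)$. If in addition $N^P_{\mathrm{hypo}(V)}(x,V(x))$ is pointed, then $$\partial^{P}V(x)= \partial^{\infty}V(x)+\mathrm{co}\big[N^{\dagger}_1(x)\big].$$ (ii) If $H^0$ is $C^1$ on $\mathbb{R}^d\times(\mathbb{R}^d\setminus\{0\})$, then $\partial^{*,\infty}V(x)\subseteq N_0^{\dagger}(x)$. If in addition $N^P_{\mathrm{hypo}(V)}(x,V(x))$ is pointed, then $$\partial^{\infty}V(x)=\mathrm{co}\big[ N^{\dagger}_0(x)\cup \{0\}\big].$$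
   Context: Setting. $U\subset\mathbb{R}^m$ is nonempty and compact, $\mathcal S\subseteq\mathbb{R}^d$ is nonempty and closed (the target), $\mathcal S^c=\mathbb{R}^d\setminus\mathcal S$, and $f:\mathbb{R}^d\times U\to\mathbb{R}^d$, $r:\mathbb{R}^d\times U\to\mathbb{R}$, $g:\mathbb{R}^d\to\mathbb{R}$ are given. For $x\in\mathbb{R}^d$ and a measurable control $u:[0,\infty)\to U$, $y^{x,u}$ is the Carath\'eodory solution of $y'(s)=f(y(s),u(s))$, $y(0)=x$, and $\tau^{x,u}=\min\{t\ge 0:y^{x,u}(t)\in\mathcal S\}$ ($+\infty$ if $\mathcal S$ is never reached). The value function is $V(x)=\inf_u\big(\int_0^{\tau^{x,u}}r(y^{x,u}(s),u(s))\,ds+g(y^{x,u}(\tau^{x,u}))\big)$, the infimum being over measurable controls with $\tau^{x,u}<\infty$ ($V(x)=+\infty$ if there are none). $\mathcal R=\{x:\tau^{x,u}<\infty\text{ for some }u\}$. "$V$ is continuous" means continuous on $\mathcal R$. A control $u^*$ is optimal for $x$ if $\tau^{x,u^*}<\infty$ and it attains the infimum; $\mathcal U_x$ is the set of controls optimal for $x$. $H(x,p)=\max_{\omega\in U}\{-p\cdot f(x,\omega)-r(x,\omega)\}$ and $H^0(x,p)=\max_{\omega\in U}\{-p\cdot f(x,\omega)\}$. Hypotheses (with constants $N,L,r_0,\rho_0>0$). [Convexity] For every $x$ the set $\{(v,\lambda)\in\mathbb{R}^d\times\mathbb{R}:\exists\omega\in U,\ v=f(x,\omega),\ \lambda\ge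 r(x,\omega)\}$ is convex. [Dynamics] $f$ is continuous, $|f|<N$; $D_xf$ exists everywhere and is continuous in $(x,u)$; $|f(y,\omega)-f(x,\omega)|\le L|y-x|$ and $|D_xf(y,\omega)-D_xf(x,\omega)|\le L|y-x|$ for all $x,y\in\mathbb{R}^d$, $\omega\in U$. [Running cost] $r$ is continuous and differentiable in $x$, $D_xr$ is continuous, $|r(y,\omega)-r(x,\omega)|+|D_xr(y,\omega)-D_xr(x,\omega)|\le L|y-x|$ for all $x,y,\omega$, and $r(x,\omega)\ge r_0$ for all $x,\omega$. [Terminal cost] There are a neighborhood $\mathcal N$ of $\partial\mathcal S$ and $0\le G<r_0/N$ with $|g(y)-g(x)|\le G|y-x|$ for $x,y\in\mathcal N$. [Inner ball] For every $x\in\partial\mathcal S$ there is a unit $\xi_x\in N^P_{\overline{\mathcal S^c}}(x)$ with $\xi_x\cdot(y-x)\le\frac1{2\rho_0}|y-x|^2$ for all $y\in\overline{\mathcal S^c}$. Nonsmooth notions. For a set $Q$ and $x\in Q$, $v\in N^P_Q(x)$ (proximal normal) iff there is $\sigma\ge0$ with $v\cdot(y-x)\le\sigma|y-x|^2$ for all $y\in Q$. $\mathrm{hypo}(V)=\{(z,\beta)\in\overline{\mathcal S^c}\times\mathbb{R}:\beta\le V(z)\}$. $\partial^PV(x)=\{v:(-v,1)\in N^P_{\mathrm{hypo}(V)}(x,V(x))\}$, $\partial^\infty V(x)=\{v:(-v,0)\in N^P_{\mathrm{hypo}(V)}(x,V(x))\}$. A cone $C$ is pointed if $C\cap(-C)=\{0\}$.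 $\partial^*V(x)$ is the set of limits $\lim DV(x_n)$ with $x_n\to x$, $x_n\ne x$, $V$ differentiable at $x_n$; $\partial^{*,\infty}V(x)$ is the set of $v\ne0$ such that $\frac v{|v|}=\lim\frac{DV(x_n)}{|DV(x_n)|}$ and $|DV(x_n)|\to\infty$ for some such sequence. $g$ is locally semiconcave if every point has a ball $B$ and $c>0$ with $(1-\lambda)g(x_0)+\lambda g(x_1)-g((1-\lambda)x_0+\lambda x_1)\le c\lambda(1-\lambda)|x_0-x_1|^2$ for $x_0,x_1\in B$, $\lambda\in[0,1]$. $D^+g(x)=\{p:\limsup_{y\to x}\frac{g(y)-g(x)-p\cdot(y-x)}{|y-x|}\le0\}$. $\mathrm{co}$ is the convex hull. Transported normals. For $x^*\in\partial\mathcal S$: $N_0(x^* )=\{0\ne\xi\in N^P_{\overline{\mathcal S^c}}(x^* ):\max_{\omega\in U}\xi\cdot f(x^*,\omega)=0\}$, $N_1(x^* )=\{\xi\in N^P_{\overline{\mathcal S^c}}(x^* ):\max_{\omega\in U}\xi\cdot f(x^*,\omega)>0\}$. For $x\in\mathcal S^c$: $N_0^\dagger(x)$ is the set of $p(0)$ where $p$ solves $p'(t)=-D_x^Tf(y^{x,u^*}(t),u^*(t))p(t)$, $p(\tau^{x,u^*})=-\xi^*$, for some $u^*\in\mathcal U_x$ and $\xi^*\in N_0(y^{x,u^*}(\tau^{x,u^*}))$. $N_1^\dagger(x)$ is the set of $p(0)$ where $p$ solves $p'(t)=-D_x^Tf(y^{x,u^*}(t),u^*(t))p(t)-D_xr(y^{x,u^*}(t),u^*(t))$,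 $p(\tau^{x,u^*})=q^*-\xi^*$, for some $u^*\in\mathcal U_x$ and, with $x^*=y^{x,u^*}(\tau^{x,u^*})$, some $\xi^*\in N_1(x^* )$, $q^*\in D^+g(x^* )$ satisfying $H(x^*,q^*-\xi^* )=0$. *)

theory Defs
  imports "HOL-Analysis.Analysis"
begin

section \<open>Absolutely continuous functions and Caratheodory solutions\<close>

text \<open>The members of a division are nonempty compact intervals with pairwise disjoint
  interiors, so \<open>D\<close> ranges over all finite nonoverlapping families of subintervals of \<open>[a, b]\<close>.\<close>

definition absolutely_continuous_fun_on :: "(real \<Rightarrow> 'a::euclidean_space) \<Rightarrow> real \<Rightarrow> real \<Rightarrow> bool" where
  "absolutely_continuous_fun_on y a b \<longleftrightarrow>
     (\<forall>\<epsilon>>0. \<exists>\<delta>>0. \<forall>D. D division_of \<Union>D \<and> \<Union>D \<subseteq> {a..b} \<and> (\<Sum>k\<in>D. Sup k - Inf k) < \<delta> \<longrightarrow>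
        (\<Sum>k\<in>D. norm (y (Sup k) - y (Inf k))) < \<epsilon>)"

definition caratheodory_solution ::
  "real set \<Rightarrow> (real \<Rightarrow> 'a::euclidean_space \<Rightarrow> 'a) \<Rightarrow> (real \<Rightarrow> 'a) \<Rightarrow> bool" where
  "caratheodory_solution I F y \<longleftrightarrow>
     (\<forall>a b. a \<le> b \<and> {a..b} \<subseteq> I \<longrightarrow> absolutely_continuous_fun_on y a b) \<and>
     (AE t in lebesgue_on I. (y has_vector_derivative F t (y t)) (at t within I))"


section \<open>The exit-time problem\<close>

text \<open>The data \<open>f\<close>, \<open>r\<close> are total functions here; their values for controls outside \<open>U\<close> are
  never used.\<close>

definition controls :: "(real^'m) set \<Rightarrow> (real \<Rightarrow> real^'m) set" where
  "controls U = {u. u \<in> borel_measurable (lebesgue_on {0..}) \<and> (\<forall>t\<ge>0. u t \<in> U)}"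

text \<open>Under the assumption on the dynamics a solution exists and its values on \<open>[0, \<infinity>)\<close> are
  unique. Only these values are used; a function on the whole real line is otherwise
  undetermined for negative times, hence the choice operator.\<close>

definition traj :: "(real^'d \<Rightarrow> real^'m \<Rightarrow> real^'d) \<Rightarrow> real^'d \<Rightarrow> (real \<Rightarrow> real^'m) \<Rightarrow> real \<Rightarrow> real^'d" where
  "traj f x u = (SOME y. caratheodory_solution {0..} (\<lambda>s z. f z (u s)) y \<and> y 0 = x)"

definition hit_time :: "(real^'d \<Rightarrow> real^'m \<Rightarrow> real^'d) \<Rightarrow> (real^'d) set \<Rightarrow> real^'d \<Rightarrow> (real \<Rightarrow> real^'m) \<Rightarrow> ereal" where
  "hit_time f S x u =
     (if \<exists>t\<ge>0. traj f x u t \<in> S then ereal (LEAST t. 0 \<le> t \<and> traj f x u t \<in> S) else \<infinity>)"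

text \<open>The following two notions are meaningful only if the target is reached.\<close>

definition exit_time :: "(real^'d \<Rightarrow> real^'m \<Rightarrow> real^'d) \<Rightarrow> (real^'d) set \<Rightarrow> real^'d \<Rightarrow> (real \<Rightarrow> real^'m) \<Rightarrow> real" where
  "exit_time f S x u = real_of_ereal (hit_time f S x u)"

definition exit_point :: "(real^'d \<Rightarrow> real^'m \<Rightarrow> real^'d) \<Rightarrow> (real^'d) set \<Rightarrow> real^'d \<Rightarrow> (real \<Rightarrow> real^'m) \<Rightarrow> real^'d" where
  "exit_point f S x u = traj f x u (exit_time f S x u)"

definition admissible :: "(real^'d \<Rightarrow> real^'m \<Rightarrow> real^'d) \<Rightarrow> (real^'m) set \<Rightarrow> (real^'d) set \<Rightarrow> real^'d \<Rightarrow> (real \<Rightarrow> real^'m) set" where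
  "admissible f U S x = {u \<in> controls U. hit_time f S x u < \<infinity>}"

definition reachable :: "(real^'d \<Rightarrow> real^'m \<Rightarrow> real^'d) \<Rightarrow> (real^'m) set \<Rightarrow> (real^'d) set \<Rightarrow> (real^'d) set" where
  "reachable f U S = {x. \<exists>u\<in>controls U. hit_time f S x u < \<infinity>}"

definition cost ::
  "(real^'d \<Rightarrow> real^'m \<Rightarrow> real^'d) \<Rightarrow> (real^'d \<Rightarrow> real^'m \<Rightarrow> real) \<Rightarrow> (real^'d \<Rightarrow> real) \<Rightarrow> (real^'d) set \<Rightarrow>
   real^'d \<Rightarrow> (real \<Rightarrow> real^'m) \<Rightarrow> real" where
  "cost f r g S x u =
     (LINT s|lebesgue_on {0..exit_time f S x u}. r (traj f x u s) (u s)) + g (exit_point f S x u)"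

definition value_fun ::
  "(real^'d \<Rightarrow> real^'m \<Rightarrow> real^'d) \<Rightarrow> (real^'d \<Rightarrow> real^'m \<Rightarrow> real) \<Rightarrow> (real^'d \<Rightarrow> real) \<Rightarrow>
   (real^'m) set \<Rightarrow> (real^'d) set \<Rightarrow> real^'d \<Rightarrow> ereal" where
  "value_fun f r g U S x = (INF u\<in>admissible f U S x. ereal (cost f r g S x u))"

definition optimal_controls ::
  "(real^'d \<Rightarrow> real^'m \<Rightarrow> real^'d) \<Rightarrow> (real^'d \<Rightarrow> real^'m \<Rightarrow> real) \<Rightarrow> (real^'d \<Rightarrow> real) \<Rightarrow>
   (real^'m) set \<Rightarrow> (real^'d) set \<Rightarrow> real^'d \<Rightarrow> (real \<Rightarrow> real^'m) set" where
  "optimal_controls f r g U S x =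
     {u \<in> admissible f U S x. ereal (cost f r g S x u) = value_fun f r g U S x}"

text \<open>In both Hamiltonians the supremum is a maximum, since \<open>U\<close> is nonempty and compact and the
  maximized function is continuous.\<close>

definition Ham :: "(real^'d \<Rightarrow> real^'m \<Rightarrow> real^'d) \<Rightarrow> (real^'d \<Rightarrow> real^'m \<Rightarrow> real) \<Rightarrow> (real^'m) set \<Rightarrow>
    real^'d \<Rightarrow> real^'d \<Rightarrow> real" where
  "Ham f r U x p = (SUP w\<in>U. - (p \<bullet> f x w) - r x w)"

definition Ham0 :: "(real^'d \<Rightarrow> real^'m \<Rightarrow> real^'d) \<Rightarrow> (real^'m) set \<Rightarrow> real^'d \<Rightarrow> real^'d \<Rightarrow> real" where
  "Ham0 f U x p = (SUP w\<in>U. - (p \<bullet> f x w))"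


section \<open>Derivatives and nonsmooth notions\<close>

text \<open>The unique gradient if \<open>h\<close> is differentiable at \<open>x\<close>; unspecified otherwise.\<close>

definition gradient :: "('a::real_inner \<Rightarrow> real) \<Rightarrow> 'a \<Rightarrow> 'a" where
  "gradient h x = (THE D. GDERIV h x :> D)"

definition Dxf :: "(real^'d \<Rightarrow> real^'m \<Rightarrow> real^'d) \<Rightarrow> real^'d \<Rightarrow> real^'m \<Rightarrow> real^'d^'d" where
  "Dxf f x w = jacobian (\<lambda>z. f z w) (at x)"

definition Dxr :: "(real^'d \<Rightarrow> real^'m \<Rightarrow> real) \<Rightarrow> real^'d \<Rightarrow> real^'m \<Rightarrow> real^'d" where
  "Dxr r x w = gradient (\<lambda>z. r z w) x"

definition C1_on :: "'a::real_inner set \<Rightarrow> ('a \<Rightarrow> real) \<Rightarrow> bool" where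
  "C1_on A h \<longleftrightarrow> (\<exists>h'. (\<forall>z\<in>A. GDERIV h z :> h' z) \<and> continuous_on A h')"

definition proximal_normals :: "'a::real_inner set \<Rightarrow> 'a \<Rightarrow> 'a set" where
  "proximal_normals Q x =
     {v. x \<in> Q \<and> (\<exists>\<sigma>\<ge>0. \<forall>y\<in>Q. v \<bullet> (y - x) \<le> \<sigma> * (norm (y - x))\<^sup>2)}"

definition hypograph :: "(real^'d) set \<Rightarrow> (real^'d \<Rightarrow> ereal) \<Rightarrow> ((real^'d) \<times> real) set" where
  "hypograph S V = {(z, \<beta>). z \<in> closure (- S) \<and> ereal \<beta> \<le> V z}"

text \<open>\<open>real_of_ereal (V x)\<close> is the value of \<open>V\<close> at \<open>x\<close> wherever \<open>V\<close> is finite.\<close>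

definition hypo_normals :: "(real^'d) set \<Rightarrow> (real^'d \<Rightarrow> ereal) \<Rightarrow> real^'d \<Rightarrow> ((real^'d) \<times> real) set" where
  "hypo_normals S V x = proximal_normals (hypograph S V) (x, real_of_ereal (V x))"

definition prox_superdiff :: "(real^'d) set \<Rightarrow> (real^'d \<Rightarrow> ereal) \<Rightarrow> real^'d \<Rightarrow> (real^'d) set" where
  "prox_superdiff S V x = {v. (- v, 1) \<in> hypo_normals S V x}"

definition horizon_superdiff :: "(real^'d) set \<Rightarrow> (real^'d \<Rightarrow> ereal) \<Rightarrow> real^'d \<Rightarrow> (real^'d) set" where
  "horizon_superdiff S V x = {v. (- v, 0) \<in> hypo_normals S V x}"

definition pointed :: "'a::real_vector set \<Rightarrow> bool" where
  "pointed C \<longleftrightarrow> C \<inter> uminus ` C = {0}"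

text \<open>Differentiability of an extended-real function includes finiteness near the point; this
  has to be required because \<open>real_of_ereal\<close> maps \<open>\<infinity>\<close> to \<open>0\<close>.\<close>

definition has_gradient_ereal :: "(real^'d \<Rightarrow> ereal) \<Rightarrow> real^'d \<Rightarrow> real^'d \<Rightarrow> bool" where
  "has_gradient_ereal V x p \<longleftrightarrow>
     (\<forall>\<^sub>F z in nhds x. \<bar>V z\<bar> \<noteq> \<infinity>) \<and> GDERIV (\<lambda>z. real_of_ereal (V z)) x :> p"

definition limiting_gradients :: "(real^'d \<Rightarrow> ereal) \<Rightarrow> real^'d \<Rightarrow> (real^'d) set" where
  "limiting_gradients V x =
     {v. \<exists>X P. (\<forall>n. X n \<noteq> x \<and> has_gradient_ereal V (X n) (P n)) \<and>
          X \<longlonglongrightarrow> x \<and> P \<longlonglongrightarrow> v}"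

definition horizon_limiting_gradients :: "(real^'d \<Rightarrow> ereal) \<Rightarrow> real^'d \<Rightarrow> (real^'d) set" where
  "horizon_limiting_gradients V x =
     {v. v \<noteq> 0 \<and> (\<exists>X P. (\<forall>n. X n \<noteq> x \<and> has_gradient_ereal V (X n) (P n)) \<and> X \<longlonglongrightarrow> x \<and>
          (\<lambda>n. P n /\<^sub>R norm (P n)) \<longlonglongrightarrow> v /\<^sub>R norm v \<and>
          filterlim (\<lambda>n. norm (P n)) at_top sequentially)}"

definition locally_semiconcave :: "(real^'d \<Rightarrow> real) \<Rightarrow> bool" where
  "locally_semiconcave g \<longleftrightarrow>
     (\<forall>x. \<exists>\<rho>>0. \<exists>c>0. \<forall>x0\<in>ball x \<rho>. \<forall>x1\<in>ball x \<rho>. \<forall>l\<in>{0..1}.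
        (1 - l) * g x0 + l * g x1 - g ((1 - l) *\<^sub>R x0 + l *\<^sub>R x1)
          \<le> c * l * (1 - l) * (norm (x0 - x1))\<^sup>2)"

definition superdiff :: "(real^'d \<Rightarrow> real) \<Rightarrow> real^'d \<Rightarrow> (real^'d) set" where
  "superdiff g x =
     {p. Limsup (at x) (\<lambda>y. ereal ((g y - g x - p \<bullet> (y - x)) / norm (y - x))) \<le> 0}"


section \<open>Transported normals\<close>

definition normals0 :: "(real^'d \<Rightarrow> real^'m \<Rightarrow> real^'d) \<Rightarrow> (real^'m) set \<Rightarrow> (real^'d) set \<Rightarrow> real^'d \<Rightarrow> (real^'d) set" where
  "normals0 f U S z =
     {\<xi> \<in> proximal_normals (closure (- S)) z. \<xi> \<noteq> 0 \<and> (SUP w\<in>U. \<xi> \<bullet> f z w) = 0}"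

definition normals1 :: "(real^'d \<Rightarrow> real^'m \<Rightarrow> real^'d) \<Rightarrow> (real^'m) set \<Rightarrow> (real^'d) set \<Rightarrow> real^'d \<Rightarrow> (real^'d) set" where
  "normals1 f U S z =
     {\<xi> \<in> proximal_normals (closure (- S)) z. (SUP w\<in>U. \<xi> \<bullet> f z w) > 0}"

definition transported_normals0 ::
  "(real^'d \<Rightarrow> real^'m \<Rightarrow> real^'d) \<Rightarrow> (real^'d \<Rightarrow> real^'m \<Rightarrow> real) \<Rightarrow> (real^'d \<Rightarrow> real) \<Rightarrow>
   (real^'m) set \<Rightarrow> (real^'d) set \<Rightarrow> real^'d \<Rightarrow> (real^'d) set" where
  "transported_normals0 f r g U S x =
     {p 0 | p u \<xi>. u \<in> optimal_controls f r g U S x \<and>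
        \<xi> \<in> normals0 f U S (exit_point f S x u) \<and>
        caratheodory_solution {0..exit_time f S x u}
          (\<lambda>t q. - (transpose (Dxf f (traj f x u t) (u t)) *v q)) p \<and>
        p (exit_time f S x u) = - \<xi>}"

definition transported_normals1 ::
  "(real^'d \<Rightarrow> real^'m \<Rightarrow> real^'d) \<Rightarrow> (real^'d \<Rightarrow> real^'m \<Rightarrow> real) \<Rightarrow> (real^'d \<Rightarrow> real) \<Rightarrow>
   (real^'m) set \<Rightarrow> (real^'d) set \<Rightarrow> real^'d \<Rightarrow> (real^'d) set" where
  "transported_normals1 f r g U S x =
     {p 0 | p u \<xi> q. u \<in> optimal_controls f r g U S x \<and>
        \<xi> \<in> normals1 f U S (exit_point f S x u) \<and>
        q \<in> superdiff g (exit_point f S x u) \<and>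
        Ham f r U (exit_point f S x u) (q - \<xi>) = 0 \<and>
        caratheodory_solution {0..exit_time f S x u}
          (\<lambda>t z. - (transpose (Dxf f (traj f x u t) (u t)) *v z) - Dxr r (traj f x u t) (u t)) p \<and>
        p (exit_time f S x u) = q - \<xi>}"


section \<open>Standing assumptions\<close>

definition convexity_assm ::
  "(real^'d \<Rightarrow> real^'m \<Rightarrow> real^'d) \<Rightarrow> (real^'d \<Rightarrow> real^'m \<Rightarrow> real) \<Rightarrow> (real^'m) set \<Rightarrow> bool" where
  "convexity_assm f r U \<longleftrightarrow> (\<forall>x. convex {(v, l). \<exists>w\<in>U. v = f x w \<and> r x w \<le> l})"

text \<open>The matrix norm is the operator norm.\<close>

definition dynamics_assm ::
  "(real^'d \<Rightarrow> real^'m \<Rightarrow> real^'d) \<Rightarrow> (real^'m) set \<Rightarrow> real \<Rightarrow> real \<Rightarrow> bool" where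
  "dynamics_assm f U N L \<longleftrightarrow>
     continuous_on (UNIV \<times> U) (\<lambda>(x, w). f x w) \<and>
     (\<forall>x. \<forall>w\<in>U. norm (f x w) < N) \<and>
     (\<forall>x. \<forall>w\<in>U. (\<lambda>z. f z w) differentiable (at x)) \<and>
     continuous_on (UNIV \<times> U) (\<lambda>(x, w). Dxf f x w) \<and>
     (\<forall>x y. \<forall>w\<in>U. norm (f y w - f x w) \<le> L * norm (y - x)) \<and>
     (\<forall>x y. \<forall>w\<in>U. onorm (\<lambda>h. (Dxf f y w - Dxf f x w) *v h) \<le> L * norm (y - x))"

definition running_cost_assm ::
  "(real^'d \<Rightarrow> real^'m \<Rightarrow> real) \<Rightarrow> (real^'m) set \<Rightarrow> real \<Rightarrow> real \<Rightarrow> bool" where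
  "running_cost_assm r U L r0 \<longleftrightarrow>
     continuous_on (UNIV \<times> U) (\<lambda>(x, w). r x w) \<and>
     (\<forall>x. \<forall>w\<in>U. (\<lambda>z. r z w) differentiable (at x)) \<and>
     continuous_on (UNIV \<times> U) (\<lambda>(x, w). Dxr r x w) \<and>
     (\<forall>x y. \<forall>w\<in>U. \<bar>r y w - r x w\<bar> + norm (Dxr r y w - Dxr r x w) \<le> L * norm (y - x)) \<and>
     (\<forall>x. \<forall>w\<in>U. r0 \<le> r x w)"

definition terminal_cost_assm :: "(real^'d \<Rightarrow> real) \<Rightarrow> (real^'d) set \<Rightarrow> real \<Rightarrow> real \<Rightarrow> bool" where
  "terminal_cost_assm g S N r0 \<longleftrightarrow>
     (\<exists>W G. open W \<and> frontier S \<subseteq> W \<and> 0 \<le> G \<and> G < r0 / N \<and>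
        (\<forall>x\<in>W. \<forall>y\<in>W. \<bar>g y - g x\<bar> \<le> G * norm (y - x)))"

definition inner_ball_assm :: "(real^'d) set \<Rightarrow> real \<Rightarrow> bool" where
  "inner_ball_assm S \<rho>0 \<longleftrightarrow>
     (\<forall>x\<in>frontier S. \<exists>\<xi>\<in>proximal_normals (closure (- S)) x. norm \<xi> = 1 \<and>
        (\<forall>y\<in>closure (- S). \<xi> \<bullet> (y - x) \<le> 1 / (2 * \<rho>0) * (norm (y - x))\<^sup>2))"

end

(* Near an interior point of the reachable set every nearly optimal control carries an adjoint arc
   with a terminal value q - xi that satisfies the maximality condition at the exit point. Comparing
   with the trajectory of the same control from a nearby point, completed by a short constant control
   if it misses the target, shows that (- p(0), lam) is, up to the error in optimality, a proximal
   normal to the hypograph of V, with a constant that is locally uniform. In particular, V is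
   differentiable wherever it is touched from below by a smooth function, and gradients of V are
   initial values of such arcs.

   For arcs starting at points X n -> x, dynamic programming along the arcs gives the maximum principle
   in the limit; differentiability of the Hamiltonian makes the maximizing velocity unique, so the
   velocities converge almost everywhere and a measurable selection yields an optimal control.

   For the equalities, let E be the compact set of limits of (- DV(X n), 1) / (|DV(X n)| + 1), X n -> x.
   If a proximal normal were outside the cone generated by E, a hyperplane would bound the directional
   derivatives of V near x in a direction in which, by a mean value argument, V would grow faster than
   the proximal normal inequality allows. *)
theory Submission
  imports Defs "HOL-Complex_Analysis.Great_Picard"
begin

section \<open>Absolutely continuous functions\<close>

text \<open>\<open>V\<close> need not be Lipschitz, so every arc carries a multiplier
  \<open>lam\<close> \<ge> 0 for the cost. \<open>Hl lam\<close> joins \<open>Ham\<close>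
  (\<open>lam = 1\<close>) to \<open>Ham0\<close> (\<open>lam = 0\<close>), and the two parts of the
  theorem are the cases of a positive and of a zero limit multiplier. What makes the limits possible
  is uniformity: one number \<open>B\<close> bounds the exit time, the multiplier, the normal and
  the curvatures of the target and of \<open>g\<close>, and all constants of the perturbation
  estimates are explicit in \<open>B\<close>. The source of this uniformity is
  \<open>\<kappa> = r0 - G * N\<close> > 0, the least rate at which the running cost outweighs what
  the terminal cost can gain along a trajectory. It bounds exit times, shows that a terminal
  covector without normal part violates the terminal condition, bounds the time shift of perturbed
  exits, and keeps the limit trajectory off the target before the limit exit time. Arcs start from
  nearly optimal controls because an optimal one appears only at the end of the limit argument.
  Pointedness serves to keep 0 out of the convex hull of the limits of normals, without which no
  strict separation would be available.\<close>

lemma AE_lebesgue_on_iff_negligible: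
  fixes I :: "'a::euclidean_space set"
  assumes "I \<in> sets lebesgue"
  shows "(AE t in lebesgue_on I. P t) \<longleftrightarrow> negligible {t \<in> I. \<not> P t}"
proof -
  have "(AE t in lebesgue_on I. P t) \<longleftrightarrow> (AE t in lebesgue. t \<in> I \<longrightarrow> P t)"
    using assms by (simp add: AE_restrict_space_iff)
  also have "\<dots> \<longleftrightarrow> negligible {t \<in> I. \<not> P t}"
  proof
    assume "AE t in lebesgue. t \<in> I \<longrightarrow> P t"
    then obtain E where E: "{t \<in> space lebesgue. \<not> (t \<in> I \<longrightarrow> P t)} \<subseteq> E" "emeasure lebesgue E = 0" "E \<in> sets lebesgue"
      by (rule AE_E)
    then have "negligible E" unfolding negligible_iff_null_sets by (intro null_setsI)
    then show "negligible {t \<in> I. \<not> P t}"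
      by (rule negligible_subset) (use E in auto)
  next
    assume "negligible {t \<in> I. \<not> P t}"
    then show "AE t in lebesgue. t \<in> I \<longrightarrow> P t"
      by (intro AE_I') (auto simp: negligible_iff_null_sets)
  qed
  finally show ?thesis .
qed

text \<open>The two kinds of tags of a fine division are treated separately. Outside
  \<open>E\<close> the derivative controls the increment of \<open>y\<close>. At tags in
  \<open>E\<close> absolute continuity does, because the gauge forces their intervals into an open
  set of measure below the \<delta> of absolute continuity.\<close>

lemma AC_has_integral:
  fixes y :: "real \<Rightarrow> 'a::euclidean_space"
  assumes ac: "absolutely_continuous_fun_on y a b" and "a \<le> b"
    and N: "negligible E"
    and der: "\<And>t. t \<in> {a..b} - E \<Longrightarrow> (y has_vector_derivative h t) (at t within {a..b})"
  shows "(h has_integral (y b - y a)) {a..b}"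
proof -
  \<comment> \<open>With the value 0 on \<open>E\<close>, intervals tagged in \<open>E\<close>
    contribute nothing to the Riemann sum.\<close>
  define h' where "h' t = (if t \<in> E then 0 else h t)" for t
  have main: "\<exists>\<gamma>. gauge \<gamma> \<and> (\<forall>\<D>. \<D> tagged_division_of cbox a b \<and> \<gamma> fine \<D> \<longrightarrow>
            norm ((\<Sum>(x, k)\<in>\<D>. measure lborel k *\<^sub>R h' x) - (y b - y a)) < e)" if e: "e > 0" for e
  proof -
    obtain \<delta> where \<delta>: "\<delta> > 0" and ac': "\<And>D. D division_of \<Union>D \<Longrightarrow> \<Union>D \<subseteq> {a..b} \<Longrightarrow> (\<Sum>k\<in>D. Sup k - Inf k) < \<delta> \<Longrightarrow>
        (\<Sum>k\<in>D. norm (y (Sup k) - y (Inf k))) < e/2"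
      using ac[unfolded absolutely_continuous_fun_on_def, rule_format, of "e/2"] e by auto
    have "\<exists>O'. open O' \<and> E \<subseteq> O' \<and> O' \<in> lmeasurable \<and> measure lebesgue O' < \<delta>"
    proof -
      have "E \<in> lmeasurable" "measure lebesgue E = 0"
        using N negligible_imp_measurable negligible_imp_measure0 by auto
      obtain T where T: "open T" "E \<subseteq> T" "T - E \<in> lmeasurable" "emeasure lebesgue (T - E) < ennreal \<delta>"
        using sets_lebesgue_outer_open[OF fmeasurableD[OF \<open>E \<in> lmeasurable\<close>] \<delta>] by metis
      have TE: "T = (T - E) \<union> E" using T by auto
      have "T \<in> lmeasurable" using T(3) \<open>E \<in> lmeasurable\<close> TE fmeasurable.Un by metis
      moreover have "measure lebesgue T \<le> measure lebesgue (T - E) + measure lebesgue E"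
        using T(3) \<open>E \<in> lmeasurable\<close> TE measure_Un_le[of "T - E" lebesgue E] by (metis fmeasurableD)
      moreover have "measure lebesgue (T - E) < \<delta>"
        using T(3,4) \<delta> by (simp add: emeasure_eq_measure2 ennreal_less_iff)
      ultimately show ?thesis using \<open>measure lebesgue E = 0\<close> T by auto
    qed
    then obtain O' where O': "open O'" "E \<subseteq> O'" "O' \<in> lmeasurable" "measure lebesgue O' < \<delta>" by blast
    \<comment> \<open>The summand 1 covers the case \<open>a = b\<close>.\<close>
    define e' where "e' = e / (2 * (b - a + 1))"
    have e': "e' > 0" using e \<open>a \<le> b\<close> by (auto simp: e'_def)
    have "\<exists>d>0. \<forall>z\<in>{a..b}. \<bar>z - t\<bar> < d \<longrightarrow> norm (y z - y t - (z - t) *\<^sub>R h t) \<le> e' * \<bar>z - t\<bar>" if "t \<in> {a..b} - E" for t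
      using der[OF that] e' unfolding has_vector_derivative_def has_derivative_within_alt by (auto simp: real_norm_def)
    then obtain d where d: "\<And>t. t \<in> {a..b} - E \<Longrightarrow> d t > 0"
      "\<And>t z. t \<in> {a..b} - E \<Longrightarrow> z\<in>{a..b} \<Longrightarrow> \<bar>z - t\<bar> < d t \<Longrightarrow> norm (y z - y t - (z - t) *\<^sub>R h t) \<le> e' * \<bar>z - t\<bar>"
      by metis
    define \<gamma> where "\<gamma> t = (if t \<in> E then O' else if t \<in> {a..b} then ball t (d t) else ball t 1)" for t
    have g: "gauge \<gamma>"
      unfolding gauge_def \<gamma>_def using O' d(1) by auto
    show ?thesis
    proof (intro exI conjI allI impI, rule g)
      fix p assume p: "p tagged_division_of cbox a b \<and> \<gamma> fine p"
      then have p1: "p tagged_division_of {a..b}" and fine: "\<gamma> fine p" by auto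
      have fin: "finite p" using p1 by blast
      have tel: "(\<Sum>(x,K)\<in>p. y (Sup K) - y (Inf K)) = y b - y a"
        using additive_tagged_division_1[OF \<open>a \<le> b\<close> p1] .
      define pE where "pE = {(x,K) \<in> p. x \<in> E}"
      have pEp: "pE \<subseteq> p" by (auto simp: pE_def)
      have finE: "finite pE" using fin pEp finite_subset by blast
      have bnd: "K = {Inf K..Sup K} \<and> Inf K \<le> x \<and> x \<le> Sup K \<and> a \<le> Inf K \<and> Sup K \<le> b \<and> measure lborel K = Sup K - Inf K" if xK: "(x,K) \<in> p" for x K
      proof -
        obtain u v where "K = cbox u v" using tagged_division_ofD(4)[OF p1 xK] by blast
        moreover have "x \<in> K" "K \<subseteq> {a..b}" using tagged_division_ofD(2,3)[OF p1 xK] by auto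
        ultimately show ?thesis by (auto simp: content_real)
      qed
      define D where "D = snd ` pE"
      have pEd: "pE tagged_division_of \<Union>D"
        using tagged_partial_division_of_Union_self tagged_partial_division_subset[OF _ pEp] p1
        unfolding D_def tagged_division_of_def by metis
      have Dd: "D division_of \<Union>D" using division_of_tagged_division[OF pEd] D_def by auto
      have Dsub: "\<Union>D \<subseteq> {a..b}" unfolding D_def pE_def using tagged_division_ofD(3)[OF p1] by fastforce
      have DO: "\<Union>D \<subseteq> O'" using fine unfolding fine_def D_def pE_def \<gamma>_def by fastforce
      have Dbnd: "measure lebesgue K = Sup K - Inf K" if K: "K \<in> D" for K
      proof -
        obtain x where "(x,K) \<in> p" using K pEp unfolding D_def by force
        then have "K = {Inf K..Sup K}" "measure lborel K = Sup K - Inf K" using bnd by blast+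
        moreover from this have "K \<in> sets lborel" by (metis atLeastAtMost_borel sets_lborel)
        ultimately show ?thesis using measure_completion[of K lborel] by simp
      qed
      have "(\<Sum>k\<in>D. Sup k - Inf k) = sum (measure lebesgue) D" using Dbnd by auto
      also have "\<dots> = measure lebesgue (\<Union>D)" using content_division[OF Dd] by simp
      also have "\<dots> \<le> measure lebesgue O'"
        using DO O' Dd by (intro measure_mono_fmeasurable) (auto intro: division_of_finite lmeasurable_division fmeasurableD)
      also have "\<dots> < \<delta>" by (rule O')
      finally have small: "(\<Sum>k\<in>D. norm (y (Sup k) - y (Inf k))) < e/2"
        using ac'[OF Dd Dsub] by auto
      \<comment> \<open>\<open>Sup\<close> and \<open>Inf\<close> of the empty set are unspecified.
        The value 0 there meets the side condition for passing from a sum over tags to a sum over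
        intervals.\<close>
      define dn where "dn k = (if k = {} then 0 else norm (y (Sup k) - y (Inf k)))" for k :: "real set"
      have ne: "K \<noteq> {}" if "(x,K) \<in> p" for x K using bnd[OF that] by auto
      have "(\<Sum>(x,K)\<in>pE. norm (y (Sup K) - y (Inf K))) = (\<Sum>(x,K)\<in>pE. dn K)"
        using ne pEp by (intro sum.cong) (auto simp: dn_def)
      also have "\<dots> = (\<Sum>k\<in>D. dn k)"
        unfolding D_def
      proof (rule sum.over_tagged_division_lemma[OF pEd])
        fix u v :: real assume "box u v = {}"
        then have "v \<le> u" by (auto simp: box_real)
        then show "dn (cbox u v) = 0" by (cases "u = v") (auto simp: dn_def)
      qed
      also have "\<dots> = (\<Sum>k\<in>D. norm (y (Sup k) - y (Inf k)))"
        using ne pEp by (intro sum.cong) (auto simp: dn_def D_def)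
      finally have "(\<Sum>(x,K)\<in>pE. norm (y (Sup K) - y (Inf K))) = (\<Sum>k\<in>D. norm (y (Sup k) - y (Inf k)))" .
      with small have E1: "(\<Sum>(x,K)\<in>pE. norm (y (Sup K) - y (Inf K))) < e/2" by simp
      have E2: "norm (measure lborel K *\<^sub>R h' x - (y (Sup K) - y (Inf K))) \<le> e' * measure lborel K" if "(x,K) \<in> p - pE" for x K
      proof -
        have m: "(x,K) \<in> p" "x \<notin> E" using that by (auto simp: pE_def)
        note b = bnd[OF m(1)]
        have x: "x \<in> {a..b} - E" using b m by auto
        have "K \<subseteq> ball x (d x)" using fine m x unfolding fine_def \<gamma>_def by fastforce
        then have "\<bar>Inf K - x\<bar> < d x" "\<bar>Sup K - x\<bar> < d x" 
          using b by (metis atLeastAtMost_iff dist_commute dist_real_def mem_ball order.trans order_refl subset_iff)+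
        then have 1: "norm (y (Inf K) - y x - (Inf K - x) *\<^sub>R h x) \<le> e' * (x - Inf K)"
             "norm (y (Sup K) - y x - (Sup K - x) *\<^sub>R h x) \<le> e' * (Sup K - x)"
          using d(2)[OF x, of "Inf K"] d(2)[OF x, of "Sup K"] b by auto
        have "measure lborel K *\<^sub>R h' x - (y (Sup K) - y (Inf K)) = 
          (y (Inf K) - y x - (Inf K - x) *\<^sub>R h x) - (y (Sup K) - y x - (Sup K - x) *\<^sub>R h x)"
          unfolding conjunct2[OF conjunct2[OF conjunct2[OF conjunct2[OF conjunct2[OF b]]]]] using m by (simp add: h'_def algebra_simps)
        also have "norm \<dots> \<le> e' * (x - Inf K) + e' * (Sup K - x)"
          using 1 norm_triangle_ineq4 by (meson add_mono order_trans)
        also have "\<dots> = e' * measure lborel K"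
          unfolding conjunct2[OF conjunct2[OF conjunct2[OF conjunct2[OF conjunct2[OF b]]]]] by (simp add: algebra_simps)
        finally show ?thesis .
      qed
      have "(\<Sum>(x, k)\<in>p. measure lborel k *\<^sub>R h' x) - (y b - y a) = (\<Sum>(x, k)\<in>p. measure lborel k *\<^sub>R h' x - (y (Sup k) - y (Inf k)))"
        unfolding tel[symmetric] by (simp add: sum_subtractf split_def)
      also have "\<dots> = (\<Sum>(x, k)\<in>p - pE. measure lborel k *\<^sub>R h' x - (y (Sup k) - y (Inf k))) + (\<Sum>(x, k)\<in>pE. measure lborel k *\<^sub>R h' x - (y (Sup k) - y (Inf k)))"
        by (rule sum.subset_diff[OF pEp fin])
      also have "norm \<dots> \<le> (\<Sum>(x, k)\<in>p - pE. e' * measure lborel k) + (\<Sum>(x, k)\<in>pE. norm (y (Sup k) - y (Inf k)))"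
      proof (rule norm_triangle_mono)
        show "norm (\<Sum>(x, k)\<in>p - pE. measure lborel k *\<^sub>R h' x - (y (Sup k) - y (Inf k))) \<le> (\<Sum>(x, k)\<in>p - pE. e' * measure lborel k)"
          using E2 by (intro sum_norm_le) auto
        show "norm (\<Sum>(x, k)\<in>pE. measure lborel k *\<^sub>R h' x - (y (Sup k) - y (Inf k))) \<le> (\<Sum>(x, k)\<in>pE. norm (y (Sup k) - y (Inf k)))"
          by (intro sum_norm_le) (auto simp: pE_def h'_def norm_minus_commute)
      qed
      also have "(\<Sum>(x, k)\<in>p - pE. e' * measure lborel k) \<le> (\<Sum>(x, k)\<in>p. e' * measure lborel k)"
        using fin e' by (intro sum_mono2) auto
      also have "(\<Sum>(x, k)\<in>p. e' * measure lborel k) = e' * (\<Sum>(x, k)\<in>p. measure lborel k)"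
        by (simp add: sum_distrib_left split_def)
      also have "(\<Sum>(x, k)\<in>p. measure lborel k) = b - a"
        using additive_content_tagged_division[of p a b] p1 \<open>a \<le> b\<close> by auto
      also have "e' * (b - a) \<le> e/2" using e \<open>a \<le> b\<close> by (auto simp: e'_def field_simps)
      finally show "norm ((\<Sum>(x, k)\<in>p. measure lborel k *\<^sub>R h' x) - (y b - y a)) < e" using E1 by auto
    qed
  qed
  have "(h' has_integral (y b - y a)) (cbox a b)"
    unfolding has_integral using main by blast
  then have "(h' has_integral (y b - y a)) {a..b}" by simp
  then show ?thesis
    by (rule has_integral_spike[OF N, rotated]) (auto simp: h'_def)
qed

lemma lipschitz_imp_AC:
  fixes y :: "real \<Rightarrow> 'a::euclidean_space"
  assumes lip: "\<And>s t. s \<in> {a..b} \<Longrightarrow> t \<in> {a..b} \<Longrightarrow> norm (y s - y t) \<le> M * \<bar>s - t\<bar>"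
  shows "absolutely_continuous_fun_on y a b"
  unfolding absolutely_continuous_fun_on_def
proof (intro allI impI)
  fix e :: real assume e: "e > 0"
  \<comment> \<open>\<open>M\<close> may be 0 or negative, and \<open>M'\<close> is used as a
    divisor.\<close>
  define M' where "M' = \<bar>M\<bar> + 1"
  have M': "M' > 0" by (auto simp: M'_def)
  show "\<exists>\<delta>>0. \<forall>D. D division_of \<Union> D \<and> \<Union> D \<subseteq> {a..b} \<and> (\<Sum>k\<in>D. Sup k - Inf k) < \<delta> \<longrightarrow>
              (\<Sum>k\<in>D. norm (y (Sup k) - y (Inf k))) < e"
  proof (intro exI[of _ "e / M'"] conjI allI impI)
    show "0 < e / M'" using e M' by simp
    fix D assume D: "D division_of \<Union> D \<and> \<Union> D \<subseteq> {a..b} \<and> (\<Sum>k\<in>D. Sup k - Inf k) < e / M'"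
    have "norm (y (Sup k) - y (Inf k)) \<le> M' * (Sup k - Inf k)" if "k \<in> D" for k
    proof -
      have "\<exists>u v. k = cbox u v" using conjunct1[OF D] that by (rule division_ofD(4))
      then obtain u v where uv: "k = cbox u v" by (elim exE)
      have "k \<noteq> {}" using conjunct1[OF D] that by (rule division_ofD(3))
      moreover have "k \<subseteq> {a..b}" using D that by auto
      moreover have k: "k = {u..v}" using uv by simp
      ultimately have uv': "u \<le> v" "u \<in> {a..b}" "v \<in> {a..b}" by auto
      have "Sup k = v" "Inf k = u" unfolding k using uv'(1) by auto
      then have "Sup k \<in> {a..b}" "Inf k \<in> {a..b}" "Inf k \<le> Sup k" using uv' by simp_all
      then have "norm (y (Sup k) - y (Inf k)) \<le> M * \<bar>Sup k - Inf k\<bar>" by (intro lip)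
      also have "\<dots> \<le> M' * (Sup k - Inf k)" using \<open>Inf k \<le> Sup k\<close> by (auto simp: M'_def intro!: mult_right_mono)
      finally show ?thesis .
    qed
    then have "(\<Sum>k\<in>D. norm (y (Sup k) - y (Inf k))) \<le> (\<Sum>k\<in>D. M' * (Sup k - Inf k))"
      by (rule sum_mono)
    also have "\<dots> = M' * (\<Sum>k\<in>D. Sup k - Inf k)" by (simp add: sum_distrib_left)
    also have "\<dots> < M' * (e / M')" using D M' by (intro mult_strict_left_mono) auto
    finally show "(\<Sum>k\<in>D. norm (y (Sup k) - y (Inf k))) < e" using M' by simp
  qed
qed

lemma AC_imp_continuous_on:
  fixes y :: "real \<Rightarrow> 'a::euclidean_space"
  assumes ac: "absolutely_continuous_fun_on y a b"
  shows "continuous_on {a..b} y"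
  unfolding continuous_on_iff
proof (intro ballI allI impI)
  fix t e :: real assume t: "t \<in> {a..b}" and e: "e > 0"
  obtain \<delta> where \<delta>: "\<delta> > 0" and ac': "\<And>D. D division_of \<Union>D \<Longrightarrow> \<Union>D \<subseteq> {a..b} \<Longrightarrow> (\<Sum>k\<in>D. Sup k - Inf k) < \<delta> \<Longrightarrow>
        (\<Sum>k\<in>D. norm (y (Sup k) - y (Inf k))) < e"
      using ac[unfolded absolutely_continuous_fun_on_def, rule_format, of "e"] e by auto
  have *: "dist (y s') (y t') < e" if "s' \<in> {a..b}" "t' \<in> {a..b}" "s' \<le> t'" "t' - s' < \<delta>" for s' t'
  proof -
    have "{{s'..t'}} division_of \<Union>{{s'..t'}}" using division_of_self[of s' t'] that by auto
    from ac'[OF this] that show ?thesis by (auto simp: dist_norm norm_minus_commute)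
  qed
  show "\<exists>d>0. \<forall>x'\<in>{a..b}. dist x' t < d \<longrightarrow> dist (y x') (y t) < e"
  proof (intro exI[of _ \<delta>] conjI \<delta> ballI impI)
    fix s assume s: "s \<in> {a..b}" "dist s t < \<delta>"
    show "dist (y s) (y t) < e"
      using *[of s t] *[of t s] s t by (cases "s \<le> t") (auto simp: dist_real_def dist_commute)
  qed
qed

text \<open>Averages over intervals to the right of a point converge to \<open>f\<close> off a null
  set. The reflected function gives the same for averages to the left, so the derivative is
  two-sided. The null set is independent of the lower limit \<open>a\<close>.\<close>

lemma lebesgue_differentiation:
  fixes f :: "real \<Rightarrow> 'a::euclidean_space"
  assumes f: "\<And>a b. f integrable_on {a..b}"
  obtains E where "negligible E" 
    "\<And>a t. t \<notin> E \<Longrightarrow> a < t \<Longrightarrow> ((\<lambda>t. integral {a..t} f) has_vector_derivative f t) (at t)"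
proof -
  obtain E1 where E1: "negligible E1" "\<And>x e. \<lbrakk>x \<notin> E1; 0 < e\<rbrakk> \<Longrightarrow>
               \<exists>d>0. \<forall>h. 0 < h \<and> h < d \<longrightarrow> norm(integral (cbox x (x + h *\<^sub>R One)) f /\<^sub>R h ^ DIM(real) - f x) < e"
    using integrable_ccontinuous_explicit[of f] f by (metis box_real(2))
  have f2: "(\<lambda>x. f (- x)) integrable_on cbox a b" for a b
    using Henstock_Kurzweil_Integration.integrable_reflect_real[where f=f and a="-b" and b="-a"] f[of "-b" "-a"] by simp
  obtain E2 where E2: "negligible E2" "\<And>x e. \<lbrakk>x \<notin> E2; 0 < e\<rbrakk> \<Longrightarrow>
               \<exists>d>0. \<forall>h. 0 < h \<and> h < d \<longrightarrow> norm(integral (cbox x (x + h *\<^sub>R One)) (\<lambda>x. f (- x)) /\<^sub>R h ^ DIM(real) - f (- x)) < e"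
    using integrable_ccontinuous_explicit[of "\<lambda>x. f (- x)", OF f2] by metis
  define E where "E = E1 \<union> uminus ` E2"
  have "negligible E" unfolding E_def
    using E1(1) E2(1) by (auto intro!: negligible_differentiable_image_negligible derivative_intros)
  moreover have "((\<lambda>t. integral {a..t} f) has_vector_derivative f t) (at t)" if t: "t \<notin> E" "a < t" for a t
    unfolding has_vector_derivative_def has_derivative_at_alt
  proof (intro conjI bounded_linear_scaleR_left allI impI)
    fix e :: real assume e: "e > 0"
    obtain d1 where d1: "d1 > 0" "\<And>h. 0 < h \<Longrightarrow> h < d1 \<Longrightarrow> norm (integral {t..t+h} f /\<^sub>R h - f t) < e"
      using E1(2)[of t e] t e by (auto simp: E_def)
    have "-t \<notin> E2" using t by (force simp: E_def)
    then obtain d2 where d2: "d2 > 0" "\<And>h. 0 < h \<Longrightarrow> h < d2 \<Longrightarrow> norm (integral {-t..-t+h} (\<lambda>x. f (- x)) /\<^sub>R h - f t) < e"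
      using E2(2)[of "-t" e] e by auto
    have d2': "norm (integral {t-h..t} f /\<^sub>R h - f t) < e" if "0 < h" "h < d2" for h
      using d2(2)[OF that] Henstock_Kurzweil_Integration.integral_reflect_real[of t "t-h" f] by (simp add: algebra_simps)
    show "\<exists>d>0. \<forall>s. norm (s - t) < d \<longrightarrow> norm (integral {a..s} f - integral {a..t} f - (s - t) *\<^sub>R f t) \<le> e * norm (s - t)"
    proof (intro exI[of _ "min d1 (min d2 (t - a))"] conjI allI impI)
      show "0 < min d1 (min d2 (t - a))" using d1 d2 t by auto
      fix s assume s: "norm (s - t) < min d1 (min d2 (t - a))"
      consider "s = t" | "s > t" | "s < t" by linarith
      then show "norm (integral {a..s} f - integral {a..t} f - (s - t) *\<^sub>R f t) \<le> e * norm (s - t)"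
      proof cases
        case 2
        have "integral {a..s} f - integral {a..t} f = integral {t..s} f"
          using 2 t Henstock_Kurzweil_Integration.integral_combine[of a t s f, OF _ _ f] by (auto simp: algebra_simps)
        then have "integral {a..s} f - integral {a..t} f - (s - t) *\<^sub>R f t = (s - t) *\<^sub>R (integral {t..t+(s-t)} f /\<^sub>R (s-t) - f t)"
          using 2 by (simp add: scaleR_right_diff_distrib)
        then show ?thesis using d1(2)[of "s - t"] s 2 by (auto simp: mult.commute)
      next
        case 3
        have "integral {a..s} f - integral {a..t} f = - integral {s..t} f"
          using 3 s t Henstock_Kurzweil_Integration.integral_combine[of a s t f, OF _ _ f] by (auto simp: algebra_simps)
        moreover have "(s - t) *\<^sub>R (integral {s..t} f /\<^sub>R (t-s)) = - integral {s..t} f"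
        proof -
          have "(s - t) * inverse (t - s) = -1" using 3 by (simp add: field_simps)
          then show ?thesis by simp
        qed
        ultimately have "integral {a..s} f - integral {a..t} f - (s - t) *\<^sub>R f t = (s - t) *\<^sub>R (integral {t-(t-s)..t} f /\<^sub>R (t-s) - f t)"
          by (simp add: scaleR_right_diff_distrib)
        then show ?thesis using d2'[of "t - s"] s 3 by (auto simp: mult.commute)
      qed auto
    qed
  qed
  ultimately show ?thesis using that by blast
qed

text \<open>The integral form of y' = h with a bounded measurable rate. Solutions are handled in
  this form because an integral equation passes to pointwise limits by dominated convergence, with
  the closed-loop rate \<open>F t (y t)\<close> inserted for \<open>h t\<close>.\<close>

definition bounded_rate :: "(real \<Rightarrow> 'a::euclidean_space) \<Rightarrow> (real \<Rightarrow> 'a) \<Rightarrow> real \<Rightarrow> real \<Rightarrow> bool" where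
  "bounded_rate y h a b \<longleftrightarrow> h \<in> borel_measurable (lebesgue_on {a..b}) \<and> (\<exists>M. \<forall>t\<in>{a..b}. norm (h t) \<le> M) \<and>
     (\<forall>t\<in>{a..b}. y t = y a + integral {a..t} h)"

lemma bounded_rate_eq: "bounded_rate y h a b \<Longrightarrow> t \<in> {a..b} \<Longrightarrow> y t = y a + integral {a..t} h"
  unfolding bounded_rate_def by blast

lemma bounded_rate_measurable: "bounded_rate y h a b \<Longrightarrow> h \<in> borel_measurable (lebesgue_on {a..b})"
  unfolding bounded_rate_def by blast

lemma bounded_rate_bound:
  assumes "bounded_rate y h a b"
  obtains M where "\<And>t. t \<in> {a..b} \<Longrightarrow> norm (h t) \<le> M"
  using assms unfolding bounded_rate_def by blast

lemma measurable_lebesgue_on_subset: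
  "h \<in> borel_measurable (lebesgue_on I) \<Longrightarrow> J \<subseteq> I \<Longrightarrow> J \<in> sets lebesgue \<Longrightarrow> h \<in> borel_measurable (lebesgue_on J)"
  by (rule measurable_restrict_mono)

lemma bounded_measurable_integrable_on:
  fixes h :: "real \<Rightarrow> 'a::euclidean_space"
  assumes "h \<in> borel_measurable (lebesgue_on {a..b})" "\<And>t. t \<in> {a..b} \<Longrightarrow> norm (h t) \<le> M"
  shows "h integrable_on {a..b}"
  by (rule measurable_bounded_by_integrable_imp_integrable[where g="\<lambda>_. M"]) (use assms in auto)

lemma bounded_rate_integrable:
  assumes "bounded_rate y h a b" "a \<le> s" "t \<le> b"
  shows "h integrable_on {s..t}"
proof -
  have "h integrable_on {a..b}"
    using assms(1) bounded_measurable_integrable_on unfolding bounded_rate_def by blast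
  then show ?thesis by (rule integrable_on_subinterval) (use assms in auto)
qed

lemma bounded_rate_has_integral:
  assumes r: "bounded_rate y h a b" and st: "a \<le> s" "s \<le> t" "t \<le> b"
  shows "(h has_integral (y t - y s)) {s..t}"
proof -
  have "integral {a..s} h + integral {s..t} h = integral {a..t} h"
    by (rule Henstock_Kurzweil_Integration.integral_combine) (use st bounded_rate_integrable[OF r] in auto)
  moreover have "y s = y a + integral {a..s} h" "y t = y a + integral {a..t} h"
    using bounded_rate_eq[OF r, of s] bounded_rate_eq[OF r, of t] st by simp_all
  ultimately have "integral {s..t} h = y t - y s" by (simp add: algebra_simps)
  then show ?thesis using bounded_rate_integrable[OF r st(1,3)] integrable_integral by fastforce
qed

lemma bounded_rate_lipschitz:
  assumes r: "bounded_rate y h a b" and M: "\<And>t. t \<in> {a..b} \<Longrightarrow> norm (h t) \<le> M"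
    and st: "s \<in> {a..b}" "t \<in> {a..b}"
  shows "norm (y s - y t) \<le> M * \<bar>s - t\<bar>"
proof -
  have *: "norm (y t - y s) \<le> M * (t - s)" if "a \<le> s" "s \<le> t" "t \<le> b" for s t
  proof -
    have "M \<ge> 0" using M[of s] that norm_ge_zero order_trans by (meson atLeastAtMost_iff)
    then show ?thesis
      using has_integral_bound[of M h "y t - y s" s t] bounded_rate_has_integral[OF r that] M that by auto
  qed
  show ?thesis using *[of s t] *[of t s] st by (cases "s \<le> t") (auto simp: norm_minus_commute)
qed

lemma bounded_rate_continuous_on:
  assumes r: "bounded_rate y h a b"
  shows "continuous_on {a..b} y"
proof -
  obtain M where "\<And>t. t \<in> {a..b} \<Longrightarrow> norm (h t) \<le> M" using bounded_rate_bound[OF r] by blast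
  from AC_imp_continuous_on[OF lipschitz_imp_AC] bounded_rate_lipschitz[OF r this]
  show ?thesis by blast
qed

lemma bounded_rate_AE_derivative:
  assumes r: "bounded_rate y h a b"
  obtains E where "negligible E" "\<And>t. t \<in> {a<..<b} - E \<Longrightarrow> (y has_vector_derivative h t) (at t)"
proof -
  define h' where "h' t = (if t \<in> {a..b} then h t else 0)" for t
  have "h integrable_on {a..b}" using bounded_rate_integrable[OF r] by auto
  then have "h' integrable_on UNIV" unfolding h'_def by (subst integrable_restrict_UNIV)
  then have "h' integrable_on {c..d}" for c d
    using integrable_on_subinterval by blast
  then obtain E where E: "negligible E"
     "\<And>a t. t \<notin> E \<Longrightarrow> a < t \<Longrightarrow> ((\<lambda>t. integral {a..t} h') has_vector_derivative h' t) (at t)"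
    by (rule lebesgue_differentiation) blast
  have "(y has_vector_derivative h t) (at t)" if t: "t \<in> {a<..<b} - E" for t
  proof -
    have "((\<lambda>t. y a + integral {a..t} h') has_vector_derivative h t) (at t)"
      using E(2)[of t a] t by (auto simp: h'_def intro!: derivative_eq_intros)
    moreover have "y a + integral {a..s} h' = y s" if "s \<in> {a<..<b}" for s
    proof -
      have "integral {a..s} h' = integral {a..s} h"
        by (rule integral_cong) (use that in \<open>auto simp: h'_def\<close>)
      then show ?thesis using bounded_rate_eq[OF r, of s] that by simp
    qed
    ultimately show ?thesis
      using has_vector_derivative_transform_within_open[of _ "h t" t "{a<..<b}" y] t by simp
  qed
  with E(1) that show ?thesis by blast
qed

lemma bounded_rateI:
  assumes lip: "\<And>s t. s \<in> {a..b} \<Longrightarrow> t \<in> {a..b} \<Longrightarrow> norm (y s - y t) \<le> C * \<bar>s - t\<bar>"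
    and "h \<in> borel_measurable (lebesgue_on {a..b})" "\<And>t. t \<in> {a..b} \<Longrightarrow> norm (h t) \<le> M"
    and E: "negligible E" "\<And>t. t \<in> {a<..<b} - E \<Longrightarrow> (y has_vector_derivative h t) (at t)"
  shows "bounded_rate y h a b"
  unfolding bounded_rate_def
proof (intro conjI ballI exI[of _ M] assms)
  fix t assume t: "t \<in> {a..b}"
  have "(h has_integral (y t - y a)) {a..t}"
  proof (rule AC_has_integral)
    show "absolutely_continuous_fun_on y a t" by (rule lipschitz_imp_AC[of _ _ _ C]) (use t lip in auto)
    show "negligible (insert a (insert t E))" using E by auto
    show "(y has_vector_derivative h s) (at s within {a..t})" if "s \<in> {a..t} - insert a (insert t E)" for s
      using that t E(2)[of s] by (auto intro: has_vector_derivative_at_within)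
  qed (use t in auto)
  then show "y t = y a + integral {a..t} h" by (simp add: integral_unique)
qed

lemma bounded_rate_imp_caratheodory:
  assumes r: "bounded_rate y (\<lambda>t. F t (y t)) a b"
  shows "caratheodory_solution {a..b} F y"
  unfolding caratheodory_solution_def
proof (intro conjI allI impI)
  obtain M where M: "\<And>t. t \<in> {a..b} \<Longrightarrow> norm (F t (y t)) \<le> M" using bounded_rate_bound[OF r] by blast
  show "absolutely_continuous_fun_on y c d" if "c \<le> d \<and> {c..d} \<subseteq> {a..b}" for c d
    by (rule lipschitz_imp_AC[of _ _ _ M]) (use that bounded_rate_lipschitz[OF r M] in auto)
  obtain E where E: "negligible E" "\<And>t. t \<in> {a<..<b} - E \<Longrightarrow> (y has_vector_derivative F t (y t)) (at t)"
    using bounded_rate_AE_derivative[OF r] by blast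
  have "negligible {t \<in> {a..b}. \<not> (y has_vector_derivative F t (y t)) (at t within {a..b})}"
    by (rule negligible_subset[of "insert a (insert b E)"])
      (use E in \<open>auto intro: has_vector_derivative_at_within\<close>)
  then show "AE t in lebesgue_on {a..b}. (y has_vector_derivative F t (y t)) (at t within {a..b})"
    by (subst AE_lebesgue_on_iff_negligible) auto
qed

text \<open>The exceptional null sets of the intervals from \<open>a\<close> to \<open>a + n\<close>
  are united. The end point \<open>a\<close> is added because only interior points of an interval
  are covered.\<close>

lemma bounded_rate_imp_caratheodory_ge:
  fixes a :: real
  assumes r: "\<And>b. bounded_rate y (\<lambda>t. F t (y t)) a b"
  shows "caratheodory_solution {a..} F y"
  unfolding caratheodory_solution_def
proof (intro conjI allI impI)
  show "absolutely_continuous_fun_on y c d" if "c \<le> d \<and> {c..d} \<subseteq> {a..}" for c d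
  proof -
    have "{c..d} \<subseteq> {a..d}" using that by auto
    then show ?thesis
      using bounded_rate_imp_caratheodory[where F=F, OF r[of d]] that unfolding caratheodory_solution_def by blast
  qed
  have "\<exists>E. negligible E \<and> (\<forall>t. t \<in> {a<..<a + real n} - E \<longrightarrow> (y has_vector_derivative F t (y t)) (at t))" for n
  proof -
    obtain E' where "negligible E'" "\<And>t. t \<in> {a<..<a + real n} - E' \<Longrightarrow> (y has_vector_derivative F t (y t)) (at t)"
      by (rule bounded_rate_AE_derivative[OF r[of "a + real n"]]) blast
    then show ?thesis by blast
  qed
  then obtain E where E: "\<And>n. negligible (E n)"
    "\<And>t n. t \<in> {a<..<a + real n} - E n \<Longrightarrow> (y has_vector_derivative F t (y t)) (at t)"
    by metis
  have "negligible {t \<in> {a..}. \<not> (y has_vector_derivative F t (y t)) (at t within {a..})}"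
  proof (rule negligible_subset[of "insert a (\<Union>n. E n)"])
    show "negligible (insert a (\<Union>n. E n))" using E(1) by (auto intro: negligible_countable_Union)
    show "{t \<in> {a..}. \<not> (y has_vector_derivative F t (y t)) (at t within {a..})} \<subseteq> insert a (\<Union>n. E n)"
    proof (rule subsetI, rule ccontr)
      fix t assume t: "t \<in> {t \<in> {a..}. \<not> (y has_vector_derivative F t (y t)) (at t within {a..})}" "t \<notin> insert a (\<Union>n. E n)"
      obtain n where "t - a < real n" using reals_Archimedean2 by blast
      then have "(y has_vector_derivative F t (y t)) (at t)" using t by (intro E(2)[of t n]) auto
      then show False using t by (auto intro: has_vector_derivative_at_within)
    qed
  qed
  then show "AE t in lebesgue_on {a..}. (y has_vector_derivative F t (y t)) (at t within {a..})"
    by (subst AE_lebesgue_on_iff_negligible) auto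
qed

text \<open>The passage back from a Caratheodory solution. Measurability and a bound of the
  closed-loop rate have to be supplied, as the differential form does not contain them.\<close>

lemma caratheodory_imp_bounded_rate:
  assumes c: "caratheodory_solution I F y" and I: "{a..b} \<subseteq> I" "I \<in> sets lebesgue"
    and m: "(\<lambda>t. F t (y t)) \<in> borel_measurable (lebesgue_on {a..b})" and M: "\<And>t. t \<in> {a..b} \<Longrightarrow> norm (F t (y t)) \<le> M"
  shows "bounded_rate y (\<lambda>t. F t (y t)) a b"
  unfolding bounded_rate_def
proof (intro conjI ballI exI[of _ M] m M)
  fix t assume t: "t \<in> {a..b}"
  have ac: "absolutely_continuous_fun_on y a t"
  proof -
    have "{a..t} \<subseteq> I" using I t by auto
    then show ?thesis using c t unfolding caratheodory_solution_def by auto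
  qed
  define E where "E = {t \<in> I. \<not> (y has_vector_derivative F t (y t)) (at t within I)}"
  have E: "negligible E" unfolding E_def
    using c I(2) unfolding caratheodory_solution_def by (subst AE_lebesgue_on_iff_negligible[symmetric]) auto
  have "((\<lambda>t. F t (y t)) has_integral (y t - y a)) {a..t}"
  proof (rule AC_has_integral[OF ac _ E])
    fix s assume s: "s \<in> {a..t} - E"
    then have "(y has_vector_derivative F s (y s)) (at s within I)" using I t by (auto simp: E_def subset_iff)
    then show "(y has_vector_derivative F s (y s)) (at s within {a..t})"
      by (rule has_vector_derivative_within_subset) (use I t in auto)
  qed (use t in auto)
  then show "y t = y a + integral {a..t} (\<lambda>t. F t (y t))" by (simp add: integral_unique)
qed

lemma caratheodory_continuous_on:
  fixes y :: "real \<Rightarrow> 'a::euclidean_space"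
  assumes c: "caratheodory_solution I F y" and I: "{a..b} \<subseteq> I"
  shows "continuous_on {a..b} y"
proof (cases "a \<le> b")
  case True
  then show ?thesis using c I AC_imp_continuous_on unfolding caratheodory_solution_def by blast
qed auto

text \<open>The product rule, to be applied to an adjoint arc and the difference of two
  trajectories.\<close>

lemma bounded_rate_inner:
  assumes p: "bounded_rate p \<alpha> a b" and q: "bounded_rate q \<beta> a b"
  shows "bounded_rate (\<lambda>t. p t \<bullet> q t) (\<lambda>t. \<alpha> t \<bullet> q t + p t \<bullet> \<beta> t) a b"
proof -
  obtain M where M: "\<And>t. t \<in> {a..b} \<Longrightarrow> norm (\<alpha> t) \<le> M" using bounded_rate_bound[OF p] by blast
  obtain M' where M': "\<And>t. t \<in> {a..b} \<Longrightarrow> norm (\<beta> t) \<le> M'" using bounded_rate_bound[OF q] by blast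
  have cp: "continuous_on {a..b} p" and cq: "continuous_on {a..b} q"
    using bounded_rate_continuous_on p q by auto
  obtain P where P: "P > 0" "\<And>t. t \<in> {a..b} \<Longrightarrow> norm (p t) \<le> P"
    using compact_imp_bounded[OF compact_continuous_image[OF cp]] unfolding bounded_pos by auto
  obtain Q where Q: "Q > 0" "\<And>t. t \<in> {a..b} \<Longrightarrow> norm (q t) \<le> Q"
    using compact_imp_bounded[OF compact_continuous_image[OF cq]] unfolding bounded_pos by auto
  obtain E1 where E1: "negligible E1" "\<And>t. t \<in> {a<..<b} - E1 \<Longrightarrow> (p has_vector_derivative \<alpha> t) (at t)"
    using bounded_rate_AE_derivative[OF p] by blast
  obtain E2 where E2: "negligible E2" "\<And>t. t \<in> {a<..<b} - E2 \<Longrightarrow> (q has_vector_derivative \<beta> t) (at t)"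
    using bounded_rate_AE_derivative[OF q] by blast
  show ?thesis
  proof (rule bounded_rateI[where C="M * Q + P * M'" and M="M * Q + P * M'" and E="E1 \<union> E2"])
    fix s t assume st: "s \<in> {a..b}" "t \<in> {a..b}"
    have "p s \<bullet> q s - p t \<bullet> q t = (p s - p t) \<bullet> q s + p t \<bullet> (q s - q t)" by (simp add: inner_diff)
    also have "norm \<dots> \<le> norm (p s - p t) * norm (q s) + norm (p t) * norm (q s - q t)"
      unfolding real_norm_def by (intro order_trans[OF abs_triangle_ineq] add_mono Cauchy_Schwarz_ineq2)
    also have "\<dots> \<le> (M * \<bar>s - t\<bar>) * Q + P * (M' * \<bar>s - t\<bar>)"
      using bounded_rate_lipschitz[OF p M st] bounded_rate_lipschitz[OF q M' st] P Q st
      by (intro add_mono mult_mono) (auto intro: order_trans[OF norm_ge_zero])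
    finally show "norm (p s \<bullet> q s - p t \<bullet> q t) \<le> (M * Q + P * M') * \<bar>s - t\<bar>" by (simp add: algebra_simps)
  next
    have "p \<in> borel_measurable (lebesgue_on {a..b})" "q \<in> borel_measurable (lebesgue_on {a..b})"
      using cp cq by (auto intro: continuous_imp_measurable_on_sets_lebesgue)
    then show "(\<lambda>t. \<alpha> t \<bullet> q t + p t \<bullet> \<beta> t) \<in> borel_measurable (lebesgue_on {a..b})"
      using bounded_rate_measurable[OF p] bounded_rate_measurable[OF q] by (intro borel_measurable_add borel_measurable_inner)
  next
    fix t assume t: "t \<in> {a..b}"
    have "norm (\<alpha> t \<bullet> q t + p t \<bullet> \<beta> t) \<le> norm (\<alpha> t) * norm (q t) + norm (p t) * norm (\<beta> t)"
      unfolding real_norm_def by (intro order_trans[OF abs_triangle_ineq] add_mono Cauchy_Schwarz_ineq2)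
    also have "\<dots> \<le> M * Q + P * M'"
      using M M' P Q t by (intro add_mono mult_mono) (auto intro: order_trans[OF norm_ge_zero])
    finally show "norm (\<alpha> t \<bullet> q t + p t \<bullet> \<beta> t) \<le> M * Q + P * M'" .
  next
    show "negligible (E1 \<union> E2)" using E1 E2 by auto
    show "((\<lambda>t. p t \<bullet> q t) has_vector_derivative \<alpha> t \<bullet> q t + p t \<bullet> \<beta> t) (at t)" if "t \<in> {a<..<b} - (E1 \<union> E2)" for t
      using bounded_bilinear.has_vector_derivative[OF bounded_bilinear_inner E1(2)[of t] E2(2)[of t]] that
      by (auto simp: add.commute)
  qed
qed

section \<open>Caratheodory differential equations\<close>

lemma measurable_lebesgue_on_affine:
  fixes \<alpha> :: "real \<Rightarrow> 'a::euclidean_space"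
  assumes "\<alpha> \<in> borel_measurable (lebesgue_on I)" "c \<noteq> 0" "\<And>t. t \<in> J \<Longrightarrow> a + c * t \<in> I"
  shows "(\<lambda>t. \<alpha> (a + c * t)) \<in> borel_measurable (lebesgue_on J)"
proof -
  have "(\<lambda>t::real. a + (\<Sum>j\<in>Basis. (c * (t \<bullet> j)) *\<^sub>R j)) \<in> lebesgue \<rightarrow>\<^sub>M lebesgue"
    by (rule lebesgue_affine_measurable[where c="\<lambda>_. c"]) (use assms in auto)
  then have "(\<lambda>t. a + c * t) \<in> lebesgue \<rightarrow>\<^sub>M lebesgue" by simp
  then have "(\<lambda>t. a + c * t) \<in> lebesgue_on J \<rightarrow>\<^sub>M lebesgue_on I"
    by (rule measurable_restrict_space3) (use assms in auto)
  from measurable_compose[OF this assms(1)] show ?thesis .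
qed

text \<open>Let m be the maximum of \<phi> weighted by \<open>exp (- (2 * L * s))\<close>, attained
  at \<open>t0\<close>. The integral up to \<open>t0\<close> is then at most (exp (2 L t0) - 1) m /
  (2 L), so the factor 2 in the exponent lets half of the left side absorb it, and m \<le>
  \<open>A\<close> remains.\<close>

lemma gronwall_exp:
  fixes \<phi> :: "real \<Rightarrow> real"
  assumes c: "continuous_on {0..T} \<phi>" and L: "L > 0"
    and nn: "\<And>t. t \<in> {0..T} \<Longrightarrow> 0 \<le> \<phi> t"
    and le: "\<And>t. t \<in> {0..T} \<Longrightarrow> \<phi> t \<le> A + L * integral {0..t} \<phi>"
    and t: "t \<in> {0..T}"
  shows "\<phi> t \<le> A * exp (2 * L * t)"
proof -
  define \<psi> where "\<psi> s = \<phi> s * exp (- (2 * L * s))" for s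
  have "continuous_on {0..T} \<psi>" unfolding \<psi>_def by (intro continuous_intros c)
  then obtain t0 where t0: "t0 \<in> {0..T}" "\<And>s. s \<in> {0..T} \<Longrightarrow> \<psi> s \<le> \<psi> t0"
    using continuous_attains_sup[of "{0..T}" \<psi>] t by auto
  define m where "m = \<psi> t0"
  have m0: "m \<ge> 0" unfolding m_def \<psi>_def using nn[OF t0(1)] by simp
  have \<phi>: "\<phi> s = \<psi> s * exp (2 * L * s)" for s unfolding \<psi>_def by (simp add: exp_minus field_simps)
  have le': "\<phi> s \<le> m * exp (2 * L * s)" if "s \<in> {0..T}" for s
    unfolding \<phi> m_def by (intro mult_right_mono t0(2) that) auto
  have I: "((\<lambda>s. m * exp (2 * L * s)) has_integral (m * exp (2 * L * t0) / (2 * L) - m * exp (2 * L * 0) / (2 * L))) {0..t0}"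
    using L t0 by (intro fundamental_theorem_of_calculus)
      (auto intro!: derivative_eq_intros simp: has_real_derivative_iff_has_vector_derivative[symmetric])
  have "integral {0..t0} \<phi> \<le> m * exp (2 * L * t0) / (2 * L) - m / (2 * L)"
  proof -
    have "\<phi> integrable_on {0..t0}"
      by (intro integrable_continuous_interval continuous_on_subset[OF c]) (use t0 in auto)
    then have "integral {0..t0} \<phi> \<le> integral {0..t0} (\<lambda>s. m * exp (2 * L * s))"
      using I le' t0 by (intro integral_le) auto
    then show ?thesis unfolding integral_unique[OF I] by simp
  qed
  then have "\<phi> t0 \<le> A + L * (m * exp (2 * L * t0) / (2 * L) - m / (2 * L))"
    using le[OF t0(1)] L by (smt (verit) mult_left_mono)
  also have "\<dots> = A + m * exp (2 * L * t0) / 2 - m / 2" using L by (simp add: field_simps)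
  finally have "m * exp (2 * L * t0) \<le> A + m * exp (2 * L * t0) / 2 - m / 2" using \<phi>[of t0] m_def by simp
  moreover have "m \<le> m * exp (2 * L * t0)" using m0 L t0(1) by (simp add: mult_le_cancel_left1)
  ultimately have "m \<le> A" by linarith
  then have "m * exp (2 * L * t) \<le> A * exp (2 * L * t)" by (intro mult_right_mono) auto
  with le'[OF t] show ?thesis by linarith
qed

lemma continuous_on_atLeast_iff:
  fixes y :: "real \<Rightarrow> 'a::topological_space"
  assumes "\<And>T. continuous_on {a..T} y"
  shows "continuous_on {a..} y"
proof -
  have "continuous (at t within {a..}) y" if "t \<ge> a" for t
  proof -
    have "continuous (at t within {a..t+1}) y"
      using assms[of "t+1"] that by (simp add: continuous_on_eq_continuous_within)
    moreover have "at t within {a..t+1} = at t within {a..}"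
      by (rule at_within_nhd[of _ "{..<t+1}"]) auto
    ultimately show ?thesis by simp
  qed
  then show ?thesis by (simp add: continuous_on_eq_continuous_within)
qed

text \<open>Picard iteration measured with the weight exp (- 2 L t), for which the integral operator
  contracts by 1/2. This gives a solution on the whole half line at once, without gluing short
  intervals.\<close>

lemma ode_exists:
  fixes F :: "real \<Rightarrow> 'a::euclidean_space \<Rightarrow> 'a"
  assumes m: "\<And>y. continuous_on {0..} y \<Longrightarrow> (\<lambda>t. F t (y t)) \<in> borel_measurable (lebesgue_on {0..})"
    and L: "L > 0" and lip: "\<And>t z z'. t \<ge> 0 \<Longrightarrow> norm (F t z - F t z') \<le> L * norm (z - z')"
    and bd: "\<And>t. t \<ge> 0 \<Longrightarrow> norm (F t 0) \<le> M"
  shows "\<exists>y. y 0 = x \<and> (\<forall>T. bounded_rate y (\<lambda>t. F t (y t)) 0 T)"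
proof -
  have M0: "M \<ge> 0" using bd[of 0] norm_ge_zero order_trans by blast
  have grow: "norm (F t z) \<le> M + L * norm z" if "t \<ge> 0" for t z
    using lip[OF that, of z 0] bd[OF that] norm_triangle_ineq[of "F t z - F t 0" "F t 0"] by auto
  have m': "(\<lambda>t. F t (y t)) \<in> borel_measurable (lebesgue_on {0..T})" if "continuous_on {0..} y" for y T
    using m[OF that] by (rule measurable_lebesgue_on_subset) auto
  have b': "\<exists>C. \<forall>t\<in>{0..T}. norm (F t (y t)) \<le> C" if y: "continuous_on {0..} y" for y T
  proof -
    have "compact (y ` {0..T})"
      by (intro compact_continuous_image continuous_on_subset[OF y]) auto
    then obtain Q where "\<forall>t\<in>{0..T}. norm (y t) \<le> Q"
      using compact_imp_bounded[of "y ` {0..T}"] unfolding bounded_iff by blast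
    then have "\<And>t. t \<in> {0..T} \<Longrightarrow> norm (y t) \<le> Q" by blast
    then have "norm (F t (y t)) \<le> M + L * Q" if "t \<in> {0..T}" for t
      using grow[of t "y t"] that L by (smt (verit) atLeastAtMost_iff mult_left_mono)
    then show ?thesis by blast
  qed
  have int: "(\<lambda>t. F t (y t)) integrable_on {0..T}" if y: "continuous_on {0..} y" for y T
    using bounded_measurable_integrable_on[OF m'[OF y]] b'[OF y, of T] by blast
  define \<Phi> where "\<Phi> y t = x + integral {0..t} (\<lambda>s. F s (y s))" for y t
  have br: "bounded_rate (\<Phi> y) (\<lambda>t. F t (y t)) 0 T" if y: "continuous_on {0..} y" for y T
    unfolding bounded_rate_def by (intro conjI m'[OF y] b'[OF y] ballI) (simp add: \<Phi>_def)
  have cont: "continuous_on {0..} (\<Phi> y)" if y: "continuous_on {0..} y" for y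
    by (rule continuous_on_atLeast_iff) (rule bounded_rate_continuous_on[OF br[OF y]])
  define Y where "Y k = (\<Phi> ^^ k) (\<lambda>_. x)" for k
  have Y0: "Y 0 = (\<lambda>_. x)" and YS: "Y (Suc k) = \<Phi> (Y k)" for k by (simp_all add: Y_def)
  have cY: "continuous_on {0..} (Y k)" for k
    by (induction k) (auto simp: Y0 YS intro: cont)
  \<comment> \<open>The first increment is at most \<open>(M + L * norm x) * t\<close>, and
    \<open>2 * L * t\<close> is below its exponential. This fixes \<open>D\<close>.\<close>
  define D where "D = (M + L * norm x) / (2 * L)"
  have D0: "D \<ge> 0" using M0 L by (simp add: D_def)
  have est: "norm (Y (Suc k) t - Y k t) \<le> D * exp (2 * L * t) * (1/2)^k" if "t \<ge> 0" for k t
    using that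
  proof (induction k arbitrary: t)
    case 0
    have "norm (integral {0..t} (\<lambda>s. F s x)) \<le> integral {0..t} (\<lambda>s. M + L * norm x)"
      using int[of "\<lambda>_. x" t] by (intro integral_norm_bound_integral) (auto intro: grow)
    also have "\<dots> = (M + L * norm x) * t" using 0 by simp
    also have "\<dots> \<le> (M + L * norm x) * (exp (2 * L * t) / (2 * L))"
    proof (rule mult_left_mono)
      have "2 * L * t \<le> exp (2 * L * t)" using exp_ge_add_one_self[of "2 * L * t"] by linarith
      then show "t \<le> exp (2 * L * t) / (2 * L)" using L by (simp add: field_simps)
    qed (use M0 L in auto)
    finally show ?case unfolding YS Y0 \<Phi>_def D_def by simp
  next
    case (Suc k)
    have "Y (Suc (Suc k)) t - Y (Suc k) t = integral {0..t} (\<lambda>s. F s (Y (Suc k) s) - F s (Y k s))"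
      unfolding YS[of "Suc k"] YS[of k] \<Phi>_def
      using int[OF cY[of "Suc k"], of t] int[OF cY[of k], of t] by (simp add: integral_diff YS \<Phi>_def)
    also have "norm \<dots> \<le> integral {0..t} (\<lambda>s. L * (D * exp (2 * L * s) * (1/2)^k))"
    proof (rule integral_norm_bound_integral)
      show "(\<lambda>s. F s (Y (Suc k) s) - F s (Y k s)) integrable_on {0..t}"
        using int[OF cY[of "Suc k"], of t] int[OF cY[of k], of t] by (rule integrable_diff)
      show "(\<lambda>s. L * (D * exp (2 * L * s) * (1/2)^k)) integrable_on {0..t}"
        by (intro integrable_continuous_interval continuous_intros)
      show "norm (F s (Y (Suc k) s) - F s (Y k s)) \<le> L * (D * exp (2 * L * s) * (1/2)^k)" if "s \<in> {0..t}" for s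
        using lip[of s "Y (Suc k) s" "Y k s"] Suc.IH[of s] that L by (smt (verit) atLeastAtMost_iff mult_left_mono)
    qed
    also have "\<dots> = D * exp (2 * L * t) * (1/2)^(Suc k) - D * (1/2)^(Suc k)"
    proof -
      have "((\<lambda>s. L * (D * exp (2 * L * s) * (1/2)^k)) has_integral 
         (D * exp (2 * L * t) * (1/2)^(Suc k) - D * exp (2 * L * 0) * (1/2)^(Suc k))) {0..t}"
        using L Suc.prems by (intro fundamental_theorem_of_calculus)
         (auto intro!: derivative_eq_intros simp: has_real_derivative_iff_has_vector_derivative[symmetric])
      from integral_unique[OF this] show ?thesis by simp
    qed
    also have "\<dots> \<le> D * exp (2 * L * t) * (1/2)^(Suc k)" using D0 by simp
    finally show ?case .
  qed
  define y where "y t = x + (\<Sum>k. Y (Suc k) t - Y k t)" for t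
  have ul: "uniform_limit {0..T} Y y sequentially" for T
  proof -
    have "uniform_limit {0..T} (\<lambda>n t. \<Sum>i<n. Y (Suc i) t - Y i t) (\<lambda>t. \<Sum>i. Y (Suc i) t - Y i t) sequentially"
    proof (rule Weierstrass_m_test)
      show "norm (Y (Suc n) t - Y n t) \<le> D * exp (2 * L * T) * (1/2)^n" if "t \<in> {0..T}" for n t
      proof -
        have "D * exp (2 * L * t) * (1/2)^n \<le> D * exp (2 * L * T) * (1/2)^n"
          using that D0 L by (intro mult_right_mono mult_left_mono) auto
        then show ?thesis using est[of t n] that by auto
      qed
      show "summable (\<lambda>n. D * exp (2 * L * T) * (1/2)^n)" by (intro summable_mult summable_geometric) auto
    qed
    then have "uniform_limit {0..T} (\<lambda>n t. x + (\<Sum>i<n. Y (Suc i) t - Y i t)) y sequentially"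
      unfolding y_def by (intro uniform_limit_intros) 
    moreover have "x + (\<Sum>i<n. Y (Suc i) t - Y i t) = Y n t" for n t
      using sum_lessThan_telescope[of "\<lambda>i. Y i t" n] by (simp add: Y0)
    ultimately show ?thesis by simp
  qed
  have cy: "continuous_on {0..} y"
  proof (rule continuous_on_atLeast_iff)
    show "continuous_on {0..T} y" for T
      by (rule uniform_limit_theorem[OF _ ul]) (intro always_eventually allI continuous_on_subset[OF cY], auto)
  qed
  have eq: "y t = \<Phi> y t" if t: "t \<ge> 0" for t
  proof (rule LIMSEQ_unique)
    show "(\<lambda>n. Y (Suc n) t) \<longlonglongrightarrow> y t"
      using tendsto_uniform_limitI[OF ul[of t], of t] t by (intro LIMSEQ_Suc) auto
    show "(\<lambda>n. Y (Suc n) t) \<longlonglongrightarrow> \<Phi> y t"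
    proof (rule LIMSEQ_I)
      fix e :: real assume e: "e > 0"
      define e' where "e' = e / (2 * L * (t + 1))"
      have e': "e' > 0" using e L t by (simp add: e'_def)
      obtain N where N: "\<And>n s. n \<ge> N \<Longrightarrow> s \<in> {0..t} \<Longrightarrow> dist (Y n s) (y s) < e'"
        using ul[of t, unfolded uniform_limit_iff, rule_format, OF e'] unfolding eventually_sequentially by blast
      have "norm (Y (Suc n) t - \<Phi> y t) < e" if n: "n \<ge> N" for n
      proof -
        have "Y (Suc n) t - \<Phi> y t = integral {0..t} (\<lambda>s. F s (Y n s) - F s (y s))"
          unfolding YS \<Phi>_def using int[OF cY[of n], of t] int[OF cy, of t] by (simp add: integral_diff)
        also have "norm \<dots> \<le> integral {0..t} (\<lambda>s. L * e')"
        proof (rule integral_norm_bound_integral)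
          show "(\<lambda>s. F s (Y n s) - F s (y s)) integrable_on {0..t}"
            using int[OF cY[of n], of t] int[OF cy, of t] by (rule integrable_diff)
          show "norm (F s (Y n s) - F s (y s)) \<le> L * e'" if "s \<in> {0..t}" for s
            using lip[of s "Y n s" "y s"] N[OF n that] that L by (smt (verit) atLeastAtMost_iff mult_left_mono dist_norm)
        qed auto
        also have "\<dots> = L * e' * t" using t by simp
        also have "\<dots> = e / 2 * (t / (t + 1))" using L t by (simp add: e'_def divide_simps)
        also have "\<dots> \<le> e / 2 * 1" using e t by (intro mult_left_mono) auto
        also have "\<dots> < e" using e by simp
        finally show ?thesis .
      qed
      then show "\<exists>no. \<forall>n\<ge>no. norm (Y (Suc n) t - \<Phi> y t) < e" by blast
    qed
  qed
  have "y 0 = x" using eq[of 0] by (simp add: \<Phi>_def)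
  moreover have "bounded_rate y (\<lambda>t. F t (y t)) 0 T" for T
    unfolding bounded_rate_def
  proof (intro conjI m'[OF cy] b'[OF cy] ballI)
    fix t assume "t \<in> {0..T}"
    then show "y t = y 0 + integral {0..t} (\<lambda>t. F t (y t))"
      using eq[of t] eq[of 0] unfolding \<Phi>_def by simp
  qed
  ultimately show ?thesis by blast
qed

text \<open>One estimate for several purposes: uniqueness and dependence on the initial point with
  \<open>c = 0\<close>, and growth of adjoint arcs by comparison with the zero function, where
  \<open>c = lam * L\<close>.\<close>

lemma bounded_rate_stability:
  fixes y z :: "real \<Rightarrow> 'a::euclidean_space"
  assumes y: "bounded_rate y \<alpha> 0 T" and z: "bounded_rate z \<beta> 0 T" and L: "L > 0"
    and le: "\<And>t. t \<in> {0..T} \<Longrightarrow> norm (\<alpha> t - \<beta> t) \<le> L * norm (y t - z t) + c"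
    and t: "t \<in> {0..T}" and c: "c \<ge> 0"
  shows "norm (y t - z t) \<le> (norm (y 0 - z 0) + c * T) * exp (2 * L * t)"
proof (rule gronwall_exp[where \<phi>="\<lambda>t. norm (y t - z t)" and T=T, OF _ L _ _ t])
  show cont: "continuous_on {0..T} (\<lambda>t. norm (y t - z t))"
    using bounded_rate_continuous_on[OF y] bounded_rate_continuous_on[OF z] by (intro continuous_intros)
  fix s assume s: "s \<in> {0..T}"
  have i: "(\<lambda>t. norm (y t - z t)) integrable_on {0..s}"
    by (intro integrable_continuous_interval continuous_on_subset[OF cont]) (use s in auto)
  have "((\<lambda>t. \<alpha> t - \<beta> t) has_integral ((y s - y 0) - (z s - z 0))) {0..s}"
    using bounded_rate_has_integral[OF y, of 0 s] bounded_rate_has_integral[OF z, of 0 s] s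
    by (intro has_integral_diff) auto
  then have "norm ((y s - y 0) - (z s - z 0)) \<le> integral {0..s} (\<lambda>t. L * norm (y t - z t) + c)"
  proof -
    assume h: "((\<lambda>t. \<alpha> t - \<beta> t) has_integral ((y s - y 0) - (z s - z 0))) {0..s}"
    have "norm (integral {0..s} (\<lambda>t. \<alpha> t - \<beta> t)) \<le> integral {0..s} (\<lambda>t. L * norm (y t - z t) + c)"
    proof (rule integral_norm_bound_integral)
      show "(\<lambda>t. \<alpha> t - \<beta> t) integrable_on {0..s}" using h by blast
      show "(\<lambda>t. L * norm (y t - z t) + c) integrable_on {0..s}"
        using i by (intro integrable_add integrable_on_mult_right integrable_const_ivl)
    qed (use le s in auto)
    then show ?thesis unfolding integral_unique[OF h] .
  qed
  also have "\<dots> = L * integral {0..s} (\<lambda>t. norm (y t - z t)) + c * s"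
    using i s by (subst integral_add) (auto intro!: integrable_on_mult_right)
  also have "c * s \<le> c * T" using s c by (intro mult_left_mono) auto
  finally show "norm (y s - z s) \<le> norm (y 0 - z 0) + c * T + L * integral {0..s} (\<lambda>t. norm (y t - z t))"
    using norm_triangle_ineq[of "(y s - y 0) - (z s - z 0)" "y 0 - z 0"] by (simp add: algebra_simps)
qed auto

lemma bounded_rate_cong:
  assumes y: "bounded_rate y h a b" and E: "negligible E" and eq: "\<And>t. t \<in> {a..b} - E \<Longrightarrow> h t = h' t"
    and h': "h' \<in> borel_measurable (lebesgue_on {a..b})" "\<And>t. t \<in> {a..b} \<Longrightarrow> norm (h' t) \<le> M"
  shows "bounded_rate y h' a b"
  unfolding bounded_rate_def
proof (intro conjI h' exI[of _ M] ballI)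
  fix t assume t: "t \<in> {a..b}"
  have "integral {a..t} h = integral {a..t} h'"
    by (rule integral_spike[OF E]) (use eq t in auto)
  then show "y t = y a + integral {a..t} h'" using bounded_rate_eq[OF y t] by simp
qed

lemma bounded_rate_subinterval:
  assumes y: "bounded_rate y h a b" and b': "b' \<le> b"
  shows "bounded_rate y h a b'"
proof -
  have s: "{a..b'} \<subseteq> {a..b}" using b' by auto
  obtain M where M: "\<And>t. t \<in> {a..b} \<Longrightarrow> norm (h t) \<le> M" using bounded_rate_bound[OF y] by blast
  show ?thesis unfolding bounded_rate_def
  proof (intro conjI exI[of _ M] ballI)
    show "h \<in> borel_measurable (lebesgue_on {a..b'})"
      using measurable_lebesgue_on_subset[OF bounded_rate_measurable[OF y] s] by simp
    show "norm (h t) \<le> M" if "t \<in> {a..b'}" for t using M s that by blast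
    show "y t = y a + integral {a..t} h" if "t \<in> {a..b'}" for t
      by (rule bounded_rate_eq[OF y]) (use s that in blast)
  qed
qed

lemma bounded_rate_shift:
  assumes y: "bounded_rate y \<alpha> 0 (s + T)" and s: "0 \<le> s"
  shows "bounded_rate (\<lambda>t. y (s + t)) (\<lambda>t. \<alpha> (s + t)) 0 T"
proof -
  obtain M where M: "\<And>t. t \<in> {0..s+T} \<Longrightarrow> norm (\<alpha> t) \<le> M" using bounded_rate_bound[OF y] by blast
  obtain E where E: "negligible E" "\<And>t. t \<in> {0<..<s+T} - E \<Longrightarrow> (y has_vector_derivative \<alpha> t) (at t)"
    using bounded_rate_AE_derivative[OF y] by blast
  show ?thesis
  proof (rule bounded_rateI[where C=M and M=M and E="(\<lambda>t. t - s) ` E"])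
    show "norm (y (s + u) - y (s + t)) \<le> M * \<bar>u - t\<bar>" if "u \<in> {0..T}" "t \<in> {0..T}" for u t
      using bounded_rate_lipschitz[OF y M, of "s + u" "s + t"] that s by auto
    show "negligible ((\<lambda>t. t - s) ` E)"
      using E(1) by (auto intro!: negligible_differentiable_image_negligible derivative_intros)
    show "norm (\<alpha> (s + t)) \<le> M" if "t \<in> {0..T}" for t using M[of "s + t"] that s by auto
    show "((\<lambda>t. y (s + t)) has_vector_derivative \<alpha> (s + t)) (at t)" if t: "t \<in> {0<..<T} - (\<lambda>t. t - s) ` E" for t
    proof -
      have "s + t \<in> {0<..<s+T} - E" using t s by (force simp: image_iff)
      then have "(y has_vector_derivative \<alpha> (s + t)) (at (s + t))" by (rule E(2))
      then have "((y \<circ> (\<lambda>t. s + t)) has_vector_derivative 1 *\<^sub>R \<alpha> (s + t)) (at t)"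
        by (intro vector_diff_chain_at) (auto intro!: derivative_eq_intros)
      then show ?thesis by (simp add: o_def)
    qed
    show "(\<lambda>t. \<alpha> (s + t)) \<in> borel_measurable (lebesgue_on {0..T})"
      using measurable_lebesgue_on_affine[OF bounded_rate_measurable[OF y], of "1" "{0..T}" s] s by simp
  qed
qed

lemma bounded_rate_reverse:
  assumes y: "bounded_rate y \<alpha> 0 T"
  shows "bounded_rate (\<lambda>t. y (T - t)) (\<lambda>t. - \<alpha> (T - t)) 0 T"
proof -
  obtain M where M: "\<And>t. t \<in> {0..T} \<Longrightarrow> norm (\<alpha> t) \<le> M" using bounded_rate_bound[OF y] by blast
  obtain E where E: "negligible E" "\<And>t. t \<in> {0<..<T} - E \<Longrightarrow> (y has_vector_derivative \<alpha> t) (at t)"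
    using bounded_rate_AE_derivative[OF y] by blast
  show ?thesis
  proof (rule bounded_rateI[where C=M and M=M and E="(\<lambda>t. T - t) ` E"])
    show "norm (y (T - s) - y (T - t)) \<le> M * \<bar>s - t\<bar>" if "s \<in> {0..T}" "t \<in> {0..T}" for s t
      using bounded_rate_lipschitz[OF y M, of "T - s" "T - t"] that by (auto simp: abs_minus_commute)
    show "negligible ((\<lambda>t. T - t) ` E)"
      using E(1) by (auto intro!: negligible_differentiable_image_negligible derivative_intros)
    show "norm (- \<alpha> (T - t)) \<le> M" if "t \<in> {0..T}" for t using M[of "T - t"] that by auto
    show "((\<lambda>t. y (T - t)) has_vector_derivative - \<alpha> (T - t)) (at t)" if t: "t \<in> {0<..<T} - (\<lambda>t. T - t) ` E" for t
    proof -
      have "T - t \<in> {0<..<T} - E" using t by (force simp: image_iff)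
      then have "(y has_vector_derivative \<alpha> (T - t)) (at (T - t))" by (rule E(2))
      then have "((y \<circ> (\<lambda>t. T - t)) has_vector_derivative (- 1) *\<^sub>R \<alpha> (T - t)) (at t)"
        by (intro vector_diff_chain_at) (auto intro!: derivative_eq_intros)
      then show ?thesis by (simp add: o_def)
    qed
    show "(\<lambda>t. - \<alpha> (T - t)) \<in> borel_measurable (lebesgue_on {0..T})"
      using measurable_lebesgue_on_affine[OF bounded_rate_measurable[OF y], of "-1" "{0..T}" T] by (simp add: borel_measurable_uminus)
  qed
qed

section \<open>The exit-time problem\<close>

lemma GDERIV_unique: "GDERIV h x :> a \<Longrightarrow> GDERIV h x :> b \<Longrightarrow> a = b"
proof -
  assume "GDERIV h x :> a" "GDERIV h x :> b"
  then have "(\<lambda>k. k \<bullet> a) = (\<lambda>k. k \<bullet> b)" unfolding gderiv_def by (rule has_derivative_unique)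
  then have "(a - b) \<bullet> a = (a - b) \<bullet> b" by meson
  then have "(a - b) \<bullet> (a - b) = 0" by (simp add: inner_diff_right)
  then show "a = b" by simp
qed

lemma differentiable_imp_GDERIV:
  fixes h :: "'a::euclidean_space \<Rightarrow> real"
  assumes "h differentiable at x"
  shows "GDERIV h x :> gradient h x"
proof -
  obtain D where D: "(h has_derivative D) (at x)" using assms differentiable_def by blast
  interpret D: bounded_linear D using D by (rule has_derivative_bounded_linear)
  define a where "a = (\<Sum>i\<in>Basis. D i *\<^sub>R i)"
  have "D k = k \<bullet> a" for k
  proof -
    have "D k = D (\<Sum>i\<in>Basis. (k \<bullet> i) *\<^sub>R i)" by (simp add: euclidean_representation)
    also have "\<dots> = (\<Sum>i\<in>Basis. (k \<bullet> i) * D i)" by (simp add: D.sum D.scaleR)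
    finally show ?thesis by (simp add: a_def inner_sum_right mult.commute)
  qed
  then have "D = (\<lambda>k. k \<bullet> a)" by auto
  then have "GDERIV h x :> a" using D unfolding gderiv_def by simp
  then show ?thesis unfolding gradient_def using GDERIV_unique by (metis theI)
qed

lemma has_derivative_lipschitz_bound:
  assumes D: "(F has_derivative D) (at x)" and lip: "\<And>y. norm (F y - F x) \<le> L * norm (y - x)"
  shows "norm (D h) \<le> L * norm h"
proof (cases "h = 0")
  case True
  then show ?thesis using linear_0[OF has_derivative_linear[OF D]] by simp
next
  case False
  interpret D: bounded_linear D using D by (rule has_derivative_bounded_linear)
  show ?thesis
  proof (rule field_le_epsilon)
    fix e :: real assume e: "e > 0"
    define e' where "e' = e / norm h"
    have e': "e' > 0" using e False by (simp add: e'_def)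
    obtain d where d: "d > 0" "\<And>y. norm (y - x) < d \<Longrightarrow> norm (F y - F x - D (y - x)) \<le> e' * norm (y - x)"
      using D e' unfolding has_derivative_at_alt by blast
    define t where "t = d / (2 * norm h)"
    have t: "t > 0" "t * norm h < d" using d False by (auto simp: t_def)
    have "norm (D (t *\<^sub>R h)) \<le> norm (F (x + t *\<^sub>R h) - F x) + norm (F (x + t *\<^sub>R h) - F x - D (t *\<^sub>R h))"
      using norm_triangle_ineq4[of "F (x + t *\<^sub>R h) - F x" "F (x + t *\<^sub>R h) - F x - D (t *\<^sub>R h)"] by simp
    also have "\<dots> \<le> L * norm (t *\<^sub>R h) + e' * norm (t *\<^sub>R h)"
      using lip[of "x + t *\<^sub>R h"] d(2)[of "x + t *\<^sub>R h"] t by (auto intro!: add_mono)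
    finally have "t * norm (D h) \<le> t * (L * norm h + e)"
      using t False by (simp add: D.scaleR e'_def algebra_simps)
    then show "norm (D h) \<le> L * norm h + e" using t by simp
  qed
qed

text \<open>\<open>\<phi>\<close> is continuous only on the closed set
  \<open>UNIV \<times> B\<close>. Its extension by 0 is Borel measurable, and the curve never leaves
  that set.\<close>

lemma borel_measurable_compose_continuous_on:
  fixes \<phi> :: "'a::euclidean_space \<Rightarrow> 'b::euclidean_space \<Rightarrow> 'c::euclidean_space"
  assumes c: "continuous_on (UNIV \<times> B) (\<lambda>(z, w). \<phi> z w)" and B: "compact B"
    and y: "y \<in> borel_measurable M" and u: "u \<in> borel_measurable M" and uB: "\<And>t. t \<in> space M \<Longrightarrow> u t \<in> B"
  shows "(\<lambda>t. \<phi> (y t) (u t)) \<in> borel_measurable M"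
proof -
  have cl: "closed (UNIV \<times> B)" using B by (intro closed_Times) (auto intro: compact_imp_closed)
  have "(\<lambda>p. if p \<in> UNIV \<times> B then (\<lambda>(z, w). \<phi> z w) p else 0) \<in> borel_measurable borel"
    by (rule borel_measurable_continuous_on_if) (use borel_closed[OF cl] c in auto)
  then have "(\<lambda>t. if (y t, u t) \<in> UNIV \<times> B then (\<lambda>(z, w). \<phi> z w) (y t, u t) else 0) \<in> borel_measurable M"
    by (rule measurable_compose_rev) (intro borel_measurable_Pair y u)
  then show ?thesis
    by (rule measurable_cong[THEN iffD1, rotated]) (use uB in auto)
qed

lemma integrable_lebesgue_on_bounded:
  fixes h :: "real \<Rightarrow> 'a::euclidean_space"
  assumes "h \<in> borel_measurable (lebesgue_on {a..b})" "\<And>t. t \<in> {a..b} \<Longrightarrow> norm (h t) \<le> M"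
  shows "integrable (lebesgue_on {a..b}) h"
proof (rule finite_measure.integrable_const_bound[of _ _ M])
  show "finite_measure (lebesgue_on {a..b})" by (rule finite_measure_lebesgue_on) auto
  show "AE x in lebesgue_on {a..b}. norm (h x) \<le> M" by (rule AE_I2) (use assms in auto)
qed (use assms in auto)

text \<open>The witnesses \<open>W\<close> and \<open>G\<close> of \<open>terminal_cost_assm\<close>
  are fixed as parameters, since \<kappa> and the constants built from it are expressed by
  \<open>G\<close>.\<close>

locale exit_problem =
  fixes f :: "real^'d \<Rightarrow> real^'m \<Rightarrow> real^'d"
    and r :: "real^'d \<Rightarrow> real^'m \<Rightarrow> real"
    and g :: "real^'d \<Rightarrow> real"
    and U :: "(real^'m) set"
    and S :: "(real^'d) set"
    and N L r0 \<rho>0 G :: real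
    and W :: "(real^'d) set"
  assumes U_ne: "U \<noteq> {}" and U_compact: "compact U"
    and S_closed: "closed S"
    and N_pos: "N > 0" and L_pos: "L > 0" and r0_pos: "r0 > 0" and \<rho>0_pos: "\<rho>0 > 0"
    and dyn: "dynamics_assm f U N L"
    and run: "running_cost_assm r U L r0"
    and W_open: "open W" and frontier_W: "frontier S \<subseteq> W" and G_nonneg: "0 \<le> G" and G_less: "G < r0 / N"
    and g_lip: "\<And>x y. x \<in> W \<Longrightarrow> y \<in> W \<Longrightarrow> \<bar>g y - g x\<bar> \<le> G * norm (y - x)"
    and inner_ball: "inner_ball_assm S \<rho>0"
    and semiconcave: "locally_semiconcave g"
begin

definition \<kappa> where "\<kappa> = r0 - G * N"

lemma \<kappa>_pos: "\<kappa> > 0" using G_less N_pos by (simp add: \<kappa>_def field_simps)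

lemma f_cont: "continuous_on (UNIV \<times> U) (\<lambda>(x, w). f x w)"
  and f_less: "w \<in> U \<Longrightarrow> norm (f x w) < N"
  and f_differentiable: "w \<in> U \<Longrightarrow> (\<lambda>z. f z w) differentiable (at x)"
  and Dxf_cont: "continuous_on (UNIV \<times> U) (\<lambda>(x, w). Dxf f x w)"
  and f_lip: "w \<in> U \<Longrightarrow> norm (f y w - f x w) \<le> L * norm (y - x)"
  and Dxf_lip: "w \<in> U \<Longrightarrow> onorm (\<lambda>h. (Dxf f y w - Dxf f x w) *v h) \<le> L * norm (y - x)"
  using dyn unfolding dynamics_assm_def by blast+

lemma r_cont: "continuous_on (UNIV \<times> U) (\<lambda>(x, w). r x w)"
  and r_differentiable: "w \<in> U \<Longrightarrow> (\<lambda>z. r z w) differentiable (at x)"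
  and Dxr_cont: "continuous_on (UNIV \<times> U) (\<lambda>(x, w). Dxr r x w)"
  and r_lip': "w \<in> U \<Longrightarrow> \<bar>r y w - r x w\<bar> + norm (Dxr r y w - Dxr r x w) \<le> L * norm (y - x)"
  and r_ge: "w \<in> U \<Longrightarrow> r0 \<le> r x w"
  using run unfolding running_cost_assm_def by blast+

lemma r_lip: "w \<in> U \<Longrightarrow> \<bar>r y w - r x w\<bar> \<le> L * norm (y - x)"
  and Dxr_lip: "w \<in> U \<Longrightarrow> norm (Dxr r y w - Dxr r x w) \<le> L * norm (y - x)"
  using r_lip'[of w y x] by (smt (verit) norm_ge_zero)+

lemma f_le: "w \<in> U \<Longrightarrow> norm (f x w) \<le> N" using f_less less_imp_le by blast

lemma f_has_derivative: "w \<in> U \<Longrightarrow> ((\<lambda>z. f z w) has_derivative (\<lambda>h. Dxf f x w *v h)) (at x)"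
  using f_differentiable[of w x] jacobian_works unfolding Dxf_def by blast

lemma r_GDERIV: "w \<in> U \<Longrightarrow> GDERIV (\<lambda>z. r z w) x :> Dxr r x w"
  unfolding Dxr_def by (rule differentiable_imp_GDERIV[OF r_differentiable])

lemma Dxf_norm: "w \<in> U \<Longrightarrow> norm (Dxf f x w *v h) \<le> L * norm h"
  by (rule has_derivative_lipschitz_bound[OF f_has_derivative]) (auto intro: f_lip)

lemma Dxf_transpose_norm:
  assumes "w \<in> U" shows "norm (transpose (Dxf f x w) *v p) \<le> L * norm p"
proof -
  let ?q = "transpose (Dxf f x w) *v p"
  have "norm ?q ^ 2 = ?q \<bullet> ?q" by (rule power2_norm_eq_inner)
  also have "\<dots> = p \<bullet> (Dxf f x w *v ?q)" by (metis dot_lmul_matrix inner_commute transpose_matrix_vector)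
  also have "\<dots> \<le> norm p * norm (Dxf f x w *v ?q)" by (rule norm_cauchy_schwarz)
  also have "\<dots> \<le> norm p * (L * norm ?q)" by (intro mult_left_mono Dxf_norm assms) auto
  finally have "norm ?q * norm ?q \<le> (L * norm p) * norm ?q" by (simp add: power2_eq_square algebra_simps)
  then show ?thesis by (cases "norm ?q = 0") (use L_pos in \<open>auto simp: mult_le_cancel_right\<close>)
qed

lemma Dxr_norm:
  assumes "w \<in> U" shows "norm (Dxr r x w) \<le> L"
proof -
  have "norm (Dxr r x w \<bullet> Dxr r x w) \<le> L * norm (Dxr r x w)"
    using has_derivative_lipschitz_bound[of "\<lambda>z. r z w" "\<lambda>h. h \<bullet> Dxr r x w" x L "Dxr r x w"]
      r_GDERIV[OF assms, of x] r_lip[OF assms] unfolding gderiv_def by auto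
  then have "norm (Dxr r x w) * norm (Dxr r x w) \<le> L * norm (Dxr r x w)" 
    by (simp add: power2_norm_eq_inner[symmetric] power2_eq_square)
  then show ?thesis by (cases "norm (Dxr r x w) = 0") (use L_pos in \<open>auto simp: mult_le_cancel_right\<close>)
qed

text \<open>The mean value theorem for \<open>f\<close> minus its linearization at \<open>x\<close>;
  the Lipschitz bound on \<open>Dxf\<close> makes the remainder quadratic, uniformly in the control
  value.\<close>

lemma f_taylor:
  assumes w: "w \<in> U" shows "norm (f y w - f x w - Dxf f x w *v (y - x)) \<le> L * (norm (y - x))\<^sup>2"
proof -
  define F where "F z = f z w - Dxf f x w *v z" for z
  have "norm (F y - F x) \<le> (L * norm (y - x)) * norm (y - x)"
  proof (rule differentiable_bound[of "closed_segment x y" F "\<lambda>z h. (Dxf f z w - Dxf f x w) *v h"])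
    fix z assume z: "z \<in> closed_segment x y"
    have "(F has_derivative (\<lambda>h. Dxf f z w *v h - Dxf f x w *v h)) (at z)"
      unfolding F_def by (intro has_derivative_diff f_has_derivative w bounded_linear_imp_has_derivative matrix_vector_mul_bounded_linear)
    moreover have "(\<lambda>h. Dxf f z w *v h - Dxf f x w *v h) = (\<lambda>h. (Dxf f z w - Dxf f x w) *v h)"
      by (rule ext) (rule matrix_vector_mult_diff_rdistrib[symmetric])
    ultimately have "(F has_derivative (\<lambda>h. (Dxf f z w - Dxf f x w) *v h)) (at z)" by metis
    then show "(F has_derivative (\<lambda>h. (Dxf f z w - Dxf f x w) *v h)) (at z within closed_segment x y)"
      by (rule has_derivative_at_withinI)
    have "norm (z - x) \<le> norm (y - x)" using segment_bound1[OF z] by simp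
    then show "onorm (\<lambda>h. (Dxf f z w - Dxf f x w) *v h) \<le> L * norm (y - x)"
      using order_trans[OF Dxf_lip[OF w, of z x] mult_left_mono[of "norm (z - x)" "norm (y - x)" L]] L_pos by simp
  qed auto
  moreover have "F y - F x = f y w - f x w - Dxf f x w *v (y - x)"
    by (simp add: F_def matrix_vector_mult_diff_distrib)
  ultimately show ?thesis by (simp add: power2_eq_square mult.assoc)
qed

lemma r_taylor:
  assumes w: "w \<in> U" shows "\<bar>r y w - r x w - (y - x) \<bullet> Dxr r x w\<bar> \<le> L * (norm (y - x))\<^sup>2"
proof -
  define F where "F z = r z w - z \<bullet> Dxr r x w" for z
  have "norm (F y - F x) \<le> (L * norm (y - x)) * norm (y - x)"
  proof (rule differentiable_bound[of "closed_segment x y" F "\<lambda>z h. h \<bullet> (Dxr r z w - Dxr r x w)"])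
    fix z assume z: "z \<in> closed_segment x y"
    have "(F has_derivative (\<lambda>h. h \<bullet> Dxr r z w - h \<bullet> Dxr r x w)) (at z)"
      unfolding F_def by (intro derivative_intros r_GDERIV[unfolded gderiv_def] w)
    then show "(F has_derivative (\<lambda>h. h \<bullet> (Dxr r z w - Dxr r x w))) (at z within closed_segment x y)"
      by (simp add: inner_diff_right has_derivative_at_withinI)
    have "norm (z - x) \<le> norm (y - x)" using segment_bound1[OF z] by simp
    then have b: "norm (Dxr r z w - Dxr r x w) \<le> L * norm (y - x)"
      using Dxr_lip[OF w, of z x] L_pos by (smt (verit) mult_left_mono)
    show "onorm (\<lambda>h. h \<bullet> (Dxr r z w - Dxr r x w)) \<le> L * norm (y - x)"
    proof (rule onorm_bound)
      show "norm (h \<bullet> (Dxr r z w - Dxr r x w)) \<le> L * norm (y - x) * norm h" for h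
        using Cauchy_Schwarz_ineq2[of h "Dxr r z w - Dxr r x w"] mult_left_mono[OF b, of "norm h"] by (simp add: mult.commute)
    qed (use L_pos in auto)
  qed auto
  moreover have "F y - F x = r y w - r x w - (y - x) \<bullet> Dxr r x w"
    by (simp add: F_def inner_diff_left)
  ultimately show ?thesis by (simp add: power2_eq_square mult.assoc)
qed

definition R0 where "R0 = (SOME R. R \<ge> 0 \<and> (\<forall>w\<in>U. \<bar>r 0 w\<bar> \<le> R))"

lemma R0: "R0 \<ge> 0" "w \<in> U \<Longrightarrow> \<bar>r 0 w\<bar> \<le> R0"
proof -
  have "continuous_on U (\<lambda>w. (\<lambda>(x, w). r x w) (0, w))"
    by (rule continuous_on_compose2[OF r_cont]) (auto intro!: continuous_intros)
  then have "bounded ((\<lambda>w. r 0 w) ` U)"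
    using compact_imp_bounded compact_continuous_image U_compact by fastforce
  then obtain R where "R > 0" "\<forall>w\<in>U. \<bar>r 0 w\<bar> \<le> R" unfolding bounded_pos by auto
  then have "\<exists>R. R \<ge> 0 \<and> (\<forall>w\<in>U. \<bar>r 0 w\<bar> \<le> R)" by (intro exI[of _ R]) auto
  from someI_ex[OF this, folded R0_def]
  show "R0 \<ge> 0" "w \<in> U \<Longrightarrow> \<bar>r 0 w\<bar> \<le> R0" by auto
qed

lemma r_bound: "w \<in> U \<Longrightarrow> \<bar>r x w\<bar> \<le> R0 + L * norm x"
  using r_lip[of w x 0] R0(2)[of w] by auto

lemma controls_in: "u \<in> controls U \<Longrightarrow> t \<ge> 0 \<Longrightarrow> u t \<in> U"
  unfolding controls_def by auto

lemma control_measurable: "u \<in> controls U \<Longrightarrow> J \<subseteq> {0..} \<Longrightarrow> J \<in> sets lebesgue \<Longrightarrow> u \<in> borel_measurable (lebesgue_on J)"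
  unfolding controls_def using measurable_lebesgue_on_subset by blast

lemma compose_measurable:
  fixes \<phi> :: "real^'d \<Rightarrow> real^'m \<Rightarrow> 'c::euclidean_space"
  assumes c: "continuous_on (UNIV \<times> U) (\<lambda>(z, w). \<phi> z w)" and u: "u \<in> controls U"
    and J: "J \<subseteq> {0..}" "J \<in> sets lebesgue" and y: "continuous_on J y"
  shows "(\<lambda>t. \<phi> (y t) (u t)) \<in> borel_measurable (lebesgue_on J)"
proof (rule borel_measurable_compose_continuous_on[OF c U_compact])
  show "y \<in> borel_measurable (lebesgue_on J)" by (rule continuous_imp_measurable_on_sets_lebesgue[OF y J(2)])
  show "u t \<in> U" if "t \<in> space (lebesgue_on J)" for t
    using that J by (intro controls_in[OF u]) auto
qed (rule control_measurable[OF u J])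

abbreviation "Y \<equiv> traj f"

abbreviation "adj_rate lam z w p \<equiv> - (transpose (Dxf f z w) *v p) - lam *\<^sub>R Dxr r z w"

lemma traj_solution:
  assumes u: "u \<in> controls U"
  shows "caratheodory_solution {0..} (\<lambda>s z. f z (u s)) (Y x u) \<and> Y x u 0 = x"
proof -
  have "\<exists>y. y 0 = x \<and> (\<forall>T. bounded_rate y (\<lambda>t. f (y t) (u t)) 0 T)"
  proof (rule ode_exists[OF _ L_pos])
    show "(\<lambda>t. f (y t) (u t)) \<in> borel_measurable (lebesgue_on {0..})" if "continuous_on {0..} y" for y
      by (rule compose_measurable[OF f_cont u _ _ that]) auto
  qed (use controls_in[OF u] f_lip f_le in blast)+
  then obtain y where "y 0 = x" "\<And>T. bounded_rate y (\<lambda>t. f (y t) (u t)) 0 T" by blast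
  then have "\<exists>y. caratheodory_solution {0..} (\<lambda>s z. f z (u s)) y \<and> y 0 = x"
    using bounded_rate_imp_caratheodory_ge[of y "\<lambda>t z. f z (u t)" 0] by blast
  then show ?thesis unfolding traj_def by (rule someI_ex)
qed

lemma traj_0: "u \<in> controls U \<Longrightarrow> Y x u 0 = x"
  using traj_solution by blast

lemma traj_rate:
  assumes u: "u \<in> controls U"
  shows "bounded_rate (Y x u) (\<lambda>t. f (Y x u t) (u t)) 0 T"
proof (rule caratheodory_imp_bounded_rate[where F="\<lambda>t z. f z (u t)" and I="{0..}" and M=N])
  show "caratheodory_solution {0..} (\<lambda>t z. f z (u t)) (Y x u)" using traj_solution[OF u] by blast
  then have "continuous_on {0..T} (Y x u)" by (rule caratheodory_continuous_on) auto
  then show "(\<lambda>t. f (Y x u t) (u t)) \<in> borel_measurable (lebesgue_on {0..T})"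
    by (intro compose_measurable[OF f_cont u]) auto
  show "norm (f (Y x u t) (u t)) \<le> N" if "t \<in> {0..T}" for t
    using controls_in[OF u, of t] f_le that by auto
qed auto

lemma traj_lip: "u \<in> controls U \<Longrightarrow> s \<ge> 0 \<Longrightarrow> t \<ge> 0 \<Longrightarrow> norm (Y x u s - Y x u t) \<le> N * \<bar>s - t\<bar>"
  using bounded_rate_lipschitz[OF traj_rate[of u x "max s t"], of N s t] by (auto intro: f_le controls_in)

lemma traj_continuous: "u \<in> controls U \<Longrightarrow> continuous_on {0..} (Y x u)"
  by (rule continuous_on_atLeast_iff) (rule bounded_rate_continuous_on[OF traj_rate])

lemma traj_unique:
  assumes u: "u \<in> controls U" and y: "bounded_rate y (\<lambda>t. f (y t) (u t)) 0 T" and t: "t \<in> {0..T}"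
  shows "y t = Y (y 0) u t"
proof -
  have "norm (y t - Y (y 0) u t) \<le> (norm (y 0 - Y (y 0) u 0) + 0 * T) * exp (2 * L * t)"
    by (rule bounded_rate_stability[OF y traj_rate[OF u] L_pos _ t])
      (auto intro: f_lip controls_in[OF u])
  then show ?thesis using traj_0[OF u] by simp
qed

lemma traj_dep:
  assumes u: "u \<in> controls U" and t: "t \<ge> 0"
  shows "norm (Y z u t - Y x u t) \<le> norm (z - x) * exp (2 * L * t)"
proof -
  have "norm (Y z u t - Y x u t) \<le> (norm (Y z u 0 - Y x u 0) + 0 * t) * exp (2 * L * t)"
    by (rule bounded_rate_stability[OF traj_rate[OF u] traj_rate[OF u] L_pos])
      (use t in \<open>auto intro: f_lip controls_in[OF u]\<close>)
  then show ?thesis using traj_0[OF u] by simp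
qed

lemma shift_control:
  assumes u: "u \<in> controls U" and s: "s \<ge> 0"
  shows "(\<lambda>t. u (s + t)) \<in> controls U"
  using u s measurable_lebesgue_on_affine[of u "{0..}" 1 "{0..}" s] unfolding controls_def by auto

lemma const_control: "w \<in> U \<Longrightarrow> (\<lambda>_. w) \<in> controls U"
  unfolding controls_def by auto

definition cat where "cat u s w t = (if t < s then u t else w (t - s))" for u w :: "real \<Rightarrow> real^'m" and s t :: real

lemma cat_control:
  assumes u: "u \<in> controls U" and s: "s \<ge> 0" and w: "w \<in> controls U"
  shows "cat u s w \<in> controls U"
proof -
  have e: "cat u s w = (\<lambda>t. if t \<in> {..<s} then u t else w (t - s))" by (auto simp: cat_def)
  have "(\<lambda>t. if t \<in> {..<s} then u t else w (t - s)) \<in> borel_measurable (lebesgue_on {0..})"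
  proof (subst measurable_If_restrict_space_iff)
    show "{x \<in> space (lebesgue_on {0..}). x \<in> {..<s}} \<in> sets (lebesgue_on {0..})"
      by (auto simp: sets_restrict_space)
    have 1: "u \<in> borel_measurable (lebesgue_on ({0..} \<inter> {..<s}))"
      by (rule control_measurable[OF u]) auto
    have 2: "(\<lambda>t. w (- s + 1 * t)) \<in> borel_measurable (lebesgue_on ({0..} \<inter> {s..}))"
      by (rule measurable_lebesgue_on_affine[of w "{0..}"]) (use w in \<open>auto simp: controls_def\<close>)
    show "u \<in> restrict_space (lebesgue_on {0..}) {x. x \<in> {..<s}} \<rightarrow>\<^sub>M borel \<and>
      (\<lambda>t. w (t - s)) \<in> restrict_space (lebesgue_on {0..}) {x. x \<notin> {..<s}} \<rightarrow>\<^sub>M borel"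
      using 1 2 by (simp add: restrict_restrict_space lessThan_def[symmetric] not_less atLeast_def[symmetric] Collect_neg_eq[symmetric])
  qed
  then show ?thesis using e u w s unfolding controls_def by (auto simp: cat_def)
qed

lemma traj_shift:
  assumes u: "u \<in> controls U" and s: "s \<ge> 0" and t: "t \<ge> 0"
  shows "Y x u (s + t) = Y (Y x u s) (\<lambda>t. u (s + t)) t"
proof -
  have "bounded_rate (\<lambda>t. Y x u (s + t)) (\<lambda>t. f (Y x u (s + t)) (u (s + t))) 0 t"
    by (rule bounded_rate_shift[OF traj_rate[OF u] s])
  from traj_unique[OF shift_control[OF u s] this, of t] t show ?thesis by simp
qed

text \<open>Agreement is asked for strictly before \<open>T\<close>, because
  \<open>cat u s w\<close> takes the value of the second control already at the junction
  time.\<close>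

lemma traj_cong:
  assumes u: "u \<in> controls U" and v: "v \<in> controls U" and eq: "\<And>t. 0 \<le> t \<Longrightarrow> t < T \<Longrightarrow> u t = v t" and t: "0 \<le> t" "t \<le> T"
  shows "Y x u t = Y x v t"
proof -
  have "bounded_rate (Y x u) (\<lambda>t. f (Y x u t) (v t)) 0 T"
  proof (rule bounded_rate_cong[OF traj_rate[OF u], of "{T}"])
    show "(\<lambda>t. f (Y x u t) (v t)) \<in> borel_measurable (lebesgue_on {0..T})"
      by (intro compose_measurable[OF f_cont v] continuous_on_subset[OF traj_continuous[OF u]]) auto
    show "norm (f (Y x u t) (v t)) \<le> N" if "t \<in> {0..T}" for t
      using controls_in[OF v, of t] f_le that by auto
  qed (use eq in auto)
  from traj_unique[OF v this, of t] t traj_0[OF u] show ?thesis by auto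
qed

lemma traj_cat1:
  assumes "u \<in> controls U" "w \<in> controls U" "0 \<le> t" "t \<le> s"
  shows "Y x (cat u s w) t = Y x u t"
  by (rule traj_cong[where T=s]) (use assms in \<open>auto intro: cat_control simp: cat_def\<close>)

lemma traj_cat2:
  assumes "u \<in> controls U" "w \<in> controls U" "0 \<le> s" "0 \<le> t"
  shows "Y x (cat u s w) (s + t) = Y (Y x u s) w t"
proof -
  have "Y x (cat u s w) (s + t) = Y (Y x (cat u s w) s) (\<lambda>t. cat u s w (s + t)) t"
    by (rule traj_shift[OF cat_control[OF assms(1,3,2)] assms(3,4)])
  also have "Y x (cat u s w) s = Y x u s" using traj_cat1[OF assms(1,2,3), of s x] by simp
  also have "Y (Y x u s) (\<lambda>t. cat u s w (s + t)) t = Y (Y x u s) w t"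
    by (rule traj_cong[where T=t, OF shift_control[OF cat_control[OF assms(1,3,2)] assms(3)] assms(2)])
      (use assms in \<open>auto simp: cat_def\<close>)
  finally show ?thesis .
qed

end

section \<open>Hitting times, costs and dynamic programming\<close>

context exit_problem
begin

text \<open>A relation instead of an extended-real time: it contains the statement that the target
  is reached, so that infinite values never occur in calculations.\<close>

definition first_hit where
  "first_hit x u tau \<longleftrightarrow> 0 \<le> tau \<and> Y x u tau \<in> S \<and> (\<forall>t. 0 \<le> t \<and> t < tau \<longrightarrow> Y x u t \<notin> S)"

abbreviation "Reach \<equiv> reachable f U S"
abbreviation "J \<equiv> cost f r g S"
abbreviation "V \<equiv> value_fun f r g U S"

definition rint where "rint x u a b = integral {a..b} (\<lambda>s. r (Y x u s) (u s))"

lemma first_hit_exists: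
  assumes u: "u \<in> controls U" and t: "t \<ge> 0" "Y x u t \<in> S"
  shows "\<exists>tau\<le>t. first_hit x u tau"
proof -
  define A where "A = {s \<in> {0..t}. Y x u s \<in> S}"
  have "closed A" unfolding A_def
    by (intro continuous_closed_preimage[unfolded vimage_def Int_def, simplified] continuous_on_subset[OF traj_continuous[OF u]] S_closed)
      (auto intro: continuous_on_subset[OF traj_continuous[OF u]])
  then have "compact A" unfolding A_def by (intro compact_eq_bounded_closed[THEN iffD2]) (auto intro: bounded_subset[of "{0..t}"])
  moreover have "t \<in> A" using t by (auto simp: A_def)
  ultimately obtain tau where "tau \<in> A" "\<And>s. s \<in> A \<Longrightarrow> tau \<le> s"
    using compact_attains_inf[of A] by auto
  then have "first_hit x u tau" "tau \<le> t" unfolding first_hit_def A_def by force+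
  then show ?thesis by blast
qed

lemma first_hit_hit_time:
  assumes h: "first_hit x u tau"
  shows "hit_time f S x u = ereal tau" "exit_time f S x u = tau" "exit_point f S x u = Y x u tau"
proof -
  have "(LEAST t. 0 \<le> t \<and> Y x u t \<in> S) = tau"
    by (rule Least_equality) (use h in \<open>auto simp: first_hit_def not_le intro: leI\<close>)
  then show 1: "hit_time f S x u = ereal tau" unfolding hit_time_def using h by (auto simp: first_hit_def)
  then show 2: "exit_time f S x u = tau" by (simp add: exit_time_def)
  show "exit_point f S x u = Y x u tau" by (simp add: exit_point_def 2)
qed

lemma admissible_iff: "u \<in> admissible f U S x \<longleftrightarrow> u \<in> controls U \<and> (\<exists>tau. first_hit x u tau)"
proof
  assume "u \<in> admissible f U S x"
  then have u: "u \<in> controls U" and "hit_time f S x u < \<infinity>" by (auto simp: admissible_def)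
  then obtain t where "t \<ge> 0" "Y x u t \<in> S" unfolding hit_time_def by (auto split: if_splits)
  then show "u \<in> controls U \<and> (\<exists>tau. first_hit x u tau)" using first_hit_exists[OF u] u by blast
qed (auto simp: admissible_def first_hit_hit_time)

lemma reachable_iff: "x \<in> Reach \<longleftrightarrow> (\<exists>u tau. u \<in> controls U \<and> first_hit x u tau)"
  using admissible_iff unfolding reachable_def admissible_def by blast

lemma r_measurable:
  assumes u: "u \<in> controls U" and ab: "0 \<le> a"
  shows "(\<lambda>s. r (Y x u s) (u s)) \<in> borel_measurable (lebesgue_on {a..b})"
  by (rule compose_measurable[OF r_cont u]) (use ab in \<open>auto intro: continuous_on_subset[OF traj_continuous[OF u]]\<close>)

lemma traj_norm: "u \<in> controls U \<Longrightarrow> t \<ge> 0 \<Longrightarrow> norm (Y x u t - x) \<le> N * t"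
  using traj_lip[of u t 0 x] traj_0[of u x] by simp

lemma r_traj_bound:
  assumes u: "u \<in> controls U" and t: "0 \<le> t" "t \<le> b"
  shows "\<bar>r (Y x u t) (u t)\<bar> \<le> R0 + L * (norm x + N * b)"
proof -
  have "norm (Y x u t) \<le> norm x + N * t" using traj_norm[OF u t(1), of x] norm_triangle_sub[of "Y x u t" x] by linarith
  also have "N * t \<le> N * b" using t N_pos by simp
  finally have "L * norm (Y x u t) \<le> L * (norm x + N * b)" using L_pos by simp
  then show ?thesis using r_bound[OF controls_in[OF u t(1)], of "Y x u t"] by linarith
qed

lemma r_integrable:
  assumes u: "u \<in> controls U" and a: "0 \<le> a"
  shows "(\<lambda>s. r (Y x u s) (u s)) integrable_on {a..b}"
  by (rule bounded_measurable_integrable_on[OF r_measurable[OF u a], where M="R0 + L * (norm x + N * b)"])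
    (use r_traj_bound[OF u, of _ b x] a in auto)

lemma rint_combine:
  assumes u: "u \<in> controls U" and "0 \<le> a" "a \<le> c" "c \<le> b"
  shows "rint x u a b = rint x u a c + rint x u c b"
  unfolding rint_def by (rule Henstock_Kurzweil_Integration.integral_combine[symmetric]) (use assms r_integrable[OF u] in auto)

lemma rint_ge:
  assumes u: "u \<in> controls U" and "0 \<le> a" "a \<le> b"
  shows "r0 * (b - a) \<le> rint x u a b"
proof -
  have "integral {a..b} (\<lambda>_. r0) \<le> rint x u a b" unfolding rint_def
    by (rule integral_le) (use assms r_integrable[OF u] r_ge controls_in[OF u] in auto)
  then show ?thesis using assms by (simp add: mult.commute)
qed

lemma cost_eq:
  assumes u: "u \<in> controls U" and h: "first_hit x u tau"
  shows "J x u = rint x u 0 tau + g (Y x u tau)"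
proof -
  have "integrable (lebesgue_on {0..tau}) (\<lambda>s. r (Y x u s) (u s))"
    by (rule integrable_lebesgue_on_bounded[OF r_measurable[OF u], where M="R0 + L * (norm x + N * tau)"])
      (use r_traj_bound[OF u, of _ tau x] in auto)
  from lebesgue_integral_eq_integral[OF this] show ?thesis
    unfolding cost_def first_hit_hit_time[OF h] rint_def by simp
qed

lemma V_le: "u \<in> controls U \<Longrightarrow> first_hit x u tau \<Longrightarrow> V x \<le> ereal (J x u)"
  unfolding value_fun_def by (rule INF_lower) (auto simp: admissible_iff)

lemma first_hit_0: "u \<in> controls U \<Longrightarrow> z \<in> S \<Longrightarrow> first_hit z u 0"
  by (auto simp: first_hit_def traj_0)

lemma V_on_S: assumes z: "z \<in> S" shows "V z = ereal (g z)"
proof -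
  have J: "J z u = g z" if "u \<in> controls U" for u
    using cost_eq[OF that first_hit_0[OF that z]] that by (simp add: rint_def traj_0)
  obtain w where "w \<in> U" using U_ne by auto
  then have a: "(\<lambda>_. w) \<in> admissible f U S z" using first_hit_0 const_control z admissible_iff by blast
  show ?thesis unfolding value_fun_def
  proof (rule antisym)
    show "(INF u\<in>admissible f U S z. ereal (J z u)) \<le> ereal (g z)"
      using INF_lower[OF a, of "\<lambda>u. ereal (J z u)"] J[OF const_control[OF \<open>w \<in> U\<close>]] by simp
    show "ereal (g z) \<le> (INF u\<in>admissible f U S z. ereal (J z u))"
      by (rule INF_greatest) (auto simp: J admissible_iff)
  qed
qed

lemma first_hit_shift:
  assumes u: "u \<in> controls U" and h: "first_hit x u tau" and s: "0 \<le> s" "s \<le> tau"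
  shows "first_hit (Y x u s) (\<lambda>t. u (s + t)) (tau - s)"
  unfolding first_hit_def
proof (intro conjI allI impI)
  have e: "Y (Y x u s) (\<lambda>t. u (s + t)) t = Y x u (s + t)" if "t \<ge> 0" for t
    using traj_shift[OF u s(1) that] by simp
  show "Y (Y x u s) (\<lambda>t. u (s + t)) (tau - s) \<in> S" using e[of "tau - s"] s h by (simp add: first_hit_def)
  show "Y (Y x u s) (\<lambda>t. u (s + t)) t \<notin> S" if "0 \<le> t \<and> t < tau - s" for t
    using e[of t] that s h by (auto simp: first_hit_def)
qed (use s in auto)

lemma rint_shift:
  assumes u: "u \<in> controls U" and s: "0 \<le> s" "0 \<le> a" "a \<le> b"
  shows "rint (Y x u s) (\<lambda>t. u (s + t)) a b = rint x u (s + a) (s + b)"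
proof -
  have "rint (Y x u s) (\<lambda>t. u (s + t)) a b = integral {a..b} (\<lambda>t. r (Y x u (s + t)) (u (s + t)))"
    unfolding rint_def by (rule integral_cong) (use traj_shift[OF u s(1)] s in auto)
  also have "\<dots> = integral {a..b} ((\<lambda>t. r (Y x u t) (u t)) \<circ> (+) s)" by (simp add: o_def)
  also have "\<dots> = integral {a + s..b + s} (\<lambda>t. r (Y x u t) (u t))"
    using integral_shift_Icc_real[of a b "\<lambda>t. r (Y x u t) (u t)" s] by simp
  finally show ?thesis by (simp add: rint_def add.commute)
qed

lemma cost_tail:
  assumes u: "u \<in> controls U" and h: "first_hit x u tau" and s: "0 \<le> s" "s \<le> tau"
  shows "J x u = rint x u 0 s + J (Y x u s) (\<lambda>t. u (s + t))"
proof -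
  have "J (Y x u s) (\<lambda>t. u (s + t)) = rint x u s tau + g (Y x u tau)"
    using cost_eq[OF shift_control[OF u s(1)] first_hit_shift[OF u h s]] rint_shift[OF u s(1), of 0 "tau - s" x]
      traj_shift[OF u s(1), of "tau - s" x] s by simp
  then show ?thesis using cost_eq[OF u h] rint_combine[OF u order_refl s, where x=x] by simp
qed

lemma rint_cong:
  assumes u: "u \<in> controls U" and v: "v \<in> controls U" and eq: "\<And>t. 0 \<le> t \<Longrightarrow> t < T \<Longrightarrow> u t = v t"
  shows "rint x u 0 T = rint x v 0 T"
  unfolding rint_def
  by (rule integral_spike[of "{T}"]) (use eq traj_cong[OF u v eq] in auto)

text \<open>Only this direction of dynamic programming is needed, by concatenation of controls. The
  opposite estimate comes from \<open>cost_tail\<close>, applied to the given nearly optimal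
  control.\<close>

lemma V_dpp:
  assumes u: "u \<in> controls U" and h: "0 \<le> h" and n: "\<And>t. 0 \<le> t \<Longrightarrow> t < h \<Longrightarrow> Y x u t \<notin> S"
  shows "V x \<le> ereal (rint x u 0 h) + V (Y x u h)"
proof -
  \<comment> \<open>With the running cost on the left, the claim is a lower bound for the infimum
    that defines \<open>V\<close> at the later point, which also covers the value
    \<infinity>.\<close>
  have "V x - ereal (rint x u 0 h) \<le> V (Y x u h)"
    unfolding value_fun_def[of f r g U S "Y x u h"]
  proof (rule INF_greatest)
    fix w assume "w \<in> admissible f U S (Y x u h)"
    then obtain tau where w: "w \<in> controls U" and tau: "first_hit (Y x u h) w tau" using admissible_iff by blast
    let ?c = "cat u h w"
    have c: "?c \<in> controls U" by (rule cat_control[OF u h w])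
    have 1: "Y x ?c t = Y x u t" if "0 \<le> t" "t \<le> h" for t using traj_cat1[OF u w that] .
    have 2: "Y x ?c (h + t) = Y (Y x u h) w t" if "0 \<le> t" for t using traj_cat2[OF u w h that] .
    have hit: "first_hit x ?c (h + tau)" unfolding first_hit_def
    proof (intro conjI allI impI)
      show "Y x ?c (h + tau) \<in> S" using 2[of tau] tau by (simp add: first_hit_def)
      fix t assume t: "0 \<le> t \<and> t < h + tau"
      show "Y x ?c t \<notin> S"
      proof (cases "t < h")
        case True then show ?thesis using 1[of t] n[of t] t by simp
      next
        case False
        then show ?thesis using 2[of "t - h"] tau t by (simp add: first_hit_def)
      qed
    qed (use h tau in \<open>auto simp: first_hit_def\<close>)
    have "J x ?c = rint x ?c 0 h + J (Y x ?c h) (\<lambda>t. ?c (h + t))"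
      by (rule cost_tail[OF c hit h]) (use tau in \<open>auto simp: first_hit_def\<close>)
    also have "rint x ?c 0 h = rint x u 0 h"
      by (rule rint_cong[OF c u]) (auto simp: cat_def)
    also have "J (Y x ?c h) (\<lambda>t. ?c (h + t)) = J (Y x u h) w"
    proof -
      have "(\<lambda>t. ?c (h + t)) \<in> controls U" by (rule shift_control[OF c h])
      moreover have eq: "?c (h + t) = w t" if "0 \<le> t" for t using that by (simp add: cat_def)
      moreover have tr: "Y (Y x u h) (\<lambda>t. ?c (h + t)) t = Y (Y x u h) w t" if "0 \<le> t" for t
        by (rule traj_cong[where T=t]) (use that w eq calculation in auto)
      ultimately have "first_hit (Y x u h) (\<lambda>t. ?c (h + t)) tau" using tau by (simp add: first_hit_def)
      then have "J (Y x u h) (\<lambda>t. ?c (h + t)) = rint (Y x u h) (\<lambda>t. ?c (h + t)) 0 tau + g (Y (Y x u h) (\<lambda>t. ?c (h + t)) tau)"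
        by (rule cost_eq[OF shift_control[OF c h]])
      also have "rint (Y x u h) (\<lambda>t. ?c (h + t)) 0 tau = rint (Y x u h) w 0 tau"
        by (rule rint_cong[OF shift_control[OF c h] w]) (rule eq)
      also have "Y (Y x u h) (\<lambda>t. ?c (h + t)) tau = Y (Y x u h) w tau"
        by (rule tr) (use tau in \<open>simp add: first_hit_def\<close>)
      also have "rint (Y x u h) w 0 tau + g (Y (Y x u h) w tau) = J (Y x u h) w"
        by (rule cost_eq[OF w tau, symmetric])
      finally have "J (Y x u h) (\<lambda>t. ?c (h + t)) = J (Y x u h) w" .
      then show ?thesis using 1[of h] h by simp
    qed
    finally have "V x \<le> ereal (rint x u 0 h + J (Y x u h) w)" using V_le[OF c hit] by simp
    then show "V x - ereal (rint x u 0 h) \<le> ereal (J (Y x u h) w)"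
      by (cases "V x") auto
  qed
  then show ?thesis by (simp add: ereal_minus_le add.commute)
qed

lemma exit_frontier:
  assumes u: "u \<in> controls U" and h: "first_hit x u tau" and x: "x \<notin> S"
  shows "tau > 0" "Y x u tau \<in> frontier S" "Y x u tau \<in> closure (- S)"
proof -
  show tau: "tau > 0"
  proof (rule ccontr)
    assume "\<not> tau > 0"
    then have "tau = 0" using h by (auto simp: first_hit_def)
    then show False using h x traj_0[OF u] by (auto simp: first_hit_def)
  qed
  have "(\<lambda>n. tau - tau / real (Suc n)) \<longlonglongrightarrow> tau - 0"
    by (intro tendsto_intros LIMSEQ_Suc lim_const_over_n)
  moreover have t: "0 \<le> tau - tau / real (Suc n)" "tau - tau / real (Suc n) < tau" for n using tau by (auto simp: field_simps)
  ultimately have "(\<lambda>n. Y x u (tau - tau / real (Suc n))) \<longlonglongrightarrow> Y x u tau"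
    by (intro continuous_on_tendsto_compose[OF traj_continuous[OF u]]) (use tau in \<open>auto intro!: always_eventually\<close>)
  moreover have "Y x u (tau - tau / real (Suc n)) \<in> - S" for n using h t by (auto simp: first_hit_def)
  ultimately show c: "Y x u tau \<in> closure (- S)" unfolding closure_sequential by (intro exI[of _ "\<lambda>n. Y x u (tau - tau / real (Suc n))"]) blast
  show "Y x u tau \<in> frontier S" using c h closure_subset unfolding frontier_closures first_hit_def by blast
qed

text \<open>Up to the exit the running cost is at least \<open>r0 * tau\<close>, while the terminal
  cost differs from \<open>g a\<close> by at most \<open>G\<close> times the distance, which is at
  most \<open>N * tau + norm (x - a)\<close>. Hence a bound on the cost bounds the exit
  time.\<close>

lemma cost_lower:
  assumes u: "u \<in> controls U" and h: "first_hit x u tau" and x: "x \<notin> S" and a: "a \<in> frontier S"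
  shows "J x u \<ge> \<kappa> * tau + g a - G * norm (x - a)"
proof -
  have "\<bar>g (Y x u tau) - g a\<bar> \<le> G * norm (Y x u tau - a)"
    using g_lip exit_frontier[OF u h x] a frontier_W by (auto simp: norm_minus_commute)
  also have "norm (Y x u tau - a) \<le> N * tau + norm (x - a)"
    using traj_norm[OF u, of tau x] exit_frontier(1)[OF u h x] norm_triangle_ineq[of "Y x u tau - x" "x - a"] by simp
  finally have "g (Y x u tau) \<ge> g a - G * (N * tau + norm (x - a))" using G_nonneg by (smt (verit) mult_left_mono)
  moreover have "r0 * tau \<le> rint x u 0 tau" using rint_ge[OF u, of 0 tau x] exit_frontier(1)[OF u h x] by simp
  ultimately show ?thesis using cost_eq[OF u h] by (simp add: \<kappa>_def algebra_simps)
qed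

lemma V_finite:
  assumes x: "x \<in> Reach"
  shows "\<bar>V x\<bar> \<noteq> \<infinity>"
proof (cases "x \<in> S")
  case True then show ?thesis using V_on_S by simp
next
  case False
  obtain u tau where u: "u \<in> controls U" and h: "first_hit x u tau" using x reachable_iff by blast
  then have "V x \<le> ereal (J x u)" by (rule V_le)
  moreover have "ereal (g (Y x u tau) - G * norm (x - Y x u tau)) \<le> V x"
    unfolding value_fun_def
  proof (rule INF_greatest)
    fix w assume "w \<in> admissible f U S x"
    then obtain \<sigma> where w: "w \<in> controls U" and \<sigma>: "first_hit x w \<sigma>" using admissible_iff by blast
    have "\<kappa> * \<sigma> \<ge> 0" using \<kappa>_pos \<sigma> by (simp add: first_hit_def)
    then show "ereal (g (Y x u tau) - G * norm (x - Y x u tau)) \<le> ereal (J x w)"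
      using cost_lower[OF w \<sigma> False exit_frontier(2)[OF u h False]] by simp
  qed
  ultimately show ?thesis by auto
qed

lemma near_optimal:
  assumes x: "x \<in> Reach" and e: "e > 0"
  obtains u tau where "u \<in> controls U" "first_hit x u tau" "J x u < real_of_ereal (V x) + e"
proof -
  have "V x < ereal (real_of_ereal (V x) + e)" using V_finite[OF x] e by (cases "V x") auto
  then obtain u where "u \<in> admissible f U S x" "ereal (J x u) < ereal (real_of_ereal (V x) + e)"
    unfolding value_fun_def[of f r g U S x] INF_less_iff by auto
  then show ?thesis using that admissible_iff by auto
qed

end

section \<open>Extremals and the sensitivity inequality\<close>

lemma bounded_rate_diff:
  assumes y: "bounded_rate y \<alpha> a b" and z: "bounded_rate z \<beta> a b"
  shows "bounded_rate (\<lambda>t. y t - z t) (\<lambda>t. \<alpha> t - \<beta> t) a b"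
proof -
  obtain M1 where M1: "\<And>t. t \<in> {a..b} \<Longrightarrow> norm (\<alpha> t) \<le> M1" using bounded_rate_bound[OF y] by blast
  obtain M2 where M2: "\<And>t. t \<in> {a..b} \<Longrightarrow> norm (\<beta> t) \<le> M2" using bounded_rate_bound[OF z] by blast
  show ?thesis unfolding bounded_rate_def
  proof (intro conjI exI[of _ "M1 + M2"] ballI)
    show "(\<lambda>t. \<alpha> t - \<beta> t) \<in> borel_measurable (lebesgue_on {a..b})"
      by (intro borel_measurable_diff bounded_rate_measurable[OF y] bounded_rate_measurable[OF z])
    show "norm (\<alpha> t - \<beta> t) \<le> M1 + M2" if "t \<in> {a..b}" for t
      by (rule order_trans[OF norm_triangle_ineq4]) (use M1[OF that] M2[OF that] in linarith)
    show "y t - z t = y a - z a + integral {a..t} (\<lambda>t. \<alpha> t - \<beta> t)" if t: "t \<in> {a..b}" for t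
      using bounded_rate_eq[OF y t] bounded_rate_eq[OF z t] t
        integral_diff[OF bounded_rate_integrable[OF y, of a t] bounded_rate_integrable[OF z, of a t]] by simp
  qed
qed

section \<open>Adjoint arcs and the duality formula\<close>

context exit_problem
begin

text \<open>The Hamiltonian with a multiplier for the running cost; it is \<open>Ham\<close> for
  \<open>lam = 1\<close> and \<open>Ham0\<close> for \<open>lam = 0\<close>.\<close>

definition Hl where "Hl lam x p = (SUP w\<in>U. - (p \<bullet> f x w) - lam * r x w)"

lemma Hl_attained:
  obtains w where "w \<in> U" "Hl lam x p = - (p \<bullet> f x w) - lam * r x w"
    "\<And>w'. w' \<in> U \<Longrightarrow> - (p \<bullet> f x w') - lam * r x w' \<le> Hl lam x p"
proof -
  have cf: "continuous_on U (\<lambda>w. f x w)"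
  proof -
    have "continuous_on U (\<lambda>w. (\<lambda>(x, w). f x w) (x, w))"
      by (rule continuous_on_compose2[OF f_cont]) (auto intro!: continuous_intros)
    then show ?thesis by simp
  qed
  have cr: "continuous_on U (\<lambda>w. r x w)"
  proof -
    have "continuous_on U (\<lambda>w. (\<lambda>(x, w). r x w) (x, w))"
      by (rule continuous_on_compose2[OF r_cont]) (auto intro!: continuous_intros)
    then show ?thesis by simp
  qed
  have "continuous_on U (\<lambda>w. - (p \<bullet> f x w) - lam * r x w)" by (intro continuous_intros cf cr)
  from continuous_attains_sup[OF U_compact U_ne this]
  obtain w where w: "w \<in> U" "\<And>w'. w' \<in> U \<Longrightarrow> - (p \<bullet> f x w') - lam * r x w' \<le> - (p \<bullet> f x w) - lam * r x w"
    by blast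
  moreover have "Hl lam x p = - (p \<bullet> f x w) - lam * r x w"
    unfolding Hl_def by (rule cSup_eq_maximum) (use w in auto)
  ultimately show ?thesis using that by auto
qed

lemma Hl_ge: "w \<in> U \<Longrightarrow> - (p \<bullet> f x w) - lam * r x w \<le> Hl lam x p"
  using Hl_attained by metis

definition adjoint where
  "adjoint lam X u p tau \<longleftrightarrow>
     bounded_rate p (\<lambda>t. adj_rate lam (Y X u t) (u t) (p t)) 0 tau"

text \<open>A trajectory with an adjoint arc and the terminal part of the maximum principle only.
  Neither optimality of \<open>u\<close> nor maximality along the arc is included; the latter comes
  out of the limit. The number \<open>B\<close> bounds all data at once, and \<open>1 / B\<close> is
  the radius of the upper quadratic bound on \<open>g\<close>, so that later constants depend on
  \<open>B\<close> alone.\<close>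

definition extremal where
  "extremal B lam X u tau q \<xi> p \<longleftrightarrow> u \<in> controls U \<and> first_hit X u tau \<and> X \<notin> S \<and> 0 \<le> lam \<and>
     adjoint lam X u p tau \<and> p tau = lam *\<^sub>R q - \<xi> \<and> Hl lam (Y X u tau) (lam *\<^sub>R q - \<xi>) = 0 \<and>
     (\<forall>z\<in>closure (- S). \<xi> \<bullet> (z - Y X u tau) \<le> B * (norm (z - Y X u tau))\<^sup>2) \<and>
     (\<forall>z. norm (z - Y X u tau) \<le> 1 / B \<longrightarrow> g z \<le> g (Y X u tau) + q \<bullet> (z - Y X u tau) + B * (norm (z - Y X u tau))\<^sup>2) \<and>
     norm q \<le> G \<and> 1 \<le> B \<and> tau \<le> B \<and> lam \<le> B \<and> norm \<xi> \<le> B"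

lemma adjoint_rate_bound:
  assumes u: "u \<in> controls U" and t: "0 \<le> t" and lam: "lam \<ge> 0"
  shows "norm (adj_rate lam (Y X u t) (u t) p) \<le> L * norm p + lam * L"
proof -
  have "norm (adj_rate lam (Y X u t) (u t) p) \<le> 
    norm (transpose (Dxf f (Y X u t) (u t)) *v p) + norm (lam *\<^sub>R Dxr r (Y X u t) (u t))"
    by (metis norm_minus_cancel norm_triangle_ineq4)
  also have "\<dots> \<le> L * norm p + lam * L"
    using Dxf_transpose_norm[OF controls_in[OF u t]] Dxr_norm[OF controls_in[OF u t]] lam
    by (intro add_mono) (auto intro: mult_left_mono)
  finally show ?thesis .
qed

lemma zero_rate: "bounded_rate (\<lambda>_. 0) (\<lambda>_. 0) a b"
  unfolding bounded_rate_def by auto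

text \<open>The estimate runs from any time to any other. Backwards from the exit it bounds the arc;
  forwards from time 0 it shows that a small initial value forces a small terminal value, which
  keeps arcs from degenerating.\<close>

lemma adjoint_bound:
  assumes p: "adjoint lam X u p tau" and u: "u \<in> controls U" and lam: "lam \<ge> 0"
    and s: "s \<in> {0..tau}" and t: "t \<in> {0..tau}"
  shows "norm (p t) \<le> (norm (p s) + lam * L * tau) * exp (2 * L * tau)"
proof -
  note P = p[unfolded adjoint_def]
  have fin: "(norm (p s) + lam * L * T) * exp (2 * L * h) \<le> (norm (p s) + lam * L * tau) * exp (2 * L * tau)" if "0 \<le> T" "T \<le> tau" "h \<le> tau" for T h
    using that L_pos lam by (intro mult_mono add_mono mult_left_mono) auto
  show ?thesis
  proof (cases "t \<le> s")
    case True
    have R: "bounded_rate (\<lambda>h. p (s - h)) (\<lambda>h. - (adj_rate lam (Y X u (s - h)) (u (s - h)) (p (s - h)))) 0 s"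
      by (rule bounded_rate_reverse[OF bounded_rate_subinterval[OF P]]) (use s in auto)
    have "norm (p (s - (s - t)) - 0) \<le> (norm (p (s - 0) - 0) + (lam * L) * s) * exp (2 * L * (s - t))"
    proof (rule bounded_rate_stability[OF R zero_rate L_pos])
      fix h assume "h \<in> {0..s}"
      then show "norm (- (adj_rate lam (Y X u (s - h)) (u (s - h)) (p (s - h))) - 0) \<le> L * norm (p (s - h) - 0) + lam * L"
        using adjoint_rate_bound[OF u _ lam, of "s - h" X "p (s - h)"] by (simp only: norm_minus_cancel diff_0_right) auto
    qed (use True t lam L_pos in auto)
    then show ?thesis using fin[of s "s - t"] s t by simp
  next
    case False
    have R: "bounded_rate (\<lambda>h. p (s + h)) (\<lambda>h. adj_rate lam (Y X u (s + h)) (u (s + h)) (p (s + h))) 0 (tau - s)"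
      by (rule bounded_rate_shift) (use P s in auto)
    have "norm (p (s + (t - s)) - 0) \<le> (norm (p (s + 0) - 0) + (lam * L) * (tau - s)) * exp (2 * L * (t - s))"
    proof (rule bounded_rate_stability[OF R zero_rate L_pos])
      fix h assume "h \<in> {0..tau - s}"
      then show "norm (adj_rate lam (Y X u (s + h)) (u (s + h)) (p (s + h)) - 0) \<le> L * norm (p (s + h) - 0) + lam * L"
        using adjoint_rate_bound[OF u _ lam, of "s + h" X "p (s + h)"] s by (simp only: diff_0_right) auto
    qed (use False s t lam L_pos in auto)
    then show ?thesis using fin[of "tau - s" "t - s"] s t by simp
  qed
qed

text \<open>\<open>cE\<close> is the growth factor of trajectories up to time \<open>B\<close>,
  \<open>cP\<close> bounds adjoint arcs, and \<open>c2\<close> is the constant of the duality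
  formula. \<open>c4\<close> bounds the change of running and terminal cost relative to the change
  of the initial point. Dividing by \<kappa> gives \<open>c5\<close>, the shift of the exit time
  relative to the perturbation, and \<open>c3\<close> is the resulting distance from the old exit
  point.\<close>

definition cE where "cE B = exp (2 * L * B)"
definition cP where "cP B = (B * G + B + B * L * B) * cE B"
definition c2 where "c2 B = B * (L * (cP B + B) * (cE B)\<^sup>2)"
definition c4 where "c4 B = B * L * cE B + G * cE B"
definition c5 where "c5 B = (c4 B + 1) / \<kappa>"
definition c3 where "c3 B = cE B + N * c5 B"

lemma const_pos: assumes "B \<ge> 1"
  shows "cE B \<ge> 1" "cP B \<ge> 0" "c2 B \<ge> 0" "c4 B \<ge> 0" "c5 B \<ge> 0" "c3 B \<ge> 1"
proof -
  show E: "cE B \<ge> 1" using assms L_pos by (simp add: cE_def)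
  show P: "cP B \<ge> 0" unfolding cP_def using assms G_nonneg L_pos E by (intro mult_nonneg_nonneg add_nonneg_nonneg) auto
  show "c2 B \<ge> 0" unfolding c2_def using assms P L_pos by (intro mult_nonneg_nonneg add_nonneg_nonneg) auto
  show 4: "c4 B \<ge> 0" unfolding c4_def using assms E L_pos G_nonneg by (intro mult_nonneg_nonneg add_nonneg_nonneg) auto
  show 5: "c5 B \<ge> 0" unfolding c5_def using 4 \<kappa>_pos by auto
  have "N * c5 B \<ge> 0" using N_pos 5 by simp
  then show "c3 B \<ge> 1" using E by (simp add: c3_def)
qed

context
  fixes B lam X u tau q \<xi> p and z :: "real^'d"
  assumes ext: "extremal B lam X u tau q \<xi> p"
begin

lemma ext_facts: "u \<in> controls U" "first_hit X u tau" "X \<notin> S" "0 \<le> lam" "adjoint lam X u p tau" "p tau = lam *\<^sub>R q - \<xi>"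
  "Hl lam (Y X u tau) (p tau) = 0" "norm q \<le> G" "1 \<le> B" "tau \<le> B" "lam \<le> B" "norm \<xi> \<le> B"
  "0 \<le> tau" "\<And>z. z \<in> closure (- S) \<Longrightarrow> \<xi> \<bullet> (z - Y X u tau) \<le> B * (norm (z - Y X u tau))\<^sup>2"
  "\<And>z. norm (z - Y X u tau) \<le> 1 / B \<Longrightarrow> g z \<le> g (Y X u tau) + q \<bullet> (z - Y X u tau) + B * (norm (z - Y X u tau))\<^sup>2"
  using ext unfolding extremal_def first_hit_def by auto

lemma ext_p_bound: "t \<in> {0..tau} \<Longrightarrow> norm (p t) \<le> cP B"
proof -
  assume t: "t \<in> {0..tau}"
  have "norm (p tau) \<le> lam * norm q + norm \<xi>"
    using norm_triangle_ineq4[of "lam *\<^sub>R q" \<xi>] ext_facts(4,6) by simp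
  also have "\<dots> \<le> B * G + B"
    using ext_facts G_nonneg by (intro add_mono mult_mono) auto
  finally have 1: "norm (p tau) \<le> B * G + B" .
  have "norm (p t) \<le> (norm (p tau) + lam * L * tau) * exp (2 * L * tau)"
    by (rule adjoint_bound[OF ext_facts(5,1,4) _ t]) (use ext_facts in auto)
  also have "\<dots> \<le> cP B" unfolding cP_def cE_def
    using ext_facts 1 L_pos G_nonneg by (intro mult_mono add_mono) auto
  finally show ?thesis .
qed

lemma ext_delta: "t \<in> {0..tau} \<Longrightarrow> norm (Y z u t - Y X u t) \<le> cE B * norm (z - X)"
proof -
  assume t: "t \<in> {0..tau}"
  have "norm (Y z u t - Y X u t) \<le> norm (z - X) * exp (2 * L * t)"
    by (rule traj_dep[OF ext_facts(1)]) (use t in auto)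
  also have "\<dots> \<le> norm (z - X) * cE B"
    unfolding cE_def using t ext_facts L_pos by (intro mult_left_mono) auto
  finally show ?thesis by (simp add: mult.commute)
qed

lemma ext_p_lip: "s \<in> {0..tau} \<Longrightarrow> t \<in> {0..tau} \<Longrightarrow> norm (p s - p t) \<le> (L * (cP B + B)) * \<bar>s - t\<bar>"
proof (rule bounded_rate_lipschitz[OF ext_facts(5)[unfolded adjoint_def]])
  fix t assume t: "t \<in> {0..tau}"
  have "norm (adj_rate lam (Y X u t) (u t) (p t)) \<le> L * norm (p t) + lam * L"
    by (rule adjoint_rate_bound) (use ext_facts t in auto)
  also have "\<dots> \<le> L * cP B + B * L" using ext_p_bound[OF t] ext_facts L_pos by (intro add_mono mult_mono) auto
  finally show "norm (adj_rate lam (Y X u t) (u t) (p t)) \<le> L * (cP B + B)"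
    by (simp add: algebra_simps)
qed

lemma ext_rint_diff: "t \<in> {0..tau} \<Longrightarrow> \<bar>rint z u 0 t - rint X u 0 t\<bar> \<le> B * L * cE B * norm (z - X)"
proof -
  assume t: "t \<in> {0..tau}"
  have i: "(\<lambda>s. r (Y z u s) (u s)) integrable_on {0..t}" "(\<lambda>s. r (Y X u s) (u s)) integrable_on {0..t}"
    using r_integrable ext_facts by auto
  have "rint z u 0 t - rint X u 0 t = integral {0..t} (\<lambda>s. r (Y z u s) (u s) - r (Y X u s) (u s))"
    unfolding rint_def using i by (simp add: integral_diff)
  also have "norm \<dots> \<le> integral {0..t} (\<lambda>s. L * (cE B * norm (z - X)))"
  proof (rule integral_norm_bound_integral)
    show "(\<lambda>s. r (Y z u s) (u s) - r (Y X u s) (u s)) integrable_on {0..t}" using i by (rule integrable_diff)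
    fix s assume s: "s \<in> {0..t}"
    have "\<bar>r (Y z u s) (u s) - r (Y X u s) (u s)\<bar> \<le> L * norm (Y z u s - Y X u s)"
      by (rule r_lip[OF controls_in[OF ext_facts(1)]]) (use s in auto)
    also have "\<dots> \<le> L * (cE B * norm (z - X))"
      using ext_delta[of s] s t L_pos by (intro mult_left_mono) auto
    finally show "norm (r (Y z u s) (u s) - r (Y X u s) (u s)) \<le> L * (cE B * norm (z - X))" by simp
  qed auto
  also have "\<dots> = t * (L * (cE B * norm (z - X)))" using t by simp
  also have "\<dots> \<le> B * (L * (cE B * norm (z - X)))"
    using t ext_facts L_pos const_pos(1)[OF ext_facts(9)] by (intro mult_right_mono) auto
  finally show ?thesis by (simp add: mult.assoc)
qed

text \<open>Differentiate the product of the arc with the difference of the two trajectories. The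
  adjoint equation cancels all first-order terms against the multiplier times the difference of
  running costs, and the Taylor remainders of \<open>f\<close> and \<open>r\<close> are
  quadratic.\<close>

lemma ext_duality:
  assumes t: "t \<in> {0..tau}"
  shows "\<bar>p t \<bullet> (Y z u t - Y X u t) - p 0 \<bullet> (z - X) + lam * (rint z u 0 t - rint X u 0 t)\<bar> \<le> c2 B * (norm (z - X))\<^sup>2"
proof -
  define \<Delta> where "\<Delta> s = Y z u s - Y X u s" for s
  have rD: "bounded_rate \<Delta> (\<lambda>s. f (Y z u s) (u s) - f (Y X u s) (u s)) 0 tau"
    unfolding \<Delta>_def by (intro bounded_rate_diff traj_rate ext_facts(1))
  have i: "((\<lambda>s. (adj_rate lam (Y X u s) (u s) (p s)) \<bullet> \<Delta> s + p s \<bullet> (f (Y z u s) (u s) - f (Y X u s) (u s)))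
     has_integral (p t \<bullet> \<Delta> t - p 0 \<bullet> \<Delta> 0)) {0..t}"
    by (rule bounded_rate_has_integral[OF bounded_rate_inner[OF ext_facts(5)[unfolded adjoint_def] rD]]) (use t in auto)
  have i2: "((\<lambda>s. lam * (r (Y z u s) (u s) - r (Y X u s) (u s))) has_integral lam * (rint z u 0 t - rint X u 0 t)) {0..t}"
    unfolding rint_def by (intro has_integral_mult_right has_integral_diff integrable_integral r_integrable) (use ext_facts in auto)
  note i3 = has_integral_add[OF i i2]
  have b: "norm ((adj_rate lam (Y X u s) (u s) (p s)) \<bullet> \<Delta> s + p s \<bullet> (f (Y z u s) (u s) - f (Y X u s) (u s))
     + lam * (r (Y z u s) (u s) - r (Y X u s) (u s))) \<le> L * (cP B + B) * (cE B)\<^sup>2 * (norm (z - X))\<^sup>2" if s: "s \<in> {0..t}" for s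
  proof -
    have us: "u s \<in> U" using controls_in[OF ext_facts(1)] s by auto
    have st: "s \<in> {0..tau}" using s t by auto
    have "(transpose (Dxf f (Y X u s) (u s)) *v p s) \<bullet> \<Delta> s = p s \<bullet> (Dxf f (Y X u s) (u s) *v \<Delta> s)"
      by (metis dot_lmul_matrix transpose_matrix_vector)
    then have eq: "(adj_rate lam (Y X u s) (u s) (p s)) \<bullet> \<Delta> s + p s \<bullet> (f (Y z u s) (u s) - f (Y X u s) (u s))
     + lam * (r (Y z u s) (u s) - r (Y X u s) (u s)) = 
       p s \<bullet> (f (Y z u s) (u s) - f (Y X u s) (u s) - Dxf f (Y X u s) (u s) *v \<Delta> s)
       + lam * (r (Y z u s) (u s) - r (Y X u s) (u s) - \<Delta> s \<bullet> Dxr r (Y X u s) (u s))"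
      by (simp add: inner_diff_left inner_diff_right inner_commute algebra_simps)
    have "norm (p s \<bullet> (f (Y z u s) (u s) - f (Y X u s) (u s) - Dxf f (Y X u s) (u s) *v \<Delta> s)
       + lam * (r (Y z u s) (u s) - r (Y X u s) (u s) - \<Delta> s \<bullet> Dxr r (Y X u s) (u s))) \<le> norm (p s) * norm (f (Y z u s) (u s) - f (Y X u s) (u s) - Dxf f (Y X u s) (u s) *v \<Delta> s)
       + lam * \<bar>r (Y z u s) (u s) - r (Y X u s) (u s) - \<Delta> s \<bullet> Dxr r (Y X u s) (u s)\<bar>"
      unfolding real_norm_def
      by (rule order_trans[OF abs_triangle_ineq]) (use ext_facts(4) in \<open>auto simp: abs_mult intro!: add_mono Cauchy_Schwarz_ineq2\<close>)
    also have "\<dots> \<le> cP B * (L * (norm (\<Delta> s))\<^sup>2) + B * (L * (norm (\<Delta> s))\<^sup>2)"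
      using ext_p_bound[OF st] f_taylor[OF us, of "Y z u s" "Y X u s"] r_taylor[OF us, of "Y z u s" "Y X u s"] ext_facts(4,9,11)
        const_pos(2)[OF ext_facts(9)]
      unfolding \<Delta>_def by (intro add_mono mult_mono) auto
    also have "\<dots> = L * (cP B + B) * (norm (\<Delta> s))\<^sup>2" by (simp add: algebra_simps)
    also have "\<dots> \<le> L * (cP B + B) * (cE B * norm (z - X))\<^sup>2"
    proof (rule mult_left_mono)
      show "(norm (\<Delta> s))\<^sup>2 \<le> (cE B * norm (z - X))\<^sup>2"
        using ext_delta[OF st] unfolding \<Delta>_def by (intro power_mono) auto
    qed (use L_pos const_pos(2)[OF ext_facts(9)] ext_facts(9) in auto)
    also have "\<dots> = L * (cP B + B) * (cE B)\<^sup>2 * (norm (z - X))\<^sup>2" by (simp add: power_mult_distrib)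
    finally show ?thesis unfolding eq .
  qed
  have "norm (p t \<bullet> \<Delta> t - p 0 \<bullet> \<Delta> 0 + lam * (rint z u 0 t - rint X u 0 t)) \<le> L * (cP B + B) * (cE B)\<^sup>2 * (norm (z - X))\<^sup>2 * (t - 0)"
    using has_integral_bound[OF _ i3[unfolded box_real(2)[symmetric]], of "L * (cP B + B) * (cE B)\<^sup>2 * (norm (z - X))\<^sup>2"] b t L_pos
      const_pos(2)[OF ext_facts(9)] ext_facts(9)
    by (simp only: content_real box_real(2)) (auto)
  also have "\<dots> \<le> L * (cP B + B) * (cE B)\<^sup>2 * (norm (z - X))\<^sup>2 * B"
    using t ext_facts L_pos const_pos(2)[OF ext_facts(9)] by (intro mult_left_mono) auto
  finally show ?thesis unfolding \<Delta>_def c2_def using traj_0[OF ext_facts(1)] by (simp add: mult.commute mult.left_commute)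
qed

end

end

section \<open>The sensitivity inequality\<close>

context exit_problem
begin

text \<open>Here \<open>e\<close> is the height of \<beta> above the cost of the arc, and
  \<open>D\<close> measures the displacement from \<open>(X, J X u)\<close> to
  \<open>(z, \<beta>)\<close>. Each case below bounds the first-order expression by a multiple of
  \<open>D\<^sup>2\<close>.\<close>

context
  fixes B lam X u tau q \<xi> p and z :: "real^'d" and \<beta> e D :: real
  assumes ext: "extremal B lam X u tau q \<xi> p" and zS: "z \<notin> S" and \<beta>: "ereal \<beta> \<le> V z"
  defines "e \<equiv> \<beta> - J X u" and "D \<equiv> norm (z - X) + \<bar>e\<bar>"
begin

lemmas F = ext_facts[OF ext]
lemmas cpos = const_pos[OF F(9)]

lemma D_facts: "norm (z - X) \<le> D" "\<bar>e\<bar> \<le> D" "0 \<le> D"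
  by (auto simp: D_def)

lemma exit_in: "Y X u tau \<in> frontier S" "tau > 0"
  using exit_frontier[OF F(1-3)] by auto

text \<open>Away from the base point the trivial linear bound is enough, since 1 \<le>
  \<open>B * c3 B * D\<close> turns it into a quadratic one.\<close>

lemma sens_large:
  assumes large: "\<not> c3 B * D \<le> 1 / B"
  shows "- (p 0 \<bullet> (z - X)) + lam * e \<le> ((cP B + B) * (B * c3 B)) * D\<^sup>2"
proof -
  have "- (p 0 \<bullet> (z - X)) \<le> norm (p 0) * norm (z - X)"
    using Cauchy_Schwarz_ineq2[of "p 0" "z - X"] by linarith
  also have "\<dots> \<le> cP B * D"
    using ext_p_bound[OF ext, of 0] F(13) D_facts cpos by (intro mult_mono) auto
  finally have 1: "- (p 0 \<bullet> (z - X)) \<le> cP B * D" .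
  have "lam * e \<le> lam * D" using F(4) D_facts by (intro mult_left_mono) auto
  also have "\<dots> \<le> B * D" using F(11) D_facts by (intro mult_right_mono) auto
  finally have 2: "- (p 0 \<bullet> (z - X)) + lam * e \<le> (cP B + B) * D" using 1 by (simp add: algebra_simps)
  have "1 \<le> B * c3 B * D" using large F(9) by (simp add: field_simps)
  then have "D * 1 \<le> D * (B * c3 B * D)" using D_facts(3) by (intro mult_left_mono) auto
  then have "(cP B + B) * D \<le> (cP B + B) * (D * (B * c3 B * D))" using cpos F(9) by (intro mult_left_mono) auto
  with 2 show ?thesis by (simp add: power2_eq_square algebra_simps)
qed

text \<open>From \<open>z\<close> the target is hit at a time \<open>t\<close> before
  \<open>tau\<close>. The duality formula is applied up to \<open>t\<close>. On the remaining piece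
  from \<open>t\<close> to \<open>tau\<close> the terminal condition makes the Hamiltonian integrand
  nonpositive up to an error of order \<open>D\<close>, and the piece itself has length of order
  \<open>D\<close>.\<close>

lemma sens_early:
  assumes hit: "first_hit z u t" and ttau: "t \<le> tau" and small: "c3 B * D \<le> 1 / B"
  shows "- (p 0 \<bullet> (z - X)) + lam * e \<le> (B * (c3 B)\<^sup>2 + (cP B + B) * (L * N) * (c5 B)\<^sup>2 + L * (cP B + B) * cE B * c5 B + c2 B + B * B * (c3 B)\<^sup>2) * D\<^sup>2"
proof -
  define d where "d = norm (z - X)"
  define xs where "xs = Y X u tau"
  define b where "b = Y z u t"
  define h where "h = tau - t"
  define Rd where "Rd = rint z u 0 t - rint X u 0 t"
  define Rt where "Rt = rint X u t tau"
  define Fi where "Fi = xs - Y X u t"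
  have t: "0 \<le> t" "t \<in> {0..tau}" and h0: "0 \<le> h" using hit ttau by (auto simp: first_hit_def h_def)
  have d: "0 \<le> d" "d \<le> D" using D_facts by (auto simp: d_def)
  have bF: "b \<in> frontier S" "b \<in> closure (- S)" using exit_frontier[OF F(1) hit zS] by (auto simp: b_def)
  have "\<beta> \<le> J z u" using \<beta> V_le[OF F(1) hit] by (metis ereal_less_eq(3) order_trans)
  then have 1: "e \<le> Rd + (g b - g xs) - Rt"
    using cost_eq[OF F(1) hit] cost_eq[OF F(1,2)] rint_combine[OF F(1) order_refl t(1) ttau, of X]
    by (simp add: e_def Rd_def Rt_def b_def xs_def)
  have 2: "\<bar>Rd\<bar> \<le> B * L * cE B * d" unfolding Rd_def d_def by (rule ext_rint_diff[OF ext t(2)])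
  have yt: "norm (Y X u t - xs) \<le> N * h" using traj_lip[OF F(1) t(1) F(13), of X] ttau by (simp add: xs_def h_def)
  have bt: "norm (b - Y X u t) \<le> cE B * d" unfolding b_def d_def by (rule ext_delta[OF ext t(2)])
  have nb: "norm (b - xs) \<le> cE B * d + N * h"
    using norm_triangle_ineq[of "b - Y X u t" "Y X u t - xs"] yt bt by simp
  have 4: "g b - g xs \<le> G * norm (b - xs)"
    using g_lip[OF subsetD[OF frontier_W exit_in(1)] subsetD[OF frontier_W bF(1)]] by (simp add: xs_def abs_le_iff)
  have 5: "r0 * h \<le> Rt" unfolding Rt_def h_def by (rule rint_ge[OF F(1) t(1) ttau])
  have "G * norm (b - xs) \<le> G * (cE B * d + N * h)" using nb G_nonneg by (intro mult_left_mono)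
  \<comment> \<open>Over the time \<open>h\<close> the longer trajectory pays at least
    \<open>r0 * h\<close> and can win back at most \<open>G * N * h\<close> at the exit; the
    difference \<kappa> controls \<open>h\<close>.\<close>
  with 1 2 4 5 have "\<kappa> * h \<le> c4 B * d + \<bar>e\<bar>" by (simp add: \<kappa>_def c4_def algebra_simps)
  also have "\<dots> \<le> (c4 B + 1) * D"
  proof -
    have "c4 B * d \<le> c4 B * D" using d cpos by (intro mult_left_mono) auto
    then show ?thesis using D_facts by (simp add: algebra_simps)
  qed
  finally have h: "h \<le> c5 B * D" using \<kappa>_pos by (simp add: c5_def field_simps)
  have nb3: "norm (b - xs) \<le> c3 B * D"
  proof -
    have "cE B * d + N * h \<le> cE B * D + N * (c5 B * D)"
      using d h N_pos cpos by (intro add_mono mult_left_mono) auto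
    then show ?thesis using nb by (simp add: c3_def algebra_simps)
  qed
  have nb3': "(norm (b - xs))\<^sup>2 \<le> (c3 B)\<^sup>2 * D\<^sup>2"
    using power_mono[OF nb3, of 2] by (simp add: power_mult_distrib)
  have Bnb: "B * (norm (b - xs))\<^sup>2 \<le> B * (c3 B)\<^sup>2 * D\<^sup>2"
    using mult_left_mono[OF nb3', of B] F(9) by (simp add: mult.assoc)
  have 9: "g b - g xs \<le> q \<bullet> (b - xs) + B * (c3 B)\<^sup>2 * D\<^sup>2"
    using F(15)[of b] nb3 small Bnb by (simp add: xs_def)
  have "lam * e \<le> lam * (Rd - Rt + q \<bullet> (b - xs)) + lam * (B * (c3 B)\<^sup>2 * D\<^sup>2)"
    using 1 9 F(4) by (simp add: distrib_left[symmetric] mult_left_mono)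
  also have "lam * (B * (c3 B)\<^sup>2 * D\<^sup>2) \<le> B * (B * (c3 B)\<^sup>2 * D\<^sup>2)"
    using F(9,11) by (intro mult_right_mono) auto
  finally have 10: "lam * e \<le> lam * Rd - lam * Rt + lam * (q \<bullet> (b - xs)) + B * B * (c3 B)\<^sup>2 * D\<^sup>2"
    by (simp add: algebra_simps)
  have 11: "- (p 0 \<bullet> (z - X)) \<le> - (p t \<bullet> (b - Y X u t)) - lam * Rd + c2 B * D\<^sup>2"
  proof -
    have "c2 B * d\<^sup>2 \<le> c2 B * D\<^sup>2" using d cpos by (intro mult_left_mono power_mono) auto
    then show ?thesis using ext_duality[OF ext t(2), of z] by (simp add: b_def Rd_def d_def)
  qed
  have 12: "- (p t \<bullet> (b - Y X u t)) \<le> - (p tau \<bullet> (b - Y X u t)) + L * (cP B + B) * cE B * c5 B * D\<^sup>2"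
  proof -
    have "(p tau - p t) \<bullet> (b - Y X u t) \<le> norm (p tau - p t) * norm (b - Y X u t)" by (rule norm_cauchy_schwarz)
    also have "\<dots> \<le> (L * (cP B + B) * (c5 B * D)) * (cE B * D)"
    proof (rule mult_mono)
      have "norm (p tau - p t) \<le> (L * (cP B + B)) * h"
        using ext_p_lip[OF ext, of tau t] t F(13) ttau by (simp add: h_def)
      also have "\<dots> \<le> (L * (cP B + B)) * (c5 B * D)" using h L_pos cpos F(9) by (intro mult_left_mono) auto
      finally show "norm (p tau - p t) \<le> L * (cP B + B) * (c5 B * D)" .
      show "norm (b - Y X u t) \<le> cE B * D" by (rule order_trans[OF bt]) (use d cpos in \<open>auto intro: mult_left_mono\<close>)
      show "0 \<le> L * (cP B + B) * (c5 B * D)" using L_pos cpos F(9) D_facts by (intro mult_nonneg_nonneg) auto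
    qed auto
    finally show ?thesis by (simp add: inner_diff_left power2_eq_square algebra_simps)
  qed
  \<comment> \<open>At the exit point the integrand is at most \<open>Hl lam xs (p tau)\<close> = 0.
    Moving to the points of the piece changes it by order \<open>h\<close>, and integration over the
    piece makes the error quadratic.\<close>
  have 14: "- (p tau \<bullet> Fi) - lam * Rt \<le> (cP B + B) * (L * N) * (c5 B)\<^sup>2 * D\<^sup>2"
  proof -
    have i1: "((\<lambda>s. f (Y X u s) (u s)) has_integral Fi) {t..tau}"
      unfolding Fi_def xs_def by (rule bounded_rate_has_integral[OF traj_rate[OF F(1)] t(1) ttau order_refl])
    have i2: "((\<lambda>s. r (Y X u s) (u s)) has_integral Rt) {t..tau}"
      unfolding Rt_def rint_def by (intro integrable_integral r_integrable F(1) t(1))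
    have i3: "((\<lambda>s. - (p tau \<bullet> f (Y X u s) (u s)) - lam * r (Y X u s) (u s)) has_integral (- (p tau \<bullet> Fi) - lam * Rt)) {t..tau}"
      using has_integral_linear[OF i1 bounded_linear_inner_right[of "p tau"]]
      by (intro has_integral_diff has_integral_neg has_integral_mult_right i2) (simp add: o_def)
    have i4: "((\<lambda>s. (cP B + B) * (L * (N * h))) has_integral (cP B + B) * (L * (N * h)) * h) {t..tau}"
      using has_integral_const_real[of "(cP B + B) * (L * (N * h))" t tau] ttau by (simp add: h_def mult.commute)
    have "- (p tau \<bullet> Fi) - lam * Rt \<le> (cP B + B) * (L * (N * h)) * h"
    proof (rule has_integral_le[OF i3 i4])
      fix s assume s: "s \<in> {t..tau}"
      have us: "u s \<in> U" using controls_in[OF F(1)] s t by auto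
      have ys: "norm (Y X u s - xs) \<le> N * h"
      proof -
        have "norm (Y X u s - xs) \<le> N * \<bar>s - tau\<bar>" unfolding xs_def by (rule traj_lip[OF F(1)]) (use s t F(13) in auto)
        also have "\<dots> \<le> N * h" using s N_pos by (auto simp: h_def)
        finally show ?thesis .
      qed
      have "- (p tau \<bullet> f xs (u s)) - lam * r xs (u s) \<le> 0" using Hl_ge[OF us, of "p tau" xs lam] F(7) by (simp add: xs_def)
      moreover have "- (p tau \<bullet> (f (Y X u s) (u s) - f xs (u s))) \<le> cP B * (L * (N * h))"
      proof -
        have "- (p tau \<bullet> (f (Y X u s) (u s) - f xs (u s))) \<le> norm (p tau) * norm (f (Y X u s) (u s) - f xs (u s))"
          using Cauchy_Schwarz_ineq2[of "p tau" "f (Y X u s) (u s) - f xs (u s)"] by linarith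
        also have "\<dots> \<le> cP B * (L * (N * h))"
          using ext_p_bound[OF ext, of tau] F(13) cpos f_lip[OF us, of "Y X u s" xs] ys L_pos
          by (intro mult_mono order_trans[OF f_lip[OF us] mult_left_mono[OF ys]]) auto
        finally show ?thesis .
      qed
      moreover have "- lam * (r (Y X u s) (u s) - r xs (u s)) \<le> B * (L * (N * h))"
      proof -
        have "\<bar>lam * (r (Y X u s) (u s) - r xs (u s))\<bar> \<le> B * (L * (N * h))"
          unfolding abs_mult using F(4,9,11) L_pos
          by (intro mult_mono order_trans[OF r_lip[OF us] mult_left_mono[OF ys]]) auto
        then show ?thesis by linarith
      qed
      ultimately show "- (p tau \<bullet> f (Y X u s) (u s)) - lam * r (Y X u s) (u s) \<le> (cP B + B) * (L * (N * h))"
        by (simp add: inner_diff_right algebra_simps)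
    qed
    also have "\<dots> = (cP B + B) * (L * N) * (h * h)" by simp
    also have "\<dots> \<le> (cP B + B) * (L * N) * ((c5 B * D) * (c5 B * D))"
      using h h0 cpos F(9) L_pos N_pos D_facts by (intro mult_left_mono mult_mono) auto
    finally show ?thesis by (simp add: power2_eq_square algebra_simps)
  qed
  have 15: "\<xi> \<bullet> (b - xs) \<le> B * (c3 B)\<^sup>2 * D\<^sup>2" using F(14)[OF bF(2)] Bnb by (simp add: xs_def)
  \<comment> \<open>Splitting \<open>p tau\<close> into its two parts: the one with \<open>q\<close>
    cancels against the terminal cost in 10, the one with \<xi> is the proximal normal inequality
    15.\<close>
  have 13: "- (p tau \<bullet> (b - Y X u t)) = \<xi> \<bullet> (b - xs) - lam * (q \<bullet> (b - xs)) - p tau \<bullet> Fi"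
    unfolding F(6) Fi_def by (simp add: inner_diff_left inner_diff_right algebra_simps)
  have "- (p 0 \<bullet> (z - X)) + lam * e \<le> B * (c3 B)\<^sup>2 * D\<^sup>2 + (cP B + B) * (L * N) * (c5 B)\<^sup>2 * D\<^sup>2 + 
    L * (cP B + B) * cE B * c5 B * D\<^sup>2 + c2 B * D\<^sup>2 + B * B * (c3 B)\<^sup>2 * D\<^sup>2"
    using 10 11 12 13 14 15 by linarith
  then show ?thesis by (simp add: algebra_simps)
qed

text \<open>From \<open>z\<close> the control \<open>u\<close> is followed up to \<open>tau\<close>
  and then by the constant maximizer \<open>w\<close> for a time \<open>s\<close>. Two endings give
  the same estimate: either the target is hit, and \<beta> is at most the cost of this control, or
  \<open>s\<close> has its full length \<open>c5 B * D\<close>.\<close>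

lemma sens_late:
  assumes w: "w \<in> U" and wH: "- (p tau \<bullet> f (Y X u tau) w) - lam * r (Y X u tau) w = 0"
    and s: "0 \<le> s" "s \<le> c5 B * D" and small: "c3 B * D \<le> 1 / B"
    and nohit: "\<And>t. 0 \<le> t \<Longrightarrow> t < tau + s \<Longrightarrow> Y z (cat u tau (\<lambda>_. w)) t \<notin> S"
    and cases: "Y z (cat u tau (\<lambda>_. w)) (tau + s) \<in> S \<or> Y z (cat u tau (\<lambda>_. w)) (tau + s) \<notin> S \<and> s = c5 B * D"
  shows "- (p 0 \<bullet> (z - X)) + lam * e \<le> (B * (c3 B)\<^sup>2 + B * B * (c3 B)\<^sup>2 + (cP B + B) * (c5 B * L * c3 B) + c2 B) * D\<^sup>2"
proof -
  define d where "d = norm (z - X)"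
  define xs where "xs = Y X u tau"
  define W where "W = (\<lambda>_::real. w)"
  define v where "v = cat u tau W"
  define b0 where "b0 = Y z u tau"
  define b where "b = Y b0 W s"
  define Rd where "Rd = rint z u 0 tau - rint X u 0 tau"
  define C where "C = c5 B * L * c3 B"
  have Wc: "W \<in> controls U" unfolding W_def by (rule const_control[OF w])
  have vc: "v \<in> controls U" unfolding v_def by (rule cat_control[OF F(1) F(13) Wc])
  have tauin: "tau \<in> {0..tau}" using F(13) by auto
  have d: "0 \<le> d" "d \<le> D" using D_facts by (auto simp: d_def)
  have bv: "Y z v (tau + s) = b" unfolding v_def b_def b0_def by (rule traj_cat2[OF F(1) Wc F(13) s(1)])
  have C0: "C \<ge> 0" unfolding C_def using cpos L_pos by (intro mult_nonneg_nonneg) auto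
  have 2: "\<bar>Rd\<bar> \<le> B * L * cE B * d" unfolding Rd_def d_def by (rule ext_rint_diff[OF ext tauin])
  have nb0: "norm (b0 - xs) \<le> cE B * d" unfolding b0_def xs_def d_def by (rule ext_delta[OF ext tauin])
  have near: "norm (Y b0 W \<sigma> - xs) \<le> c3 B * D" if "0 \<le> \<sigma>" "\<sigma> \<le> s" for \<sigma>
  proof -
    have "norm (Y b0 W \<sigma> - xs) \<le> norm (Y b0 W \<sigma> - b0) + norm (b0 - xs)"
      using norm_triangle_ineq[of "Y b0 W \<sigma> - b0" "b0 - xs"] by simp
    also have "norm (Y b0 W \<sigma> - b0) \<le> N * \<sigma>" by (rule traj_norm[OF Wc that(1)])
    also have "N * \<sigma> \<le> N * (c5 B * D)" using that s N_pos by (intro mult_left_mono) auto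
    also have "norm (b0 - xs) \<le> cE B * D" by (rule order_trans[OF nb0]) (use d cpos in \<open>auto intro: mult_left_mono\<close>)
    finally show ?thesis by (simp add: c3_def algebra_simps)
  qed
  have nb3: "norm (b - xs) \<le> c3 B * D" unfolding b_def by (rule near) (use s in auto)
  have nb3': "(norm (b - xs))\<^sup>2 \<le> (c3 B)\<^sup>2 * D\<^sup>2"
    using power_mono[OF nb3, of 2] by (simp add: power_mult_distrib)
  have Bnb: "B * (norm (b - xs))\<^sup>2 \<le> B * (c3 B)\<^sup>2 * D\<^sup>2"
    using mult_left_mono[OF nb3', of B] F(9) by (simp add: mult.assoc)
  have CD: "L * (c3 B * D) * s \<le> C * D\<^sup>2"
  proof -
    have "L * (c3 B * D) * s \<le> L * (c3 B * D) * (c5 B * D)"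
      using s L_pos cpos D_facts by (intro mult_left_mono) auto
    then show ?thesis by (simp add: C_def power2_eq_square algebra_simps)
  qed
  have fb: "norm (b - b0 - s *\<^sub>R f xs w) \<le> C * D\<^sup>2"
  proof -
    have "((\<lambda>\<sigma>. f (Y b0 W \<sigma>) (W \<sigma>)) has_integral (Y b0 W s - Y b0 W 0)) {0..s}"
      by (rule bounded_rate_has_integral[OF traj_rate[OF Wc] order_refl s(1) order_refl])
    moreover have "((\<lambda>\<sigma>. f xs w) has_integral s *\<^sub>R f xs w) {0..s}"
      using has_integral_const_real[of "f xs w" 0 s] s by simp
    ultimately have "((\<lambda>\<sigma>. f (Y b0 W \<sigma>) (W \<sigma>) - f xs w) has_integral (b - b0 - s *\<^sub>R f xs w)) {0..s}"
      using traj_0[OF Wc] by (auto simp: b_def dest: has_integral_diff)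
    then have "norm (b - b0 - s *\<^sub>R f xs w) \<le> (L * (c3 B * D)) * measure lborel (cbox 0 s)"
      unfolding box_real(2)[symmetric]
    proof (rule has_integral_bound[rotated])
      show "0 \<le> L * (c3 B * D)" using L_pos cpos D_facts by (intro mult_nonneg_nonneg) auto
      show "norm (f (Y b0 W \<sigma>) (W \<sigma>) - f xs w) \<le> L * (c3 B * D)" if "\<sigma> \<in> cbox 0 s" for \<sigma>
        using order_trans[OF f_lip[OF w] mult_left_mono[OF near[of \<sigma>]]] that L_pos by (simp add: W_def)
    qed
    also have "\<dots> \<le> C * D\<^sup>2" using CD s by simp
    finally show ?thesis .
  qed
  have rb: "\<bar>rint b0 W 0 s - s * r xs w\<bar> \<le> C * D\<^sup>2"
  proof -
    have "((\<lambda>\<sigma>. r (Y b0 W \<sigma>) (W \<sigma>)) has_integral rint b0 W 0 s) {0..s}"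
      unfolding rint_def by (intro integrable_integral r_integrable Wc order_refl)
    moreover have "((\<lambda>\<sigma>. r xs w) has_integral s * r xs w) {0..s}"
      using has_integral_const_real[of "r xs w" 0 s] s by simp
    ultimately have "((\<lambda>\<sigma>. r (Y b0 W \<sigma>) (W \<sigma>) - r xs w) has_integral (rint b0 W 0 s - s * r xs w)) {0..s}"
      by (rule has_integral_diff)
    then have "norm (rint b0 W 0 s - s * r xs w) \<le> (L * (c3 B * D)) * measure lborel (cbox 0 s)"
      unfolding box_real(2)[symmetric]
    proof (rule has_integral_bound[rotated])
      show "0 \<le> L * (c3 B * D)" using L_pos cpos D_facts by (intro mult_nonneg_nonneg) auto
      show "norm (r (Y b0 W \<sigma>) (W \<sigma>) - r xs w) \<le> L * (c3 B * D)" if "\<sigma> \<in> cbox 0 s" for \<sigma>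
        using order_trans[OF r_lip[OF w] mult_left_mono[OF near[of \<sigma>]]] that L_pos by (simp add: W_def)
    qed
    also have "\<dots> \<le> C * D\<^sup>2" using CD s by simp
    finally show ?thesis by simp
  qed
  \<comment> \<open>In both endings the end point is a limit of points outside the target, so the
    inequality for \<xi> may be tested there.\<close>
  have bS: "b \<in> closure (- S)"
  proof (cases "b \<in> S")
    case True
    then have "first_hit z v (tau + s)" using bv nohit s F(13) by (auto simp: first_hit_def v_def W_def)
    from exit_frontier(3)[OF vc this zS] show ?thesis using bv by simp
  next
    case False
    then show ?thesis using closure_subset[of "- S"] by auto
  qed
  have 15: "\<xi> \<bullet> (b - xs) \<le> B * (c3 B)\<^sup>2 * D\<^sup>2" using F(14)[OF bS] Bnb by (simp add: xs_def)
  have 11: "- (p 0 \<bullet> (z - X)) \<le> - (p tau \<bullet> (b0 - xs)) - lam * Rd + c2 B * D\<^sup>2"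
  proof -
    have "c2 B * d\<^sup>2 \<le> c2 B * D\<^sup>2" using d cpos by (intro mult_left_mono power_mono) auto
    then show ?thesis using ext_duality[OF ext tauin, of z] by (simp add: b0_def xs_def Rd_def d_def)
  qed
  have 12: "- (p tau \<bullet> (b0 - xs)) \<le> \<xi> \<bullet> (b - xs) - lam * (q \<bullet> (b - xs)) + s * (p tau \<bullet> f xs w) + cP B * (C * D\<^sup>2)"
  proof -
    have "p tau \<bullet> (b - b0 - s *\<^sub>R f xs w) \<le> norm (p tau) * norm (b - b0 - s *\<^sub>R f xs w)" by (rule norm_cauchy_schwarz)
    also have "\<dots> \<le> cP B * (C * D\<^sup>2)" using ext_p_bound[OF ext tauin] fb cpos by (intro mult_mono) auto
    finally have "- (p tau \<bullet> (b0 - xs)) \<le> - (p tau \<bullet> (b - xs)) + s * (p tau \<bullet> f xs w) + cP B * (C * D\<^sup>2)"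
      by (simp add: inner_diff_right)
    moreover have "- (p tau \<bullet> (b - xs)) = \<xi> \<bullet> (b - xs) - lam * (q \<bullet> (b - xs))"
      unfolding F(6) by (simp add: inner_diff_left)
    ultimately show ?thesis by simp
  qed
  \<comment> \<open>By the choice of \<open>w\<close> the displacement during the extra time is
    exactly balanced, to first order, by the extra running cost.\<close>
  have "p tau \<bullet> f xs w = - (lam * r xs w)" using wH by (simp add: xs_def)
  then have H0: "s * (p tau \<bullet> f xs w) = - (s * lam * r xs w)" by simp
  have key: "lam * e - lam * Rd \<le> lam * (q \<bullet> (b - xs)) + s * lam * r xs w + B * (C * D\<^sup>2) + B * (B * (c3 B)\<^sup>2 * D\<^sup>2)"
  proof (cases "b \<in> S")
    case True
    then have hit: "first_hit z v (tau + s)" using bv nohit s F(13) by (auto simp: first_hit_def v_def W_def)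
    have bF: "b \<in> frontier S" using exit_frontier(2)[OF vc hit zS] bv by simp
    have "\<beta> \<le> J z v" using \<beta> V_le[OF vc hit] by (metis ereal_less_eq(3) order_trans)
    also have "J z v = rint z v 0 tau + rint z v tau (tau + s) + g b"
      using cost_eq[OF vc hit] bv rint_combine[OF vc order_refl F(13), of "tau + s" z] s by simp
    also have "rint z v 0 tau = rint z u 0 tau" by (rule rint_cong[OF vc F(1)]) (auto simp: v_def cat_def)
    also have "rint z v tau (tau + s) = rint b0 W 0 s"
    proof -
      have "Y z v tau = b0" unfolding v_def b0_def by (rule traj_cat1[OF F(1) Wc F(13) order_refl])
      then have "rint z v tau (tau + s) = rint b0 (\<lambda>t. v (tau + t)) 0 s"
        using rint_shift[OF vc F(13) order_refl s(1), of z] by simp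
      also have "\<dots> = rint b0 W 0 s" by (rule rint_cong[OF shift_control[OF vc F(13)] Wc]) (auto simp: v_def cat_def)
      finally show ?thesis .
    qed
    finally have "e \<le> Rd + rint b0 W 0 s + (g b - g xs)"
      using cost_eq[OF F(1,2)] by (simp add: e_def Rd_def xs_def)
    moreover have "g b - g xs \<le> q \<bullet> (b - xs) + B * (c3 B)\<^sup>2 * D\<^sup>2"
      using F(15)[of b] nb3 small Bnb by (simp add: xs_def)
    ultimately have "e - Rd \<le> q \<bullet> (b - xs) + s * r xs w + (C * D\<^sup>2 + B * (c3 B)\<^sup>2 * D\<^sup>2)" using rb by linarith
    then have "lam * (e - Rd) \<le> lam * (q \<bullet> (b - xs) + s * r xs w + (C * D\<^sup>2 + B * (c3 B)\<^sup>2 * D\<^sup>2))"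
      using F(4) by (rule mult_left_mono)
    moreover have "lam * (C * D\<^sup>2 + B * (c3 B)\<^sup>2 * D\<^sup>2) \<le> B * (C * D\<^sup>2 + B * (c3 B)\<^sup>2 * D\<^sup>2)"
      using F(9,11) C0 by (intro mult_right_mono) auto
    ultimately show ?thesis by (simp add: algebra_simps)
  next
    case False
    then have sD: "s = c5 B * D" using cases bv by (auto simp: v_def W_def)
    \<comment> \<open>The length \<open>c5 B * D\<close> is made for this: \<kappa> times it equals
      \<open>(c4 B + 1) * D\<close>, which dominates every gain from the perturbation.\<close>
    have "e - Rd - q \<bullet> (b - xs) - s * r xs w \<le> 0"
    proof -
      have n: "norm (b - xs) \<le> N * s + cE B * d"
      proof -
        have "norm (b - b0) \<le> N * s" unfolding b_def by (rule traj_norm[OF Wc s(1)])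
        then show ?thesis using nb0 norm_triangle_ineq[of "b - b0" "b0 - xs"] by simp
      qed
      have "- (q \<bullet> (b - xs)) \<le> norm q * norm (b - xs)" using Cauchy_Schwarz_ineq2[of q "b - xs"] by linarith
      also have "\<dots> \<le> G * (N * s + cE B * d)" using F(8) n G_nonneg by (intro mult_mono) auto
      finally have q: "- (q \<bullet> (b - xs)) \<le> G * (N * s + cE B * d)" .
      have "s * r0 \<le> s * r xs w" using r_ge[OF w] s by (intro mult_left_mono) auto
      then have "e - Rd - q \<bullet> (b - xs) - s * r xs w \<le> \<bar>e\<bar> + c4 B * d - \<kappa> * s"
        using q 2 by (simp add: c4_def \<kappa>_def algebra_simps)
      also have "\<dots> \<le> (c4 B + 1) * D - \<kappa> * s"
        using mult_left_mono[OF d(2) cpos(4)] D_facts by (simp add: algebra_simps)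
      also have "\<dots> = 0" using \<kappa>_pos by (simp add: sD c5_def)
      finally show ?thesis .
    qed
    then have "lam * (e - Rd - q \<bullet> (b - xs) - s * r xs w) \<le> 0" using F(4) by (simp add: mult_nonneg_nonpos)
    moreover have "0 \<le> B * (C * D\<^sup>2) + B * (B * (c3 B)\<^sup>2 * D\<^sup>2)"
      using F(9) C0 by (intro add_nonneg_nonneg mult_nonneg_nonneg) auto
    ultimately show ?thesis by (simp add: algebra_simps)
  qed
  have "- (p 0 \<bullet> (z - X)) + lam * e \<le> B * (c3 B)\<^sup>2 * D\<^sup>2 + cP B * (C * D\<^sup>2) + B * (C * D\<^sup>2) + B * (B * (c3 B)\<^sup>2 * D\<^sup>2) + c2 B * D\<^sup>2"
    using 11 12 15 key H0 by (simp add: algebra_simps)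
  then show ?thesis by (simp add: C_def algebra_simps)
qed

end

text \<open>The constants of the three cases are added. The factor 2 comes from replacing
  \<open>D\<^sup>2\<close> by the sum of the two squares.\<close>

definition cK where "cK B = 2 * ((cP B + B) * (B * c3 B) +
  (B * (c3 B)\<^sup>2 + (cP B + B) * (L * N) * (c5 B)\<^sup>2 + L * (cP B + B) * cE B * c5 B + c2 B + B * B * (c3 B)\<^sup>2) +
  (B * (c3 B)\<^sup>2 + B * B * (c3 B)\<^sup>2 + (cP B + B) * (c5 B * L * c3 B) + c2 B))"

text \<open>Starting from \<open>z\<close>, follow \<open>u\<close> up to \<open>tau\<close> and then a maximizing constant control for a time
  proportional to \<open>|z - X| + |\<beta> - J X u|\<close>. If the target has been hit by then, the hypothesis
  \<open>\<beta> \<le> V z\<close> gives the estimate; otherwise the end point lies outside the target and the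
  proximal normal inequality for \<open>\<xi>\<close> does.\<close>

theorem sensitivity:
  assumes ext: "extremal B lam X u tau q \<xi> p" and zS: "z \<notin> S" and \<beta>: "ereal \<beta> \<le> V z"
  shows "- (p 0 \<bullet> (z - X)) + lam * (\<beta> - J X u) \<le> cK B * ((norm (z - X))\<^sup>2 + (\<beta> - J X u)\<^sup>2)"
proof -
  define D where "D = norm (z - X) + \<bar>\<beta> - J X u\<bar>"
  define k1 where "k1 = (cP B + B) * (B * c3 B)"
  define k2 where "k2 = B * (c3 B)\<^sup>2 + (cP B + B) * (L * N) * (c5 B)\<^sup>2 + L * (cP B + B) * cE B * c5 B + c2 B + B * B * (c3 B)\<^sup>2"
  define k3 where "k3 = B * (c3 B)\<^sup>2 + B * B * (c3 B)\<^sup>2 + (cP B + B) * (c5 B * L * c3 B) + c2 B"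
  note F = ext_facts[OF ext]
  note cpos = const_pos[OF F(9)]
  have k: "k1 \<ge> 0" "k2 \<ge> 0" "k3 \<ge> 0"
    unfolding k1_def k2_def k3_def using cpos F(9) L_pos N_pos
    by (intro add_nonneg_nonneg mult_nonneg_nonneg; simp)+
  have D0: "D \<ge> 0" by (simp add: D_def)
  have "- (p 0 \<bullet> (z - X)) + lam * (\<beta> - J X u) \<le> (k1 + k2 + k3) * D\<^sup>2"
  proof (cases "c3 B * D \<le> 1 / B")
    case False
    then have "- (p 0 \<bullet> (z - X)) + lam * (\<beta> - J X u) \<le> k1 * D\<^sup>2"
      unfolding D_def k1_def by (rule sens_large[OF ext zS \<beta>])
    also have "\<dots> \<le> (k1 + k2 + k3) * D\<^sup>2" using k by (intro mult_right_mono) auto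
    finally show ?thesis .
  next
    case small: True
    obtain w where w: "w \<in> U" "Hl lam (Y X u tau) (p tau) = - (p tau \<bullet> f (Y X u tau) w) - lam * r (Y X u tau) w"
      using Hl_attained by metis
    have wH: "- (p tau \<bullet> f (Y X u tau) w) - lam * r (Y X u tau) w = 0" using w(2) F(7) by simp
    let ?v = "cat u tau (\<lambda>_. w)"
    have vc: "?v \<in> controls U" by (rule cat_control[OF F(1) F(13) const_control[OF w(1)]])
    have s0: "0 \<le> c5 B * D" using cpos D0 by simp
    have late: "- (p 0 \<bullet> (z - X)) + lam * (\<beta> - J X u) \<le> k3 * D\<^sup>2" if "0 \<le> s" "s \<le> c5 B * D"
      "\<And>t. 0 \<le> t \<Longrightarrow> t < tau + s \<Longrightarrow> Y z ?v t \<notin> S"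
      "Y z ?v (tau + s) \<in> S \<or> Y z ?v (tau + s) \<notin> S \<and> s = c5 B * D" for s
      unfolding k3_def D_def using that small by (intro sens_late[OF ext zS \<beta> w(1) wH]) (auto simp: D_def)
    show ?thesis
    proof (cases "\<exists>t. 0 \<le> t \<and> t \<le> tau + c5 B * D \<and> Y z ?v t \<in> S")
      case True
      then obtain t' where "0 \<le> t'" "t' \<le> tau + c5 B * D" "Y z ?v t' \<in> S" by blast
      then obtain t where t: "t \<le> tau + c5 B * D" "first_hit z ?v t"
        using first_hit_exists[OF vc, of t' z] by (meson order_trans)
      show ?thesis
      proof (cases "t \<le> tau")
        case True
        have "first_hit z u t" using t(2) traj_cat1[OF F(1) const_control[OF w(1)], of _ tau z] True
          by (auto simp: first_hit_def)
        then have "- (p 0 \<bullet> (z - X)) + lam * (\<beta> - J X u) \<le> k2 * D\<^sup>2"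
          unfolding k2_def D_def using True small by (intro sens_early[OF ext zS \<beta>]) (auto simp: D_def)
        also have "\<dots> \<le> (k1 + k2 + k3) * D\<^sup>2" using k by (intro mult_right_mono) auto
        finally show ?thesis .
      next
        case False
        have "- (p 0 \<bullet> (z - X)) + lam * (\<beta> - J X u) \<le> k3 * D\<^sup>2"
          by (rule late[of "t - tau"]) (use False t in \<open>auto simp: first_hit_def\<close>)
        also have "\<dots> \<le> (k1 + k2 + k3) * D\<^sup>2" using k by (intro mult_right_mono) auto
        finally show ?thesis .
      qed
    next
      case False
      have "- (p 0 \<bullet> (z - X)) + lam * (\<beta> - J X u) \<le> k3 * D\<^sup>2"
        by (rule late[of "c5 B * D"]) (use False s0 F(13) in auto)
      also have "\<dots> \<le> (k1 + k2 + k3) * D\<^sup>2" using k by (intro mult_right_mono) auto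
      finally show ?thesis .
    qed
  qed
  also have "\<dots> \<le> (k1 + k2 + k3) * (2 * ((norm (z - X))\<^sup>2 + (\<beta> - J X u)\<^sup>2))"
  proof (rule mult_left_mono)
    have "(a + \<bar>b\<bar>)\<^sup>2 \<le> 2 * (a\<^sup>2 + b\<^sup>2)" for a b :: real
      using zero_le_power2[of "a - \<bar>b\<bar>"] by (simp add: power2_diff power2_sum)
    then show "D\<^sup>2 \<le> 2 * ((norm (z - X))\<^sup>2 + (\<beta> - J X u)\<^sup>2)" unfolding D_def .
  qed (use k in auto)
  also have "\<dots> = cK B * ((norm (z - X))\<^sup>2 + (\<beta> - J X u)\<^sup>2)"
    unfolding cK_def k1_def[symmetric] k2_def[symmetric] k3_def[symmetric] by (simp only: mult.assoc mult.left_commute)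
  finally show ?thesis .
qed

lemma cK_nonneg: "B \<ge> 1 \<Longrightarrow> cK B \<ge> 0"
  using const_pos[of B] L_pos N_pos unfolding cK_def
  by (intro mult_nonneg_nonneg add_nonneg_nonneg; simp)

end

section \<open>Proximal normals to the hypograph\<close>

text \<open>A hyperplane supporting the strict epigraph at \<open>(y, h y)\<close>. It is not
  vertical, since a vertical one would be violated by moving from the interior point
  \<open>y\<close> against \<open>a1\<close>; division by \<open>a2\<close> then gives the
  slope.\<close>

lemma supergradient_exists:
  fixes h :: "'a::euclidean_space \<Rightarrow> real"
  assumes \<rho>: "\<rho> > 0" and conv: "convex_on (ball y \<rho>) h"
  obtains q where "\<And>z. z \<in> ball y \<rho> \<Longrightarrow> h y + q \<bullet> (z - y) \<le> h z"
proof -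
  define A where "A = {(z, t). z \<in> ball y \<rho> \<and> h z < t}"
  have "convex A"
  proof (rule convexI)
    fix a b and u v :: real assume ab: "a \<in> A" "b \<in> A" and uv: "0 \<le> u" "0 \<le> v" "u + v = 1"
    obtain z1 t1 z2 t2 where e: "a = (z1, t1)" "b = (z2, t2)" by fastforce
    have m: "z1 \<in> ball y \<rho>" "z2 \<in> ball y \<rho>" "h z1 < t1" "h z2 < t2" using ab e by (auto simp: A_def)
    have 1: "u *\<^sub>R z1 + v *\<^sub>R z2 \<in> ball y \<rho>" using m uv convex_ball convexD by blast
    have "h (u *\<^sub>R z1 + v *\<^sub>R z2) \<le> u * h z1 + v * h z2"
      using conv m uv unfolding convex_on_def by blast
    also have "\<dots> < u * t1 + v * t2"
    proof (cases "u = 0")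
      case True
      then show ?thesis using uv m by simp
    next
      case False
      then show ?thesis using uv m by (intro add_less_le_mono mult_strict_left_mono mult_left_mono) auto
    qed
    finally show "u *\<^sub>R a + v *\<^sub>R b \<in> A" using 1 by (simp add: A_def e)
  qed
  moreover have "(y, h y + 1) \<in> A" using \<rho> by (simp add: A_def)
  moreover have "{(y, h y)} \<inter> A = {}" by (simp add: A_def)
  ultimately have "\<exists>a b. a \<noteq> 0 \<and> (\<forall>x\<in>{(y, h y)}. a \<bullet> x \<le> b) \<and> (\<forall>x\<in>A. b \<le> a \<bullet> x)"
    by (intro separating_hyperplane_sets) auto
  then obtain a b where ab: "a \<noteq> 0" "\<forall>x\<in>{(y, h y)}. a \<bullet> x \<le> b" "\<forall>x\<in>A. b \<le> a \<bullet> x"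
    by blast
  obtain a1 a2 where a: "a = (a1, a2)" by fastforce
  have sep: "a1 \<bullet> y + a2 * h y \<le> a1 \<bullet> z + a2 * t" if "z \<in> ball y \<rho>" "h z < t" for z t
    using ab(2,3) that by (force simp: a A_def)
  have a2: "a2 \<ge> 0" using sep[of y "h y + 1"] \<rho> by (simp add: algebra_simps)
  have "a2 \<noteq> 0"
  proof
    assume z: "a2 = 0"
    then have a1: "a1 \<noteq> 0" using ab(1) a by (auto simp: zero_prod_def)
    define s where "s = \<rho> / (2 * norm a1)"
    have s: "s > 0" using \<rho> a1 by (simp add: s_def)
    have "y - s *\<^sub>R a1 \<in> ball y \<rho>" using \<rho> a1 by (simp add: dist_norm s_def)
    from sep[OF this, of "h (y - s *\<^sub>R a1) + 1"]
    have "a1 \<bullet> y \<le> a1 \<bullet> (y - s *\<^sub>R a1)" using z by simp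
    then have "s * (a1 \<bullet> a1) \<le> 0" by (simp add: inner_diff_right)
    then have "a1 \<bullet> a1 \<le> 0" using s by (simp add: mult_le_0_iff)
    then show False using a1 inner_gt_zero_iff[of a1] by (metis not_le)
  qed
  with a2 have a2: "a2 > 0" by simp
  have "h y + (- (1 / a2) *\<^sub>R a1) \<bullet> (z - y) \<le> h z" if z: "z \<in> ball y \<rho>" for z
  proof (rule field_le_epsilon)
    fix e :: real assume e: "e > 0"
    have "a1 \<bullet> y + a2 * h y \<le> a1 \<bullet> z + a2 * (h z + e)" by (rule sep[OF z]) (use e in auto)
    then have "a2 * (h y + (- (1 / a2) *\<^sub>R a1) \<bullet> (z - y)) \<le> a2 * (h z + e)"
      using a2 by (simp add: algebra_simps inner_diff_right)
    then show "h y + (- (1 / a2) *\<^sub>R a1) \<bullet> (z - y) \<le> h z + e" using a2 by simp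
  qed
  then show ?thesis using that by blast
qed

text \<open>The body of \<open>locally_semiconcave\<close> with radius and constant exposed, so that
  both can be chosen uniformly on a compact set.\<close>

definition semiconcave_at :: "('a::real_inner \<Rightarrow> real) \<Rightarrow> real \<Rightarrow> real \<Rightarrow> 'a \<Rightarrow> bool" where
  "semiconcave_at g \<rho> c y \<longleftrightarrow> (\<forall>x0\<in>ball y \<rho>. \<forall>x1\<in>ball y \<rho>. \<forall>l\<in>{0..1}.
        (1 - l) * g x0 + l * g x1 - g ((1 - l) *\<^sub>R x0 + l *\<^sub>R x1) \<le> c * l * (1 - l) * (norm (x0 - x1))\<^sup>2)"

text \<open>The radius is a Lebesgue number of a finite cover by balls of semiconcavity, the
  constant is the largest of the finitely many constants.\<close>

lemma semiconcave_uniform: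
  fixes g :: "real^'d \<Rightarrow> real"
  assumes g: "locally_semiconcave g" and C: "compact C"
  obtains \<rho> c where "\<rho> > 0" "c > 0" "\<And>y. y \<in> C \<Longrightarrow> semiconcave_at g \<rho> c y"
proof -
  obtain R k where R: "\<And>x. R x > 0" "\<And>x. k x > 0" "\<And>x. semiconcave_at g (R x) (k x) x"
    using g unfolding locally_semiconcave_def semiconcave_at_def by metis
  obtain D where D: "finite D" "D \<subseteq> C" "C \<subseteq> (\<Union>x\<in>D. ball x (R x))"
  proof (rule compactE_image[OF C, of C "\<lambda>x. ball x (R x)"])
    show "C \<subseteq> (\<Union>x\<in>C. ball x (R x))" using R(1) by force
  qed auto
  show ?thesis
  proof (cases "C = {}")
    case True
    then show ?thesis using that[of 1 1] by auto
  next
    case False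
    then have Dne: "D \<noteq> {}" using D by auto
    obtain e where e: "e > 0" "\<And>y. y \<in> C \<Longrightarrow> \<exists>A\<in>(\<lambda>x. ball x (R x)) ` D. ball y e \<subseteq> A"
      using Heine_Borel_lemma[OF C, of "(\<lambda>x. ball x (R x)) ` D"] D by auto
    define c where "c = Max (k ` D)"
    have c: "k x \<le> c" if "x \<in> D" for x unfolding c_def using that D by auto
    have "c > 0" using c R(2) Dne by (metis all_not_in_conv less_le_trans)
    moreover have "semiconcave_at g e c y" if y: "y \<in> C" for y
    proof -
      obtain x where x: "x \<in> D" "ball y e \<subseteq> ball x (R x)" using e(2)[OF y] by auto
      show ?thesis unfolding semiconcave_at_def
      proof (intro ballI)
        fix x0 x1 and l :: real assume a: "x0 \<in> ball y e" "x1 \<in> ball y e" "l \<in> {0..1}"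
        then have m: "x0 \<in> ball x (R x)" "x1 \<in> ball x (R x)" using x(2) by blast+
        have "(1 - l) * g x0 + l * g x1 - g ((1 - l) *\<^sub>R x0 + l *\<^sub>R x1) \<le> k x * (l * (1 - l) * (norm (x0 - x1))\<^sup>2)"
          using R(3)[of x, unfolded semiconcave_at_def, rule_format, OF m a(3)] by (simp add: mult.assoc)
        also have "\<dots> \<le> c * (l * (1 - l) * (norm (x0 - x1))\<^sup>2)"
          using c[OF x(1)] a by (intro mult_right_mono) auto
        finally show "(1 - l) * g x0 + l * g x1 - g ((1 - l) *\<^sub>R x0 + l *\<^sub>R x1) \<le> c * l * (1 - l) * (norm (x0 - x1))\<^sup>2"
          by (simp add: mult.assoc)
      qed
    qed
    ultimately show ?thesis using that e(1) by blast
  qed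
qed

text \<open>Subtracting \<open>g\<close> from \<open>c\<close> times the squared distance leaves a
  convex function, because the convexity defect of the squared norm equals the semiconcavity bound
  exactly. A subgradient of it at \<open>y\<close> gives \<open>q\<close> with the opposite
  sign.\<close>

lemma semiconcave_superdiff_exists:
  fixes g :: "real^'d \<Rightarrow> real"
  assumes s: "semiconcave_at g \<rho> c y" and \<rho>: "\<rho> > 0"
  obtains q where "\<And>z. z \<in> ball y \<rho> \<Longrightarrow> g z \<le> g y + q \<bullet> (z - y) + c * (norm (z - y))\<^sup>2"
proof -
  define h where "h z = c * (norm (z - y))\<^sup>2 - g z" for z
  have "convex_on (ball y \<rho>) h"
  proof (rule convex_onI)
    fix l x0 x1 assume l: "(0::real) < l" "l < 1" and x: "x0 \<in> ball y \<rho>" "x1 \<in> ball y \<rho>"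
    have "(1 - l) * (norm (x0 - y))\<^sup>2 + l * (norm (x1 - y))\<^sup>2 - (norm ((1 - l) *\<^sub>R x0 + l *\<^sub>R x1 - y))\<^sup>2 = l * (1 - l) * (norm (x0 - x1))\<^sup>2"
    proof -
      have e1: "(1 - l) *\<^sub>R x0 + l *\<^sub>R x1 - y = (1 - l) *\<^sub>R (x0 - y) + l *\<^sub>R (x1 - y)" by (simp add: algebra_simps)
      have e2: "x0 - x1 = (x0 - y) - (x1 - y)" by simp
      have "(1 - l) * (norm a)\<^sup>2 + l * (norm b)\<^sup>2 - (norm ((1 - l) *\<^sub>R a + l *\<^sub>R b))\<^sup>2 = l * (1 - l) * (norm (a - b))\<^sup>2" for a b :: "real^'d"
        unfolding power2_norm_eq_inner
        by (simp add: inner_add_left inner_add_right inner_diff_left inner_diff_right inner_commute[of b a]) algebra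
      then show ?thesis unfolding e1 unfolding e2 by blast
    qed
    then have "c * ((1 - l) * (norm (x0 - y))\<^sup>2 + l * (norm (x1 - y))\<^sup>2 - (norm ((1 - l) *\<^sub>R x0 + l *\<^sub>R x1 - y))\<^sup>2) = c * l * (1 - l) * (norm (x0 - x1))\<^sup>2"
      by (simp add: mult.assoc)
    moreover have "(1 - l) * g x0 + l * g x1 - g ((1 - l) *\<^sub>R x0 + l *\<^sub>R x1) \<le> c * l * (1 - l) * (norm (x0 - x1))\<^sup>2"
      using s x l unfolding semiconcave_at_def by auto
    ultimately show "h ((1 - l) *\<^sub>R x0 + l *\<^sub>R x1) \<le> (1 - l) * h x0 + l * h x1"
      by (simp add: h_def algebra_simps)
  qed auto
  then obtain q where q: "\<And>z. z \<in> ball y \<rho> \<Longrightarrow> h y + q \<bullet> (z - y) \<le> h z" using supergradient_exists[OF \<rho>] by metis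
  show ?thesis
    by (rule that[of "- q"]) (use q in \<open>force simp: h_def\<close>)
qed

lemma superdiff_upper:
  fixes g :: "real^'d \<Rightarrow> real"
  assumes q: "q \<in> superdiff g y" and e: "e > 0"
  obtains d where "d > 0" "\<And>z. norm (z - y) < d \<Longrightarrow> g z \<le> g y + q \<bullet> (z - y) + e * norm (z - y)"
proof -
  have "Limsup (at y) (\<lambda>z. ereal ((g z - g y - q \<bullet> (z - y)) / norm (z - y))) < ereal e"
    using q e unfolding superdiff_def by (auto intro: le_less_trans)
  from Limsup_lessD[OF this] obtain d where d: "d > 0" "\<And>z. z \<noteq> y \<Longrightarrow> dist z y < d \<Longrightarrow> (g z - g y - q \<bullet> (z - y)) / norm (z - y) < e"
    unfolding eventually_at by auto
  have "g z \<le> g y + q \<bullet> (z - y) + e * norm (z - y)" if "norm (z - y) < d" for z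
  proof (cases "z = y")
    case False
    then have "(g z - g y - q \<bullet> (z - y)) / norm (z - y) < e" using d(2) that by (simp add: dist_norm)
    then show ?thesis using False by (simp add: field_simps)
  qed simp
  then show ?thesis using that d(1) by blast
qed

lemma superdiffI:
  fixes g :: "real^'d \<Rightarrow> real"
  assumes d: "d > 0" and le: "\<And>z. norm (z - y) \<le> d \<Longrightarrow> g z \<le> g y + q \<bullet> (z - y) + c * (norm (z - y))\<^sup>2"
  shows "q \<in> superdiff g y"
proof -
  have "Limsup (at y) (\<lambda>z. ereal ((g z - g y - q \<bullet> (z - y)) / norm (z - y))) \<le> 0"
  proof (rule ereal_le_epsilon2)
    fix e :: real assume e: "e > 0"
    show "Limsup (at y) (\<lambda>z. ereal ((g z - g y - q \<bullet> (z - y)) / norm (z - y))) \<le> 0 + ereal e"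
    proof (rule Limsup_bounded)
      define d' where "d' = min d (e / (\<bar>c\<bar> + 1))"
      have d': "d' > 0" using d e by (simp add: d'_def)
      have "(g z - g y - q \<bullet> (z - y)) / norm (z - y) \<le> e" if z: "z \<noteq> y" "dist z y < d'" for z
      proof -
        have n: "norm (z - y) > 0" "norm (z - y) \<le> d" "norm (z - y) < e / (\<bar>c\<bar> + 1)" using z by (auto simp: d'_def dist_norm)
        have "g z - g y - q \<bullet> (z - y) \<le> c * (norm (z - y))\<^sup>2" using le[OF n(2)] by simp
        also have "\<dots> \<le> (\<bar>c\<bar> + 1) * (norm (z - y))\<^sup>2" by (rule mult_right_mono) auto
        also have "\<dots> = (\<bar>c\<bar> + 1) * norm (z - y) * norm (z - y)" by (simp add: power2_eq_square mult.assoc)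
        also have "\<dots> \<le> e * norm (z - y)"
          using n by (intro mult_right_mono) (auto simp: field_simps)
        finally show ?thesis using n by (simp add: field_simps)
      qed
      then show "\<forall>\<^sub>F z in at y. ereal ((g z - g y - q \<bullet> (z - y)) / norm (z - y)) \<le> 0 + ereal e"
        unfolding eventually_at using d' by (intro exI[of _ d']) auto
    qed
  qed
  then show ?thesis unfolding superdiff_def by simp
qed

text \<open>Every supergradient, not just a constructed one, satisfies the quadratic bound on the
  whole ball. Semiconcavity on the segment from \<open>y\<close> to \<open>z\<close> is combined
  with the first-order inequality at a point close to \<open>y\<close>, divided by the parameter
  \<open>l\<close>, and \<open>l\<close> is made small.\<close>

lemma semiconcave_superdiff:
  fixes g :: "real^'d \<Rightarrow> real"
  assumes s: "semiconcave_at g \<rho> c y" and q: "q \<in> superdiff g y" and z: "z \<in> ball y \<rho>"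
  shows "g z \<le> g y + q \<bullet> (z - y) + c * (norm (z - y))\<^sup>2"
proof (rule field_le_epsilon)
  fix e :: real assume e: "e > 0"
  define w where "w = z - y"
  define e' where "e' = e / (norm w + \<bar>c\<bar> * (norm w)\<^sup>2 + 1)"
  have den: "norm w + \<bar>c\<bar> * (norm w)\<^sup>2 + 1 > 0" by (smt (verit) norm_ge_zero mult_nonneg_nonneg zero_le_power2)
  have e': "e' > 0" using e den by (simp add: e'_def)
  obtain d where d: "d > 0" "\<And>z. norm (z - y) < d \<Longrightarrow> g z \<le> g y + q \<bullet> (z - y) + e' * norm (z - y)"
    using superdiff_upper[OF q e'] by blast
  \<comment> \<open>Small enough for the first-order inequality to hold at the intermediate point,
    and at most \<open>e'\<close> so that the lost part of the quadratic term is absorbed.\<close>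
  define l where "l = min (min 1 e') (d / (2 * (norm w + 1)))"
  have nw: "norm w + 1 > 0" by (smt (verit) norm_ge_zero)
  have l: "0 < l" "l \<le> 1" "l \<le> e'" using e' d nw by (auto simp: l_def)
  have "l * norm w \<le> d / (2 * (norm w + 1)) * (norm w + 1)"
    using l nw by (intro mult_mono) (auto simp: l_def)
  also have "d / (2 * (norm w + 1)) * (norm w + 1) = d / 2" using nw by (simp add: divide_simps)
  finally have lw: "l * norm w < d" using d by simp
  have p: "(1 - l) *\<^sub>R y + l *\<^sub>R z = y + l *\<^sub>R w" by (simp add: w_def algebra_simps)
  have \<rho>: "\<rho> > 0" using z by (metis ball_eq_empty equals0D not_le)
  have "(1 - l) * g y + l * g z - g (y + l *\<^sub>R w) \<le> c * l * (1 - l) * (norm (y - z))\<^sup>2"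
    using s[unfolded semiconcave_at_def, rule_format, of y z l] z l \<rho> p by auto
  moreover have "g (y + l *\<^sub>R w) \<le> g y + q \<bullet> (l *\<^sub>R w) + e' * norm (l *\<^sub>R w)"
    using d(2)[of "y + l *\<^sub>R w"] lw l by simp
  moreover have "norm (y - z) = norm w" by (simp add: w_def norm_minus_commute)
  ultimately have "l * (g z - g y) \<le> l * (q \<bullet> w + e' * norm w + c * (1 - l) * (norm w)\<^sup>2)"
    using l by (simp add: algebra_simps)
  then have "g z - g y \<le> q \<bullet> w + e' * norm w + c * (1 - l) * (norm w)\<^sup>2" using l by simp
  also have "c * (1 - l) * (norm w)\<^sup>2 = c * (norm w)\<^sup>2 - l * c * (norm w)\<^sup>2" by (simp add: algebra_simps)
  finally have gz: "g z - g y \<le> q \<bullet> w + e' * norm w + (c * (norm w)\<^sup>2 - l * c * (norm w)\<^sup>2)" .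
  have "- (l * c * (norm w)\<^sup>2) \<le> e' * (\<bar>c\<bar> * (norm w)\<^sup>2)"
  proof -
    have "- (l * c) \<le> l * \<bar>c\<bar>" using l by (simp add: abs_if mult_le_0_iff)
    also have "\<dots> \<le> e' * \<bar>c\<bar>" using l by (intro mult_right_mono) auto
    finally show ?thesis using mult_right_mono[of "- (l * c)" "e' * \<bar>c\<bar>" "(norm w)\<^sup>2"] by (simp add: mult.assoc)
  qed
  with gz have "g z - g y \<le> q \<bullet> w + c * (norm w)\<^sup>2 + e' * (norm w + \<bar>c\<bar> * (norm w)\<^sup>2)" by (simp add: algebra_simps)
  also have "e' * (norm w + \<bar>c\<bar> * (norm w)\<^sup>2) \<le> e' * (norm w + \<bar>c\<bar> * (norm w)\<^sup>2 + 1)" using e' by (intro mult_left_mono) auto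
  also have "\<dots> = e" using den by (simp add: e'_def)
  finally show "g z \<le> g y + q \<bullet> (z - y) + c * (norm (z - y))\<^sup>2 + e" by (simp add: w_def)
qed

section \<open>Hamiltonians, normals at the exit and backward adjoint equations\<close>

context exit_problem
begin

text \<open>A short step from \<open>y\<close> in the direction of \<open>- q\<close> lowers the
  upper bound at the rate \<open>norm q\<close>, whereas \<open>g\<close> itself can drop only at
  the rate \<open>G\<close>.\<close>

lemma superdiff_norm:
  assumes y: "y \<in> frontier S" and q: "q \<in> superdiff g y"
  shows "norm q \<le> G"
proof (rule field_le_epsilon)
  fix e :: real assume e: "e > 0"
  obtain d where d: "d > 0" "\<And>z. norm (z - y) < d \<Longrightarrow> g z \<le> g y + q \<bullet> (z - y) + e * norm (z - y)"
    using superdiff_upper[OF q e] by blast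
  obtain d2 where d2: "d2 > 0" "ball y d2 \<subseteq> W" using W_open frontier_W y openE by blast
  show "norm q \<le> G + e"
  proof (cases "q = 0")
    case True then show ?thesis using G_nonneg e by simp
  next
    case False
    define t where "t = min d d2 / (2 * norm q)"
    have "t * norm q = min d d2 / 2" using False by (simp add: t_def)
    then have t: "t > 0" "t * norm q < d" "t * norm q < d2" using d d2 False by (auto simp: t_def)
    let ?z = "y - t *\<^sub>R q"
    have "?z \<in> W" using d2 t by (auto simp: dist_norm subset_iff)
    then have "\<bar>g ?z - g y\<bar> \<le> G * norm (?z - y)" using subsetD[OF frontier_W y] by (intro g_lip)
    moreover have "g ?z \<le> g y + q \<bullet> (?z - y) + e * norm (?z - y)" by (rule d(2)) (use t in auto)
    ultimately have "t * (q \<bullet> q) \<le> (G + e) * (t * norm q)" using t by (simp add: algebra_simps)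
    then have "(t * norm q) * norm q \<le> (t * norm q) * (G + e)"
      by (simp add: power2_norm_eq_inner[symmetric] power2_eq_square algebra_simps)
    then show ?thesis using t False by simp
  qed
qed

lemma Hl_diff:
  "\<bar>Hl lam x p - Hl mu y q\<bar> \<le> N * norm (p - q) + norm q * (L * norm (x - y)) + \<bar>lam - mu\<bar> * (R0 + L * norm x) + \<bar>mu\<bar> * (L * norm (x - y))"
    (is "_ \<le> ?R")
proof -
  have b: "\<bar>(- (p \<bullet> f x w) - lam * r x w) - (- (q \<bullet> f y w) - mu * r y w)\<bar> \<le> ?R" if w: "w \<in> U" for w
  proof -
    have "(- (p \<bullet> f x w) - lam * r x w) - (- (q \<bullet> f y w) - mu * r y w) =
       - ((p - q) \<bullet> f x w) - q \<bullet> (f x w - f y w) - (lam - mu) * r x w - mu * (r x w - r y w)"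
      by (simp add: inner_diff_left inner_diff_right algebra_simps)
    moreover have "\<bar>(p - q) \<bullet> f x w\<bar> \<le> N * norm (p - q)"
      using order_trans[OF Cauchy_Schwarz_ineq2 mult_left_mono[OF f_le[OF w]]] by (simp add: mult.commute)
    moreover have "\<bar>q \<bullet> (f x w - f y w)\<bar> \<le> norm q * (L * norm (x - y))"
      using order_trans[OF Cauchy_Schwarz_ineq2 mult_left_mono[OF f_lip[OF w]]] by simp
    moreover have "\<bar>(lam - mu) * r x w\<bar> \<le> \<bar>lam - mu\<bar> * (R0 + L * norm x)"
      using r_bound[OF w, of x] by (simp add: abs_mult mult_left_mono)
    moreover have "\<bar>mu * (r x w - r y w)\<bar> \<le> \<bar>mu\<bar> * (L * norm (x - y))"
      using r_lip[OF w, of x y] by (simp add: abs_mult mult_left_mono)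
    ultimately show ?thesis by linarith
  qed
  obtain w1 where w1: "w1 \<in> U" "Hl lam x p = - (p \<bullet> f x w1) - lam * r x w1" using Hl_attained by metis
  obtain w2 where w2: "w2 \<in> U" "Hl mu y q = - (q \<bullet> f y w2) - mu * r y w2" using Hl_attained by metis
  have "Hl lam x p - Hl mu y q \<le> ?R" using b[OF w1(1)] w1(2) Hl_ge[OF w1(1), of q y mu] by linarith
  moreover have "Hl mu y q - Hl lam x p \<le> ?R" using b[OF w2(1)] w2(2) Hl_ge[OF w2(1), of p x lam] by linarith
  ultimately show ?thesis by linarith
qed

lemma Hl_tendsto:
  assumes "(a \<longlongrightarrow> lam) F" "(b \<longlongrightarrow> x) F" "(c \<longlongrightarrow> p) F"
  shows "((\<lambda>n. Hl (a n) (b n) (c n)) \<longlongrightarrow> Hl lam x p) F"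
proof -
  have "((\<lambda>n. N * norm (c n - p) + norm p * (L * norm (b n - x)) + \<bar>a n - lam\<bar> * (R0 + L * norm (b n)) + \<bar>lam\<bar> * (L * norm (b n - x))) \<longlongrightarrow>
    N * norm (p - p) + norm p * (L * norm (x - x)) + \<bar>lam - lam\<bar> * (R0 + L * norm x) + \<bar>lam\<bar> * (L * norm (x - x))) F"
    by (intro tendsto_intros assms)
  then have "((\<lambda>n. N * norm (c n - p) + norm p * (L * norm (b n - x)) + \<bar>a n - lam\<bar> * (R0 + L * norm (b n)) + \<bar>lam\<bar> * (L * norm (b n - x))) \<longlongrightarrow> 0) F"
    by simp
  then have "((\<lambda>n. Hl (a n) (b n) (c n) - Hl lam x p) \<longlongrightarrow> 0) F"
    by (rule Lim_null_comparison[rotated]) (auto intro!: always_eventually Hl_diff simp: real_norm_def)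
  then show ?thesis by (simp add: LIM_zero_iff)
qed

text \<open>If every velocity pointed strictly against \<xi> at the exit point, then shortly before
  the exit the trajectory would lie on the side of \<xi> by a first-order amount. It is outside the
  target there, and the proximal inequality allows only a second-order amount.\<close>

lemma exit_normal_nonneg:
  assumes u: "u \<in> controls U" and h: "first_hit X u tau" and X: "X \<notin> S"
    and \<xi>: "\<And>z. z \<in> closure (- S) \<Longrightarrow> \<xi> \<bullet> (z - Y X u tau) \<le> \<sigma> * (norm (z - Y X u tau))\<^sup>2"
  shows "Hl 0 (Y X u tau) (- \<xi>) \<ge> 0"
proof (rule ccontr)
  assume "\<not> ?thesis"
  then have neg: "Hl 0 (Y X u tau) (- \<xi>) < 0" by simp
  define m where "m = - Hl 0 (Y X u tau) (- \<xi>)"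
  define xs where "xs = Y X u tau"
  have m: "m > 0" using neg by (simp add: m_def)
  have tau: "tau > 0" using exit_frontier(1)[OF u h X] .
  define C where "C = norm \<xi> * (L * N) + \<bar>\<sigma>\<bar> * N\<^sup>2"
  have C0: "C \<ge> 0" unfolding C_def using L_pos N_pos by simp
  \<comment> \<open>A time before the exit so short that the second-order errors, collected in
    \<open>C\<close>, use at most half of the margin \<open>m\<close>.\<close>
  define k where "k = min tau (m / (2 * (C + 1)))"
  have "k * (C + 1) \<le> m / (2 * (C + 1)) * (C + 1)" using C0 by (intro mult_right_mono) (auto simp: k_def)
  also have "\<dots> = m / 2" using C0 by (simp add: divide_simps)
  finally have k: "0 < k" "k \<le> tau" "k * (C + 1) \<le> m / 2"
    using tau m C0 by (auto simp: k_def)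
  define t where "t = tau - k"
  have t: "0 \<le> t" "t < tau" using k by (auto simp: t_def)
  have i1: "((\<lambda>s. f (Y X u s) (u s)) has_integral (xs - Y X u t)) {t..tau}"
    unfolding xs_def by (rule bounded_rate_has_integral[OF traj_rate[OF u]]) (use t in auto)
  have i2: "((\<lambda>s. \<xi> \<bullet> f (Y X u s) (u s)) has_integral (\<xi> \<bullet> (xs - Y X u t))) {t..tau}"
    using has_integral_linear[OF i1 bounded_linear_inner_right[of \<xi>]] by (simp add: o_def)
  have i3: "((\<lambda>s. - m + norm \<xi> * (L * (N * k))) has_integral k * (- m + norm \<xi> * (L * (N * k)))) {t..tau}"
    using has_integral_const_real[of "- m + norm \<xi> * (L * (N * k))" t tau] k by (simp add: t_def)
  have "\<xi> \<bullet> (xs - Y X u t) \<le> k * (- m + norm \<xi> * (L * (N * k)))"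
  proof (rule has_integral_le[OF i2 i3])
    fix s assume s: "s \<in> {t..tau}"
    have us: "u s \<in> U" using controls_in[OF u] s t by auto
    have "norm (Y X u s - xs) \<le> N * \<bar>s - tau\<bar>" unfolding xs_def by (rule traj_lip[OF u]) (use s t in auto)
    also have "\<dots> \<le> N * k" using s N_pos by (auto simp: t_def)
    finally have ys: "norm (Y X u s - xs) \<le> N * k" .
    have "\<xi> \<bullet> f xs (u s) \<le> - m" using Hl_ge[OF us, of "- \<xi>" xs 0] by (simp add: m_def xs_def)
    moreover have "\<xi> \<bullet> (f (Y X u s) (u s) - f xs (u s)) \<le> norm \<xi> * (L * (N * k))"
      using order_trans[OF norm_cauchy_schwarz mult_left_mono[OF order_trans[OF f_lip[OF us] mult_left_mono[OF ys]]]] L_pos by simp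
    ultimately show "\<xi> \<bullet> f (Y X u s) (u s) \<le> - m + norm \<xi> * (L * (N * k))" by (simp add: inner_diff_right)
  qed
  moreover have "\<xi> \<bullet> (Y X u t - xs) \<le> \<bar>\<sigma>\<bar> * (N * k)\<^sup>2"
  proof -
    have "Y X u t \<notin> S" using h t by (auto simp: first_hit_def)
    then have "Y X u t \<in> closure (- S)" using closure_subset[of "- S"] by auto
    then have "\<xi> \<bullet> (Y X u t - xs) \<le> \<sigma> * (norm (Y X u t - xs))\<^sup>2" using \<xi> by (simp add: xs_def)
    also have "\<dots> \<le> \<bar>\<sigma>\<bar> * (N * k)\<^sup>2"
    proof (intro mult_mono power_mono)
      show "norm (Y X u t - xs) \<le> N * k" using traj_lip[OF u, of t tau X] t by (simp add: xs_def t_def)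
    qed auto
    finally show ?thesis .
  qed
  ultimately have "0 \<le> k * (- m + norm \<xi> * (L * (N * k))) + \<bar>\<sigma>\<bar> * (N * k)\<^sup>2" by (simp add: inner_diff_right)
  also have "\<dots> = k * (- m + k * C)" by (simp add: C_def power2_eq_square algebra_simps)
  finally have "m \<le> k * C" using k by (simp add: zero_le_mult_iff)
  also have "\<dots> \<le> k * (C + 1)" using k by simp
  finally show False using k m by linarith
qed

text \<open>Time reversal turns the terminal value problem into an initial value problem on
  \<open>{0..}\<close>. The rate is continued by 0 beyond \<open>tau\<close>, which preserves
  measurability, the Lipschitz bound and boundedness.\<close>

lemma adjoint_exists:
  assumes u: "u \<in> controls U" and tau: "0 \<le> tau"
  obtains p where "adjoint lam X u p tau" "p tau = v"
proof -
  define A where "A t = transpose (Dxf f (Y X u t) (u t))" for t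
  define b where "b t = lam *\<^sub>R Dxr r (Y X u t) (u t)" for t
  define F where "F s z = (if s \<le> tau then A (tau - s) *v z + b (tau - s) else 0)" for s z
  have Am: "(\<lambda>t. A t *v z t) \<in> borel_measurable (lebesgue_on {0..tau})" if z: "continuous_on {0..tau} z" for z
  proof -
    have 1: "(\<lambda>t. Dxf f (Y X u t) (u t)) \<in> borel_measurable (lebesgue_on {0..tau})"
      by (intro compose_measurable[OF Dxf_cont u] continuous_on_subset[OF traj_continuous[OF u]]) auto
    have 2: "z \<in> borel_measurable (lebesgue_on {0..tau})" by (rule continuous_imp_measurable_on_sets_lebesgue[OF z]) auto
    have "continuous_on UNIV (\<lambda>p::(real^'d^'d) \<times> (real^'d). transpose (fst p) *v snd p)"
      unfolding transpose_def matrix_vector_mult_def by (intro continuous_intros)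
    then have "(\<lambda>p::(real^'d^'d) \<times> (real^'d). transpose (fst p) *v snd p) \<in> borel_measurable borel"
      by (rule borel_measurable_continuous_onI)
    from measurable_compose[OF borel_measurable_Pair[OF 1 2] this] show ?thesis by (simp add: A_def)
  qed
  have bm: "b \<in> borel_measurable (lebesgue_on {0..tau})"
    unfolding b_def by (intro borel_measurable_scaleR borel_measurable_const compose_measurable[OF Dxr_cont u] continuous_on_subset[OF traj_continuous[OF u]]) auto
  have Fm: "(\<lambda>t. F t (y t)) \<in> borel_measurable (lebesgue_on {0..})" if y: "continuous_on {0..} y" for y
  proof -
    have "continuous_on {0..tau} (\<lambda>t. y (tau - t))"
      by (rule continuous_on_compose2[OF y]) (auto intro!: continuous_intros)
    then have "(\<lambda>t. A t *v y (tau - t) + b t) \<in> borel_measurable (lebesgue_on {0..tau})"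
      using Am bm by (intro borel_measurable_add) auto
    from measurable_lebesgue_on_affine[OF this, of "-1" "{0..} \<inter> {..tau}" tau]
    have 1: "(\<lambda>t. A (tau - t) *v y t + b (tau - t)) \<in> borel_measurable (lebesgue_on ({0..} \<inter> {..tau}))" by simp
    have "(\<lambda>t. if t \<in> {..tau} then A (tau - t) *v y t + b (tau - t) else 0) \<in> borel_measurable (lebesgue_on {0..})"
    proof (subst measurable_If_restrict_space_iff)
      show "{x \<in> space (lebesgue_on {0..}). x \<in> {..tau}} \<in> sets (lebesgue_on {0..})"
        by (auto simp: sets_restrict_space)
      show "(\<lambda>t. A (tau - t) *v y t + b (tau - t)) \<in> restrict_space (lebesgue_on {0..}) {x. x \<in> {..tau}} \<rightarrow>\<^sub>M borel \<and>
        (\<lambda>_. 0) \<in> restrict_space (lebesgue_on {0..}) {x. x \<notin> {..tau}} \<rightarrow>\<^sub>M borel"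
        using 1 by (simp add: restrict_restrict_space atMost_def[symmetric])
    qed
    then show ?thesis by (simp add: F_def)
  qed
  have lip: "norm (F t z - F t z') \<le> L * norm (z - z')" if t: "t \<ge> 0" for t z z'
  proof (cases "t \<le> tau")
    case True
    then have "F t z - F t z' = A (tau - t) *v (z - z')" by (simp add: F_def matrix_vector_mult_diff_distrib)
    then show ?thesis using Dxf_transpose_norm[OF controls_in[OF u, of "tau - t"]] True by (simp add: A_def)
  qed (use L_pos in \<open>auto simp: F_def\<close>)
  have bd: "norm (F t 0) \<le> \<bar>lam\<bar> * L" if t: "t \<ge> 0" for t
  proof (cases "t \<le> tau")
    case True
    then show ?thesis using Dxr_norm[OF controls_in[OF u, of "tau - t"]] by (simp add: F_def b_def mult_left_mono)
  qed (use L_pos in \<open>auto simp: F_def\<close>)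
  obtain P where P: "P 0 = v" "\<And>T. bounded_rate P (\<lambda>t. F t (P t)) 0 T"
    using ode_exists[of F L "\<bar>lam\<bar> * L" v, OF Fm L_pos lip bd] by blast
  have "bounded_rate (\<lambda>t. P (tau - t)) (\<lambda>t. - F (tau - t) (P (tau - t))) 0 tau" by (rule bounded_rate_reverse[OF P(2)])
  then have "bounded_rate (\<lambda>t. P (tau - t)) (\<lambda>t. - (A t *v P (tau - t)) - b t) 0 tau"
  proof -
    assume R: "bounded_rate (\<lambda>t. P (tau - t)) (\<lambda>t. - F (tau - t) (P (tau - t))) 0 tau"
    have eq: "- F (tau - t) (P (tau - t)) = - (A t *v P (tau - t)) - b t" if "t \<in> {0..tau}" for t
      using that by (simp add: F_def)
    obtain M where M: "\<And>t. t \<in> {0..tau} \<Longrightarrow> norm (- F (tau - t) (P (tau - t))) \<le> M"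
      using bounded_rate_bound[OF R] by blast
    have "(\<lambda>t. - (A t *v P (tau - t)) - b t) \<in> borel_measurable (lebesgue_on {0..tau})"
      by (rule measurable_cong[THEN iffD1, OF _ bounded_rate_measurable[OF R]]) (use eq in simp)
    moreover have "norm (- (A t *v P (tau - t)) - b t) \<le> M" if "t \<in> {0..tau}" for t
      using M[OF that] eq[OF that] by simp
    ultimately show ?thesis
      by (intro bounded_rate_cong[OF R negligible_empty, where M=M]) (use eq in auto)
  qed
  then have "adjoint lam X u (\<lambda>t. P (tau - t)) tau" unfolding adjoint_def A_def b_def .
  then show ?thesis using that[of "\<lambda>t. P (tau - t)"] P(1) by simp
qed

end

section \<open>Extremals with locally uniform constants\<close>

context exit_problem
begin

abbreviation "v X \<equiv> real_of_ereal (V X)"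

lemma V_real: "X \<in> Reach \<Longrightarrow> V X = ereal (v X)"
  using V_finite[of X] by (cases "V X") auto

lemma v_le_J: "u \<in> controls U \<Longrightarrow> first_hit X u tau \<Longrightarrow> v X \<le> J X u"
  using V_le V_real reachable_iff by (metis ereal_less_eq(3))

lemma v_continuous:
  assumes "continuous_on Reach V"
  shows "continuous_on Reach v"
proof (rule continuous_on_compose2[OF _ assms])
  show "continuous_on (UNIV - {\<infinity>, -\<infinity>}) real_of_ereal" by (rule continuous_on_real)
  show "V ` Reach \<subseteq> UNIV - {\<infinity>, -\<infinity>}" using V_finite by fastforce
qed

text \<open>The parameter interpolating between the normal of the inner ball and the superdifferential of
  \<open>g\<close> is found by the intermediate value theorem.\<close>

lemma transversality:
  assumes y: "y \<in> frontier S" and \<xi>0: "norm \<xi>0 = 1" "Hl 0 y (- \<xi>0) \<ge> 0" and q: "norm q \<le> G"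
  obtains s where "0 < s" "s \<le> 1" "Hl (1 - s) y ((1 - s) *\<^sub>R q - s *\<^sub>R \<xi>0) = 0"
proof -
  define \<phi> where "\<phi> s = Hl (1 - s) y ((1 - s) *\<^sub>R q - s *\<^sub>R \<xi>0)" for s
  have c: "continuous_on {0..1} \<phi>"
    unfolding continuous_on_def \<phi>_def by (intro ballI Hl_tendsto tendsto_intros)
  obtain w where w: "w \<in> U" "Hl 1 y q = - (q \<bullet> f y w) - 1 * r y w" using Hl_attained by metis
  have "- (q \<bullet> f y w) \<le> norm q * norm (f y w)" using Cauchy_Schwarz_ineq2[of q "f y w"] by linarith
  also have "\<dots> \<le> G * N" using q f_le[OF w(1)] G_nonneg by (intro mult_mono) auto
  finally have neg: "\<phi> 0 < 0" using w r_ge[OF w(1), of y] \<kappa>_pos by (simp add: \<phi>_def \<kappa>_def)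
  have "\<phi> 1 \<ge> 0" using \<xi>0 by (simp add: \<phi>_def)
  then obtain s where s: "0 \<le> s" "s \<le> 1" "\<phi> s = 0" using IVT'[of \<phi> 0 0 1] neg c by auto
  then have "s \<noteq> 0" using neg by auto
  with s show ?thesis by (intro that[of s]) (auto simp: \<phi>_def)
qed

text \<open>In \<open>B\<close>, the term \<open>T\<close> bounds the exit time, \<open>c\<close>
  and \<open>2 / \<rho>\<close> give the quadratic bound on \<open>g\<close> within distance
  \<open>1 / B\<close>, \<open>1 / (2 * \<rho>0)\<close> comes from the inner ball, and the
  exponential terms serve the last inequality. That inequality keeps \<open>(p 0, lam)\<close> away
  from 0, a property that survives limits, unlike the arcs themselves.\<close>

lemma extremal_exists:
  assumes u: "u \<in> controls U" and h: "first_hit X u tau" and X: "X \<notin> S"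
    and sc: "semiconcave_at g \<rho> c (Y X u tau)" and \<rho>: "\<rho> > 0" and c: "c > 0" and T: "tau \<le> T"
    and B: "B = 1 + T + c + 2 / \<rho> + 1 / (2 * \<rho>0) + exp (2 * L * T) + L * T * exp (2 * L * T) + G"
  shows "\<exists>lam q \<xi> p. extremal B lam X u tau q \<xi> p \<and> lam + norm \<xi> = 1 \<and> 1 \<le> B * (norm (p 0) + lam)"
proof -
  note ef = exit_frontier[OF u h X]
  have T0: "T \<ge> 0" using T ef(1) by simp
  have nn: "0 \<le> 2 / \<rho>" "0 \<le> 1 / (2 * \<rho>0)" "0 \<le> exp (2 * L * T)" "0 \<le> L * T * exp (2 * L * T)" "0 \<le> G"
    using \<rho> \<rho>0_pos L_pos T0 G_nonneg by auto
  have Bs: "B \<ge> 1" "B \<ge> T" "B \<ge> c" "B \<ge> 2 / \<rho>" "B \<ge> 1 / (2 * \<rho>0)" "B \<ge> exp (2 * L * T)" "B \<ge> 1 + L * T * exp (2 * L * T) + G"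
    unfolding B using nn T0 c by linarith+
  define y where "y = Y X u tau"
  obtain \<xi>0 where \<xi>0: "norm \<xi>0 = 1" "\<And>z. z \<in> closure (- S) \<Longrightarrow> \<xi>0 \<bullet> (z - y) \<le> 1 / (2 * \<rho>0) * (norm (z - y))\<^sup>2"
    using inner_ball ef(2) unfolding inner_ball_assm_def y_def by blast
  obtain q where q: "\<And>z. z \<in> ball y \<rho> \<Longrightarrow> g z \<le> g y + q \<bullet> (z - y) + c * (norm (z - y))\<^sup>2"
    using semiconcave_superdiff_exists[OF sc[folded y_def] \<rho>] by metis
  have "q \<in> superdiff g y"
    by (rule superdiffI[of "\<rho>/2" _ _ _ c]) (use q \<rho> in \<open>auto simp: dist_norm norm_minus_commute\<close>)
  then have qG: "norm q \<le> G" using superdiff_norm ef(2) y_def by blast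
  have "Hl 0 y (- \<xi>0) \<ge> 0" unfolding y_def
    by (rule exit_normal_nonneg[OF u h X, of \<xi>0 "1 / (2 * \<rho>0)"]) (use \<xi>0(2) in \<open>simp add: y_def\<close>)
  then obtain s where s: "0 < s" "s \<le> 1" "Hl (1 - s) y ((1 - s) *\<^sub>R q - s *\<^sub>R \<xi>0) = 0"
    using transversality[OF ef(2)[folded y_def] \<xi>0(1) _ qG] by blast
  define lam where "lam = 1 - s"
  define \<xi> where "\<xi> = s *\<^sub>R \<xi>0"
  have lam: "0 \<le> lam" "lam \<le> 1" using s by (auto simp: lam_def)
  have n\<xi>: "norm \<xi> = s" using s \<xi>0 by (simp add: \<xi>_def)
  obtain p where p: "adjoint lam X u p tau" "p tau = lam *\<^sub>R q - \<xi>"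
    using adjoint_exists[OF u less_imp_le[OF ef(1)]] by blast
  have ext: "extremal B lam X u tau q \<xi> p" unfolding extremal_def y_def[symmetric]
  proof (intro conjI ballI allI impI u h X lam p qG Bs(1))
    show "Hl lam y (lam *\<^sub>R q - \<xi>) = 0" using s by (simp add: lam_def \<xi>_def)
    show "\<xi> \<bullet> (z - y) \<le> B * (norm (z - y))\<^sup>2" if z: "z \<in> closure (- S)" for z
    proof -
      have "\<xi> \<bullet> (z - y) = s * (\<xi>0 \<bullet> (z - y))" by (simp add: \<xi>_def)
      also have "\<dots> \<le> s * (1 / (2 * \<rho>0) * (norm (z - y))\<^sup>2)" using \<xi>0(2)[OF z] s by (intro mult_left_mono) auto
      also have "\<dots> \<le> 1 * (1 / (2 * \<rho>0) * (norm (z - y))\<^sup>2)" using s \<rho>0_pos by (intro mult_right_mono) auto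
      also have "\<dots> \<le> B * (norm (z - y))\<^sup>2" using Bs(5) by (simp only: mult_1) (rule mult_right_mono, auto)
      finally show ?thesis .
    qed
    show "g z \<le> g y + q \<bullet> (z - y) + B * (norm (z - y))\<^sup>2" if z: "norm (z - y) \<le> 1 / B" for z
    proof -
      have "1 / B \<le> \<rho> / 2" using Bs(1,4) \<rho> by (simp add: field_simps)
      then have "z \<in> ball y \<rho>" using z \<rho> by (simp add: dist_norm norm_minus_commute)
      from q[OF this] show ?thesis using mult_right_mono[OF Bs(3), of "(norm (z - y))\<^sup>2"] by simp
    qed
    show "tau \<le> B" using T Bs by simp
    show "lam \<le> B" using lam Bs by simp
    show "norm \<xi> \<le> B" using n\<xi> s Bs by simp
  qed
  \<comment> \<open>Forward growth of the adjoint arc: the normalized terminal data cannot come from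
    an initial value and a multiplier that are both small.\<close>
  have "norm (p tau) \<le> (norm (p 0) + lam * L * tau) * exp (2 * L * tau)"
    by (rule adjoint_bound[OF p(1) u lam(1)]) (use ef(1) in auto)
  also have "\<dots> \<le> (norm (p 0) + lam * L * T) * exp (2 * L * T)"
    using T ef(1) lam L_pos by (intro mult_mono add_mono mult_left_mono) auto
  finally have 1: "norm (p tau) \<le> norm (p 0) * exp (2 * L * T) + lam * (L * T * exp (2 * L * T))"
    by (simp add: algebra_simps)
  have "norm \<xi> \<le> norm (p tau) + norm (lam *\<^sub>R q)" unfolding p(2) by (metis add.commute norm_minus_commute norm_triangle_sub)
  moreover have "norm (lam *\<^sub>R q) \<le> lam * G" using lam qG by (simp add: mult_left_mono)
  ultimately have "norm \<xi> \<le> norm (p 0) * exp (2 * L * T) + lam * (L * T * exp (2 * L * T)) + lam * G"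
    using 1 by linarith
  then have "1 \<le> norm (p 0) * exp (2 * L * T) + (lam * 1 + lam * (L * T * exp (2 * L * T)) + lam * G)"
    using n\<xi> lam_def by linarith
  then have "1 \<le> norm (p 0) * exp (2 * L * T) + lam * (1 + L * T * exp (2 * L * T) + G)"
    by (simp only: distrib_left)
  also have "\<dots> \<le> norm (p 0) * B + lam * B" using Bs lam by (intro add_mono mult_left_mono) auto
  finally have "1 \<le> B * (norm (p 0) + lam)" by (simp add: algebra_simps)
  with ext n\<xi> lam_def show ?thesis by (intro exI[of _ lam] exI[of _ q] exI[of _ \<xi>] exI[of _ p]) auto
qed

text \<open>One \<open>B\<close> serves all initial points near \<open>x\<close>: comparison with a
  fixed frontier point \<open>a\<close> bounds the exit times of nearly optimal controls by
  \<open>T\<close>, hence all exit points lie in one ball, on which the semiconcavity constants are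
  uniform.\<close>

lemma local_extremals:
  assumes Vc: "continuous_on Reach V" and x: "x \<in> interior Reach - S"
  obtains \<delta> B where "\<delta> > 0" "B \<ge> 1" "\<And>X. X \<in> ball x \<delta> \<Longrightarrow> X \<in> Reach" "\<And>X. X \<in> ball x \<delta> \<Longrightarrow> X \<notin> S"
    "\<And>X u tau. X \<in> ball x \<delta> \<Longrightarrow> u \<in> controls U \<Longrightarrow> first_hit X u tau \<Longrightarrow> J X u < v X + 1 \<Longrightarrow>
       \<exists>lam q \<xi> p. extremal B lam X u tau q \<xi> p \<and> lam + norm \<xi> = 1 \<and> 1 \<le> B * (norm (p 0) + lam)"
proof -
  have xr: "x \<in> Reach" using x interior_subset by blast
  obtain u0 tau0 where u0: "u0 \<in> controls U" "first_hit x u0 tau0" using xr reachable_iff by blast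
  define a where "a = Y x u0 tau0"
  have a: "a \<in> frontier S" using exit_frontier(2)[OF u0] x by (simp add: a_def)
  obtain d1 where d1: "d1 > 0" "ball x d1 \<subseteq> Reach" using x mem_interior by blast
  obtain d2 where d2: "d2 > 0" "ball x d2 \<subseteq> - S" using x S_closed by (metis Compl_iff DiffD2 open_Compl openE)
  obtain d3 where d3: "d3 > 0" "\<And>X. X \<in> Reach \<Longrightarrow> dist X x < d3 \<Longrightarrow> dist (v X) (v x) < 1"
    using v_continuous[OF Vc] xr unfolding continuous_on_iff by (metis zero_less_one)
  define \<delta> where "\<delta> = min (min d1 d2) (min d3 1)"
  have \<delta>: "\<delta> > 0" "\<delta> \<le> 1" using d1 d2 d3 by (auto simp: \<delta>_def)
  have reach: "X \<in> Reach" if "X \<in> ball x \<delta>" for X using that d1 by (auto simp: \<delta>_def)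
  have notS: "X \<notin> S" if "X \<in> ball x \<delta>" for X using that d2 by (auto simp: \<delta>_def)
  have vX: "v X < v x + 1" if "X \<in> ball x \<delta>" for X
    using d3(2)[OF reach[OF that]] that by (auto simp: \<delta>_def dist_commute dist_real_def)
  \<comment> \<open>By \<open>cost_lower\<close>, \<kappa> times an exit time is at most a cost
    below \<open>v x + 2\<close>, minus \<open>g a\<close>, plus \<open>G\<close> times the distance
    to \<open>a\<close>, which is at most \<open>norm (x - a) + 1\<close>.\<close>
  define T where "T = max 0 ((v x + 2 - g a + G * (norm (x - a) + 1)) / \<kappa>)"
  define R where "R = norm x + 1 + N * T"
  obtain \<rho> c where \<rho>: "\<rho> > 0" "c > 0" "\<And>y. y \<in> cball 0 R \<Longrightarrow> semiconcave_at g \<rho> c y"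
    using semiconcave_uniform[OF semiconcave compact_cball] by metis
  define B where "B = 1 + T + c + 2 / \<rho> + 1 / (2 * \<rho>0) + exp (2 * L * T) + L * T * exp (2 * L * T) + G"
  have T0: "T \<ge> 0" by (simp add: T_def)
  have nn: "0 \<le> 2 / \<rho>" "0 \<le> 1 / (2 * \<rho>0)" "0 \<le> exp (2 * L * T)" "0 \<le> L * T * exp (2 * L * T)" "0 \<le> G"
    using \<rho> \<rho>0_pos L_pos T0 G_nonneg by auto
  show ?thesis
  proof (rule that[OF \<delta>(1) _ reach notS])
    show "B \<ge> 1" unfolding B_def using nn T0 \<rho> by linarith
    fix X u tau assume X: "X \<in> ball x \<delta>" and u: "u \<in> controls U" and h: "first_hit X u tau" and J: "J X u < v X + 1"
    have Xx: "norm (X - x) \<le> 1" using X \<delta> by (simp add: dist_norm norm_minus_commute)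
    have "norm (X - a) \<le> norm (x - a) + 1" using Xx norm_triangle_ineq[of "X - x" "x - a"] by simp
    then have "G * norm (X - a) \<le> G * (norm (x - a) + 1)" using G_nonneg by (intro mult_left_mono)
    then have "\<kappa> * tau \<le> v x + 2 - g a + G * (norm (x - a) + 1)"
      using cost_lower[OF u h notS[OF X] a] J vX[OF X] by linarith
    then have tauT: "tau \<le> T" using \<kappa>_pos by (simp add: T_def field_simps le_max_iff_disj)
    have tau0: "0 \<le> tau" using h by (simp add: first_hit_def)
    have "norm (Y X u tau) \<le> R"
    proof -
      have "norm (Y X u tau - X) \<le> N * tau" by (rule traj_norm[OF u tau0])
      also have "\<dots> \<le> N * T" using tauT N_pos by simp
      finally show ?thesis using Xx norm_triangle_sub[of "Y X u tau" X] norm_triangle_sub[of X x] by (simp add: R_def)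
    qed
    then show "\<exists>lam q \<xi> p. extremal B lam X u tau q \<xi> p \<and> lam + norm \<xi> = 1 \<and> 1 \<le> B * (norm (p 0) + lam)"
      by (intro extremal_exists[OF u h notS[OF X] \<rho>(3) \<rho>(1,2) tauT B_def]) auto
  qed
qed

text \<open>For \<open>lam\<close> \<ge> 0 this expresses that \<open>(- \<pi>, lam)\<close> is a
  proximal normal to the hypograph at \<open>(X, v X)\<close>, with a visible constant and tested
  only off the target; see \<open>hypo_normals_iff\<close>. The sign of \<pi> is that of a
  gradient.\<close>

definition is_normal where
  "is_normal K X \<pi> lam \<longleftrightarrow> (\<forall>z \<beta>. z \<notin> S \<longrightarrow> ereal \<beta> \<le> V z \<longrightarrow>
     - (\<pi> \<bullet> (z - X)) + lam * (\<beta> - v X) \<le> K * ((norm (z - X))\<^sup>2 + (\<beta> - v X)\<^sup>2))"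

text \<open>Move from \<open>X\<close> in the direction w = lam \<zeta> - \<pi>. The touching
  function provides points of the hypograph along which the normal gains the squared norm of w per
  unit step, up to a small fraction, while the proximal inequality permits only second order. So w =
  0.\<close>

lemma normal_at_touching:
  assumes n: "is_normal K X \<pi> lam" and lam: "0 \<le> lam" and XS: "X \<notin> S"
    and touch: "\<And>e. e > 0 \<Longrightarrow> \<exists>d>0. \<forall>z. norm (z - X) < d \<longrightarrow> ereal (v X + \<zeta> \<bullet> (z - X) - e * norm (z - X)) \<le> V z"
  shows "\<pi> = lam *\<^sub>R \<zeta>"
proof -
  define w where "w = lam *\<^sub>R \<zeta> - \<pi>"
  have K: "\<bar>K\<bar> + 1 > 0" by simp
  show ?thesis
  proof (rule ccontr)
    assume "\<pi> \<noteq> lam *\<^sub>R \<zeta>"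
    then have w: "norm w > 0" by (simp add: w_def)
    \<comment> \<open>Then \<open>lam * e\<close> is at most a quarter of \<open>norm w\<close>,
      which leaves room for the quadratic error.\<close>
    define e where "e = norm w / (4 * (lam + 1))"
    have e: "e > 0" using w lam by (simp add: e_def)
    obtain d where d: "d > 0" "\<And>z. norm (z - X) < d \<Longrightarrow> ereal (v X + \<zeta> \<bullet> (z - X) - e * norm (z - X)) \<le> V z"
      using touch[OF e] by blast
    obtain d2 where d2: "d2 > 0" "ball X d2 \<subseteq> - S" using XS S_closed by (metis ComplI open_Compl openE)
    define M where "M = (norm w)\<^sup>2 + (\<bar>\<zeta> \<bullet> w\<bar> + e * norm w)\<^sup>2"
    \<comment> \<open>The first bound keeps the point off the target and where the touching
      inequality holds; the second makes the quadratic right side at most half of the first-order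
      gain.\<close>
    define t where "t = min (min d d2 / (2 * norm w)) ((norm w)\<^sup>2 / (2 * ((\<bar>K\<bar> + 1) * (M + 1))))"
    have M: "M \<ge> 0" by (simp add: M_def)
    have t0: "t > 0" using d d2 w M K by (auto simp: t_def)
    have "t * norm w \<le> min d d2 / (2 * norm w) * norm w" using w by (intro mult_right_mono) (auto simp: t_def)
    also have "\<dots> = min d d2 / 2" using w by simp
    finally have tw: "t * norm w < d" "t * norm w < d2" using d d2 by auto
    have "t * ((\<bar>K\<bar> + 1) * (M + 1)) \<le> (norm w)\<^sup>2 / (2 * ((\<bar>K\<bar> + 1) * (M + 1))) * ((\<bar>K\<bar> + 1) * (M + 1))"
      using M by (intro mult_right_mono) (auto simp: t_def)
    also have "\<dots> = (norm w)\<^sup>2 / 2" using M by simp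
    finally have tM: "t * ((\<bar>K\<bar> + 1) * (M + 1)) \<le> (norm w)\<^sup>2 / 2" .
    define z where "z = X + t *\<^sub>R w"
    define \<beta> where "\<beta> = v X + \<zeta> \<bullet> (z - X) - e * norm (z - X)"
    have zX: "z - X = t *\<^sub>R w" "norm (z - X) = t * norm w" using t0 by (auto simp: z_def)
    have "z \<notin> S" using d2(2) tw(2) t0 by (auto simp: z_def dist_norm subset_iff)
    moreover have "ereal \<beta> \<le> V z" unfolding \<beta>_def by (rule d(2)) (use tw zX(2) in linarith)
    ultimately have "- (\<pi> \<bullet> (z - X)) + lam * (\<beta> - v X) \<le> K * ((norm (z - X))\<^sup>2 + (\<beta> - v X)\<^sup>2)"
      using n unfolding is_normal_def by blast
    moreover have b: "\<beta> - v X = t * (\<zeta> \<bullet> w - e * norm w)" using t0 by (simp add: \<beta>_def zX algebra_simps)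
    moreover have "- (\<pi> \<bullet> (z - X)) + lam * (\<beta> - v X) = t * ((norm w)\<^sup>2 - lam * e * norm w)"
      unfolding b zX power2_norm_eq_inner by (simp add: w_def inner_diff_left inner_diff_right algebra_simps inner_commute)
    moreover have "K * ((norm (z - X))\<^sup>2 + (\<beta> - v X)\<^sup>2) \<le> t * (norm w)\<^sup>2 / 2"
    proof -
      have "(\<zeta> \<bullet> w - e * norm w)\<^sup>2 \<le> (\<bar>\<zeta> \<bullet> w\<bar> + e * norm w)\<^sup>2"
        using e w abs_triangle_ineq4[of "\<zeta> \<bullet> w" "e * norm w"]
        by (intro abs_le_square_iff[THEN iffD1]) (simp add: abs_mult)
      then have "(norm (z - X))\<^sup>2 + (\<beta> - v X)\<^sup>2 \<le> t\<^sup>2 * M"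
        unfolding b zX(2) M_def power_mult_distrib
        using mult_left_mono[of "(\<zeta> \<bullet> w - e * norm w)\<^sup>2" "(\<bar>\<zeta> \<bullet> w\<bar> + e * norm w)\<^sup>2" "t\<^sup>2"]
        by (simp only: distrib_left) simp
      moreover have "t\<^sup>2 * M \<le> t\<^sup>2 * (M + 1)" by (intro mult_left_mono) auto
      ultimately have "(norm (z - X))\<^sup>2 + (\<beta> - v X)\<^sup>2 \<le> t\<^sup>2 * (M + 1)" by linarith
      then have "K * ((norm (z - X))\<^sup>2 + (\<beta> - v X)\<^sup>2) \<le> (\<bar>K\<bar> + 1) * (t\<^sup>2 * (M + 1))"
        using M by (intro mult_mono) auto
      also have "\<dots> = t * (t * ((\<bar>K\<bar> + 1) * (M + 1)))" by (simp add: power2_eq_square)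
      also have "\<dots> \<le> t * ((norm w)\<^sup>2 / 2)" using tM t0 by (intro mult_left_mono) auto
      finally show ?thesis by simp
    qed
    ultimately have "t * ((norm w)\<^sup>2 - lam * e * norm w) \<le> t * ((norm w)\<^sup>2 / 2)" by linarith
    then have "(norm w)\<^sup>2 / 2 \<le> lam * e * norm w" using t0 by simp
    then have "norm w / 2 \<le> lam * e" using w by (simp add: power2_eq_square)
    also have "\<dots> \<le> (lam + 1) * e" using e by simp
    also have "\<dots> = norm w / 4"
    proof -
      have "lam + 1 \<noteq> 0" using lam by simp
      then show ?thesis unfolding e_def by (metis divide_divide_eq_left mult.commute nonzero_mult_div_cancel_left times_divide_eq_right)
    qed
    finally show False using w by simp
  qed
qed

end

section \<open>Normals and differentiability at points where \<open>V\<close> is touched from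
  below\<close>

context exit_problem
begin

definition near_extremal where
  "near_extremal B \<epsilon> lam X u tau q \<xi> p \<longleftrightarrow> extremal B lam X u tau q \<xi> p \<and> lam + norm \<xi> = 1 \<and>
     1 \<le> B * (norm (p 0) + lam) \<and> J X u < v X + \<epsilon>"

definition regular_ball where
  "regular_ball x \<delta> B \<longleftrightarrow> \<delta> > 0 \<and> B \<ge> 1 \<and> (\<forall>X\<in>ball x \<delta>. X \<in> Reach \<and> X \<notin> S \<and>
     (\<forall>u tau. u \<in> controls U \<longrightarrow> first_hit X u tau \<longrightarrow> J X u < v X + 1 \<longrightarrow>
       (\<exists>lam q \<xi> p. extremal B lam X u tau q \<xi> p \<and> lam + norm \<xi> = 1 \<and> 1 \<le> B * (norm (p 0) + lam))))"

lemma regular_ball_exists: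
  assumes "continuous_on Reach V" and "x \<in> interior Reach - S"
  obtains \<delta> B where "regular_ball x \<delta> B"
proof -
  obtain \<delta> B where "\<delta> > 0" "B \<ge> 1" "\<And>X. X \<in> ball x \<delta> \<Longrightarrow> X \<in> Reach" "\<And>X. X \<in> ball x \<delta> \<Longrightarrow> X \<notin> S"
    "\<And>X u tau. X \<in> ball x \<delta> \<Longrightarrow> u \<in> controls U \<Longrightarrow> first_hit X u tau \<Longrightarrow> J X u < v X + 1 \<Longrightarrow>
       \<exists>lam q \<xi> p. extremal B lam X u tau q \<xi> p \<and> lam + norm \<xi> = 1 \<and> 1 \<le> B * (norm (p 0) + lam)"
    using local_extremals[OF assms] by blast
  then have "regular_ball x \<delta> B" unfolding regular_ball_def by blast
  then show ?thesis by (rule that)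
qed

lemma near_extremal_exists:
  assumes rb: "regular_ball x \<delta> B" and X: "X \<in> ball x \<delta>" and e: "\<epsilon> > 0"
  obtains lam u tau q \<xi> p where "near_extremal B \<epsilon> lam X u tau q \<xi> p"
proof -
  have XR: "X \<in> Reach" using rb X by (auto simp: regular_ball_def)
  obtain u tau where u: "u \<in> controls U" "first_hit X u tau" "J X u < v X + min \<epsilon> 1"
    using near_optimal[OF XR, of "min \<epsilon> 1"] e by auto
  then have "J X u < v X + 1" "J X u < v X + \<epsilon>" by auto
  then show ?thesis using rb X u that unfolding regular_ball_def near_extremal_def by blast
qed

lemma bounded_subseq:
  fixes a :: "nat \<Rightarrow> 'a::heine_borel"
  assumes "bounded (range a)"
  obtains l k where "strict_mono (k :: nat \<Rightarrow> nat)" "(a \<circ> k) \<longlonglongrightarrow> l"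
proof -
  have "compact (closure (range a))" using assms by (simp add: compact_closure)
  moreover have "\<forall>n. a n \<in> closure (range a)" using closure_subset[of "range a"] by auto
  ultimately show ?thesis using that unfolding compact_def by metis
qed

text \<open>Limits of the initial values of adjoint arcs along minimizing sequences of controls are normals
  to the hypograph, with a constant that is uniform in the point.\<close>

lemma normal_exists:
  assumes rb: "regular_ball x \<delta> B" and X: "X \<in> ball x \<delta>"
  obtains \<pi> lam where "0 \<le> lam" "lam \<le> B" "is_normal (cK B) X \<pi> lam" "1 \<le> B * (norm \<pi> + lam)" "norm \<pi> \<le> cP B"
    "\<And>\<epsilon>. \<epsilon> > 0 \<Longrightarrow> \<exists>lam' u tau q \<xi> p. near_extremal B \<epsilon> lam' X u tau q \<xi> p \<and> norm (p 0 - \<pi>) < \<epsilon> \<and> \<bar>lam' - lam\<bar> < \<epsilon>"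
proof -
  have "\<exists>lam u tau q \<xi> p. near_extremal B (1 / real (Suc n)) lam X u tau q \<xi> p" for n
    using near_extremal_exists[OF rb X, of "1 / real (Suc n)"] by (metis of_nat_0_less_iff zero_less_Suc zero_less_divide_1_iff)
  then obtain a u tau q \<xi> p where d: "\<And>n. near_extremal B (1 / real (Suc n)) (a n) X (u n) (tau n) (q n) (\<xi> n) (p n)"
    by metis
  have ext: "extremal B (a n) X (u n) (tau n) (q n) (\<xi> n) (p n)" for n using d by (auto simp: near_extremal_def)
  note F = ext_facts[OF ext]
  have pb: "norm (p n 0) \<le> cP B" for n by (rule ext_p_bound[OF ext]) (use F(13) in auto)
  have ab: "0 \<le> a n" "a n \<le> B" for n using F by auto
  have "bounded (range (\<lambda>n. (p n 0, a n)))"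
    unfolding bounded_iff using pb ab
    by (intro exI[of _ "cP B + B"]) (auto intro!: order_trans[OF norm_Pair_le] add_mono)
  then obtain l k where k: "strict_mono (k :: nat \<Rightarrow> nat)" and lim: "((\<lambda>n. (p n 0, a n)) \<circ> k) \<longlonglongrightarrow> l"
    by (rule bounded_subseq)
  define \<pi> where "\<pi> = fst l"
  define lam where "lam = snd l"
  have pl: "(\<lambda>n. p (k n) 0) \<longlonglongrightarrow> \<pi>" and al: "(\<lambda>n. a (k n)) \<longlonglongrightarrow> lam"
    using tendsto_fst[OF lim] tendsto_snd[OF lim] by (auto simp: \<pi>_def lam_def o_def)
  have z: "(\<lambda>n. 1 / real (Suc (k n))) \<longlonglongrightarrow> 0"
    using LIMSEQ_subseq_LIMSEQ[OF LIMSEQ_Suc[OF lim_1_over_n] k] by (simp add: o_def)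
  have Jl: "(\<lambda>n. J X (u (k n))) \<longlonglongrightarrow> v X"
  proof (rule tendsto_sandwich[of "\<lambda>_. v X" _ _ "\<lambda>n. v X + 1 / real (Suc (k n))"])
    show "\<forall>\<^sub>F n in sequentially. v X \<le> J X (u (k n))" using v_le_J[OF F(1,2)] by auto
    show "\<forall>\<^sub>F n in sequentially. J X (u (k n)) \<le> v X + 1 / real (Suc (k n))"
      using d by (auto simp: near_extremal_def intro!: always_eventually less_imp_le)
    show "(\<lambda>n. v X + 1 / real (Suc (k n))) \<longlonglongrightarrow> v X" using tendsto_add[OF tendsto_const z, of "v X"] by simp
  qed auto
  show ?thesis
  proof (rule that[of lam \<pi>])
    show "0 \<le> lam" "lam \<le> B" using al ab by (auto intro: LIMSEQ_le_const LIMSEQ_le_const2)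
    show "norm \<pi> \<le> cP B" using tendsto_norm[OF pl] pb by (auto intro: LIMSEQ_le_const2)
    show "1 \<le> B * (norm \<pi> + lam)"
    proof (rule LIMSEQ_le_const)
      show "(\<lambda>n. B * (norm (p (k n) 0) + a (k n))) \<longlonglongrightarrow> B * (norm \<pi> + lam)" by (intro tendsto_intros pl al)
      show "\<exists>M. \<forall>n\<ge>M. 1 \<le> B * (norm (p (k n) 0) + a (k n))" using d by (auto simp: near_extremal_def)
    qed
    show "is_normal (cK B) X \<pi> lam" unfolding is_normal_def
    proof (intro allI impI)
      fix z \<beta> assume z: "z \<notin> S" "ereal \<beta> \<le> V z"
      show "- (\<pi> \<bullet> (z - X)) + lam * (\<beta> - v X) \<le> cK B * ((norm (z - X))\<^sup>2 + (\<beta> - v X)\<^sup>2)"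
      proof (rule LIMSEQ_le)
        show "(\<lambda>n. - (p (k n) 0 \<bullet> (z - X)) + a (k n) * (\<beta> - J X (u (k n)))) \<longlonglongrightarrow> - (\<pi> \<bullet> (z - X)) + lam * (\<beta> - v X)"
          by (intro tendsto_intros pl al Jl)
        show "(\<lambda>n. cK B * ((norm (z - X))\<^sup>2 + (\<beta> - J X (u (k n)))\<^sup>2)) \<longlonglongrightarrow> cK B * ((norm (z - X))\<^sup>2 + (\<beta> - v X)\<^sup>2)"
          by (intro tendsto_intros Jl)
      qed (use sensitivity[OF ext z] in auto)
    qed
    fix \<epsilon> :: real assume e: "\<epsilon> > 0"
    have "\<forall>\<^sub>F n in sequentially. norm (p (k n) 0 - \<pi>) < \<epsilon> \<and> \<bar>a (k n) - lam\<bar> < \<epsilon> \<and> 1 / real (Suc (k n)) < \<epsilon>"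
      using tendstoD[OF pl e] tendstoD[OF al e] tendstoD[OF z e]
      by eventually_elim (auto simp: dist_norm)
    then obtain n where n: "norm (p (k n) 0 - \<pi>) < \<epsilon>" "\<bar>a (k n) - lam\<bar> < \<epsilon>" "1 / real (Suc (k n)) < \<epsilon>"
      using eventually_happens' sequentially_bot by blast
    then have "near_extremal B \<epsilon> (a (k n)) X (u (k n)) (tau (k n)) (q (k n)) (\<xi> (k n)) (p (k n))"
      using d[of "k n"] by (auto simp: near_extremal_def)
    then show "\<exists>lam' u tau q \<xi> p. near_extremal B \<epsilon> lam' X u tau q \<xi> p \<and> norm (p 0 - \<pi>) < \<epsilon> \<and> \<bar>lam' - lam\<bar> < \<epsilon>"
      using n by blast
  qed
qed

definition touches where
  "touches X \<zeta> \<longleftrightarrow> (\<forall>e>0. \<exists>d>0. \<forall>z. norm (z - X) < d \<longrightarrow> ereal (v X + \<zeta> \<bullet> (z - X) - e * norm (z - X)) \<le> V z)"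

lemma gradient_touches:
  assumes "has_gradient_ereal V X P"
  shows "touches X P"
  unfolding touches_def
proof (intro allI impI)
  fix e :: real assume e: "e > 0"
  obtain d1 where d1: "d1 > 0" "\<And>z. dist z X < d1 \<Longrightarrow> \<bar>V z\<bar> \<noteq> \<infinity>"
    using assms unfolding has_gradient_ereal_def eventually_nhds_metric by blast
  have "(v has_derivative (\<lambda>h. h \<bullet> P)) (at X)" using assms unfolding has_gradient_ereal_def gderiv_def by auto
  then obtain d2 where d2: "d2 > 0" "\<And>z. norm (z - X) < d2 \<Longrightarrow> norm (v z - v X - (z - X) \<bullet> P) \<le> e * norm (z - X)"
    using e unfolding has_derivative_at_alt by blast
  have "ereal (v X + P \<bullet> (z - X) - e * norm (z - X)) \<le> V z" if z: "norm (z - X) < min d1 d2" for z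
  proof -
    have "\<bar>v z - v X - (z - X) \<bullet> P\<bar> \<le> e * norm (z - X)" using d2(2)[of z] z by simp
    then have "v X + P \<bullet> (z - X) - e * norm (z - X) \<le> v z" by (simp add: inner_commute)
    moreover have "V z = ereal (v z)" using d1(2)[of z] z by (cases "V z") (auto simp: dist_norm)
    ultimately show ?thesis by (metis ereal_less_eq(3))
  qed
  then show "\<exists>d>0. \<forall>z. norm (z - X) < d \<longrightarrow> ereal (v X + P \<bullet> (z - X) - e * norm (z - X)) \<le> V z"
    using d1(1) d2(1) by (intro exI[of _ "min d1 d2"]) auto
qed

text \<open>The normal of \<open>normal_exists\<close> must be a multiple of
  \<open>(\<zeta>, 1)\<close>. A zero multiplier would make the whole normal vanish, contrary to its
  lower bound.\<close>

lemma normal_of_touching: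
  assumes rb: "regular_ball x \<delta> B" and X: "X \<in> ball x \<delta>" and t: "touches X \<zeta>"
  obtains lam where "0 < lam" "1 \<le> B * (lam * (norm \<zeta> + 1))" "lam * norm \<zeta> \<le> cP B" "lam \<le> B" "is_normal (cK B) X (lam *\<^sub>R \<zeta>) lam"
    "\<And>\<epsilon>. \<epsilon> > 0 \<Longrightarrow> \<exists>lam' u tau q \<xi> p. near_extremal B \<epsilon> lam' X u tau q \<xi> p \<and> norm (p 0 - lam *\<^sub>R \<zeta>) < \<epsilon> \<and> \<bar>lam' - lam\<bar> < \<epsilon>"
proof -
  have XS: "X \<notin> S" using rb X by (auto simp: regular_ball_def)
  obtain \<pi> lam where n: "0 \<le> lam" "lam \<le> B" "is_normal (cK B) X \<pi> lam" "1 \<le> B * (norm \<pi> + lam)" "norm \<pi> \<le> cP B"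
    "\<And>\<epsilon>. \<epsilon> > 0 \<Longrightarrow> \<exists>lam' u tau q \<xi> p. near_extremal B \<epsilon> lam' X u tau q \<xi> p \<and> norm (p 0 - \<pi>) < \<epsilon> \<and> \<bar>lam' - lam\<bar> < \<epsilon>"
    by (rule normal_exists[OF rb X]) (rule that, assumption+)
  have e: "\<pi> = lam *\<^sub>R \<zeta>"
    by (rule normal_at_touching[OF n(3,1) XS]) (use t in \<open>auto simp: touches_def\<close>)
  have "lam \<noteq> 0" using n(4) e by auto
  then have "0 < lam" using n(1) by simp
  then show ?thesis using n e by (intro that[of lam]) (auto simp: algebra_simps)
qed

text \<open>Touching supplies the lower half of differentiability. The upper half is the normal
  inequality tested at \<open>(z, v z)\<close>, divided by \<open>lam\<close>. It contains the
  squared increment of \<open>v\<close> on the right, which is removed in two rounds: continuity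
  first gives a Lipschitz bound at \<open>X\<close>, and with it the square is of second
  order.\<close>

lemma touching_imp_gradient:
  assumes Vc: "continuous_on Reach V" and rb: "regular_ball x \<delta> B" and X: "X \<in> ball x \<delta>" and t: "touches X \<zeta>"
  shows "has_gradient_ereal V X \<zeta>"
proof -
  have sub: "ball x \<delta> \<subseteq> Reach" "ball x \<delta> \<subseteq> - S" using rb by (auto simp: regular_ball_def)
  have nh: "\<forall>\<^sub>F z in nhds X. z \<in> ball x \<delta>" using X by (intro eventually_nhds_in_open) auto
  obtain lam where lam: "0 < lam" "is_normal (cK B) X (lam *\<^sub>R \<zeta>) lam" using normal_of_touching[OF rb X t] by metis
  have B: "B \<ge> 1" using rb by (simp add: regular_ball_def)
  define k where "k = cK B / lam"
  have k: "k \<ge> 0" using lam cK_nonneg[OF B] by (simp add: k_def)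
  have up: "v z - v X \<le> \<zeta> \<bullet> (z - X) + k * ((norm (z - X))\<^sup>2 + (v z - v X)\<^sup>2)" if z: "z \<in> ball x \<delta>" for z
  proof -
    have "ereal (v z) \<le> V z" using V_real sub z by (metis order_refl subsetD)
    then have "- (lam *\<^sub>R \<zeta> \<bullet> (z - X)) + lam * (v z - v X) \<le> cK B * ((norm (z - X))\<^sup>2 + (v z - v X)\<^sup>2)"
      using lam(2) z sub unfolding is_normal_def by blast
    then have "lam * (- (\<zeta> \<bullet> (z - X)) + (v z - v X)) \<le> lam * (k * ((norm (z - X))\<^sup>2 + (v z - v X)\<^sup>2))"
      using lam(1) by (simp add: k_def algebra_simps)
    then have "- (\<zeta> \<bullet> (z - X)) + (v z - v X) \<le> k * ((norm (z - X))\<^sup>2 + (v z - v X)\<^sup>2)"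
      using lam(1) by (rule mult_left_le_imp_le)
    then show ?thesis by simp
  qed
  have vc: "isCont v X"
    using continuous_on_subset[OF v_continuous[OF Vc] sub(1)] X continuous_on_eq_continuous_at open_ball by blast
  have "(v has_derivative (\<lambda>h. h \<bullet> \<zeta>)) (at X)"
    unfolding has_derivative_at_alt
  proof (intro conjI allI impI bounded_linear_inner_left)
    fix e :: real assume e: "e > 0"
    define e1 where "e1 = min e 1"
    have e1: "e1 > 0" "e1 \<le> e" using e by (auto simp: e1_def)
    obtain d1 where d1: "d1 > 0" "\<And>z. norm (z - X) < d1 \<Longrightarrow> ereal (v X + \<zeta> \<bullet> (z - X) - e1 * norm (z - X)) \<le> V z"
      using t e1(1) unfolding touches_def by blast
    obtain d2 where d2: "d2 > 0" "ball X d2 \<subseteq> ball x \<delta>" using X open_ball openE by blast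
    obtain d3 where d3: "d3 > 0" "\<And>z. dist z X < d3 \<Longrightarrow> dist (v z) (v X) < 1 / (2 * (k + 1))"
      using vc k unfolding continuous_at_eps_delta by (metis add_nonneg_pos divide_pos_pos mult_pos_pos zero_less_numeral zero_less_one)
    \<comment> \<open>A Lipschitz constant of \<open>v\<close> at \<open>X\<close>: it exceeds the
      constants from the upper estimate after absorption and from the lower estimate with slope
      \<open>norm \<zeta> + 1\<close>.\<close>
    define C where "C = 2 * (norm \<zeta> + k + 1) + norm \<zeta> + 1"
    have C: "C \<ge> 1" using k by (simp add: C_def)
    define d where "d = min (min d1 d2) (min (min d3 1) (e / ((k + 1) * (1 + C\<^sup>2))))"
    have kC: "(k + 1) * (1 + C\<^sup>2) > 0" using k by (simp add: add_pos_nonneg)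
    have d: "d > 0" using d1 d2 d3 e kC by (simp add: d_def)
    show "\<exists>d>0. \<forall>z. norm (z - X) < d \<longrightarrow> norm (v z - v X - (z - X) \<bullet> \<zeta>) \<le> e * norm (z - X)"
    proof (intro exI[of _ d] conjI d allI impI)
      fix z assume z: "norm (z - X) < d"
      define h where "h = norm (z - X)"
      define a where "a = v z - v X"
      have h: "0 \<le> h" "h \<le> 1" "h * ((k + 1) * (1 + C\<^sup>2)) \<le> e" using z kC by (auto simp: h_def d_def pos_less_divide_eq intro: less_imp_le)
      have zb: "z \<in> ball x \<delta>" using z d2(2) by (auto simp: d_def dist_norm norm_minus_commute subset_iff)
      have Vz: "V z = ereal (v z)" using V_real zb sub by blast
      have "ereal (v X + \<zeta> \<bullet> (z - X) - e1 * norm (z - X)) \<le> V z" by (rule d1(2)) (use z in \<open>simp add: d_def\<close>)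
      then have "v X + \<zeta> \<bullet> (z - X) - e1 * norm (z - X) \<le> v z" using Vz by (metis ereal_less_eq(3))
      then have lo: "\<zeta> \<bullet> (z - X) - e1 * h \<le> a" by (simp add: a_def h_def)
      have zz: "\<bar>\<zeta> \<bullet> (z - X)\<bar> \<le> norm \<zeta> * h" unfolding h_def by (rule Cauchy_Schwarz_ineq2)
      have small: "\<bar>a\<bar> \<le> 1 / (2 * (k + 1))" using d3(2)[of z] z by (simp add: a_def d_def dist_norm)
      \<comment> \<open>By continuity the increment is so small that the quadratic term is at most
        half of the increment and can be moved to the left side.\<close>
      have ka: "k * a\<^sup>2 \<le> \<bar>a\<bar> / 2"
      proof -
        have "(k + 1) * \<bar>a\<bar> \<le> (k + 1) * (1 / (2 * (k + 1)))" using small k by (intro mult_left_mono) auto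
        also have "\<dots> = 1 / 2" using k by (simp add: field_simps)
        finally have "k * \<bar>a\<bar> \<le> 1 / 2" by (simp add: algebra_simps)
        then have "k * \<bar>a\<bar> * \<bar>a\<bar> \<le> 1 / 2 * \<bar>a\<bar>" by (intro mult_right_mono) auto
        then show ?thesis by (simp add: power2_eq_square mult.assoc)
      qed
      have upz: "a \<le> \<zeta> \<bullet> (z - X) + k * (h\<^sup>2 + a\<^sup>2)" using up[OF zb] by (simp add: a_def h_def)
      have hh: "h\<^sup>2 \<le> h" using h by (simp add: power2_eq_square mult_left_le)
      then have kh: "k * h\<^sup>2 \<le> k * h" using k by (intro mult_left_mono)
      have aC: "\<bar>a\<bar> \<le> C * h"
      proof (cases "a \<ge> 0")
        case True
        then have "a / 2 \<le> norm \<zeta> * h + k * h" using upz ka kh zz by (simp add: distrib_left)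
        then have "a \<le> 2 * (norm \<zeta> + k) * h" by (simp add: algebra_simps)
        also have "\<dots> \<le> C * h" using h by (intro mult_right_mono) (auto simp: C_def)
        finally show ?thesis using True by simp
      next
        case False
        have "e1 * h \<le> 1 * h" using h by (intro mult_right_mono) (auto simp: e1_def)
        then have "- a \<le> (norm \<zeta> + 1) * h" using lo zz by (simp add: algebra_simps)
        also have "\<dots> \<le> C * h" using h k by (intro mult_right_mono) (auto simp: C_def)
        finally show ?thesis using False by simp
      qed
      have "a\<^sup>2 \<le> (C * h)\<^sup>2" using aC by (metis abs_ge_zero power2_abs power_mono)
      then have "k * (h\<^sup>2 + a\<^sup>2) \<le> (k + 1) * (h\<^sup>2 + (C * h)\<^sup>2)" using k by (intro mult_mono) auto
      also have "\<dots> = h * ((k + 1) * (1 + C\<^sup>2)) * h" by (simp add: power2_eq_square algebra_simps)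
      also have "\<dots> \<le> e * h" using h by (intro mult_right_mono) auto
      finally have "a - \<zeta> \<bullet> (z - X) \<le> e * h" using upz by linarith
      moreover have "- (e * h) \<le> a - \<zeta> \<bullet> (z - X)" using lo mult_right_mono[OF e1(2) h(1)] by linarith
      ultimately have "\<bar>a - \<zeta> \<bullet> (z - X)\<bar> \<le> e * h" by linarith
      then show "norm (v z - v X - (z - X) \<bullet> \<zeta>) \<le> e * norm (z - X)"
        unfolding a_def h_def real_norm_def inner_commute[of "z - X" \<zeta>] .
    qed
  qed
  moreover have "\<forall>\<^sub>F z in nhds X. \<bar>V z\<bar> \<noteq> \<infinity>"
  proof (rule eventually_mono[OF nh])
    fix z assume "z \<in> ball x \<delta>"
    then have "z \<in> Reach" using sub(1) by (rule subsetD[rotated])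
    then show "\<bar>V z\<bar> \<noteq> \<infinity>" by (rule V_finite)
  qed
  ultimately show ?thesis unfolding has_gradient_ereal_def gderiv_def by blast
qed

text \<open>Normalizing by \<open>norm P + 1\<close> gives a constant that does not depend on the
  size of the gradient: the lower bound for \<open>lam * (norm P + 1)\<close> costs one factor
  \<open>B\<close>. This is what allows gradients to diverge along a sequence.\<close>

lemma gradient_is_normal:
  assumes rb: "regular_ball x \<delta> B" and X: "X \<in> ball x \<delta>" and t: "touches X P"
  shows "is_normal (cK B * B) X (P /\<^sub>R (norm P + 1)) (1 / (norm P + 1))"
  unfolding is_normal_def
proof (intro allI impI)
  fix z \<beta> assume z: "z \<notin> S" "ereal \<beta> \<le> V z"
  have B: "B \<ge> 1" using rb by (simp add: regular_ball_def)
  obtain lam where lam: "0 < lam" "1 \<le> B * (lam * (norm P + 1))" "is_normal (cK B) X (lam *\<^sub>R P) lam"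
    using normal_of_touching[OF rb X t] by metis
  define s where "s = norm P + 1"
  have s: "s > 0" by (simp add: s_def add_nonneg_pos)
  define Q where "Q = (norm (z - X))\<^sup>2 + (\<beta> - v X)\<^sup>2"
  have Q: "Q \<ge> 0" by (simp add: Q_def)
  define A where "A = - ((P /\<^sub>R s) \<bullet> (z - X)) + 1 / s * (\<beta> - v X)"
  have "- (lam *\<^sub>R P \<bullet> (z - X)) + lam * (\<beta> - v X) \<le> cK B * Q" using lam(3) z unfolding is_normal_def Q_def by blast
  also have "- (lam *\<^sub>R P \<bullet> (z - X)) + lam * (\<beta> - v X) = (lam * s) * A"
  proof -
    have "(P /\<^sub>R s) \<bullet> (z - X) = (P \<bullet> (z - X)) / s" unfolding inner_scaleR_left divide_inverse by (rule mult.commute)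
    then have "s * A = - (P \<bullet> (z - X)) + (\<beta> - v X)" unfolding A_def using s by (simp only: distrib_left) simp
    then have "lam * (s * A) = lam * (- (P \<bullet> (z - X)) + (\<beta> - v X))" by simp
    then show ?thesis by (simp only: distrib_left inner_scaleR_left mult.assoc mult_minus_right)
  qed
  finally have "(lam * s) * A \<le> cK B * Q" .
  then have "B * ((lam * s) * A) \<le> B * (cK B * Q)" using B by (intro mult_left_mono) auto
  then have 1: "(B * (lam * s)) * A \<le> cK B * B * Q" by (simp add: algebra_simps)
  have "A \<le> cK B * B * Q"
  proof (cases "A \<ge> 0")
    case True
    then have "1 * A \<le> (B * (lam * s)) * A" using lam(2) by (intro mult_right_mono) (auto simp: s_def)
    then show ?thesis using 1 by simp
  next
    case False
    moreover have "0 \<le> cK B * B * Q" using cK_nonneg[OF B] B Q by simp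
    ultimately show ?thesis by simp
  qed
  then show "- ((P /\<^sub>R (norm P + 1)) \<bullet> (z - X)) + 1 / (norm P + 1) * (\<beta> - v X) \<le> cK B * B * ((norm (z - X))\<^sup>2 + (\<beta> - v X)\<^sup>2)"
    by (simp add: A_def s_def Q_def)
qed

end

lemma bounded_rate_scaleR:
  assumes y: "bounded_rate y \<alpha> a b"
  shows "bounded_rate (\<lambda>t. c *\<^sub>R y t) (\<lambda>t. c *\<^sub>R \<alpha> t) a b"
proof -
  obtain M where M: "\<And>t. t \<in> {a..b} \<Longrightarrow> norm (\<alpha> t) \<le> M" using bounded_rate_bound[OF y] by blast
  show ?thesis unfolding bounded_rate_def
  proof (intro conjI exI[of _ "\<bar>c\<bar> * M"] ballI)
    show "(\<lambda>t. c *\<^sub>R \<alpha> t) \<in> borel_measurable (lebesgue_on {a..b})"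
      by (intro borel_measurable_scaleR borel_measurable_const bounded_rate_measurable[OF y])
    show "norm (c *\<^sub>R \<alpha> t) \<le> \<bar>c\<bar> * M" if "t \<in> {a..b}" for t using M[OF that] by (simp add: mult_left_mono)
    show "c *\<^sub>R y t = c *\<^sub>R y a + integral {a..t} (\<lambda>t. c *\<^sub>R \<alpha> t)" if t: "t \<in> {a..b}" for t
      using bounded_rate_eq[OF y t] by (simp add: scaleR_right_distrib)
  qed
qed

lemma proximal_normals_scale:
  assumes "a \<in> proximal_normals Q y" "c \<ge> 0"
  shows "c *\<^sub>R a \<in> proximal_normals Q y"
proof -
  obtain s where s: "y \<in> Q" "s \<ge> 0" "\<And>z. z \<in> Q \<Longrightarrow> a \<bullet> (z - y) \<le> s * (norm (z - y))\<^sup>2"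
    using assms unfolding proximal_normals_def by blast
  have "(c *\<^sub>R a) \<bullet> (z - y) \<le> (c * s) * (norm (z - y))\<^sup>2" if "z \<in> Q" for z
    using mult_left_mono[OF s(3)[OF that] assms(2)] by (simp add: mult.assoc)
  then show ?thesis using s(1,2) assms(2) unfolding proximal_normals_def by (auto intro!: exI[of _ "c * s"])
qed

section \<open>Transported normals with a multiplier\<close>

context exit_problem
begin

lemma Ham_eq_Hl: "Ham f r U x p = Hl 1 x p" and Ham0_eq_Hl: "Ham0 f U x p = Hl 0 x p"
  and SUP_eq_Hl: "(SUP w\<in>U. \<xi> \<bullet> f x w) = Hl 0 x (- \<xi>)"
  by (simp_all add: Ham_def Ham0_def Hl_def)

lemma Hl_scale:
  assumes c: "c > 0" shows "Hl (c * lam) x (c *\<^sub>R p) = c * Hl lam x p"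
proof -
  obtain w where w: "w \<in> U" "Hl lam x p = - (p \<bullet> f x w) - lam * r x w" using Hl_attained by metis
  obtain w' where w': "w' \<in> U" "Hl (c * lam) x (c *\<^sub>R p) = - (c *\<^sub>R p \<bullet> f x w') - c * lam * r x w'" using Hl_attained by metis
  have "Hl (c * lam) x (c *\<^sub>R p) = c * (- (p \<bullet> f x w') - lam * r x w')" using w'(2) by (simp add: algebra_simps)
  also have "\<dots> \<le> c * Hl lam x p" using Hl_ge[OF w'(1)] c by (intro mult_left_mono) auto
  finally have 1: "Hl (c * lam) x (c *\<^sub>R p) \<le> c * Hl lam x p" .
  have "c * Hl lam x p = - (c *\<^sub>R p \<bullet> f x w) - c * lam * r x w" unfolding w(2) by (simp add: algebra_simps)
  also have "\<dots> \<le> Hl (c * lam) x (c *\<^sub>R p)" by (rule Hl_ge[OF w(1)])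
  finally show ?thesis using 1 by simp
qed

text \<open>A common form of both families of transported normals, stable under positive scaling of
  \<open>(lam, \<pi>)\<close>. The multiplier 1 gives \<open>transported_normals1\<close>, and
  nonzero \<pi> with multiplier 0 give \<open>transported_normals0\<close>.\<close>

definition transported where
  "transported lam X \<pi> \<longleftrightarrow> (\<exists>u tau q \<xi> p. u \<in> controls U \<and> first_hit X u tau \<and> J X u = v X \<and>
     \<xi> \<in> proximal_normals (closure (- S)) (Y X u tau) \<and> q \<in> superdiff g (Y X u tau) \<and>
     Hl lam (Y X u tau) (lam *\<^sub>R q - \<xi>) = 0 \<and> adjoint lam X u p tau \<and> p tau = lam *\<^sub>R q - \<xi> \<and> p 0 = \<pi>)"

lemma adjoint_scale:
  assumes "adjoint lam X u p tau" shows "adjoint (c * lam) X u (\<lambda>t. c *\<^sub>R p t) tau"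
proof -
  have eq: "c *\<^sub>R (- (A *v w) - lam *\<^sub>R b) = - (A *v (c *\<^sub>R w)) - (c * lam) *\<^sub>R b" for A :: "real^'d^'d" and w b
    by (simp add: scaleR_right_diff_distrib matrix_vector_mult_scaleR)
  show ?thesis using bounded_rate_scaleR[OF assms[unfolded adjoint_def], of c] unfolding adjoint_def eq .
qed

lemma transported_scale:
  assumes t: "transported lam X \<pi>" and c: "c > 0"
  shows "transported (c * lam) X (c *\<^sub>R \<pi>)"
proof -
  obtain u tau q \<xi> p where h: "u \<in> controls U" "first_hit X u tau" "J X u = v X"
     "\<xi> \<in> proximal_normals (closure (- S)) (Y X u tau)" "q \<in> superdiff g (Y X u tau)"
     "Hl lam (Y X u tau) (lam *\<^sub>R q - \<xi>) = 0" "adjoint lam X u p tau" "p tau = lam *\<^sub>R q - \<xi>" "p 0 = \<pi>"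
    using t unfolding transported_def by blast
  have e: "(c * lam) *\<^sub>R q - c *\<^sub>R \<xi> = c *\<^sub>R (lam *\<^sub>R q - \<xi>)" by (simp add: scaleR_right_diff_distrib)
  show ?thesis unfolding transported_def
    using h proximal_normals_scale[OF h(4) less_imp_le[OF c]] adjoint_scale[OF h(7), of c] Hl_scale[OF c, of lam "Y X u tau" "lam *\<^sub>R q - \<xi>"]
    by (intro exI[of _ u] exI[of _ tau] exI[of _ q] exI[of _ "c *\<^sub>R \<xi>"] exI[of _ "\<lambda>t. c *\<^sub>R p t"]) (simp add: e)
qed

text \<open>For a single optimal arc the bound \<open>B\<close> may depend on the arc, so an
  arbitrary proximal normal and an arbitrary supergradient at the exit point still yield an
  \<open>extremal\<close>, and \<open>sensitivity\<close> applies with the exact value of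
  \<open>V\<close>.\<close>

lemma transported_is_normal:
  assumes t: "transported lam X \<pi>" and X: "X \<notin> S" and lam: "0 \<le> lam"
  obtains K where "is_normal K X \<pi> lam"
proof -
  obtain u tau q \<xi> p where h: "u \<in> controls U" "first_hit X u tau" "J X u = v X"
     "\<xi> \<in> proximal_normals (closure (- S)) (Y X u tau)" "q \<in> superdiff g (Y X u tau)"
     "Hl lam (Y X u tau) (lam *\<^sub>R q - \<xi>) = 0" "adjoint lam X u p tau" "p tau = lam *\<^sub>R q - \<xi>" "p 0 = \<pi>"
    using t unfolding transported_def by blast
  note ef = exit_frontier[OF h(1,2) X]
  obtain \<sigma> where \<sigma>: "\<sigma> \<ge> 0" "\<And>z. z \<in> closure (- S) \<Longrightarrow> \<xi> \<bullet> (z - Y X u tau) \<le> \<sigma> * (norm (z - Y X u tau))\<^sup>2"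
    using h(4) by (auto simp: proximal_normals_def)
  obtain \<rho> c where \<rho>: "\<rho> > 0" "c > 0" "semiconcave_at g \<rho> c (Y X u tau)"
    using semiconcave unfolding locally_semiconcave_def semiconcave_at_def by blast
  define B where "B = 1 + tau + lam + norm \<xi> + \<sigma> + c + 2 / \<rho>"
  have nn: "0 \<le> 2 / \<rho>" using \<rho> by simp
  have Bs: "1 \<le> B" "tau \<le> B" "lam \<le> B" "norm \<xi> \<le> B" "\<sigma> \<le> B" "c \<le> B" "2 / \<rho> \<le> B"
    unfolding B_def using ef(1) lam \<sigma>(1) \<rho>(2) nn norm_ge_zero[of \<xi>] by linarith+
  have "extremal B lam X u tau q \<xi> p" unfolding extremal_def
  proof (intro conjI ballI allI impI h X lam Bs)
    show "norm q \<le> G" by (rule superdiff_norm[OF ef(2) h(5)])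
    show "\<xi> \<bullet> (z - Y X u tau) \<le> B * (norm (z - Y X u tau))\<^sup>2" if "z \<in> closure (- S)" for z
      by (rule order_trans[OF \<sigma>(2)[OF that]]) (use Bs in \<open>auto intro: mult_right_mono\<close>)
    show "g z \<le> g (Y X u tau) + q \<bullet> (z - Y X u tau) + B * (norm (z - Y X u tau))\<^sup>2" if z: "norm (z - Y X u tau) \<le> 1 / B" for z
    proof -
      have "1 / B \<le> \<rho> / 2" using Bs(1,7) \<rho> by (simp add: field_simps)
      then have "z \<in> ball (Y X u tau) \<rho>" using z \<rho> by (simp add: dist_norm norm_minus_commute)
      from semiconcave_superdiff[OF \<rho>(3) h(5) this] show ?thesis
        using mult_right_mono[OF Bs(6), of "(norm (z - Y X u tau))\<^sup>2"] by simp
    qed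
  qed
  then have "is_normal (cK B) X \<pi> lam"
    unfolding is_normal_def using sensitivity h(3,9) by metis
  then show ?thesis by (rule that)
qed

lemma adjoint_measurable:
  assumes u: "u \<in> controls U" and p: "continuous_on {0..tau} p"
  shows "(\<lambda>t. adj_rate lam (Y X u t) (u t) (p t)) \<in> borel_measurable (lebesgue_on {0..tau})"
proof -
  have 1: "(\<lambda>t. Dxf f (Y X u t) (u t)) \<in> borel_measurable (lebesgue_on {0..tau})"
    by (intro compose_measurable[OF Dxf_cont u] continuous_on_subset[OF traj_continuous[OF u]]) auto
  have 2: "p \<in> borel_measurable (lebesgue_on {0..tau})" by (rule continuous_imp_measurable_on_sets_lebesgue[OF p]) auto
  have "continuous_on UNIV (\<lambda>p::(real^'d^'d) \<times> (real^'d). transpose (fst p) *v snd p)"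
    unfolding transpose_def matrix_vector_mult_def by (intro continuous_intros)
  then have "(\<lambda>p::(real^'d^'d) \<times> (real^'d). transpose (fst p) *v snd p) \<in> borel_measurable borel"
    by (rule borel_measurable_continuous_onI)
  from measurable_compose[OF borel_measurable_Pair[OF 1 2] this]
  have 3: "(\<lambda>t. transpose (Dxf f (Y X u t) (u t)) *v p t) \<in> borel_measurable (lebesgue_on {0..tau})" by simp
  have 4: "(\<lambda>t. Dxr r (Y X u t) (u t)) \<in> borel_measurable (lebesgue_on {0..tau})"
    by (intro compose_measurable[OF Dxr_cont u] continuous_on_subset[OF traj_continuous[OF u]]) auto
  show ?thesis by (intro borel_measurable_diff borel_measurable_uminus borel_measurable_scaleR borel_measurable_const 3 4)
qed

lemma adjoint_iff_caratheodory:
  assumes u: "u \<in> controls U" and lam: "0 \<le> lam"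
  shows "adjoint lam X u p tau \<longleftrightarrow>
    caratheodory_solution {0..tau} (\<lambda>t z. adj_rate lam (Y X u t) (u t) z) p"
proof
  assume "adjoint lam X u p tau"
  then show "caratheodory_solution {0..tau} (\<lambda>t z. adj_rate lam (Y X u t) (u t) z) p"
    unfolding adjoint_def
    by (rule bounded_rate_imp_caratheodory[where F="\<lambda>t z. adj_rate lam (Y X u t) (u t) z"])
next
  assume c: "caratheodory_solution {0..tau} (\<lambda>t z. adj_rate lam (Y X u t) (u t) z) p"
  have p: "continuous_on {0..tau} p" by (rule caratheodory_continuous_on[OF c order_refl])
  obtain P where P: "\<forall>t\<in>{0..tau}. norm (p t) \<le> P"
    using compact_imp_bounded[OF compact_continuous_image[OF p]] unfolding bounded_iff by auto
  show "adjoint lam X u p tau" unfolding adjoint_def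
  proof (rule caratheodory_imp_bounded_rate[where F="\<lambda>t z. adj_rate lam (Y X u t) (u t) z", OF c order_refl])
    show "norm (adj_rate lam (Y X u t) (u t) (p t)) \<le> L * P + lam * L" if "t \<in> {0..tau}" for t
      by (rule order_trans[OF adjoint_rate_bound[OF u _ lam]]) (use that P L_pos in auto)
  qed (use adjoint_measurable[OF u p] in auto)
qed

lemma optimal_iff:
  assumes X: "X \<in> Reach"
  shows "u \<in> optimal_controls f r g U S X \<longleftrightarrow> u \<in> controls U \<and> (\<exists>tau. first_hit X u tau) \<and> J X u = v X"
proof -
  have "ereal (J X u) = V X \<longleftrightarrow> J X u = v X" using V_finite[OF X] by (cases "V X") auto
  then show ?thesis by (auto simp: optimal_controls_def admissible_iff)
qed

lemma transported_normals1_iff: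
  assumes X: "X \<in> Reach" "X \<notin> S"
  shows "\<pi> \<in> transported_normals1 f r g U S X \<longleftrightarrow> transported 1 X \<pi>"
proof
  assume "\<pi> \<in> transported_normals1 f r g U S X"
  then obtain p u \<xi> q where h: "u \<in> optimal_controls f r g U S X" "\<xi> \<in> normals1 f U S (exit_point f S X u)"
        "q \<in> superdiff g (exit_point f S X u)" "Ham f r U (exit_point f S X u) (q - \<xi>) = 0"
        "caratheodory_solution {0..exit_time f S X u}
          (\<lambda>t z. - (transpose (Dxf f (Y X u t) (u t)) *v z) - Dxr r (Y X u t) (u t)) p"
        "p (exit_time f S X u) = q - \<xi>" "p 0 = \<pi>"
    unfolding transported_normals1_def by blast
  obtain tau where u: "u \<in> controls U" "first_hit X u tau" "J X u = v X" using h(1) optimal_iff[OF X(1)] by blast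
  note e = first_hit_hit_time[OF u(2)]
  have "adjoint 1 X u p tau" using h(5) adjoint_iff_caratheodory[OF u(1) zero_le_one, of X p tau] unfolding e scaleR_one by blast
  moreover have "\<xi> \<in> proximal_normals (closure (- S)) (Y X u tau)" using h(2) by (simp add: e normals1_def)
  moreover have "q \<in> superdiff g (Y X u tau)" using h(3) by (simp only: e)
  moreover have "Hl 1 (Y X u tau) (1 *\<^sub>R q - \<xi>) = 0" using h(4) by (simp add: e Ham_eq_Hl)
  moreover have "p tau = 1 *\<^sub>R q - \<xi>" using h(6) by (simp add: e)
  ultimately show "transported 1 X \<pi>" unfolding transported_def using u h(7) by blast
next
  assume "transported 1 X \<pi>"
  then obtain u tau q \<xi> p where h: "u \<in> controls U" "first_hit X u tau" "J X u = v X"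
     "\<xi> \<in> proximal_normals (closure (- S)) (Y X u tau)" "q \<in> superdiff g (Y X u tau)"
     "Hl 1 (Y X u tau) (q - \<xi>) = 0" "adjoint 1 X u p tau" "p tau = q - \<xi>" "p 0 = \<pi>"
    unfolding transported_def by auto
  note e = first_hit_hit_time[OF h(2)]
  \<comment> \<open>The strict inequality in \<open>normals1\<close> is automatic: at a maximizer
    the terminal condition makes the product of \<xi> with the velocity at least
    \<open>r0 - G * N\<close>, which is \<kappa>.\<close>
  obtain w where w: "w \<in> U" "0 = - ((q - \<xi>) \<bullet> f (Y X u tau) w) - 1 * r (Y X u tau) w"
    using Hl_attained[of 1 "Y X u tau" "q - \<xi>"] h(6) by metis
  have "norm q \<le> G" by (rule superdiff_norm[OF exit_frontier(2)[OF h(1,2) X(2)] h(5)])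
  then have "norm q * norm (f (Y X u tau) w) \<le> G * N" using f_le[OF w(1)] G_nonneg by (intro mult_mono) auto
  then have "- (q \<bullet> f (Y X u tau) w) \<le> G * N" using Cauchy_Schwarz_ineq2[of q "f (Y X u tau) w"] by linarith
  then have "\<xi> \<bullet> f (Y X u tau) w \<ge> \<kappa>" using w r_ge[OF w(1), of "Y X u tau"] by (simp add: \<kappa>_def inner_diff_left)
  then have "Hl 0 (Y X u tau) (- \<xi>) > 0" using Hl_ge[OF w(1), of "- \<xi>" "Y X u tau" 0] \<kappa>_pos by simp
  then have "\<xi> \<in> normals1 f U S (Y X u tau)" using h(4) by (simp add: normals1_def SUP_eq_Hl)
  moreover have "u \<in> optimal_controls f r g U S X" using h optimal_iff[OF X(1)] by blast
  moreover have "caratheodory_solution {0..tau} (\<lambda>t z. - (transpose (Dxf f (Y X u t) (u t)) *v z) - Dxr r (Y X u t) (u t)) p"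
    using h(7) adjoint_iff_caratheodory[OF h(1) zero_le_one, of X p tau] unfolding scaleR_one by blast
  ultimately show "\<pi> \<in> transported_normals1 f r g U S X"
    unfolding transported_normals1_def using h
    by (intro CollectI exI[of _ p] exI[of _ u] exI[of _ \<xi>] exI[of _ q]) (simp add: e Ham_eq_Hl)
qed

lemma superdiff_nonempty: obtains q where "q \<in> superdiff g y"
proof -
  obtain \<rho> c where \<rho>: "\<rho> > 0" "c > 0" "semiconcave_at g \<rho> c y"
    using semiconcave unfolding locally_semiconcave_def semiconcave_at_def by blast
  obtain q where q: "\<And>z. z \<in> ball y \<rho> \<Longrightarrow> g z \<le> g y + q \<bullet> (z - y) + c * (norm (z - y))\<^sup>2"
    using semiconcave_superdiff_exists[OF \<rho>(3,1)] by metis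
  have "q \<in> superdiff g y"
    by (rule superdiffI[of "\<rho>/2" _ _ _ c]) (use q \<rho> in \<open>auto simp: dist_norm norm_minus_commute\<close>)
  then show ?thesis by (rule that)
qed

text \<open>With multiplier 0 the adjoint equation is linear and homogeneous, so its initial value
  vanishes exactly if its terminal value does. The \<open>q\<close> in \<open>transported\<close> is
  provided by \<open>superdiff_nonempty\<close>.\<close>

lemma transported_normals0_iff:
  assumes X: "X \<in> Reach" "X \<notin> S"
  shows "\<pi> \<in> transported_normals0 f r g U S X \<longleftrightarrow> \<pi> \<noteq> 0 \<and> transported 0 X \<pi>"
proof
  assume "\<pi> \<in> transported_normals0 f r g U S X"
  then obtain p u \<xi> where h: "u \<in> optimal_controls f r g U S X" "\<xi> \<in> normals0 f U S (exit_point f S X u)"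
        "caratheodory_solution {0..exit_time f S X u} (\<lambda>t z. - (transpose (Dxf f (Y X u t) (u t)) *v z)) p"
        "p (exit_time f S X u) = - \<xi>" "p 0 = \<pi>"
    unfolding transported_normals0_def by blast
  obtain tau where u: "u \<in> controls U" "first_hit X u tau" "J X u = v X" using h(1) optimal_iff[OF X(1)] by blast
  note e = first_hit_hit_time[OF u(2)]
  have a: "adjoint 0 X u p tau" using h(3) adjoint_iff_caratheodory[OF u(1) order_refl, of X p tau] unfolding e scaleR_zero_left diff_0_right by blast
  have tau: "tau > 0" by (rule exit_frontier(1)[OF u(1,2) X(2)])
  have "\<xi> \<noteq> 0" using h(2) by (simp add: normals0_def)
  then have "\<pi> \<noteq> 0" using adjoint_bound[OF a u(1) order_refl, of 0 tau] h(4,5) tau e by auto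
  moreover obtain q where "q \<in> superdiff g (Y X u tau)" by (rule superdiff_nonempty)
  ultimately show "\<pi> \<noteq> 0 \<and> transported 0 X \<pi>" unfolding transported_def
    using u h a by (intro conjI exI[of _ u] exI[of _ tau] exI[of _ q] exI[of _ \<xi>] exI[of _ p]) (auto simp: e normals0_def SUP_eq_Hl)
next
  assume "\<pi> \<noteq> 0 \<and> transported 0 X \<pi>"
  then obtain u tau q \<xi> p where h: "u \<in> controls U" "first_hit X u tau" "J X u = v X"
     "\<xi> \<in> proximal_normals (closure (- S)) (Y X u tau)" "q \<in> superdiff g (Y X u tau)"
     "Hl 0 (Y X u tau) (- \<xi>) = 0" "adjoint 0 X u p tau" "p tau = - \<xi>" "p 0 = \<pi>" and \<pi>: "\<pi> \<noteq> 0"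
    unfolding transported_def by auto
  note e = first_hit_hit_time[OF h(2)]
  have tau: "tau > 0" by (rule exit_frontier(1)[OF h(1,2) X(2)])
  have "\<xi> \<noteq> 0" using adjoint_bound[OF h(7,1) order_refl, of tau 0] h(8,9) \<pi> tau by auto
  then have "\<xi> \<in> normals0 f U S (Y X u tau)" using h(4,6) by (simp add: normals0_def SUP_eq_Hl)
  moreover have "u \<in> optimal_controls f r g U S X" using h optimal_iff[OF X(1)] by blast
  moreover have "caratheodory_solution {0..tau} (\<lambda>t z. - (transpose (Dxf f (Y X u t) (u t)) *v z)) p"
    using h(7) adjoint_iff_caratheodory[OF h(1) order_refl, of X p tau] unfolding scaleR_zero_left diff_0_right by blast
  ultimately show "\<pi> \<in> transported_normals0 f r g U S X"
    unfolding transported_normals0_def using h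
    by (intro CollectI exI[of _ p] exI[of _ u] exI[of _ \<xi>]) (simp add: e)
qed

text \<open>The hypograph contains the vertical half line below its boundary point, which forces
  \<open>lam\<close> \<ge> 0. Points over the target, absent from \<open>is_normal\<close>, have a
  positive distance from \<open>x\<close>, so linear terms are dominated by quadratic ones
  there.\<close>

lemma hypo_normals_iff:
  assumes x: "x \<in> Reach" "x \<notin> S"
  shows "(\<pi>, lam) \<in> hypo_normals S V x \<longleftrightarrow> 0 \<le> lam \<and> (\<exists>K. is_normal K x (- \<pi>) lam)"
proof -
  have Vx: "V x = ereal (v x)" by (rule V_real[OF x(1)])
  have in_cl: "x \<in> closure (- S)" using x closure_subset[of "- S"] by auto
  have n2: "(norm (a, b))\<^sup>2 = (norm a)\<^sup>2 + b\<^sup>2" for a :: "real^'d" and b :: real by (simp add: norm_Pair)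
  have xin: "(x, v x) \<in> hypograph S V" using in_cl Vx unfolding hypograph_def by (metis (mono_tags, lifting) case_prodI mem_Collect_eq order_refl)
  show ?thesis
  proof
    assume "(\<pi>, lam) \<in> hypo_normals S V x"
    then obtain \<sigma> where \<sigma>: "\<sigma> \<ge> 0" "\<forall>y\<in>hypograph S V. (\<pi>, lam) \<bullet> (y - (x, v x)) \<le> \<sigma> * (norm (y - (x, v x)))\<^sup>2"
      unfolding hypo_normals_def proximal_normals_def by blast
    have i: "\<pi> \<bullet> (z - x) + lam * (\<beta> - v x) \<le> \<sigma> * ((norm (z - x))\<^sup>2 + (\<beta> - v x)\<^sup>2)" if "z \<in> closure (- S)" "ereal \<beta> \<le> V z" for z \<beta>
    proof -
      have "(z, \<beta>) \<in> hypograph S V" using that by (simp add: hypograph_def)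
      then have "(\<pi>, lam) \<bullet> ((z, \<beta>) - (x, v x)) \<le> \<sigma> * (norm ((z, \<beta>) - (x, v x)))\<^sup>2" using \<sigma>(2) by blast
      then show ?thesis by (simp only: diff_Pair inner_Pair n2) simp
    qed
    have "0 \<le> lam"
    proof (rule ccontr)
      assume "\<not> 0 \<le> lam"
      then have l: "lam < 0" by simp
      \<comment> \<open>A vertical step down, so short that the quadratic right side stays below
        half of \<open>- lam * t\<close>.\<close>
      define t where "t = - lam / (2 * (\<sigma> + 1))"
      have t: "t > 0" unfolding t_def by (rule divide_pos_pos) (use l \<sigma>(1) in auto)
      have "ereal (v x - t) \<le> ereal (v x)" using t by simp
      then have "ereal (v x - t) \<le> V x" using Vx by metis
      from i[OF in_cl this] have "- lam * t \<le> \<sigma> * t\<^sup>2" by simp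
      then have "t * (- lam) \<le> t * (\<sigma> * t)" by (simp add: power2_eq_square algebra_simps)
      then have "- lam \<le> \<sigma> * t" using t by (rule mult_left_le_imp_le)
      also have "\<dots> \<le> (\<sigma> + 1) * t" using t by simp
      also have "\<dots> = - lam / 2"
      proof -
        have "\<sigma> + 1 \<noteq> 0" using \<sigma>(1) by simp
        then show ?thesis unfolding t_def by (metis divide_divide_eq_left mult.commute nonzero_mult_div_cancel_left times_divide_eq_right)
      qed
      finally show False using l by simp
    qed
    moreover have "is_normal \<sigma> x (- \<pi>) lam" unfolding is_normal_def
    proof (intro allI impI)
      fix z \<beta> assume z: "z \<notin> S" "ereal \<beta> \<le> V z"
      then have "z \<in> closure (- S)" using closure_subset[of "- S"] by auto
      from i[OF this z(2)] show "- (- \<pi> \<bullet> (z - x)) + lam * (\<beta> - v x) \<le> \<sigma> * ((norm (z - x))\<^sup>2 + (\<beta> - v x)\<^sup>2)" by simp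
    qed
    ultimately show "0 \<le> lam \<and> (\<exists>K. is_normal K x (- \<pi>) lam)" by blast
  next
    assume "0 \<le> lam \<and> (\<exists>K. is_normal K x (- \<pi>) lam)"
    then obtain K where lam: "0 \<le> lam" and K: "is_normal K x (- \<pi>) lam" by blast
    obtain d where d: "d > 0" "ball x d \<subseteq> - S" using x(2) S_closed by (metis ComplI open_Compl openE)
    \<comment> \<open>The first summand serves points off the target; the others convert the linear
      terms at points of the target, whose distance from \<open>x\<close> is at least
      \<open>d\<close>.\<close>
    define \<sigma> where "\<sigma> = \<bar>K\<bar> + norm \<pi> / d + lam / d\<^sup>2 + lam"
    have nn: "0 \<le> norm \<pi> / d" "0 \<le> lam / d\<^sup>2" using d lam by auto
    have \<sigma>0: "\<sigma> \<ge> 0" unfolding \<sigma>_def using nn lam by linarith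
    have "\<pi> \<bullet> (z - x) + lam * (\<beta> - v x) \<le> \<sigma> * ((norm (z - x))\<^sup>2 + (\<beta> - v x)\<^sup>2)" if z: "ereal \<beta> \<le> V z" for z \<beta>
    proof (cases "z \<in> S")
      case False
      have "\<pi> \<bullet> (z - x) + lam * (\<beta> - v x) \<le> K * ((norm (z - x))\<^sup>2 + (\<beta> - v x)\<^sup>2)"
        using K False z unfolding is_normal_def by fastforce
      also have "\<dots> \<le> \<sigma> * ((norm (z - x))\<^sup>2 + (\<beta> - v x)\<^sup>2)"
      proof (rule mult_right_mono)
        show "K \<le> \<sigma>" unfolding \<sigma>_def using nn lam by linarith
      qed simp
      finally show ?thesis .
    next
      case True
      define h where "h = norm (z - x)"
      define e where "e = \<beta> - v x"
      have "z \<notin> ball x d" using True d(2) by auto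
      then have h: "d \<le> h" by (simp add: h_def dist_norm norm_minus_commute)
      have h2: "h \<le> h\<^sup>2 / d"
        using mult_right_mono[OF h, of h] d h by (simp add: power2_eq_square field_simps)
      have "\<pi> \<bullet> (z - x) \<le> norm \<pi> * h" unfolding h_def by (rule norm_cauchy_schwarz)
      also have "\<dots> \<le> norm \<pi> * (h\<^sup>2 / d)" using h2 by (intro mult_left_mono) auto
      finally have 1: "\<pi> \<bullet> (z - x) \<le> norm \<pi> / d * h\<^sup>2" by simp
      have "2 * e \<le> e\<^sup>2 + 1" using zero_le_power2[of "e - 1"] by (simp add: power2_diff)
      then have e: "e \<le> 1 + e\<^sup>2" using zero_le_power2[of e] by linarith
      have "d\<^sup>2 \<le> h\<^sup>2" using h d by (intro power_mono) auto
      then have "1 \<le> h\<^sup>2 / d\<^sup>2" using d by simp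
      then have "lam * e \<le> lam * (h\<^sup>2 / d\<^sup>2 + e\<^sup>2)" using e lam by (intro mult_left_mono) auto
      then have 2: "lam * e \<le> lam / d\<^sup>2 * h\<^sup>2 + lam * e\<^sup>2" by (simp add: distrib_left)
      have 3: "norm \<pi> / d * h\<^sup>2 + lam / d\<^sup>2 * h\<^sup>2 \<le> \<sigma> * h\<^sup>2"
        using mult_right_mono[of "norm \<pi> / d + lam / d\<^sup>2" \<sigma> "h\<^sup>2"] lam by (simp add: \<sigma>_def distrib_right)
      have 4: "lam * e\<^sup>2 \<le> \<sigma> * e\<^sup>2"
        by (rule mult_right_mono) (use nn in \<open>auto simp: \<sigma>_def\<close>)
      have "\<pi> \<bullet> (z - x) + lam * e \<le> \<sigma> * h\<^sup>2 + \<sigma> * e\<^sup>2" using 1 2 3 4 by linarith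
      then show ?thesis by (simp add: h_def e_def distrib_left)
    qed
    then show "(\<pi>, lam) \<in> hypo_normals S V x"
      unfolding hypo_normals_def proximal_normals_def
      using xin \<sigma>0 by (auto simp: hypograph_def n2 intro!: exI[of _ \<sigma>])
  qed
qed

end

section \<open>Limits of extremals\<close>

lemma eq_if_inner_eq:
  fixes a b :: "'a::real_inner"
  assumes "\<And>h. h \<bullet> a = h \<bullet> b"
  shows "a = b"
proof -
  have "(a - b) \<bullet> (a - b) = 0" using assms[of "a - b"] by (simp add: inner_diff_right)
  then show ?thesis by simp
qed

lemma tendsto_subseq:
  assumes "strict_mono (k :: nat \<Rightarrow> nat)" "h \<longlonglongrightarrow> l"
  shows "(\<lambda>n. h (k n)) \<longlonglongrightarrow> l"
  using LIMSEQ_subseq_LIMSEQ[OF assms(2,1)] by (simp add: o_def)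

text \<open>The zero set of a Caratheodory function with compact values has a measurable selection: fix the
  coordinates one after the other, each time at its minimum over the remaining zeros.\<close>

lemma measurable_zero_coordinate:
  fixes h :: "'t \<Rightarrow> 'b::euclidean_space \<Rightarrow> real"
  assumes U: "compact U"
    and hm: "\<And>w. w \<in> U \<Longrightarrow> (\<lambda>t. h t w) \<in> borel_measurable M"
    and hc: "\<And>t. t \<in> space M \<Longrightarrow> continuous_on U (h t)"
    and h0: "\<And>t w. t \<in> space M \<Longrightarrow> w \<in> U \<Longrightarrow> 0 \<le> h t w"
    and ex: "\<And>t. t \<in> space M \<Longrightarrow> \<exists>w\<in>U. h t w = 0"
  obtains b where "b \<in> borel_measurable M" "\<And>t. t \<in> space M \<Longrightarrow> \<exists>w\<in>U. h t w = 0 \<and> w \<bullet> e = b t"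
proof -
  define Z where "Z t = {w \<in> U. h t w = 0}" for t
  have Zc: "compact (Z t)" "Z t \<noteq> {}" if t: "t \<in> space M" for t
  proof -
    have "closed (Z t)" unfolding Z_def
      using continuous_closed_preimage[OF hc[OF t] compact_imp_closed[OF U], of "{0}"] by (simp add: vimage_def Int_def)
    moreover have "bounded (Z t)" by (rule bounded_subset[OF compact_imp_bounded[OF U]]) (auto simp: Z_def)
    ultimately show "compact (Z t)" by (simp add: compact_eq_bounded_closed)
    show "Z t \<noteq> {}" using ex[OF t] by (auto simp: Z_def)
  qed
  have "\<exists>w\<in>Z t. \<forall>w'\<in>Z t. w \<bullet> e \<le> w' \<bullet> e" if t: "t \<in> space M" for t
    by (rule continuous_attains_inf[OF Zc[OF t]]) (intro continuous_intros)
  then obtain m where m: "\<And>t. t \<in> space M \<Longrightarrow> m t \<in> Z t" "\<And>t w. t \<in> space M \<Longrightarrow> w \<in> Z t \<Longrightarrow> m t \<bullet> e \<le> w \<bullet> e"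
    by metis
  define b where "b t = m t \<bullet> e" for t
  have "b \<in> borel_measurable M"
    unfolding borel_measurable_iff_le
  proof
    fix c :: real
    define Uc where "Uc = U \<inter> {w. w \<bullet> e \<le> c}"
    have Ucc: "compact Uc" unfolding Uc_def
      by (intro compact_Int_closed U closed_Collect_le continuous_intros)
    obtain D where D: "countable D" "D \<subseteq> Uc" "Uc \<subseteq> closure D" using separable by blast
    \<comment> \<open>Density of \<open>D\<close> and continuity give approximate zeros in
      \<open>D\<close>; compactness of \<open>Uc\<close> turns approximate zeros into a zero, at
      which the coordinate is still at most \<open>c\<close>.\<close>
    have eq: "{t \<in> space M. b t \<le> c} = (\<Inter>k::nat. \<Union>d\<in>D. {t \<in> space M. h t d < 1 / real (Suc k)})"
    proof (intro equalityI subsetI)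
      fix t assume "t \<in> {t \<in> space M. b t \<le> c}"
      then have t: "t \<in> space M" and b: "b t \<le> c" by auto
      have mu: "m t \<in> Uc" "h t (m t) = 0" using m(1)[OF t] b by (auto simp: Z_def Uc_def b_def)
      have "\<exists>d\<in>D. h t d < 1 / real (Suc k)" for k
      proof -
        have "continuous_on Uc (h t)" by (rule continuous_on_subset[OF hc[OF t]]) (auto simp: Uc_def)
        then obtain \<delta> where \<delta>: "\<delta> > 0" "\<And>w. w \<in> Uc \<Longrightarrow> dist w (m t) < \<delta> \<Longrightarrow> dist (h t w) (h t (m t)) < 1 / real (Suc k)"
          using mu(1) unfolding continuous_on_iff by (metis of_nat_0_less_iff zero_less_Suc zero_less_divide_1_iff)
        obtain d where "d \<in> D" "dist d (m t) < \<delta>" using D(3) mu(1) \<delta>(1) closure_approachable by blast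
        then show ?thesis using \<delta>(2)[of d] D(2) mu(2) by (intro bexI[of _ d]) (auto simp: dist_real_def)
      qed
      then show "t \<in> (\<Inter>k. \<Union>d\<in>D. {t \<in> space M. h t d < 1 / real (Suc k)})" using t by auto
    next
      fix t assume "t \<in> (\<Inter>k. \<Union>d\<in>D. {t \<in> space M. h t d < 1 / real (Suc k)})"
      then have "\<forall>k. \<exists>d. d \<in> D \<and> t \<in> space M \<and> h t d < 1 / real (Suc k)" by auto
      then obtain d where d: "\<And>k. d k \<in> D" "t \<in> space M" "\<And>k. h t (d k) < 1 / real (Suc k)" by metis
      then obtain w j where w: "w \<in> Uc" "strict_mono (j :: nat \<Rightarrow> nat)" "(d \<circ> j) \<longlonglongrightarrow> w"
        using Ucc D(2) unfolding compact_def by (metis subsetD)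
      have "(\<lambda>n. h t (d (j n))) \<longlonglongrightarrow> h t w"
      proof (rule continuous_on_tendsto_compose[OF hc[OF d(2)]])
        show "(\<lambda>n. d (j n)) \<longlonglongrightarrow> w" using w(3) by (simp add: o_def)
        show "w \<in> U" using w(1) by (simp add: Uc_def)
        have "d k \<in> U" for k using d(1)[of k] D(2) by (auto simp: Uc_def)
        then show "\<forall>\<^sub>F n in sequentially. d (j n) \<in> U" by simp
      qed
      moreover have "(\<lambda>n. h t (d (j n))) \<longlonglongrightarrow> 0"
      proof (rule tendsto_sandwich[of "\<lambda>_. 0" _ _ "\<lambda>n. 1 / real (Suc (j n))"])
        show "\<forall>\<^sub>F n in sequentially. 0 \<le> h t (d (j n))"
        proof (intro always_eventually allI h0[OF d(2)])
          fix n show "d (j n) \<in> U" using d(1)[of "j n"] D(2) by (auto simp: Uc_def)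
        qed
        show "\<forall>\<^sub>F n in sequentially. h t (d (j n)) \<le> 1 / real (Suc (j n))" by (intro always_eventually allI less_imp_le d(3))
        show "(\<lambda>n. 1 / real (Suc (j n))) \<longlonglongrightarrow> 0"
          using LIMSEQ_subseq_LIMSEQ[OF LIMSEQ_Suc[OF lim_1_over_n] w(2)] by (simp add: o_def)
      qed auto
      ultimately have "h t w = 0" by (rule LIMSEQ_unique)
      then have "w \<in> Z t" using w(1) by (auto simp: Z_def Uc_def)
      then have "b t \<le> w \<bullet> e" using m(2)[OF d(2)] by (simp add: b_def)
      then show "t \<in> {t \<in> space M. b t \<le> c}" using w(1) d(2) by (auto simp: Uc_def)
    qed
    have "{t \<in> space M. h t d < 1 / real (Suc k)} \<in> sets M" if "d \<in> D" for d k
      using hm[of d] that D(2) unfolding borel_measurable_iff_less by (auto simp: Uc_def)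
    then have "(\<Union>d\<in>D. {t \<in> space M. h t d < 1 / real (Suc k)}) \<in> sets M" for k
      by (intro sets.countable_UN' D(1)) auto
    then show "{t \<in> space M. b t \<le> c} \<in> sets M"
      unfolding eq by (intro sets.countable_INT) auto
  qed
  moreover have "\<exists>w\<in>U. h t w = 0 \<and> w \<bullet> e = b t" if "t \<in> space M" for t
    using m(1)[OF that] by (auto simp: Z_def b_def)
  ultimately show ?thesis by (rule that)
qed

lemma measurable_zero_selection:
  fixes h :: "'t \<Rightarrow> 'b::euclidean_space \<Rightarrow> real"
  assumes U: "compact U"
    and hm: "\<And>w. w \<in> U \<Longrightarrow> (\<lambda>t. h t w) \<in> borel_measurable M"
    and hc: "\<And>t. t \<in> space M \<Longrightarrow> continuous_on U (h t)"
    and h0: "\<And>t w. t \<in> space M \<Longrightarrow> w \<in> U \<Longrightarrow> 0 \<le> h t w"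
    and ex: "\<And>t. t \<in> space M \<Longrightarrow> \<exists>w\<in>U. h t w = 0"
  obtains s where "s \<in> borel_measurable M" "\<And>t. t \<in> space M \<Longrightarrow> s t \<in> U \<and> h t (s t) = 0"
proof -
  have "\<exists>a. (\<forall>e\<in>A. a e \<in> borel_measurable M) \<and> (\<forall>t\<in>space M. \<exists>w\<in>U. h t w = 0 \<and> (\<forall>e\<in>A. w \<bullet> e = a e t))"
    if "finite A" for A :: "'b set"
    using that
  proof (induction A)
    case empty
    then show ?case using ex by auto
  next
    case (insert e A)
    then obtain a where a: "\<forall>e\<in>A. a e \<in> borel_measurable M" "\<forall>t\<in>space M. \<exists>w\<in>U. h t w = 0 \<and> (\<forall>e\<in>A. w \<bullet> e = a e t)" by blast
    \<comment> \<open>The zeros of \<open>h'\<close> are those zeros of \<open>h\<close> whose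
      coordinates in \<open>A\<close> already have the selected values.\<close>
    define h' where "h' t w = h t w + (\<Sum>e\<in>A. \<bar>w \<bullet> e - a e t\<bar>)" for t w
    have h'0: "h' t w = 0 \<longleftrightarrow> h t w = 0 \<and> (\<forall>e\<in>A. w \<bullet> e = a e t)" if "t \<in> space M" "w \<in> U" for t w
    proof -
      have "h' t w = 0 \<longleftrightarrow> h t w = 0 \<and> (\<Sum>e\<in>A. \<bar>w \<bullet> e - a e t\<bar>) = 0"
        unfolding h'_def by (rule add_nonneg_eq_0_iff[OF h0[OF that] sum_nonneg]) simp
      then show ?thesis using insert.hyps(1) by (simp add: sum_nonneg_eq_0_iff)
    qed
    obtain b where b: "b \<in> borel_measurable M" "\<And>t. t \<in> space M \<Longrightarrow> \<exists>w\<in>U. h' t w = 0 \<and> w \<bullet> e = b t"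
    proof (rule measurable_zero_coordinate[OF U, of h' M e])
      show "(\<lambda>t. h' t w) \<in> borel_measurable M" if "w \<in> U" for w
        unfolding h'_def using a(1) hm[OF that]
        by (intro borel_measurable_add borel_measurable_sum borel_measurable_abs borel_measurable_diff) auto
      show "continuous_on U (h' t)" if "t \<in> space M" for t
        unfolding h'_def by (intro continuous_intros hc that)
      show "0 \<le> h' t w" if "t \<in> space M" "w \<in> U" for t w
        unfolding h'_def by (intro add_nonneg_nonneg sum_nonneg h0 that) auto
      show "\<exists>w\<in>U. h' t w = 0" if "t \<in> space M" for t using a(2) h'0[OF that] that by blast
    qed (rule that)
    define a' where "a' = a(e := b)"
    have "\<forall>e'\<in>insert e A. a' e' \<in> borel_measurable M" using a(1) b(1) by (auto simp: a'_def)
    moreover have "\<forall>t\<in>space M. \<exists>w\<in>U. h t w = 0 \<and> (\<forall>e'\<in>insert e A. w \<bullet> e' = a' e' t)"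
    proof
      fix t assume t: "t \<in> space M"
      obtain w where w: "w \<in> U" "h' t w = 0" "w \<bullet> e = b t" using b(2)[OF t] by blast
      then show "\<exists>w\<in>U. h t w = 0 \<and> (\<forall>e'\<in>insert e A. w \<bullet> e' = a' e' t)"
        using h'0[OF t w(1)] by (intro bexI[of _ w]) (auto simp: a'_def)
    qed
    ultimately show ?case by blast
  qed
  from this[OF finite_Basis] obtain a where a: "\<forall>e\<in>Basis. a e \<in> borel_measurable M"
     "\<forall>t\<in>space M. \<exists>w\<in>U. h t w = 0 \<and> (\<forall>e\<in>Basis. w \<bullet> e = a e t)" by blast
  define s where "s t = (\<Sum>e\<in>Basis. a e t *\<^sub>R e)" for t
  have "s \<in> borel_measurable M" unfolding s_def
    using a(1) by (intro borel_measurable_sum borel_measurable_scaleR) auto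
  moreover have "s t \<in> U \<and> h t (s t) = 0" if t: "t \<in> space M" for t
  proof -
    obtain w where w: "w \<in> U" "h t w = 0" "\<forall>e\<in>Basis. w \<bullet> e = a e t" using a(2) t by blast
    have "s t = (\<Sum>e\<in>Basis. (w \<bullet> e) *\<^sub>R e)" unfolding s_def using w(3) by (intro sum.cong) auto
    then have "s t = w" by (simp add: euclidean_representation)
    then show ?thesis using w by simp
  qed
  ultimately show ?thesis by (rule that)
qed

text \<open>A subsequence argument for values that depend on a sequence in a compact set: it
  suffices to know the limit along those subsequences for which that sequence converges.\<close>

lemma tendsto_of_cluster_values:
  fixes u :: "nat \<Rightarrow> 'b::metric_space" and \<Phi> :: "nat \<Rightarrow> 'c::metric_space"
  assumes U: "compact U" and u: "\<And>n. u n \<in> U"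
    and cl: "\<And>j w. strict_mono (j :: nat \<Rightarrow> nat) \<Longrightarrow> w \<in> U \<Longrightarrow> (\<lambda>n. u (j n)) \<longlonglongrightarrow> w \<Longrightarrow> (\<lambda>n. \<Phi> (j n)) \<longlonglongrightarrow> l"
  shows "\<Phi> \<longlonglongrightarrow> l"
proof (rule ccontr)
  assume "\<not> \<Phi> \<longlonglongrightarrow> l"
  then obtain e where e: "e > 0" "\<not> (\<forall>\<^sub>F n in sequentially. dist (\<Phi> n) l < e)" unfolding tendsto_iff by blast
  then have "\<exists>\<^sub>F n in sequentially. \<not> dist (\<Phi> n) l < e" by (simp add: frequently_def)
  then have "infinite {n. \<not> dist (\<Phi> n) l < e}" by (simp add: frequently_cofinite[symmetric] cofinite_eq_sequentially)
  then obtain i where i: "strict_mono (i :: nat \<Rightarrow> nat)" "\<And>n. \<not> dist (\<Phi> (i n)) l < e"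
    using infinite_enumerate by blast
  have "\<forall>n. (u \<circ> i) n \<in> U" using u by simp
  then obtain w j where w: "w \<in> U" "strict_mono (j :: nat \<Rightarrow> nat)" "((u \<circ> i) \<circ> j) \<longlonglongrightarrow> w"
    using U unfolding compact_def by metis
  have "(\<lambda>n. \<Phi> ((i \<circ> j) n)) \<longlonglongrightarrow> l"
    by (rule cl[OF strict_mono_o[OF i(1) w(2)] w(1)]) (use w(3) in \<open>simp add: o_def\<close>)
  from tendstoD[OF this e(1)] obtain n where "dist (\<Phi> (i (j n))) l < e"
    unfolding eventually_sequentially by auto
  with i(2) show False by blast
qed

section \<open>The envelope theorem and tails of extremals\<close>

context exit_problem
begin

lemma f_tendsto: assumes "y \<longlonglongrightarrow> z" "u \<longlonglongrightarrow> w" "\<And>n. u n \<in> U" "w \<in> U"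
  shows "(\<lambda>n. f (y n) (u n)) \<longlonglongrightarrow> f z w"
  using continuous_on_tendsto_compose[OF f_cont tendsto_Pair[OF assms(1,2)]] assms(3,4) by simp

lemma r_tendsto: assumes "y \<longlonglongrightarrow> z" "u \<longlonglongrightarrow> w" "\<And>n. u n \<in> U" "w \<in> U"
  shows "(\<lambda>n. r (y n) (u n)) \<longlonglongrightarrow> r z w"
  using continuous_on_tendsto_compose[OF r_cont tendsto_Pair[OF assms(1,2)]] assms(3,4) by simp

lemma adjoint_rate_tendsto:
  assumes "y \<longlonglongrightarrow> z" "u \<longlonglongrightarrow> w" "\<And>n. u n \<in> U" "w \<in> U" "p \<longlonglongrightarrow> P" "a \<longlonglongrightarrow> lam"
  shows "(\<lambda>n. - (transpose (Dxf f (y n) (u n)) *v p n) - a n *\<^sub>R Dxr r (y n) (u n)) \<longlonglongrightarrow> adj_rate lam z w P"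
proof -
  have A: "(\<lambda>n. Dxf f (y n) (u n)) \<longlonglongrightarrow> Dxf f z w"
    using continuous_on_tendsto_compose[OF Dxf_cont tendsto_Pair[OF assms(1,2)]] assms(3,4) by simp
  have D: "(\<lambda>n. Dxr r (y n) (u n)) \<longlonglongrightarrow> Dxr r z w"
    using continuous_on_tendsto_compose[OF Dxr_cont tendsto_Pair[OF assms(1,2)]] assms(3,4) by simp
  have "continuous_on UNIV (\<lambda>p::(real^'d^'d) \<times> (real^'d). transpose (fst p) *v snd p)"
    unfolding transpose_def matrix_vector_mult_def by (intro continuous_intros)
  from continuous_on_tendsto_compose[OF this tendsto_Pair[OF A assms(5)]]
  have "(\<lambda>n. transpose (Dxf f (y n) (u n)) *v p n) \<longlonglongrightarrow> transpose (Dxf f z w) *v P" by simp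
  then show ?thesis by (intro tendsto_intros assms D)
qed

text \<open>Envelope theorem: a maximizer determines the gradient of the Hamiltonian.\<close>

lemma envelope:
  assumes d: "(\<lambda>(z, p). Hl lam z p) differentiable (at (x, p))" and w: "w \<in> U"
    and m: "- (p \<bullet> f x w) - lam * r x w = Hl lam x p"
    and w': "w' \<in> U" and m': "- (p \<bullet> f x w') - lam * r x w' = Hl lam x p"
  shows "f x w = f x w'"
    "transpose (Dxf f x w) *v p + lam *\<^sub>R Dxr r x w = transpose (Dxf f x w') *v p + lam *\<^sub>R Dxr r x w'"
proof -
  obtain D where D: "((\<lambda>(z, p). Hl lam z p) has_derivative D) (at (x, p))" using d differentiable_def by blast
  have key: "D h = - (snd h \<bullet> f x w) - fst h \<bullet> (transpose (Dxf f x w) *v p + lam *\<^sub>R Dxr r x w)"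
    if w: "w \<in> U" and m: "- (p \<bullet> f x w) - lam * r x w = Hl lam x p" for w h
  proof -
    have fd: "((\<lambda>a. f (fst a) w) has_derivative (\<lambda>h. Dxf f x w *v fst h)) (at (x, p))"
      using has_derivative_compose[OF has_derivative_fst[OF has_derivative_ident] f_has_derivative[OF w, of "fst (x, p)"]] by simp
    have rd: "((\<lambda>a. r (fst a) w) has_derivative (\<lambda>h. fst h \<bullet> Dxr r x w)) (at (x, p))"
      using has_derivative_compose[OF has_derivative_fst[OF has_derivative_ident] r_GDERIV[OF w, of "fst (x, p)", unfolded gderiv_def]] by simp
    have "((\<lambda>a. snd a \<bullet> f (fst a) w) has_derivative (\<lambda>h. snd (x, p) \<bullet> (Dxf f x w *v fst h) + snd h \<bullet> f (fst (x, p)) w)) (at (x, p))"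
      by (intro has_derivative_inner fd has_derivative_snd has_derivative_ident)
    then have pd: "((\<lambda>a. snd a \<bullet> f (fst a) w) has_derivative (\<lambda>h. p \<bullet> (Dxf f x w *v fst h) + snd h \<bullet> f x w)) (at (x, p))" by simp
    \<comment> \<open>The Hamiltonian minus the expression for the fixed value \<open>w\<close> is
      nonnegative and vanishes at the given point, so its derivative is zero there.\<close>
    have "((\<lambda>a. (\<lambda>(z, p). Hl lam z p) a + snd a \<bullet> f (fst a) w + lam * r (fst a) w) has_derivative
       (\<lambda>h. D h + (p \<bullet> (Dxf f x w *v fst h) + snd h \<bullet> f x w) + lam * (fst h \<bullet> Dxr r x w))) (at (x, p))"
      by (intro has_derivative_add D pd has_derivative_mult_right rd)
    then have "(\<lambda>h. D h + (p \<bullet> (Dxf f x w *v fst h) + snd h \<bullet> f x w) + lam * (fst h \<bullet> Dxr r x w)) = (\<lambda>h. 0)"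
    proof (rule differential_zero_maxmin[of "(x, p)" UNIV, rotated 2])
      have "0 \<le> Hl lam z q + q \<bullet> f z w + lam * r z w" for z q
        using Hl_ge[OF w, of q z lam] by linarith
      then show "(\<forall>y\<in>UNIV. (\<lambda>(z, p). Hl lam z p) y + snd y \<bullet> f (fst y) w + lam * r (fst y) w
             \<le> (\<lambda>(z, p). Hl lam z p) (x, p) + snd (x, p) \<bullet> f (fst (x, p)) w + lam * r (fst (x, p)) w) \<or>
         (\<forall>y\<in>UNIV. (\<lambda>(z, p). Hl lam z p) (x, p) + snd (x, p) \<bullet> f (fst (x, p)) w + lam * r (fst (x, p)) w
             \<le> (\<lambda>(z, p). Hl lam z p) y + snd y \<bullet> f (fst y) w + lam * r (fst y) w)"
        using m[symmetric] by (auto simp: split_beta)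
    qed auto
    from fun_cong[OF this, of h]
    have "D h + (p \<bullet> (Dxf f x w *v fst h) + snd h \<bullet> f x w) + lam * (fst h \<bullet> Dxr r x w) = 0" .
    moreover have "p \<bullet> (Dxf f x w *v fst h) = fst h \<bullet> (transpose (Dxf f x w) *v p)"
      by (metis dot_lmul_matrix inner_commute transpose_matrix_vector)
    ultimately show ?thesis by (simp add: inner_add_right)
  qed
  have 1: "snd h \<bullet> f x w + fst h \<bullet> (transpose (Dxf f x w) *v p + lam *\<^sub>R Dxr r x w) =
    snd h \<bullet> f x w' + fst h \<bullet> (transpose (Dxf f x w') *v p + lam *\<^sub>R Dxr r x w')" for h
    using key[OF w m, of h] key[OF w' m', of h] by linarith
  have "h \<bullet> f x w = h \<bullet> f x w'" for h using 1[of "(0, h)"] by simp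
  then show "f x w = f x w'" by (rule eq_if_inner_eq)
  have "h \<bullet> (transpose (Dxf f x w) *v p + lam *\<^sub>R Dxr r x w) = h \<bullet> (transpose (Dxf f x w') *v p + lam *\<^sub>R Dxr r x w')" for h
    using 1[of "(h, 0)"] by simp
  then show "transpose (Dxf f x w) *v p + lam *\<^sub>R Dxr r x w = transpose (Dxf f x w') *v p + lam *\<^sub>R Dxr r x w'"
    by (rule eq_if_inner_eq)
qed

lemma const_step:
  assumes w: "w \<in> U" and h: "0 \<le> h"
  shows "norm (Y z (\<lambda>_. w) h - z - h *\<^sub>R f z w) \<le> L * N * h\<^sup>2"
    "\<bar>rint z (\<lambda>_. w) 0 h - h * r z w\<bar> \<le> L * N * h\<^sup>2"
proof -
  define W where "W = (\<lambda>_::real. w)"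
  have Wc: "W \<in> controls U" unfolding W_def by (rule const_control[OF w])
  have near: "norm (Y z W s - z) \<le> N * h" if "s \<in> cbox 0 h" for s
  proof -
    have "norm (Y z W s - z) \<le> N * s" by (rule traj_norm[OF Wc]) (use that in auto)
    also have "\<dots> \<le> N * h" using that N_pos by auto
    finally show ?thesis .
  qed
  have LN: "0 \<le> L * (N * h)" using L_pos N_pos h by simp
  have c: "L * (N * h) * measure lborel (cbox 0 h) = L * N * h\<^sup>2" using h by (simp add: power2_eq_square)
  have "((\<lambda>s. f (Y z W s) (W s) - f z w) has_integral (Y z W h - Y z W 0) - h *\<^sub>R f z w) {0..h}"
    using has_integral_const_real[of "f z w" 0 h] h
    by (intro has_integral_diff bounded_rate_has_integral[OF traj_rate[OF Wc] order_refl h order_refl]) simp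
  then have "norm ((Y z W h - Y z W 0) - h *\<^sub>R f z w) \<le> L * (N * h) * measure lborel (cbox 0 h)"
    unfolding box_real(2)[symmetric]
  proof (rule has_integral_bound[OF LN])
    show "norm (f (Y z W s) (W s) - f z w) \<le> L * (N * h)" if "s \<in> cbox 0 h" for s
      using order_trans[OF f_lip[OF w] mult_left_mono[OF near[OF that]]] L_pos by (simp add: W_def)
  qed
  then show "norm (Y z (\<lambda>_. w) h - z - h *\<^sub>R f z w) \<le> L * N * h\<^sup>2" unfolding c traj_0[OF Wc] by (simp add: W_def)
  have "((\<lambda>s. r (Y z W s) (W s) - r z w) has_integral rint z W 0 h - h * r z w) {0..h}"
    unfolding rint_def using has_integral_const_real[of "r z w" 0 h] h
    by (intro has_integral_diff integrable_integral r_integrable[OF Wc order_refl]) simp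
  then have "norm (rint z W 0 h - h * r z w) \<le> L * (N * h) * measure lborel (cbox 0 h)"
    unfolding box_real(2)[symmetric]
  proof (rule has_integral_bound[OF LN])
    show "norm (r (Y z W s) (W s) - r z w) \<le> L * (N * h)" if "s \<in> cbox 0 h" for s
      using order_trans[OF r_lip[OF w] mult_left_mono[OF near[OF that]]] L_pos by (simp add: W_def)
  qed
  then show "\<bar>rint z (\<lambda>_. w) 0 h - h * r z w\<bar> \<le> L * N * h\<^sup>2" unfolding c by (simp add: W_def)
qed

text \<open>The terminal data are unchanged, hence so is \<open>B\<close>. This is why
  \<open>extremal\<close> speaks of the exit point only: the sensitivity inequality becomes
  available at every intermediate time with the same constant.\<close>

lemma extremal_tail:
  assumes e: "extremal B lam X u tau q \<xi> p" and t: "0 \<le> t" "t < tau"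
  shows "extremal B lam (Y X u t) (\<lambda>s. u (t + s)) (tau - t) q \<xi> (\<lambda>s. p (t + s))"
proof -
  note F = ext_facts[OF e]
  have sc: "(\<lambda>s. u (t + s)) \<in> controls U" by (rule shift_control[OF F(1) t(1)])
  have Ys: "Y (Y X u t) (\<lambda>s. u (t + s)) s = Y X u (t + s)" if "0 \<le> s" for s
    using traj_shift[OF F(1) t(1) that] by simp
  have fin: "Y (Y X u t) (\<lambda>s. u (t + s)) (tau - t) = Y X u tau" using Ys[of "tau - t"] t by simp
  have R: "bounded_rate (\<lambda>s. p (t + s)) (\<lambda>s. adj_rate lam (Y X u (t + s)) (u (t + s)) (p (t + s))) 0 (tau - t)"
    by (rule bounded_rate_shift) (use F(5)[unfolded adjoint_def] t in auto)
  have "adjoint lam (Y X u t) (\<lambda>s. u (t + s)) (\<lambda>s. p (t + s)) (tau - t)"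
    unfolding adjoint_def
  proof -
    obtain M where M: "\<And>s. s \<in> {0..tau - t} \<Longrightarrow> norm (adj_rate lam (Y X u (t + s)) (u (t + s)) (p (t + s))) \<le> M"
      using bounded_rate_bound[OF R] by blast
    show "bounded_rate (\<lambda>s. p (t + s)) (\<lambda>s. adj_rate lam (Y (Y X u t) (\<lambda>s. u (t + s)) s) (u (t + s)) (p (t + s))) 0 (tau - t)"
    proof (rule bounded_rate_cong[OF R negligible_empty, where M=M])
      show "(\<lambda>s. adj_rate lam (Y (Y X u t) (\<lambda>s. u (t + s)) s) (u (t + s)) (p (t + s))) \<in> borel_measurable (lebesgue_on {0..tau - t})"
        by (rule measurable_cong[THEN iffD1, OF _ bounded_rate_measurable[OF R]]) (simp add: Ys)
    qed (use M Ys in auto)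
  qed
  moreover have "Y X u t \<notin> S" using F(2) t by (auto simp: first_hit_def)
  ultimately show ?thesis
    using e first_hit_shift[OF F(1,2) t(1) less_imp_le[OF t(2)]] sc t unfolding extremal_def fin by auto
qed

text \<open>The tail inherits the same error in optimality, since the part before \<open>t\<close>
  obeys the dynamic programming inequality.\<close>

lemma near_optimal_tail:
  assumes u: "u \<in> controls U" and h: "first_hit X u tau" and e: "J X u < v X + \<epsilon>" and t: "0 \<le> t" "t \<le> tau"
  shows "J (Y X u t) (\<lambda>s. u (t + s)) < v (Y X u t) + \<epsilon>" "Y X u t \<in> Reach"
proof -
  have sc: "(\<lambda>s. u (t + s)) \<in> controls U" by (rule shift_control[OF u t(1)])
  show R: "Y X u t \<in> Reach" using first_hit_shift[OF u h t] sc reachable_iff by blast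
  have X: "X \<in> Reach" using u h reachable_iff by blast
  have "V X \<le> ereal (rint X u 0 t) + V (Y X u t)"
    by (rule V_dpp[OF u t(1)]) (use h t in \<open>auto simp: first_hit_def\<close>)
  then have "v X \<le> rint X u 0 t + v (Y X u t)"
    using V_finite[OF X] V_finite[OF R] by (cases "V X"; cases "V (Y X u t)") auto
  then show "J (Y X u t) (\<lambda>s. u (t + s)) < v (Y X u t) + \<epsilon>" using cost_tail[OF u h t] e by linarith
qed

end

section \<open>Limits of sequences of extremals\<close>

lemma tendsto_zero_if_bounded:
  assumes "\<And>n. norm (c n) \<le> d n" "(d \<longlongrightarrow> (l::real)) F" "l = 0"
  shows "(c \<longlongrightarrow> 0) F"
  by (rule Lim_null_comparison[of _ d]) (use assms in auto)

text \<open>The situation after all subsequences have been chosen. Adjoint arcs live on the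
  different intervals \<open>{0..tau n}\<close>; freezing them after the exit time puts them on the
  common interval \<open>{0..B}\<close>. The hypothesis on \<open>Hl lam\<close> concerns the limit
  multiplier only, which decides between the two Hamiltonians.\<close>

locale limit_problem = exit_problem f r g U S N L r0 \<rho>0 G W
  for f :: "real^'d \<Rightarrow> real^'m \<Rightarrow> real^'d" and r g U S N L r0 \<rho>0 G W +
  fixes B :: real and a :: "nat \<Rightarrow> real" and X :: "nat \<Rightarrow> real^'d" and u :: "nat \<Rightarrow> real \<Rightarrow> real^'m" and tau :: "nat \<Rightarrow> real"
    and q \<xi> :: "nat \<Rightarrow> real^'d" and p :: "nat \<Rightarrow> real \<Rightarrow> real^'d" and \<epsilon> :: "nat \<Rightarrow> real"
    and x \<pi> q' \<xi>' :: "real^'d" and lam tau' :: real and y P :: "real \<Rightarrow> real^'d"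
  assumes ext: "\<And>n. extremal B (a n) (X n) (u n) (tau n) (q n) (\<xi> n) (p n)"
    and Jn: "\<And>n. J (X n) (u n) < v (X n) + \<epsilon> n"
    and \<epsilon>lim: "\<epsilon> \<longlonglongrightarrow> 0" and Xlim: "X \<longlonglongrightarrow> x" and plim: "(\<lambda>n. p n 0) \<longlonglongrightarrow> \<pi>" and alim: "a \<longlonglongrightarrow> lam"
    and taulim: "tau \<longlonglongrightarrow> tau'" and qlim: "q \<longlonglongrightarrow> q'" and \<xi>lim: "\<xi> \<longlonglongrightarrow> \<xi>'"
    and ylim: "\<And>t. t \<in> {0..B} \<Longrightarrow> (\<lambda>n. Y (X n) (u n) t) \<longlonglongrightarrow> y t"
    and Plim: "\<And>t. t \<in> {0..B} \<Longrightarrow> (\<lambda>n. p n (min t (tau n))) \<longlonglongrightarrow> P t"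
    and Vc: "continuous_on Reach V" and xr: "x \<in> Reach" and xS: "x \<notin> S"
    and nz: "\<pi> \<noteq> 0 \<or> lam \<noteq> 0"
    and hdiff: "\<And>z p. p \<noteq> 0 \<Longrightarrow> (\<lambda>(z, p). Hl lam z p) differentiable (at (z, p))"
begin

lemmas E = ext_facts[OF ext]

abbreviation "Yn n \<equiv> Y (X n) (u n)"
abbreviation "pn n t \<equiv> p n (min t (tau n))"
abbreviation "fn n t \<equiv> f (Yn n t) (u n t)"
abbreviation "rn n t \<equiv> r (Yn n t) (u n t)"

lemma B1: "1 \<le> B" using E(9) .

lemma tau'_in: "tau' \<in> {0..B}"
  using LIMSEQ_le_const[OF taulim] LIMSEQ_le_const2[OF taulim] E(10,13) by auto

lemma lam_nonneg: "0 \<le> lam"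
  using LIMSEQ_le_const[OF alim] E(4) by auto

lemma un_in: "0 \<le> t \<Longrightarrow> u n t \<in> U" using controls_in[OF E(1)] .

definition "XB = (SOME C. \<forall>n. norm (X n) \<le> C)"

lemma X_bound: "norm (X n) \<le> XB"
proof -
  have "\<exists>C. \<forall>n. norm (X n) \<le> C" using convergent_imp_bounded[OF Xlim] unfolding bounded_iff by auto
  from someI_ex[OF this] show ?thesis unfolding XB_def by blast
qed

definition "RB = R0 + L * (XB + N * B)"

lemma rn_bound: "0 \<le> t \<Longrightarrow> t \<le> B \<Longrightarrow> \<bar>rn n t\<bar> \<le> RB"
  using order_trans[OF r_traj_bound[OF E(1), of t B "X n" n], of RB] X_bound[of n] L_pos by (simp add: RB_def)

lemma pn_bound: "0 \<le> t \<Longrightarrow> norm (pn n t) \<le> cP B"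
  by (rule ext_p_bound[OF ext]) (use E(13)[of n] in auto)

definition "Lp = L * (cP B + B)"

lemma Lp_nonneg: "0 \<le> Lp"
  unfolding Lp_def using L_pos const_pos(2)[OF B1] B1 by simp

lemma pn_lip: "0 \<le> s \<Longrightarrow> 0 \<le> t \<Longrightarrow> norm (pn n s - pn n t) \<le> Lp * \<bar>s - t\<bar>"
proof -
  assume st: "0 \<le> s" "0 \<le> t"
  have "norm (pn n s - pn n t) \<le> Lp * \<bar>min s (tau n) - min t (tau n)\<bar>"
    unfolding Lp_def by (rule ext_p_lip[OF ext]) (use st E(13)[of n] in auto)
  also have "\<dots> \<le> Lp * \<bar>s - t\<bar>" by (rule mult_left_mono[OF _ Lp_nonneg]) linarith
  finally show ?thesis .
qed

lemma y_lip: "s \<in> {0..B} \<Longrightarrow> t \<in> {0..B} \<Longrightarrow> norm (y s - y t) \<le> N * \<bar>s - t\<bar>"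
  using traj_lip[OF E(1)] by (intro LIMSEQ_le_const2[OF tendsto_norm[OF tendsto_diff[OF ylim ylim]]]) auto

lemma P_lip: "s \<in> {0..B} \<Longrightarrow> t \<in> {0..B} \<Longrightarrow> norm (P s - P t) \<le> Lp * \<bar>s - t\<bar>"
  using pn_lip by (intro LIMSEQ_le_const2[OF tendsto_norm[OF tendsto_diff[OF Plim Plim]]]) auto

lemma y_cont: "continuous_on {0..B} y"
  by (rule AC_imp_continuous_on[OF lipschitz_imp_AC]) (rule y_lip)

lemma P_cont: "continuous_on {0..B} P"
  by (rule AC_imp_continuous_on[OF lipschitz_imp_AC]) (rule P_lip)

lemma y0: "y 0 = x"
  using LIMSEQ_unique[OF ylim[of 0]] Xlim B1 traj_0[OF E(1)] by simp

lemma P0: "P 0 = \<pi>"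
proof -
  have "pn n 0 = p n 0" for n using E(13)[of n] by simp
  then show ?thesis using LIMSEQ_unique[OF Plim[of 0]] plim B1 by simp
qed

lemma exit_lim: "(\<lambda>n. Yn n (tau n)) \<longlonglongrightarrow> y tau'"
proof -
  have "(\<lambda>n. N * \<bar>tau n - tau'\<bar>) \<longlonglongrightarrow> N * \<bar>tau' - tau'\<bar>" by (intro tendsto_intros taulim)
  then have "(\<lambda>n. Yn n (tau n) - Yn n tau') \<longlonglongrightarrow> 0"
  proof (rule tendsto_zero_if_bounded[rotated])
    show "norm (Yn n (tau n) - Yn n tau') \<le> N * \<bar>tau n - tau'\<bar>" for n by (rule traj_lip[OF E(1,13)]) (use tau'_in in auto)
  qed simp
  from tendsto_add[OF this ylim[OF tau'_in]] show ?thesis by simp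
qed

lemma exit_n: "Yn n (tau n) \<in> frontier S"
  using exit_frontier(2)[OF E(1-3)] .

lemma exit_frontier': "y tau' \<in> frontier S"
  using closed_sequentially[OF frontier_closed _ exit_lim] exit_n by blast

lemma frontier_sub: "frontier S \<subseteq> S" "frontier S \<subseteq> closure (- S)"
  using S_closed by (auto simp: frontier_closures)

lemma tau'_pos: "0 < tau'"
proof (rule ccontr)
  assume "\<not> 0 < tau'"
  then have "tau' = 0" using tau'_in by auto
  then show False using exit_frontier' frontier_sub y0 xS by auto
qed

lemma P_end: "P tau' = lam *\<^sub>R q' - \<xi>'"
proof -
  have "(\<lambda>n. Lp * \<bar>tau n - tau'\<bar>) \<longlonglongrightarrow> Lp * \<bar>tau' - tau'\<bar>" by (intro tendsto_intros taulim)
  then have "(\<lambda>n. pn n (tau n) - pn n tau') \<longlonglongrightarrow> 0"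
  proof (rule tendsto_zero_if_bounded[rotated])
    show "norm (pn n (tau n) - pn n tau') \<le> Lp * \<bar>tau n - tau'\<bar>" for n by (rule pn_lip[OF E(13)]) (use tau'_in in auto)
  qed simp
  from tendsto_add[OF this Plim[OF tau'_in]] have "(\<lambda>n. p n (tau n)) \<longlonglongrightarrow> P tau'" by simp
  moreover have "(\<lambda>n. p n (tau n)) \<longlonglongrightarrow> lam *\<^sub>R q' - \<xi>'"
    unfolding E(6) by (intro tendsto_intros alim qlim \<xi>lim)
  ultimately show ?thesis by (rule LIMSEQ_unique)
qed

lemma Hl_end: "Hl lam (y tau') (lam *\<^sub>R q' - \<xi>') = 0"
proof -
  have "(\<lambda>n. Hl (a n) (Yn n (tau n)) (a n *\<^sub>R q n - \<xi> n)) \<longlonglongrightarrow> Hl lam (y tau') (lam *\<^sub>R q' - \<xi>')"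
    by (intro Hl_tendsto tendsto_intros alim exit_lim qlim \<xi>lim)
  moreover have "Hl (a n) (Yn n (tau n)) (a n *\<^sub>R q n - \<xi> n) = 0" for n using E(7)[of n] by (simp add: E(6))
  ultimately show ?thesis by (simp add: LIMSEQ_const_iff)
qed

lemma \<xi>'_normal: "\<xi>' \<in> proximal_normals (closure (- S)) (y tau')"
proof -
  have "\<xi>' \<bullet> (z - y tau') \<le> B * (norm (z - y tau'))\<^sup>2" if z: "z \<in> closure (- S)" for z
  proof (rule LIMSEQ_le)
    show "(\<lambda>n. \<xi> n \<bullet> (z - Yn n (tau n))) \<longlonglongrightarrow> \<xi>' \<bullet> (z - y tau')" by (intro tendsto_intros \<xi>lim exit_lim)
    show "(\<lambda>n. B * (norm (z - Yn n (tau n)))\<^sup>2) \<longlonglongrightarrow> B * (norm (z - y tau'))\<^sup>2" by (intro tendsto_intros exit_lim)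
  qed (use E(14)[OF z] in auto)
  moreover have "0 \<le> B" using B1 by simp
  ultimately show ?thesis unfolding proximal_normals_def using exit_frontier' frontier_sub by blast
qed

lemma g_exit_lim: "(\<lambda>n. g (Yn n (tau n))) \<longlonglongrightarrow> g (y tau')"
proof -
  have "(\<lambda>n. G * norm (Yn n (tau n) - y tau')) \<longlonglongrightarrow> G * norm (y tau' - y tau')" by (intro tendsto_intros exit_lim)
  then have "(\<lambda>n. g (Yn n (tau n)) - g (y tau')) \<longlonglongrightarrow> 0"
  proof (rule tendsto_zero_if_bounded[rotated])
    show "norm (g (Yn n (tau n)) - g (y tau')) \<le> G * norm (Yn n (tau n) - y tau')" for n
      using g_lip[OF subsetD[OF frontier_W exit_frontier'] subsetD[OF frontier_W exit_n]] by simp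
  qed simp
  from tendsto_add[OF this tendsto_const[of "g (y tau')"]] show ?thesis by simp
qed

lemma q'_superdiff: "q' \<in> superdiff g (y tau')"
proof (rule superdiffI[of "1 / (2 * B)" _ _ _ B])
  show "0 < 1 / (2 * B)" using B1 by simp
  fix z assume z: "norm (z - y tau') \<le> 1 / (2 * B)"
  show "g z \<le> g (y tau') + q' \<bullet> (z - y tau') + B * (norm (z - y tau'))\<^sup>2"
  proof (rule tendsto_le[OF sequentially_bot _ tendsto_const])
    show "(\<lambda>n. g (Yn n (tau n)) + q n \<bullet> (z - Yn n (tau n)) + B * (norm (z - Yn n (tau n)))\<^sup>2) \<longlonglongrightarrow>
       g (y tau') + q' \<bullet> (z - y tau') + B * (norm (z - y tau'))\<^sup>2"
      by (intro tendsto_intros g_exit_lim qlim exit_lim)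
    have "(\<lambda>n. norm (z - Yn n (tau n))) \<longlonglongrightarrow> norm (z - y tau')" by (intro tendsto_intros exit_lim)
    moreover have "norm (z - y tau') < 1 / B"
    proof -
      have "1 / B > 0" "1 / (2 * B) = 1 / B / 2" using B1 by simp_all
      then show ?thesis using z by linarith
    qed
    ultimately have "\<forall>\<^sub>F n in sequentially. norm (z - Yn n (tau n)) < 1 / B" by (rule order_tendstoD)
    then show "\<forall>\<^sub>F n in sequentially. g z \<le> g (Yn n (tau n)) + q n \<bullet> (z - Yn n (tau n)) + B * (norm (z - Yn n (tau n)))\<^sup>2"
      by eventually_elim (rule E(15), simp)
  qed
qed

lemma ev_before: "t < tau' \<Longrightarrow> \<forall>\<^sub>F n in sequentially. t < tau n"
  using order_tendstoD(1)[OF taulim] .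

lemma rint_bound: "0 \<le> s \<Longrightarrow> s \<le> t \<Longrightarrow> t \<le> B \<Longrightarrow> \<bar>rint (X n) (u n) s t\<bar> \<le> RB * (t - s)"
proof -
  assume st: "0 \<le> s" "s \<le> t" "t \<le> B"
  have "norm (rint (X n) (u n) s t) \<le> integral {s..t} (\<lambda>_. RB)"
    unfolding rint_def by (rule integral_norm_bound_integral[OF r_integrable[OF E(1) st(1)]]) (use rn_bound st in auto)
  then show ?thesis using st by (simp add: mult.commute)
qed

text \<open>The limit trajectory cannot touch the target before the limit exit time, since \<open>V = g\<close> on the
  target and \<open>g\<close> varies by less than the running cost along trajectories.\<close>

lemma y_notin:
  assumes t: "0 \<le> t" "t < tau'"
  shows "y t \<notin> S"
proof
  assume yS: "y t \<in> S"
  have tB: "t \<in> {0..B}" using t tau'_in by auto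
  have ev: "\<forall>\<^sub>F n in sequentially. t < tau n" using ev_before[OF t(2)] .
  have "\<forall>\<^sub>F n in sequentially. Yn n t \<in> closure (- S)"
    using ev
  proof eventually_elim
    case (elim n)
    then have "Yn n t \<notin> S" using E(2)[of n] t by (auto simp: first_hit_def)
    then show ?case using closure_subset[of "- S"] by auto
  qed
  then have "y t \<in> closure (- S)" using Lim_in_closed_set[OF closed_closure _ sequentially_bot ylim[OF tB]] by blast
  then have yF: "y t \<in> frontier S" using yS closure_subset[of S] by (auto simp: frontier_closures)
  obtain w where "w \<in> U" using U_ne by blast
  then have yr: "y t \<in> Reach" using first_hit_0[OF const_control yS] const_control reachable_iff by blast
  have "(\<lambda>n. v (Yn n t)) \<longlonglongrightarrow> v (y t)"
  proof (rule continuous_on_tendsto_compose[OF v_continuous[OF Vc] ylim[OF tB] yr])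
    show "\<forall>\<^sub>F n in sequentially. Yn n t \<in> Reach"
      using ev by eventually_elim (rule near_optimal_tail(2)[OF E(1,2) Jn], use t in auto)
  qed
  then have vl: "(\<lambda>n. v (Yn n t) + \<epsilon> n) \<longlonglongrightarrow> g (y t) + 0" using V_on_S[OF yS] by (intro tendsto_add \<epsilon>lim) simp
  have "(\<lambda>n. r0 * (tau n - t) + g (Yn n (tau n))) \<longlonglongrightarrow> r0 * (tau' - t) + g (y tau')"
    by (intro tendsto_intros taulim g_exit_lim)
  then have "r0 * (tau' - t) + g (y tau') \<le> g (y t) + 0"
  proof (rule tendsto_le[OF sequentially_bot vl])
    show "\<forall>\<^sub>F n in sequentially. r0 * (tau n - t) + g (Yn n (tau n)) \<le> v (Yn n t) + \<epsilon> n"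
      using ev
    proof eventually_elim
      case (elim n)
      have "J (Yn n t) (\<lambda>s. u n (t + s)) < v (Yn n t) + \<epsilon> n"
        by (rule near_optimal_tail(1)[OF E(1,2) Jn]) (use t elim in auto)
      moreover have "J (X n) (u n) = rint (X n) (u n) 0 t + J (Yn n t) (\<lambda>s. u n (t + s))"
        by (rule cost_tail[OF E(1,2)]) (use t elim in auto)
      moreover have "J (X n) (u n) = rint (X n) (u n) 0 t + rint (X n) (u n) t (tau n) + g (Yn n (tau n))"
        using cost_eq[OF E(1,2)] rint_combine[OF E(1) order_refl t(1), of "tau n" "X n" n] elim by simp
      moreover have "r0 * (tau n - t) \<le> rint (X n) (u n) t (tau n)" by (rule rint_ge[OF E(1)]) (use t elim in auto)
      ultimately show ?case by linarith
    qed
  qed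
  moreover have "\<bar>g (y tau') - g (y t)\<bar> \<le> G * norm (y tau' - y t)"
    using g_lip subsetD[OF frontier_W exit_frontier'] subsetD[OF frontier_W yF] by blast
  moreover have "G * norm (y tau' - y t) \<le> G * (N * (tau' - t))"
    using y_lip[OF tau'_in tB] t G_nonneg by (intro mult_left_mono) auto
  ultimately have "\<kappa> * (tau' - t) \<le> 0" by (simp add: \<kappa>_def algebra_simps)
  then show False using \<kappa>_pos t by (simp add: mult_le_0_iff)
qed

lemma sens_tail:
  assumes t: "0 \<le> t" "t < tau n" and z: "z \<notin> S" "ereal \<beta> \<le> V z"
  shows "- (p n t \<bullet> (z - Yn n t)) + a n * (\<beta> - J (Yn n t) (\<lambda>s. u n (t + s))) \<le>
    cK B * ((norm (z - Yn n t))\<^sup>2 + (\<beta> - J (Yn n t) (\<lambda>s. u n (t + s)))\<^sup>2)"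
  using sensitivity[OF extremal_tail[OF ext t] z] by simp

text \<open>Start at an intermediate point and apply the maximizing constant control for a time
  \<open>h\<close>. Dynamic programming gives a point of the hypograph there, and the sensitivity
  inequality for the tail bounds \<open>h\<close> times the Hamiltonian by
  \<open>C * h\<^sup>2\<close> plus terms that vanish with the optimality error. The order of limits
  matters: first n with \<open>h\<close> fixed, then \<open>h\<close>.\<close>

lemma Hl_nonpos:
  assumes t: "0 \<le> t" "t < tau'"
  shows "Hl lam (y t) (P t) \<le> 0"
proof -
  have tB: "t \<in> {0..B}" using t tau'_in by auto
  \<comment> \<open>The ball keeps the short constant-control trajectories off the target, as
    \<open>V_dpp\<close> requires.\<close>
  obtain \<eta> where \<eta>: "\<eta> > 0" "ball (y t) \<eta> \<subseteq> - S" using y_notin[OF t] S_closed by (metis ComplI open_Compl openE)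
  define R where "R = R0 + L * (norm (y t) + 1 + \<eta>) + L * N"
  define C where "C = cP B * (L * N) + B * (L * N) + cK B * (N\<^sup>2 + R\<^sup>2)"
  have R_nonneg: "0 \<le> R" using R0(1) L_pos N_pos \<eta> by (simp add: R_def)
  have step: "h * Hl lam (y t) (P t) \<le> C * h\<^sup>2" if h: "0 < h" "h \<le> 1" "N * h < \<eta> / 2" for h
  proof -
    have "\<forall>\<^sub>F n in sequentially. h * Hl (a n) (Yn n t) (pn n t) \<le> a n * \<epsilon> n + (C * h\<^sup>2 + cK B * (2 * R * h * \<bar>\<epsilon> n\<bar> + (\<epsilon> n)\<^sup>2))"
      using ev_before[OF t(2)] tendstoD[OF ylim[OF tB] half_gt_zero[OF \<eta>(1)]]
    proof eventually_elim
      case (elim n)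
      have d: "norm (Yn n t - y t) < \<eta> / 2" using elim \<eta> by (simp add: dist_norm)
      have pt: "pn n t = p n t" using elim by simp
      obtain w where w: "w \<in> U" "Hl (a n) (Yn n t) (p n t) = - (p n t \<bullet> f (Yn n t) w) - a n * r (Yn n t) w" using Hl_attained by metis
      define W where "W = (\<lambda>_::real. w)"
      have Wc: "W \<in> controls U" unfolding W_def by (rule const_control[OF w(1)])
      define z where "z = Y (Yn n t) W h"
      define I where "I = rint (Yn n t) W 0 h"
      define Jt where "Jt = J (Yn n t) (\<lambda>s. u n (t + s))"
      have out: "Y (Yn n t) W s \<notin> S" if "0 \<le> s" "s \<le> h" for s
      proof -
        have "norm (Y (Yn n t) W s - Yn n t) \<le> N * s" by (rule traj_norm[OF Wc that(1)])
        also have "\<dots> \<le> N * h" using that N_pos by simp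
        finally have "norm (Y (Yn n t) W s - y t) < \<eta>"
          using d h norm_triangle_ineq[of "Y (Yn n t) W s - Yn n t" "Yn n t - y t"] by simp
        then have "Y (Yn n t) W s \<in> ball (y t) \<eta>" by (simp add: dist_norm norm_minus_commute)
        then show ?thesis using \<eta> by blast
      qed
      have zS: "z \<notin> S" unfolding z_def by (rule out) (use h in auto)
      have zY: "norm (z - Yn n t) \<le> N * h" unfolding z_def by (rule traj_norm[OF Wc]) (use h in auto)
      have st: "norm (z - Yn n t - h *\<^sub>R f (Yn n t) w) \<le> L * N * h\<^sup>2" "\<bar>I - h * r (Yn n t) w\<bar> \<le> L * N * h\<^sup>2"
        using const_step[OF w(1), of h "Yn n t"] h by (auto simp: z_def I_def W_def)
      have Ib: "\<bar>I\<bar> \<le> R * h"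
      proof -
        have "norm (Yn n t) \<le> norm (y t) + \<eta>" using d \<eta> norm_triangle_sub[of "Yn n t" "y t"] by linarith
        then have "L * norm (Yn n t) \<le> L * (norm (y t) + 1 + \<eta>)" using L_pos by (intro mult_left_mono) auto
        then have "\<bar>r (Yn n t) w\<bar> \<le> R0 + L * (norm (y t) + 1 + \<eta>)" using r_bound[OF w(1), of "Yn n t"] by linarith
        then have "\<bar>h * r (Yn n t) w\<bar> \<le> h * (R0 + L * (norm (y t) + 1 + \<eta>))" using h by (simp add: abs_mult mult_left_mono)
        moreover have "L * N * h\<^sup>2 \<le> L * N * h" using h L_pos N_pos by (intro mult_left_mono) (auto simp: power2_eq_square mult_left_le)
        ultimately show ?thesis using st(2) by (simp add: R_def algebra_simps)
      qed
      have tail: "Jt < v (Yn n t) + \<epsilon> n" "Yn n t \<in> Reach"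
        unfolding Jt_def by (rule near_optimal_tail[OF E(1,2) Jn]; use t elim in simp)+
      \<comment> \<open>The largest height that near optimality and dynamic programming guarantee to
        lie below \<open>V z\<close>.\<close>
      define \<beta> where "\<beta> = Jt - \<epsilon> n - I"
      have "V (Yn n t) \<le> ereal I + V z" unfolding I_def z_def by (rule V_dpp[OF Wc]) (use h out in auto)
      then have \<beta>V: "ereal \<beta> \<le> V z"
        using tail V_finite[OF tail(2)] by (cases "V (Yn n t)"; cases "V z") (auto simp: \<beta>_def)
      have bJ: "\<beta> - Jt = - (\<epsilon> n + I)" by (simp add: \<beta>_def)
      have s: "- (p n t \<bullet> (z - Yn n t)) + a n * (- (\<epsilon> n + I)) \<le> cK B * ((norm (z - Yn n t))\<^sup>2 + (\<epsilon> n + I)\<^sup>2)"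
        using sens_tail[OF t(1) elim(1) zS \<beta>V] unfolding Jt_def[symmetric] bJ power2_minus .
      have c1: "p n t \<bullet> (z - Yn n t) \<le> h * (p n t \<bullet> f (Yn n t) w) + cP B * (L * N * h\<^sup>2)"
      proof -
        have "p n t \<bullet> (z - Yn n t - h *\<^sub>R f (Yn n t) w) \<le> norm (p n t) * norm (z - Yn n t - h *\<^sub>R f (Yn n t) w)" by (rule norm_cauchy_schwarz)
        also have "\<dots> \<le> cP B * (L * N * h\<^sup>2)"
          using pn_bound[OF t(1), of n] st(1) const_pos(2)[OF B1] unfolding pt by (intro mult_mono) auto
        finally show ?thesis by (simp add: inner_diff_right)
      qed
      have c2: "a n * I \<le> h * (a n * r (Yn n t) w) + B * (L * N * h\<^sup>2)"
      proof -
        have "a n * (I - h * r (Yn n t) w) \<le> a n * (L * N * h\<^sup>2)" using st(2) E(4) by (intro mult_left_mono) auto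
        also have "\<dots> \<le> B * (L * N * h\<^sup>2)" using E(11) L_pos N_pos by (intro mult_right_mono) auto
        finally show ?thesis by (simp add: algebra_simps)
      qed
      have Heq: "h * Hl (a n) (Yn n t) (p n t) = - (h * (p n t \<bullet> f (Yn n t) w)) - h * (a n * r (Yn n t) w)"
        unfolding w(2) by (simp add: algebra_simps)
      have "a n * (- (\<epsilon> n + I)) = - (a n * \<epsilon> n) - a n * I" by (simp add: algebra_simps)
      then have "h * Hl (a n) (Yn n t) (p n t) \<le> a n * \<epsilon> n + cP B * (L * N * h\<^sup>2) + B * (L * N * h\<^sup>2) + cK B * ((norm (z - Yn n t))\<^sup>2 + (\<epsilon> n + I)\<^sup>2)"
        using s c1 c2 Heq by linarith
      also have "cK B * ((norm (z - Yn n t))\<^sup>2 + (\<epsilon> n + I)\<^sup>2) \<le> cK B * ((N * h)\<^sup>2 + (\<bar>\<epsilon> n\<bar> + R * h)\<^sup>2)"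
      proof (intro mult_left_mono add_mono cK_nonneg[OF B1])
        show "(norm (z - Yn n t))\<^sup>2 \<le> (N * h)\<^sup>2" by (rule power_mono[OF zY]) simp
        have "\<bar>\<epsilon> n + I\<bar> \<le> \<bar>\<bar>\<epsilon> n\<bar> + R * h\<bar>" using Ib by linarith
        then show "(\<epsilon> n + I)\<^sup>2 \<le> (\<bar>\<epsilon> n\<bar> + R * h)\<^sup>2" by (rule abs_le_square_iff[THEN iffD1])
      qed
      also have "a n * \<epsilon> n + cP B * (L * N * h\<^sup>2) + B * (L * N * h\<^sup>2) + cK B * ((N * h)\<^sup>2 + (\<bar>\<epsilon> n\<bar> + R * h)\<^sup>2)
         = a n * \<epsilon> n + (C * h\<^sup>2 + cK B * (2 * R * h * \<bar>\<epsilon> n\<bar> + (\<epsilon> n)\<^sup>2))"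
        by (simp add: C_def power2_sum power_mult_distrib algebra_simps)
      finally show ?case unfolding pt by simp
    qed
    moreover have "(\<lambda>n. h * Hl (a n) (Yn n t) (pn n t)) \<longlonglongrightarrow> h * Hl lam (y t) (P t)"
      by (intro tendsto_intros Hl_tendsto alim ylim[OF tB] Plim[OF tB])
    moreover have "(\<lambda>n. a n * \<epsilon> n + (C * h\<^sup>2 + cK B * (2 * R * h * \<bar>\<epsilon> n\<bar> + (\<epsilon> n)\<^sup>2))) \<longlonglongrightarrow> lam * 0 + (C * h\<^sup>2 + cK B * (2 * R * h * \<bar>0\<bar> + 0\<^sup>2))"
      by (intro tendsto_intros alim \<epsilon>lim)
    ultimately have "h * Hl lam (y t) (P t) \<le> lam * 0 + (C * h\<^sup>2 + cK B * (2 * R * h * \<bar>0\<bar> + 0\<^sup>2))"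
      using tendsto_le[OF sequentially_bot] by blast
    then show ?thesis by simp
  qed
  show ?thesis
  proof (rule field_le_epsilon)
    fix e :: real assume e: "e > 0"
    define h where "h = min 1 (min (\<eta> / (4 * N)) (e / (\<bar>C\<bar> + 1)))"
    have "N * h \<le> N * (\<eta> / (4 * N))" using N_pos by (intro mult_left_mono) (auto simp: h_def)
    then have h: "0 < h" "h \<le> 1" "N * h < \<eta> / 2" using N_pos \<eta> e by (auto simp: h_def)
    have "h * Hl lam (y t) (P t) \<le> h * (C * h)" using step[OF h] by (simp add: power2_eq_square algebra_simps)
    then have "Hl lam (y t) (P t) \<le> C * h" using h(1) by (rule mult_left_le_imp_le)
    also have "\<dots> \<le> (\<bar>C\<bar> + 1) * (e / (\<bar>C\<bar> + 1))" using h by (intro mult_mono) (auto simp: h_def)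
    also have "\<dots> = e" by simp
    finally show "Hl lam (y t) (P t) \<le> 0 + e" by simp
  qed
qed

text \<open>Minus the time integral of the function that is maximized in \<open>Hl\<close>, along
  the n-th arc. An upper bound on it says that this function is, on average, not much below
  0.\<close>

definition "\<phi> n t = integral {0..t} (\<lambda>s. pn n s \<bullet> fn n s + a n * rn n s)"

lemma pnf_integrable:
  assumes "0 \<le> s" "t \<le> B"
  shows "(\<lambda>s. pn n s \<bullet> fn n s) integrable_on {s..t}" "(\<lambda>s. pn n s \<bullet> fn n s) \<in> borel_measurable (lebesgue_on {0..B})"
proof -
  have fm: "(\<lambda>s. fn n s) \<in> borel_measurable (lebesgue_on {0..B})"
    by (intro compose_measurable[OF f_cont E(1)] continuous_on_subset[OF traj_continuous[OF E(1)]]) auto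
  have "continuous_on {0..B} (pn n)"
    by (rule AC_imp_continuous_on[OF lipschitz_imp_AC[of _ _ _ Lp]]) (use pn_lip in auto)
  then have pm: "pn n \<in> borel_measurable (lebesgue_on {0..B})" by (rule continuous_imp_measurable_on_sets_lebesgue) auto
  show m: "(\<lambda>s. pn n s \<bullet> fn n s) \<in> borel_measurable (lebesgue_on {0..B})" by (intro borel_measurable_inner pm fm)
  have "(\<lambda>s. pn n s \<bullet> fn n s) integrable_on {0..B}"
  proof (rule bounded_measurable_integrable_on[OF m, where M="cP B * N"])
    fix s assume s: "s \<in> {0..B}"
    show "norm (pn n s \<bullet> fn n s) \<le> cP B * N"
      unfolding real_norm_def
      by (rule order_trans[OF Cauchy_Schwarz_ineq2]) (use s pn_bound f_le un_in const_pos(2)[OF B1] in \<open>auto intro!: mult_mono\<close>)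
  qed
  then show "(\<lambda>s. pn n s \<bullet> fn n s) integrable_on {s..t}" by (rule integrable_on_subinterval) (use assms in auto)
qed

text \<open>Here the sensitivity inequality at time \<open>t\<close> is tested at the earlier point
  of the same trajectory, whose height is known up to the optimality error. The increment of \<phi>
  is then quadratic in the time step, up to terms in that error.\<close>

lemma \<phi>_step:
  assumes st: "0 \<le> s" "s \<le> t" "t < tau n"
  shows "\<phi> n t - \<phi> n s \<le> (Lp * N + cK B * (N\<^sup>2 + 2 * RB\<^sup>2)) * (t - s)\<^sup>2 + (B * \<bar>\<epsilon> n\<bar> + 2 * cK B * (\<epsilon> n)\<^sup>2)"
proof -
  have t0: "0 \<le> t" and tB: "t \<le> B" using st E(10)[of n] by auto
  define I where "I = rint (X n) (u n) s t"
  define h where "h = t - s"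
  have h0: "0 \<le> h" using st by (simp add: h_def)
  have ri: "rn n integrable_on {0..t}" "rn n integrable_on {s..t}" by (rule r_integrable[OF E(1)]; use st in simp)+
  have "\<phi> n t - \<phi> n s = integral {s..t} (\<lambda>\<sigma>. pn n \<sigma> \<bullet> fn n \<sigma> + a n * rn n \<sigma>)"
  proof -
    have "(\<lambda>\<sigma>. pn n \<sigma> \<bullet> fn n \<sigma> + a n * rn n \<sigma>) integrable_on {0..t}"
      by (intro integrable_add integrable_on_mult_right pnf_integrable ri tB order_refl)
    from Henstock_Kurzweil_Integration.integral_combine[OF st(1,2) this] show ?thesis by (simp add: \<phi>_def)
  qed
  also have "\<dots> = integral {s..t} (\<lambda>\<sigma>. pn n \<sigma> \<bullet> fn n \<sigma>) + a n * I"
    unfolding I_def rint_def using pnf_integrable(1)[OF st(1) tB, of n] ri(2)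
    by (subst integral_add) (auto intro!: integrable_on_mult_right)
  finally have 1: "\<phi> n t - \<phi> n s = integral {s..t} (\<lambda>\<sigma>. pn n \<sigma> \<bullet> fn n \<sigma>) + a n * I" .
  have fi: "((\<lambda>\<sigma>. fn n \<sigma>) has_integral (Yn n t - Yn n s)) {s..t}"
    by (rule bounded_rate_has_integral[OF traj_rate[OF E(1)] st(1,2) order_refl])
  have fi2: "((\<lambda>\<sigma>. p n t \<bullet> fn n \<sigma>) has_integral (p n t \<bullet> (Yn n t - Yn n s))) {s..t}"
    using has_integral_linear[OF fi bounded_linear_inner_right[of "p n t"]] by (simp add: o_def)
  have "integral {s..t} (\<lambda>\<sigma>. pn n \<sigma> \<bullet> fn n \<sigma>) \<le> integral {s..t} (\<lambda>\<sigma>. p n t \<bullet> fn n \<sigma> + Lp * h * N)"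
  proof (rule integral_le)
    show "(\<lambda>\<sigma>. p n t \<bullet> fn n \<sigma> + Lp * h * N) integrable_on {s..t}" using fi2 by (intro integrable_add) auto
    fix \<sigma> assume \<sigma>: "\<sigma> \<in> {s..t}"
    have "(pn n \<sigma> - pn n t) \<bullet> fn n \<sigma> \<le> norm (pn n \<sigma> - pn n t) * norm (fn n \<sigma>)" by (rule norm_cauchy_schwarz)
    also have "\<dots> \<le> (Lp * h) * N"
    proof (rule mult_mono)
      have "norm (pn n \<sigma> - pn n t) \<le> Lp * \<bar>\<sigma> - t\<bar>" by (rule pn_lip) (use \<sigma> st in auto)
      also have "\<dots> \<le> Lp * h" using \<sigma> by (intro mult_left_mono Lp_nonneg) (auto simp: h_def)
      finally show "norm (pn n \<sigma> - pn n t) \<le> Lp * h" .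
      show "norm (fn n \<sigma>) \<le> N" by (rule f_le[OF un_in]) (use \<sigma> st in auto)
    qed (use Lp_nonneg h0 in auto)
    finally show "pn n \<sigma> \<bullet> fn n \<sigma> \<le> p n t \<bullet> fn n \<sigma> + Lp * h * N" using st by (simp add: inner_diff_left)
  qed (rule pnf_integrable(1)[OF st(1) tB])
  also have "\<dots> = p n t \<bullet> (Yn n t - Yn n s) + Lp * h * N * h"
    using fi2 st by (subst integral_add) (auto simp: integral_unique h_def)
  finally have 2: "integral {s..t} (\<lambda>\<sigma>. pn n \<sigma> \<bullet> fn n \<sigma>) \<le> p n t \<bullet> (Yn n t - Yn n s) + Lp * h * N * h" .
  define Jt where "Jt = J (Yn n t) (\<lambda>\<sigma>. u n (t + \<sigma>))"
  define Js where "Js = J (Yn n s) (\<lambda>\<sigma>. u n (s + \<sigma>))"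
  have "J (X n) (u n) = rint (X n) (u n) 0 t + Jt" unfolding Jt_def by (rule cost_tail[OF E(1,2)]) (use st in auto)
  moreover have "J (X n) (u n) = rint (X n) (u n) 0 s + Js" unfolding Js_def by (rule cost_tail[OF E(1,2)]) (use st in auto)
  moreover have "rint (X n) (u n) 0 t = rint (X n) (u n) 0 s + I" unfolding I_def by (rule rint_combine[OF E(1) order_refl st(1,2)])
  ultimately have Jst: "Js = I + Jt" by simp
  have tail: "Js < v (Yn n s) + \<epsilon> n" "Yn n s \<in> Reach"
    unfolding Js_def by (rule near_optimal_tail[OF E(1,2) Jn]; use st in simp)+
  define \<beta> where "\<beta> = Js - \<epsilon> n"
  have \<beta>V: "ereal \<beta> \<le> V (Yn n s)" using tail V_finite[OF tail(2)] by (cases "V (Yn n s)") (auto simp: \<beta>_def)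
  have sS: "Yn n s \<notin> S" using E(2)[of n] st by (auto simp: first_hit_def)
  have bJ: "\<beta> - Jt = I - \<epsilon> n" by (simp add: \<beta>_def Jst)
  have "- (p n t \<bullet> (Yn n s - Yn n t)) + a n * (I - \<epsilon> n) \<le> cK B * ((norm (Yn n s - Yn n t))\<^sup>2 + (I - \<epsilon> n)\<^sup>2)"
    using sens_tail[OF t0 st(3) sS \<beta>V] unfolding Jt_def[symmetric] bJ .
  also have "\<dots> \<le> cK B * ((N * h)\<^sup>2 + (2 * (RB * h)\<^sup>2 + 2 * (\<epsilon> n)\<^sup>2))"
  proof (intro mult_left_mono add_mono power_mono cK_nonneg[OF B1])
    show "norm (Yn n s - Yn n t) \<le> N * h" using traj_lip[OF E(1), of s t "X n" n] st by (simp add: h_def)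
    have "(b - c)\<^sup>2 \<le> 2 * b\<^sup>2 + 2 * c\<^sup>2" for b c :: real using zero_le_power2[of "b + c"] by (simp add: power2_sum power2_diff)
    then have "(I - \<epsilon> n)\<^sup>2 \<le> 2 * I\<^sup>2 + 2 * (\<epsilon> n)\<^sup>2" .
    moreover have "\<bar>I\<bar> \<le> \<bar>RB * h\<bar>" using rint_bound[OF st(1,2) tB, of n] by (simp add: I_def h_def)
    then have "I\<^sup>2 \<le> (RB * h)\<^sup>2" by (rule abs_le_square_iff[THEN iffD1])
    ultimately show "(I - \<epsilon> n)\<^sup>2 \<le> 2 * (RB * h)\<^sup>2 + 2 * (\<epsilon> n)\<^sup>2" by linarith
  qed auto
  finally have 3: "p n t \<bullet> (Yn n t - Yn n s) + a n * I \<le> a n * \<epsilon> n + cK B * ((N * h)\<^sup>2 + (2 * (RB * h)\<^sup>2 + 2 * (\<epsilon> n)\<^sup>2))"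
    by (simp add: inner_diff_right algebra_simps)
  have "a n * \<epsilon> n \<le> a n * \<bar>\<epsilon> n\<bar>" by (rule mult_left_mono[OF abs_ge_self E(4)])
  also have "\<dots> \<le> B * \<bar>\<epsilon> n\<bar>" by (rule mult_right_mono[OF E(11)]) simp
  finally have "a n * \<epsilon> n \<le> B * \<bar>\<epsilon> n\<bar>" .
  with 1 2 3 have "\<phi> n t - \<phi> n s \<le> Lp * h * N * h + B * \<bar>\<epsilon> n\<bar> + cK B * ((N * h)\<^sup>2 + (2 * (RB * h)\<^sup>2 + 2 * (\<epsilon> n)\<^sup>2))" by linarith
  also have "\<dots> = (Lp * N + cK B * (N\<^sup>2 + 2 * RB\<^sup>2)) * h\<^sup>2 + (B * \<bar>\<epsilon> n\<bar> + 2 * cK B * (\<epsilon> n)\<^sup>2)"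
    by (simp add: power_mult_distrib power2_eq_square algebra_simps)
  finally show ?thesis by (simp add: h_def)
qed

text \<open>Cut the interval into \<open>M\<close> equal steps: the quadratic errors add up to order
  1 / M, the optimality errors to \<open>M\<close> times a null sequence. \<open>M\<close> is fixed
  first and n is sent to infinity afterwards.\<close>

lemma \<phi>_limsup:
  assumes t: "0 \<le> t" "t < tau'" and e: "e > 0"
  shows "\<forall>\<^sub>F n in sequentially. \<phi> n t < e"
proof -
  define C where "C = Lp * N + cK B * (N\<^sup>2 + 2 * RB\<^sup>2)"
  define \<delta> where "\<delta> n = B * \<bar>\<epsilon> n\<bar> + 2 * cK B * (\<epsilon> n)\<^sup>2" for n
  have C0: "0 \<le> C" unfolding C_def using Lp_nonneg N_pos cK_nonneg[OF B1] by (intro add_nonneg_nonneg mult_nonneg_nonneg) auto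
  obtain M :: nat where M: "real M > 2 * (C * t\<^sup>2) / e" using reals_Archimedean2 by blast
  have "0 \<le> 2 * (C * t\<^sup>2) / e" using C0 e by simp
  then have M0: "real M > 0" using M by linarith
  have MC: "C * t\<^sup>2 / real M < e / 2" using M M0 e by (simp add: field_simps)
  have "(\<lambda>n. real M * \<delta> n) \<longlonglongrightarrow> real M * (B * \<bar>0\<bar> + 2 * cK B * 0\<^sup>2)"
    unfolding \<delta>_def by (intro tendsto_intros \<epsilon>lim)
  then have "\<forall>\<^sub>F n in sequentially. real M * \<delta> n < e / 2" using e by (intro order_tendstoD) auto
  then show ?thesis using ev_before[OF t(2)]
  proof eventually_elim
    case (elim n)
    define s where "s j = t * (real j / real M)" for j
    have sM: "s 0 = 0" "s M = t" using M0 by (auto simp: s_def)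
    have "\<phi> n t = (\<Sum>j<M. \<phi> n (s (Suc j)) - \<phi> n (s j))"
      using sum_lessThan_telescope[of "\<lambda>j. \<phi> n (s j)" M] sM by (simp add: \<phi>_def)
    also have "\<dots> \<le> (\<Sum>j<M. C * (t / real M)\<^sup>2 + \<delta> n)"
    proof (rule sum_mono)
      fix j assume j: "j \<in> {..<M}"
      have d: "s (Suc j) - s j = t / real M" unfolding s_def right_diff_distrib[symmetric] diff_divide_distrib[symmetric] by simp
      have "s (Suc j) \<le> t * 1" unfolding s_def using j t by (intro mult_left_mono) auto
      moreover have "0 \<le> s j" "s j \<le> s (Suc j)" unfolding s_def using t by (auto intro!: mult_left_mono divide_right_mono)
      ultimately have "\<phi> n (s (Suc j)) - \<phi> n (s j) \<le> C * (s (Suc j) - s j)\<^sup>2 + \<delta> n"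
        unfolding C_def \<delta>_def using elim by (intro \<phi>_step) auto
      then show "\<phi> n (s (Suc j)) - \<phi> n (s j) \<le> C * (t / real M)\<^sup>2 + \<delta> n" unfolding d .
    qed
    also have "\<dots> = C * t\<^sup>2 / real M + real M * \<delta> n" using M0 by (simp add: power_divide power2_eq_square field_simps)
    also have "\<dots> < e" using MC elim by linarith
    finally show ?case .
  qed
qed

end

lemma dominated_convergence_negligible:
  fixes F :: "nat \<Rightarrow> real \<Rightarrow> 'a::euclidean_space"
  assumes Z: "negligible Z" and int: "\<And>n. F n integrable_on {a..b}" and bd: "\<And>n s. s \<in> {a..b} \<Longrightarrow> norm (F n s) \<le> C"
    and conv: "\<And>s. s \<in> {a..b} - Z \<Longrightarrow> (\<lambda>n. F n s) \<longlonglongrightarrow> G s"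
  shows "(\<lambda>n. integral {a..b} (F n)) \<longlonglongrightarrow> integral {a..b} G"
proof -
  define F' where "F' n s = (if s \<in> Z then 0 else F n s)" for n s
  define G' where "G' s = (if s \<in> Z then 0 else G s)" for s
  have 1: "integral {a..b} (F n) = integral {a..b} (F' n)" for n
    by (rule integral_spike[OF Z]) (auto simp: F'_def)
  have 2: "integral {a..b} G = integral {a..b} G'"
    by (rule integral_spike[OF Z]) (auto simp: G'_def)
  have "(\<lambda>n. integral {a..b} (F' n)) \<longlonglongrightarrow> integral {a..b} G'"
  proof (rule dominated_convergence(2)[where h="\<lambda>_. \<bar>C\<bar>"])
    show "F' n integrable_on {a..b}" for n
      by (rule integrable_spike[OF int[of n] Z]) (auto simp: F'_def)
    show "norm (F' n s) \<le> \<bar>C\<bar>" if "s \<in> {a..b}" for n s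
      using bd[OF that, of n] by (auto simp: F'_def)
    show "(\<lambda>n. F' n s) \<longlonglongrightarrow> G' s" if "s \<in> {a..b}" for s
      using conv[of s] that by (auto simp: F'_def G'_def)
  qed auto
  then show ?thesis unfolding 1 2 .
qed

section \<open>Vanishing of the maximality defect and convergence of the velocities\<close>

context limit_problem
begin

definition "Hn n s = Hl (a n) (Yn n s) (pn n s)"
definition "Hb s = Hl lam (y s) (P s)"
text \<open>The defect of \<open>u n s\<close> in the maximization at time \<open>s\<close>. It is
  nonnegative, so convergence of its integral to 0 is convergence in the mean.\<close>

definition "psi n s = pn n s \<bullet> fn n s + a n * rn n s + Hn n s"

lemma psi_nonneg: "0 \<le> s \<Longrightarrow> 0 \<le> psi n s"
proof -
  assume s: "0 \<le> s"
  have "- (pn n s \<bullet> fn n s) - a n * rn n s \<le> Hn n s" unfolding Hn_def by (rule Hl_ge[OF un_in[OF s]])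
  then show ?thesis unfolding psi_def by linarith
qed

lemma Yn_norm: "0 \<le> s \<Longrightarrow> s \<le> B \<Longrightarrow> norm (Yn n s) \<le> XB + N * B"
proof -
  assume s: "0 \<le> s" "s \<le> B"
  have "norm (Yn n s - X n) \<le> N * s" by (rule traj_norm[OF E(1) s(1)])
  also have "\<dots> \<le> N * B" using s N_pos by simp
  finally show ?thesis using X_bound[of n] norm_triangle_sub[of "Yn n s" "X n"] by linarith
qed

definition "HB = cP B * N + B * RB"

lemma pf_bound: "s \<in> {0..B} \<Longrightarrow> \<bar>pn n s \<bullet> fn n s + a n * rn n s\<bar> \<le> HB"
proof -
  assume s: "s \<in> {0..B}"
  have "\<bar>pn n s \<bullet> fn n s\<bar> \<le> cP B * N"
    by (rule order_trans[OF Cauchy_Schwarz_ineq2]) (use s pn_bound f_le un_in const_pos(2)[OF B1] in \<open>auto intro!: mult_mono\<close>)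
  moreover have "\<bar>a n * rn n s\<bar> \<le> B * RB"
    unfolding abs_mult using rn_bound[of s n] s E(4,11)[of n] B1 by (intro mult_mono) auto
  ultimately show ?thesis unfolding HB_def by linarith
qed

lemma Hn_bound: "s \<in> {0..B} \<Longrightarrow> \<bar>Hn n s\<bar> \<le> HB"
proof -
  assume s: "s \<in> {0..B}"
  obtain w where w: "w \<in> U" "Hn n s = - (pn n s \<bullet> f (Yn n s) w) - a n * r (Yn n s) w"
    unfolding Hn_def using Hl_attained by metis
  have "\<bar>pn n s \<bullet> f (Yn n s) w\<bar> \<le> cP B * N"
    by (rule order_trans[OF Cauchy_Schwarz_ineq2]) (use s pn_bound f_le[OF w(1)] const_pos(2)[OF B1] in \<open>auto intro!: mult_mono\<close>)
  moreover have "\<bar>a n * r (Yn n s) w\<bar> \<le> B * RB"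
  proof -
    have "L * norm (Yn n s) \<le> L * (XB + N * B)" using Yn_norm[of s n] s L_pos by (intro mult_left_mono) auto
    then have "\<bar>r (Yn n s) w\<bar> \<le> RB" using r_bound[OF w(1), of "Yn n s"] by (simp add: RB_def)
    then show ?thesis unfolding abs_mult using E(4,11)[of n] B1 by (intro mult_mono) auto
  qed
  ultimately show ?thesis unfolding w(2) HB_def by linarith
qed

lemma psi_bound: "s \<in> {0..B} \<Longrightarrow> psi n s \<le> 2 * HB"
  using pf_bound[of s n] Hn_bound[of s n] unfolding psi_def by linarith

lemma Hn_lim: "s \<in> {0..B} \<Longrightarrow> (\<lambda>n. Hn n s) \<longlonglongrightarrow> Hb s"
  unfolding Hn_def Hb_def by (intro Hl_tendsto alim ylim Plim)

lemma pn_cont: "continuous_on {0..B} (pn n)"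
  by (rule AC_imp_continuous_on[OF lipschitz_imp_AC[of _ _ _ Lp]]) (use pn_lip in auto)

lemma Yn_cont: "continuous_on {0..B} (Yn n)"
  by (rule continuous_on_subset[OF traj_continuous[OF E(1)]]) auto

lemma Hn_cont: "continuous_on {0..B} (Hn n)"
  unfolding continuous_on_def
proof
  fix s assume s: "s \<in> {0..B}"
  show "(Hn n \<longlongrightarrow> Hn n s) (at s within {0..B})" unfolding Hn_def
    by (intro Hl_tendsto tendsto_const) (use s Yn_cont pn_cont in \<open>auto simp: continuous_on_def\<close>)
qed

lemma Hb_cont: "continuous_on {0..B} Hb"
  unfolding continuous_on_def
proof
  fix s assume s: "s \<in> {0..B}"
  show "(Hb \<longlongrightarrow> Hb s) (at s within {0..B})" unfolding Hb_def
    by (intro Hl_tendsto tendsto_const) (use s y_cont P_cont in \<open>auto simp: continuous_on_def\<close>)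
qed

lemma Hn_integrable: "0 \<le> s \<Longrightarrow> t \<le> B \<Longrightarrow> Hn n integrable_on {s..t}"
  by (intro integrable_continuous_interval continuous_on_subset[OF Hn_cont]) auto

lemma psi_integrable: "0 \<le> s \<Longrightarrow> t \<le> B \<Longrightarrow> psi n integrable_on {s..t}"
  unfolding psi_def by (intro integrable_add integrable_on_mult_right pnf_integrable(1) r_integrable[OF E(1)] Hn_integrable)

lemma psi_measurable: "psi n \<in> borel_measurable (lebesgue_on {0..B})"
  unfolding psi_def using r_measurable[OF E(1) order_refl] pnf_integrable(2)[of 0 B n] B1
    continuous_imp_measurable_on_sets_lebesgue[OF Hn_cont]
  by (intro borel_measurable_add borel_measurable_times borel_measurable_const) auto

lemma psi_integral:
  assumes t: "0 \<le> t" "t \<le> B"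
  shows "integral {0..t} (psi n) = \<phi> n t + integral {0..t} (Hn n)"
  unfolding psi_def \<phi>_def
  by (rule integral_add) (intro integrable_add integrable_on_mult_right pnf_integrable(1) r_integrable[OF E(1)] Hn_integrable order_refl t)+

lemma Hn_integral_lim:
  assumes t: "0 \<le> t" "t \<le> B"
  shows "(\<lambda>n. integral {0..t} (Hn n)) \<longlonglongrightarrow> integral {0..t} Hb"
  by (rule dominated_convergence_negligible[OF negligible_empty, where C=HB])
    (use t Hn_integrable Hn_bound Hn_lim in auto)

text \<open>The integrals of \<phi>'s integrand and of \<open>Hn\<close> add up to that of
  \<open>psi\<close>, which is nonnegative, and \<phi> is asymptotically at most 0.\<close>

lemma Hb_integral_nonneg:
  assumes t: "0 \<le> t" "t < tau'"
  shows "0 \<le> integral {0..t} Hb"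
proof (rule field_le_epsilon)
  fix e :: real assume e: "e > 0"
  have tB: "t \<le> B" using t tau'_in by auto
  have "\<forall>\<^sub>F n in sequentially. - e \<le> integral {0..t} (Hn n)"
    using \<phi>_limsup[OF t e]
  proof eventually_elim
    case (elim n)
    have "0 \<le> integral {0..t} (psi n)" by (rule integral_nonneg[OF psi_integrable]) (use t tB psi_nonneg in auto)
    then show ?case using psi_integral[OF t(1) tB, of n] elim by linarith
  qed
  then have "- e \<le> integral {0..t} Hb" using tendsto_le[OF sequentially_bot Hn_integral_lim[OF t(1) tB] tendsto_const] by blast
  then show "0 \<le> integral {0..t} Hb + e" by simp
qed

text \<open>A continuous function that is nonpositive and has a nonnegative integral vanishes. The
  interval is taken slightly beyond \<open>s\<close> so that its length is positive.\<close>

lemma Hb_zero: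
  assumes s: "0 \<le> s" "s < tau'"
  shows "Hb s = 0"
proof -
  define t where "t = (s + tau') / 2"
  have t: "0 \<le> t" "t < tau'" "s \<le> t" "0 < t" "t \<le> B" using s tau'_in by (auto simp: t_def)
  have c: "continuous_on {0..t} Hb" by (rule continuous_on_subset[OF Hb_cont]) (use t in auto)
  have np: "Hb \<sigma> \<le> 0" if "\<sigma> \<in> {0..t}" for \<sigma> unfolding Hb_def by (rule Hl_nonpos) (use that t in auto)
  have "integral {0..t} Hb \<le> 0"
    using integral_nonneg[OF integrable_neg[OF integrable_continuous_interval[OF c]]] np by simp
  then have "integral {0..t} Hb = 0" using Hb_integral_nonneg[OF t(1,2)] by simp
  then have "integral {0..t} (\<lambda>\<sigma>. - Hb \<sigma>) = 0" by simp
  moreover have "continuous_on {0..t} (\<lambda>\<sigma>. - Hb \<sigma>)" by (intro continuous_intros c)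
  ultimately have "\<forall>\<sigma>\<in>{0..t}. - Hb \<sigma> = 0" using integral_eq_0_iff[of 0 t "\<lambda>\<sigma>. - Hb \<sigma>"] np t(4) by auto
  then show ?thesis using s t by auto
qed

lemma psi_integral_lim: "(\<lambda>n. integral {0..tau'} (psi n)) \<longlonglongrightarrow> 0"
proof (rule LIMSEQ_I)
  fix e :: real assume e: "e > 0"
  have HB: "0 \<le> HB" using Hn_bound[of 0 0] B1 by auto
  \<comment> \<open>Close enough to \<open>tau'\<close> for the bound \<open>2 * HB\<close> on
    \<open>psi\<close> to contribute at most half of \<open>e\<close>.\<close>
  define t where "t = max 0 (tau' - e / (4 * (HB + 1)))"
  have t: "0 \<le> t" "t < tau'" using tau'_pos e HB by (auto simp: t_def intro!: divide_pos_pos)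
  then have t3: "t \<le> B" using tau'_in by simp
  note t = t t3
  have tB: "tau' \<le> B" using tau'_in by simp
  have "2 * HB * (tau' - t) \<le> 2 * (HB + 1) * (e / (4 * (HB + 1)))"
    using HB t by (intro mult_mono) (auto simp: t_def)
  also have "\<dots> = e / 2"
  proof -
    have "HB + 1 \<noteq> 0" using HB by simp
    then show ?thesis by (simp add: divide_simps)
  qed
  finally have small: "2 * HB * (tau' - t) \<le> e / 2" .
  have "integral {0..t} Hb = integral {0..t} (\<lambda>_. 0)"
    by (rule integral_cong) (use Hb_zero t in auto)
  then have "(\<lambda>n. integral {0..t} (Hn n)) \<longlonglongrightarrow> 0" using Hn_integral_lim[OF t(1,3)] by simp
  then have "\<forall>\<^sub>F n in sequentially. integral {0..t} (Hn n) < e / 4" using e by (intro order_tendstoD) auto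
  moreover have "\<forall>\<^sub>F n in sequentially. \<phi> n t < e / 4" by (rule \<phi>_limsup[OF t(1,2)]) (use e in simp)
  ultimately have "\<forall>\<^sub>F n in sequentially. norm (integral {0..tau'} (psi n) - 0) < e"
  proof eventually_elim
    case (elim n)
    have i: "psi n integrable_on {0..tau'}" "psi n integrable_on {t..tau'}" using psi_integrable t tB by auto
    have 1: "integral {0..tau'} (psi n) = integral {0..t} (psi n) + integral {t..tau'} (psi n)"
      by (rule Henstock_Kurzweil_Integration.integral_combine[symmetric]) (use t i in auto)
    have "integral {t..tau'} (psi n) \<le> integral {t..tau'} (\<lambda>_. 2 * HB)"
      by (rule integral_le) (use i psi_bound t tB in auto)
    moreover have "integral {t..tau'} (\<lambda>_. 2 * HB) = 2 * HB * (tau' - t)" using t by simp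
    ultimately have 2: "integral {t..tau'} (psi n) \<le> e / 2" using small by linarith
    have 3: "integral {0..t} (psi n) < e / 2" using psi_integral[OF t(1,3), of n] elim by linarith
    have "0 \<le> integral {0..tau'} (psi n)" by (rule integral_nonneg[OF i(1)]) (use psi_nonneg in auto)
    then show ?case using 1 2 3 by simp
  qed
  then show "\<exists>no. \<forall>n\<ge>no. norm (integral {0..tau'} (psi n) - 0) < e" unfolding eventually_sequentially .
qed

lemma tau'_sub: "{0..tau'} \<subseteq> {0..B}" using tau'_in by auto

lemma psi_AE_subseq:
  obtains k Z where "strict_mono (k :: nat \<Rightarrow> nat)" "negligible Z" "\<And>s. s \<in> {0..tau'} - Z \<Longrightarrow> (\<lambda>n. psi (k n) s) \<longlonglongrightarrow> 0"
proof -
  have m: "psi n \<in> borel_measurable (lebesgue_on {0..tau'})" for n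
    by (rule measurable_lebesgue_on_subset[OF psi_measurable tau'_sub]) simp
  have i: "integrable (lebesgue_on {0..tau'}) (psi n)" for n
    by (rule integrable_lebesgue_on_bounded[OF m, where M="2 * HB"])
      (use psi_bound psi_nonneg tau'_sub in \<open>auto simp: subset_iff\<close>)
  have "(LINT s|lebesgue_on {0..tau'}. norm (psi n s)) = integral {0..tau'} (psi n)" for n
  proof -
    have "(LINT s|lebesgue_on {0..tau'}. norm (psi n s)) = (LINT s|lebesgue_on {0..tau'}. psi n s)"
      by (rule Bochner_Integration.integral_cong) (use psi_nonneg in auto)
    also have "\<dots> = integral {0..tau'} (psi n)" by (rule lebesgue_integral_eq_integral[OF i]) simp
    finally show ?thesis .
  qed
  then have "(\<lambda>n. LINT s|lebesgue_on {0..tau'}. norm (psi n s)) \<longlonglongrightarrow> 0" using psi_integral_lim by simp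
  from tendsto_L1_AE_subseq[OF i this] obtain k :: "nat \<Rightarrow> nat" where k: "strict_mono k"
    "AE s in lebesgue_on {0..tau'}. (\<lambda>n. psi (k n) s) \<longlonglongrightarrow> 0" by blast
  then have "negligible {s \<in> {0..tau'}. \<not> (\<lambda>n. psi (k n) s) \<longlonglongrightarrow> 0}"
    by (subst (asm) AE_lebesgue_on_iff_negligible) auto
  then show ?thesis by (rule that[OF k(1)]) auto
qed

text \<open>The Hamiltonian is smooth only for nonzero covectors, so this has to be excluded. If
  \<open>P s = 0\<close>, the vanishing Hamiltonian and r \<ge> r0 force \<open>lam = 0\<close>;
  then the homogeneous adjoint bound carries the zero back to time 0, against
  \<open>nz\<close>.\<close>

lemma P_nonzero:
  assumes s: "0 \<le> s" "s < tau'"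
  shows "P s \<noteq> 0"
proof
  assume P0': "P s = 0"
  have sB: "s \<in> {0..B}" using s tau'_in by auto
  obtain w where w: "w \<in> U" "Hl lam (y s) (P s) = - (P s \<bullet> f (y s) w) - lam * r (y s) w" using Hl_attained by metis
  then have "lam * r (y s) w = 0" using Hb_zero[OF s] P0' by (simp add: Hb_def)
  then have lam0: "lam = 0" using r_ge[OF w(1), of "y s"] r0_pos by auto
  have "norm \<pi> \<le> (norm (P s) + lam * L * B) * exp (2 * L * B)"
  proof (rule tendsto_le[OF sequentially_bot _ tendsto_norm[OF plim]])
    show "(\<lambda>n. (norm (pn n s) + a n * L * B) * exp (2 * L * B)) \<longlonglongrightarrow> (norm (P s) + lam * L * B) * exp (2 * L * B)"
      by (intro tendsto_intros Plim[OF sB] alim)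
    show "\<forall>\<^sub>F n in sequentially. norm (p n 0) \<le> (norm (pn n s) + a n * L * B) * exp (2 * L * B)"
      using ev_before[OF s(2)]
    proof eventually_elim
      case (elim n)
      have "norm (p n 0) \<le> (norm (p n s) + a n * L * tau n) * exp (2 * L * tau n)"
        by (rule adjoint_bound[OF E(5,1,4)]) (use elim s E(13)[of n] in auto)
      also have "\<dots> \<le> (norm (p n s) + a n * L * B) * exp (2 * L * B)"
        using E(4,10,13)[of n] L_pos B1 by (intro mult_mono add_mono mult_left_mono) auto
      finally show ?case using elim by simp
    qed
  qed
  then have "\<pi> = 0" using P0' lam0 by simp
  with lam0 nz show False by simp
qed

definition "argmax s w \<longleftrightarrow> w \<in> U \<and> - (P s \<bullet> f (y s) w) - lam * r (y s) w = Hb s"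

definition "rate s w = adj_rate lam (y s) w (P s)"

lemma argmax_unique:
  assumes s: "0 \<le> s" "s < tau'" and w: "argmax s w" "argmax s w'"
  shows "f (y s) w = f (y s) w'" "rate s w = rate s w'"
proof -
  note e = envelope[OF hdiff[OF P_nonzero[OF s]], of w "y s" w'] 
  show "f (y s) w = f (y s) w'" using e(1) w unfolding argmax_def Hb_def by blast
  have "transpose (Dxf f (y s) w) *v P s + lam *\<^sub>R Dxr r (y s) w = transpose (Dxf f (y s) w') *v P s + lam *\<^sub>R Dxr r (y s) w'"
    using e(2) w unfolding argmax_def Hb_def by blast
  then have "- (transpose (Dxf f (y s) w) *v P s + lam *\<^sub>R Dxr r (y s) w) = - (transpose (Dxf f (y s) w') *v P s + lam *\<^sub>R Dxr r (y s) w')" by simp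
  then show "rate s w = rate s w'" unfolding rate_def by (simp only: minus_add_distrib add_uminus_conv_diff)
qed

lemma cluster_argmax:
  assumes s: "0 \<le> s" "s < tau'" and k: "strict_mono (k :: nat \<Rightarrow> nat)" and z: "(\<lambda>n. psi (k n) s) \<longlonglongrightarrow> 0"
    and w: "w \<in> U" "(\<lambda>n. u (k n) s) \<longlonglongrightarrow> w"
  shows "argmax s w" "(\<lambda>n. fn (k n) s) \<longlonglongrightarrow> f (y s) w" "(\<lambda>n. rn (k n) s) \<longlonglongrightarrow> r (y s) w"
    "(\<lambda>n. - (transpose (Dxf f (Yn (k n) s) (u (k n) s)) *v pn (k n) s) - a (k n) *\<^sub>R Dxr r (Yn (k n) s) (u (k n) s)) \<longlonglongrightarrow> rate s w"
proof -
  have sB: "s \<in> {0..B}" using s tau'_in by auto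
  note sub = tendsto_subseq[OF k]
  note Yl = sub[OF ylim[OF sB]] and Pl = sub[OF Plim[OF sB]] and al = sub[OF alim] and Hnl = sub[OF Hn_lim[OF sB]]
  have uU: "u (k n) s \<in> U" for n by (rule un_in[OF s(1)])
  show fl: "(\<lambda>n. fn (k n) s) \<longlonglongrightarrow> f (y s) w" by (rule f_tendsto[OF Yl w(2) uU w(1)])
  show rl: "(\<lambda>n. rn (k n) s) \<longlonglongrightarrow> r (y s) w" by (rule r_tendsto[OF Yl w(2) uU w(1)])
  show "(\<lambda>n. - (transpose (Dxf f (Yn (k n) s) (u (k n) s)) *v pn (k n) s) - a (k n) *\<^sub>R Dxr r (Yn (k n) s) (u (k n) s)) \<longlonglongrightarrow> rate s w"
    unfolding rate_def by (rule adjoint_rate_tendsto[OF Yl w(2) uU w(1) Pl al])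
  have "(\<lambda>n. psi (k n) s) \<longlonglongrightarrow> P s \<bullet> f (y s) w + lam * r (y s) w + Hb s"
    unfolding psi_def by (intro tendsto_intros Pl fl al rl Hnl)
  from LIMSEQ_unique[OF this z] show "argmax s w" unfolding argmax_def using w(1) by simp
qed

text \<open>The controls need not converge. Each of their cluster values is a maximizer, and all
  maximizers give the same velocity and the same adjoint rate, so these two do converge.\<close>

lemma rates_converge:
  assumes s: "0 \<le> s" "s < tau'" and k: "strict_mono (k :: nat \<Rightarrow> nat)" and z: "(\<lambda>n. psi (k n) s) \<longlonglongrightarrow> 0" and w: "argmax s w"
  shows "(\<lambda>n. fn (k n) s) \<longlonglongrightarrow> f (y s) w"
    "(\<lambda>n. - (transpose (Dxf f (Yn (k n) s) (u (k n) s)) *v pn (k n) s) - a (k n) *\<^sub>R Dxr r (Yn (k n) s) (u (k n) s)) \<longlonglongrightarrow> rate s w"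
proof -
  have sub: "strict_mono (\<lambda>n. k (j n))" "(\<lambda>n. psi (k (j n)) s) \<longlonglongrightarrow> 0" if j: "strict_mono (j :: nat \<Rightarrow> nat)" for j
    using LIMSEQ_subseq_LIMSEQ[OF z j] strict_mono_o[OF k j] by (simp_all add: o_def)
  show "(\<lambda>n. fn (k n) s) \<longlonglongrightarrow> f (y s) w"
  proof (rule tendsto_of_cluster_values[OF U_compact, of "\<lambda>n. u (k n) s"])
    fix j w' assume j: "strict_mono (j :: nat \<Rightarrow> nat)" and w': "w' \<in> U" "(\<lambda>n. u (k (j n)) s) \<longlonglongrightarrow> w'"
    note c = cluster_argmax[OF s sub[OF j] w']
    show "(\<lambda>n. fn (k (j n)) s) \<longlonglongrightarrow> f (y s) w" using c(2) argmax_unique(1)[OF s c(1) w] by simp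
  qed (rule un_in[OF s(1)])
  show "(\<lambda>n. - (transpose (Dxf f (Yn (k n) s) (u (k n) s)) *v pn (k n) s) - a (k n) *\<^sub>R Dxr r (Yn (k n) s) (u (k n) s)) \<longlonglongrightarrow> rate s w"
  proof (rule tendsto_of_cluster_values[OF U_compact, of "\<lambda>n. u (k n) s"])
    fix j w' assume j: "strict_mono (j :: nat \<Rightarrow> nat)" and w': "w' \<in> U" "(\<lambda>n. u (k (j n)) s) \<longlonglongrightarrow> w'"
    note c = cluster_argmax[OF s sub[OF j] w']
    show "(\<lambda>n. - (transpose (Dxf f (Yn (k (j n)) s) (u (k (j n)) s)) *v pn (k (j n)) s) - a (k (j n)) *\<^sub>R Dxr r (Yn (k (j n)) s) (u (k (j n)) s)) \<longlonglongrightarrow> rate s w"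
      using c(4) unfolding argmax_unique(2)[OF s c(1) w] .
  qed (rule un_in[OF s(1)])
qed

lemma rint_lim: "(\<lambda>n. rint (X n) (u n) 0 tau') \<longlonglongrightarrow> v x - g (y tau')"
proof -
  have XR: "X n \<in> Reach" for n using E(1,2) reachable_iff by blast
  have vl: "(\<lambda>n. v (X n)) \<longlonglongrightarrow> v x"
    by (rule continuous_on_tendsto_compose[OF v_continuous[OF Vc] Xlim xr]) (use XR in auto)
  have Jl: "(\<lambda>n. J (X n) (u n)) \<longlonglongrightarrow> v x"
  proof (rule tendsto_sandwich[OF _ _ vl])
    show "\<forall>\<^sub>F n in sequentially. v (X n) \<le> J (X n) (u n)" using v_le_J[OF E(1,2)] by auto
    show "\<forall>\<^sub>F n in sequentially. J (X n) (u n) \<le> v (X n) + \<epsilon> n" by (intro always_eventually allI less_imp_le Jn)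
    show "(\<lambda>n. v (X n) + \<epsilon> n) \<longlonglongrightarrow> v x" using tendsto_add[OF vl \<epsilon>lim] by simp
  qed
  have "(\<lambda>n. rint (X n) (u n) 0 tau' - rint (X n) (u n) 0 (tau n)) \<longlonglongrightarrow> 0"
  proof (rule tendsto_zero_if_bounded)
    show "norm (rint (X n) (u n) 0 tau' - rint (X n) (u n) 0 (tau n)) \<le> RB * \<bar>tau' - tau n\<bar>" for n
    proof (cases "tau' \<le> tau n")
      case True
      then show ?thesis
        using rint_combine[OF E(1) order_refl _ True, of "X n" n] rint_bound[of tau' "tau n" n] tau'_in E(10)[of n] by auto
    next
      case False
      then show ?thesis
        using rint_combine[OF E(1) order_refl E(13), of n tau' "X n" n] rint_bound[of "tau n" tau' n] tau'_in E(13)[of n] by auto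
    qed
    show "(\<lambda>n. RB * \<bar>tau' - tau n\<bar>) \<longlonglongrightarrow> RB * \<bar>tau' - tau'\<bar>" by (intro tendsto_intros taulim)
  qed simp
  moreover have "(\<lambda>n. rint (X n) (u n) 0 (tau n)) \<longlonglongrightarrow> v x - g (y tau')"
  proof -
    have "rint (X n) (u n) 0 (tau n) = J (X n) (u n) - g (Yn n (tau n))" for n using cost_eq[OF E(1,2)] by simp
    then show ?thesis using tendsto_diff[OF Jl g_exit_lim] by simp
  qed
  ultimately show ?thesis using tendsto_add by fastforce
qed

end

section \<open>An optimal control for the limit arc\<close>

context limit_problem
begin

definition "adj n s = - (transpose (Dxf f (Yn n s) (u n s)) *v pn n s) - a n *\<^sub>R Dxr r (Yn n s) (u n s)"

lemma adj_measurable: "adj n \<in> borel_measurable (lebesgue_on {0..tau'})"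
  unfolding adj_def by (rule adjoint_measurable[OF E(1)]) (rule continuous_on_subset[OF pn_cont tau'_sub])

lemma adj_bound: "s \<in> {0..tau'} \<Longrightarrow> norm (adj n s) \<le> L * cP B + B * L"
proof -
  assume s: "s \<in> {0..tau'}"
  have "norm (adj n s) \<le> L * norm (pn n s) + a n * L"
    unfolding adj_def by (rule adjoint_rate_bound[OF E(1) _ E(4)]) (use s in auto)
  also have "\<dots> \<le> L * cP B + B * L"
    using pn_bound[of s n] s E(11)[of n] L_pos by (intro add_mono mult_left_mono mult_right_mono) auto
  finally show ?thesis .
qed

lemma adj_integral:
  assumes t: "0 \<le> t" "t \<le> tau'" "t \<le> tau n"
  shows "pn n t = p n 0 + integral {0..t} (adj n)"
proof -
  have "p n t = p n 0 + integral {0..t} (\<lambda>s. - (transpose (Dxf f (Yn n s) (u n s)) *v p n s) - a n *\<^sub>R Dxr r (Yn n s) (u n s))"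
    by (rule bounded_rate_eq[OF E(5)[unfolded adjoint_def]]) (use t in auto)
  also have "integral {0..t} (\<lambda>s. - (transpose (Dxf f (Yn n s) (u n s)) *v p n s) - a n *\<^sub>R Dxr r (Yn n s) (u n s)) = integral {0..t} (adj n)"
    by (rule integral_cong) (use t in \<open>auto simp: adj_def min_def\<close>)
  finally show ?thesis using t by (simp add: min_def)
qed

text \<open>For \<open>lam = 0\<close> maximizers with the same velocity may differ in running cost,
  so the velocity does not determine the cost of a selected control. The selection therefore
  prescribes the cost as well, and the lower limit is the value that Fatou's lemma can
  handle.\<close>

definition "minrate k s = enn2real (liminf (\<lambda>n. ennreal (rn (k n) s)))"

text \<open>Pass first to a subsequence that realizes the lower limit of the running costs and then
  to one along which the controls converge.\<close>

lemma cluster_point: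
  assumes s: "0 \<le> s" "s < tau'" and k: "strict_mono (k :: nat \<Rightarrow> nat)" and z: "(\<lambda>n. psi (k n) s) \<longlonglongrightarrow> 0"
  obtains w where "argmax s w" "r (y s) w = minrate k s"
proof -
  obtain j where j: "strict_mono j" "((\<lambda>n. ennreal (rn (k n) s)) \<circ> j) \<longlonglongrightarrow> liminf (\<lambda>n. ennreal (rn (k n) s))"
    using liminf_subseq_lim by blast
  have "\<forall>n. u (k (j n)) s \<in> U" using un_in[OF s(1)] by blast
  then obtain w i where w: "w \<in> U" "strict_mono i" "((\<lambda>n. u (k (j n)) s) \<circ> i) \<longlonglongrightarrow> w"
    using U_compact unfolding compact_def by meson
  define h where "h n = k (j (i n))" for n
  have h: "strict_mono h" unfolding h_def using strict_mono_o[OF k strict_mono_o[OF j(1) w(2)]] by (simp add: o_def)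
  have ji: "strict_mono (j \<circ> i)" by (rule strict_mono_o[OF j(1) w(2)])
  have "(\<lambda>n. psi (h n) s) \<longlonglongrightarrow> 0" using LIMSEQ_subseq_LIMSEQ[OF z ji] by (simp add: o_def h_def)
  note c = cluster_argmax[OF s h this w(1) w(3)[unfolded o_def, folded h_def]]
  have "(\<lambda>n. ennreal (rn (h n) s)) \<longlonglongrightarrow> liminf (\<lambda>n. ennreal (rn (k n) s))"
    using LIMSEQ_subseq_LIMSEQ[OF j(2) w(2)] by (simp add: o_def h_def)
  moreover have "(\<lambda>n. ennreal (rn (h n) s)) \<longlonglongrightarrow> ennreal (r (y s) w)" by (rule tendsto_ennrealI[OF c(3)])
  ultimately have "liminf (\<lambda>n. ennreal (rn (k n) s)) = ennreal (r (y s) w)" by (rule LIMSEQ_unique)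
  then have "r (y s) w = minrate k s" using r_ge[OF w(1), of "y s"] r0_pos by (simp add: minrate_def)
  with c(1) show ?thesis by (rule that)
qed

lemma optimal_selection:
  assumes k: "strict_mono (k :: nat \<Rightarrow> nat)" and Z: "negligible Z"
    and conv: "\<And>s. s \<in> {0..tau'} - Z \<Longrightarrow> (\<lambda>n. psi (k n) s) \<longlonglongrightarrow> 0"
  obtains \<sigma> where "\<sigma> \<in> controls U" "\<And>s. s \<in> {0..<tau'} - Z \<Longrightarrow> argmax s (\<sigma> s) \<and> r (y s) (\<sigma> s) = minrate k s"
proof -
  define A where "A = {0..<tau'} - Z"
  \<comment> \<open>Stopping the time at \<open>tau'\<close> defines the data of the selection
    problem on all of \<open>{0..}\<close>, where controls live.\<close>
  define c where "c s = min s tau'" for s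
  define M where "M = lebesgue_on {0::real..}"
  \<comment> \<open>On \<open>A\<close> its zeros are the maximizers with the prescribed running
    cost; elsewhere every control value is a zero, so that zeros exist at all times.\<close>
  define h where "h s w = (if s \<in> A then \<bar>P (c s) \<bullet> f (y (c s)) w + lam * r (y (c s)) w + Hb (c s)\<bar> + \<bar>r (y (c s)) w - minrate k s\<bar> else 0)" for s w
  have A: "A \<inter> space M \<in> sets M"
  proof -
    have "A \<in> sets lebesgue" unfolding A_def using Z by (intro sets.Diff) (auto intro: negligible_imp_sets)
    moreover have "A \<inter> {0..} = A" by (auto simp: A_def)
    ultimately show ?thesis unfolding M_def by (auto simp: sets_restrict_space space_restrict_space)
  qed
  have cc: "continuous_on {0..} (\<lambda>s. F (c s))" if "continuous_on {0..B} F" for F :: "real \<Rightarrow> 'z::topological_space"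
    by (rule continuous_on_compose2[OF that]) (use tau'_in in \<open>auto simp: c_def intro!: continuous_intros\<close>)
  have cm: "(\<lambda>s. F (c s)) \<in> borel_measurable M" if "continuous_on {0..B} F" for F :: "real \<Rightarrow> 'z::euclidean_space"
    unfolding M_def by (rule continuous_imp_measurable_on_sets_lebesgue[OF cc[OF that]]) simp
  have fm: "(\<lambda>s. f (y (c s)) w) \<in> borel_measurable M" "(\<lambda>s. r (y (c s)) w) \<in> borel_measurable M" if w: "w \<in> U" for w
    unfolding M_def using compose_measurable[OF f_cont const_control[OF w] order_refl _ cc[OF y_cont]]
      compose_measurable[OF r_cont const_control[OF w] order_refl _ cc[OF y_cont]] by auto
  have rm: "(\<lambda>s. rn (k n) s) \<in> borel_measurable M" for n
    unfolding M_def by (rule compose_measurable[OF r_cont E(1) order_refl _ traj_continuous[OF E(1)]]) simp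
  have mm: "minrate k \<in> borel_measurable M"
    unfolding minrate_def by (intro borel_measurable_enn2real borel_measurable_liminf measurable_compose[OF _ measurable_ennreal] rm)
  obtain \<sigma> where \<sigma>: "\<sigma> \<in> borel_measurable M" "\<And>t. t \<in> space M \<Longrightarrow> \<sigma> t \<in> U \<and> h t (\<sigma> t) = 0"
  proof (rule measurable_zero_selection[OF U_compact, of h M])
    show "(\<lambda>t. h t w) \<in> borel_measurable M" if w: "w \<in> U" for w
      unfolding h_def by (rule measurable_If_set[OF _ _ A])
        (intro borel_measurable_add borel_measurable_abs borel_measurable_inner borel_measurable_times borel_measurable_diff borel_measurable_const
          cm[OF P_cont] cm[OF Hb_cont] fm[OF w] mm)+
    show "continuous_on U (h t)" if "t \<in> space M" for t
    proof (cases "t \<in> A")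
      case True
      have pc: "continuous_on U (\<lambda>w. (z, w))" for z :: "real^'d" by (intro continuous_intros)
      have 1: "continuous_on U (\<lambda>w. f z w)" and 2: "continuous_on U (\<lambda>w. r z w)" for z
        using continuous_on_compose2[OF f_cont pc, of z] continuous_on_compose2[OF r_cont pc, of z] by auto
      have "continuous_on U (\<lambda>w. \<bar>P (c t) \<bullet> f (y (c t)) w + lam * r (y (c t)) w + Hb (c t)\<bar> + \<bar>r (y (c t)) w - minrate k t\<bar>)"
        by (intro continuous_intros 1 2)
      then show ?thesis using True by (simp add: h_def[abs_def])
    next
      case False
      then show ?thesis by (simp add: h_def[abs_def])
    qed
    show "0 \<le> h t w" for t w by (simp add: h_def)
    show "\<exists>w\<in>U. h t w = 0" for t
    proof (cases "t \<in> A")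
      case True
      then have t: "0 \<le> t" "t < tau'" "(\<lambda>n. psi (k n) t) \<longlonglongrightarrow> 0" using conv by (auto simp: A_def)
      obtain w where w: "argmax t w" "r (y t) w = minrate k t" using cluster_point[OF t(1,2) k t(3)] by blast
      then show ?thesis using t by (intro bexI[of _ w]) (auto simp: h_def c_def argmax_def)
    next
      case False
      then show ?thesis using U_ne by (auto simp: h_def)
    qed
  qed blast
  show ?thesis
  proof (rule that)
    show "\<sigma> \<in> controls U" using \<sigma> by (auto simp: controls_def M_def)
    fix s assume s: "s \<in> {0..<tau'} - Z"
    then have "s \<in> space M" "s \<in> A" "c s = s" by (auto simp: M_def A_def c_def)
    then show "argmax s (\<sigma> s) \<and> r (y s) (\<sigma> s) = minrate k s"
      using \<sigma>(2)[of s] by (simp add: h_def argmax_def) linarith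
  qed
qed

text \<open>Dominated convergence identifies \<open>y\<close> and \<open>P\<close> as the trajectory
  and adjoint arc of the selected control. Its optimality comes from Fatou's lemma.\<close>

theorem limit_transported: "transported lam x \<pi>"
proof -
  obtain k Z where k: "strict_mono (k :: nat \<Rightarrow> nat)" and Z: "negligible Z"
    and conv: "\<And>s. s \<in> {0..tau'} - Z \<Longrightarrow> (\<lambda>n. psi (k n) s) \<longlonglongrightarrow> 0" by (rule psi_AE_subseq) blast
  obtain \<sigma> where \<sigma>: "\<sigma> \<in> controls U" "\<And>s. s \<in> {0..<tau'} - Z \<Longrightarrow> argmax s (\<sigma> s) \<and> r (y s) (\<sigma> s) = minrate k s"
    using optimal_selection[OF k Z conv] by blast
  note sub = tendsto_subseq[OF k]
  \<comment> \<open>The maximum condition is known only before the limit exit time.\<close>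
  define Z' where "Z' = insert tau' Z"
  have Z': "negligible Z'" using Z by (simp add: Z'_def)
  have cvs: "(\<lambda>n. fn (k n) s) \<longlonglongrightarrow> f (y s) (\<sigma> s)" "(\<lambda>n. adj (k n) s) \<longlonglongrightarrow> rate s (\<sigma> s)" if "s \<in> {0..tau'} - Z'" for s
    unfolding adj_def using rates_converge[OF _ _ k conv, of s "\<sigma> s"] \<sigma>(2)[of s] that by (auto simp: Z'_def)
  have yc: "continuous_on {0..tau'} y" and Pc: "continuous_on {0..tau'} P"
    by (rule continuous_on_subset[OF y_cont tau'_sub], rule continuous_on_subset[OF P_cont tau'_sub])
  have y_eq: "y t = x + integral {0..t} (\<lambda>s. f (y s) (\<sigma> s))" if t: "t \<in> {0..tau'}" for t
  proof (rule LIMSEQ_unique)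
    show "(\<lambda>n. Yn (k n) t) \<longlonglongrightarrow> y t" by (rule sub[OF ylim]) (use t tau'_sub in auto)
    have "(\<lambda>n. integral {0..t} (fn (k n))) \<longlonglongrightarrow> integral {0..t} (\<lambda>s. f (y s) (\<sigma> s))"
    proof (rule dominated_convergence_negligible[OF Z', where C=N])
      show "fn (k n) integrable_on {0..t}" for n
        by (rule bounded_rate_integrable[OF traj_rate[OF E(1), where T=t]]) auto
    qed (use t cvs(1) f_le un_in in auto)
    then have "(\<lambda>n. X (k n) + integral {0..t} (fn (k n))) \<longlonglongrightarrow> x + integral {0..t} (\<lambda>s. f (y s) (\<sigma> s))"
      by (intro tendsto_add sub[OF Xlim])
    moreover have "Yn (k n) t = X (k n) + integral {0..t} (fn (k n))" for n
      using bounded_rate_eq[OF traj_rate[OF E(1)], of t t "X (k n)" "k n"] t traj_0[OF E(1)] by simp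
    ultimately show "(\<lambda>n. Yn (k n) t) \<longlonglongrightarrow> x + integral {0..t} (\<lambda>s. f (y s) (\<sigma> s))" by simp
  qed
  have yr: "bounded_rate y (\<lambda>t. f (y t) (\<sigma> t)) 0 tau'"
    unfolding bounded_rate_def
  proof (intro conjI)
    show "(\<lambda>t. f (y t) (\<sigma> t)) \<in> borel_measurable (lebesgue_on {0..tau'})"
      by (rule compose_measurable[OF f_cont \<sigma>(1) _ _ yc]) auto
    show "\<exists>M. \<forall>t\<in>{0..tau'}. norm (f (y t) (\<sigma> t)) \<le> M" by (intro exI[of _ N] ballI f_le controls_in[OF \<sigma>(1)]) auto
    show "\<forall>t\<in>{0..tau'}. y t = y 0 + integral {0..t} (\<lambda>t. f (y t) (\<sigma> t))" unfolding y0 using y_eq by blast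
  qed
  have yY: "y t = Y x \<sigma> t" if "t \<in> {0..tau'}" for t
    using traj_unique[OF \<sigma>(1) yr that] unfolding y0 .
  define rt where "rt t = adj_rate lam (Y x \<sigma> t) (\<sigma> t) (P t)" for t
  have rt: "rt s = rate s (\<sigma> s)" if "s \<in> {0..tau'}" for s using yY[OF that] by (simp add: rt_def rate_def)
  have rtm: "rt \<in> borel_measurable (lebesgue_on {0..tau'})" unfolding rt_def by (rule adjoint_measurable[OF \<sigma>(1) Pc])
  have rtb: "norm (rt t) \<le> L * cP B + lam * L" if t: "t \<in> {0..tau'}" for t
  proof -
    have "norm (P t) \<le> cP B" using Plim[of t] pn_bound[of t] t tau'_sub
      by (intro LIMSEQ_le_const2[OF tendsto_norm[OF Plim]]) auto
    then have "L * norm (P t) \<le> L * cP B" using L_pos by simp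
    moreover have "norm (rt t) \<le> L * norm (P t) + lam * L"
      unfolding rt_def by (rule adjoint_rate_bound[OF \<sigma>(1) _ lam_nonneg]) (use t in auto)
    ultimately show ?thesis by linarith
  qed
  have rti: "rt integrable_on {0..tau'}" by (rule bounded_measurable_integrable_on[OF rtm rtb])
  \<comment> \<open>The exit times may approach \<open>tau'\<close> from below, so the integral
    equation of the n-th arc holds eventually only for times before \<open>tau'\<close>. The end
    point follows by continuity in \<open>P_eq\<close>.\<close>
  have P_eq': "P t = \<pi> + integral {0..t} rt" if t: "0 \<le> t" "t < tau'" for t
  proof (rule LIMSEQ_unique)
    show "(\<lambda>n. pn (k n) t) \<longlonglongrightarrow> P t" by (rule sub[OF Plim]) (use t tau'_sub in auto)
    have "(\<lambda>n. integral {0..t} (adj (k n))) \<longlonglongrightarrow> integral {0..t} rt"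
    proof (rule dominated_convergence_negligible[OF Z'])
      show "adj (k n) integrable_on {0..t}" for n
        by (rule integrable_on_subinterval[OF bounded_measurable_integrable_on[OF adj_measurable adj_bound]]) (use t in auto)
      show "norm (adj (k n) s) \<le> L * cP B + B * L" if "s \<in> {0..t}" for n s by (rule adj_bound) (use that t in auto)
      show "(\<lambda>n. adj (k n) s) \<longlonglongrightarrow> rt s" if "s \<in> {0..t} - Z'" for s using cvs(2)[of s] rt[of s] that t by auto
    qed
    then have l: "(\<lambda>n. p (k n) 0 + integral {0..t} (adj (k n))) \<longlonglongrightarrow> \<pi> + integral {0..t} rt"
      by (intro tendsto_add sub[OF plim])
    have "\<forall>\<^sub>F n in sequentially. t < tau (k n)" using order_tendstoD(1)[OF sub[OF taulim] t(2)] .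
    then have "\<forall>\<^sub>F n in sequentially. p (k n) 0 + integral {0..t} (adj (k n)) = pn (k n) t"
    proof eventually_elim
      case (elim n)
      show ?case by (rule adj_integral[symmetric]) (use elim t in auto)
    qed
    with l show "(\<lambda>n. pn (k n) t) \<longlonglongrightarrow> \<pi> + integral {0..t} rt" by (rule Lim_transform_eventually)
  qed
  have P_eq: "P t - integral {0..t} rt = \<pi>" if t: "t \<in> {0..tau'}" for t
  proof (rule continuous_constant_on_closure[where S="{0..<tau'}"])
    show "continuous_on (closure {0..<tau'}) (\<lambda>t. P t - integral {0..t} rt)"
      using tau'_pos by (simp, intro continuous_intros Pc indefinite_integral_continuous_1 rti)
    show "P s - integral {0..s} rt = \<pi>" if "s \<in> {0..<tau'}" for s using P_eq'[of s] that by simp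
    show "t \<in> closure {0..<tau'}" using t tau'_pos by simp
  qed
  have adjP: "adjoint lam x \<sigma> P tau'"
    unfolding adjoint_def bounded_rate_def rt_def[symmetric, abs_def]
  proof (intro conjI)
    show "\<exists>M. \<forall>t\<in>{0..tau'}. norm (rt t) \<le> M" using rtb by blast
    show "\<forall>t\<in>{0..tau'}. P t = P 0 + integral {0..t} rt" using P_eq unfolding P0 by (simp add: diff_eq_eq)
  qed (rule rtm)
  have hit: "first_hit x \<sigma> tau'"
    unfolding first_hit_def using yY y_notin exit_frontier' frontier_sub(1) tau'_in by force
  have yend: "Y x \<sigma> tau' = y tau'" using yY[of tau'] tau'_in by simp
  \<comment> \<open>The selected running cost is the lower limit of the running costs along the
    sequence, whose integrals converge to the limit value minus the terminal cost.\<close>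
  have "rint x \<sigma> 0 tau' \<le> v x - g (y tau')"
  proof -
    let ?M = "lebesgue_on {0..tau'}"
    have nn: "(\<integral>\<^sup>+ s. ennreal (r (Y z w s) (w s)) \<partial>?M) = ennreal (rint z w 0 tau')" if w: "w \<in> controls U" for z w
    proof -
      have i: "integrable ?M (\<lambda>s. r (Y z w s) (w s))"
        by (rule integrable_lebesgue_on_bounded[OF r_measurable[OF w order_refl], where M="R0 + L * (norm z + N * tau')"]) (use r_traj_bound[OF w] in simp)
      have "(\<integral>\<^sup>+ s. ennreal (r (Y z w s) (w s)) \<partial>?M) = ennreal (LINT s|?M. r (Y z w s) (w s))"
        by (rule nn_integral_eq_integral[OF i]) (use r_ge[OF controls_in[OF w]] r0_pos in \<open>auto intro!: AE_I2 intro: order_trans less_imp_le\<close>)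
      also have "(LINT s|?M. r (Y z w s) (w s)) = rint z w 0 tau'"
        unfolding rint_def by (rule lebesgue_integral_eq_integral[OF i]) simp
      finally show ?thesis .
    qed
    have "ennreal (rint x \<sigma> 0 tau') = (\<integral>\<^sup>+ s. liminf (\<lambda>n. ennreal (rn (k n) s)) \<partial>?M)"
      unfolding nn[OF \<sigma>(1), symmetric]
    proof (rule nn_integral_cong_AE)
      have "ennreal (r (Y x \<sigma> s) (\<sigma> s)) = liminf (\<lambda>n. ennreal (rn (k n) s))" if s: "s \<in> {0..tau'}" "s \<notin> Z'" for s
      proof -
        have "liminf (\<lambda>n. ennreal (rn (k n) s)) \<le> ennreal RB"
          using rn_bound[of s] s tau'_sub by (intro Liminf_le always_eventually allI ennreal_leI) (auto simp: abs_le_iff)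
        then have "liminf (\<lambda>n. ennreal (rn (k n) s)) < top" by (rule le_less_trans) simp
        then show ?thesis using \<sigma>(2)[of s] s yY[of s] by (simp add: Z'_def minrate_def)
      qed
      then have "{s \<in> {0..tau'}. \<not> ennreal (r (Y x \<sigma> s) (\<sigma> s)) = liminf (\<lambda>n. ennreal (rn (k n) s))} \<subseteq> Z'" by blast
      then show "AE s in ?M. ennreal (r (Y x \<sigma> s) (\<sigma> s)) = liminf (\<lambda>n. ennreal (rn (k n) s))"
        by (subst AE_lebesgue_on_iff_negligible) (auto intro: negligible_subset[OF Z'])
    qed
    also have "\<dots> \<le> liminf (\<lambda>n. \<integral>\<^sup>+ s. ennreal (rn (k n) s) \<partial>?M)"
      by (rule nn_integral_liminf) (rule measurable_compose[OF r_measurable[OF E(1) order_refl] measurable_ennreal])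
    also have "(\<lambda>n. \<integral>\<^sup>+ s. ennreal (rn (k n) s) \<partial>?M) = (\<lambda>n. ennreal (rint (X (k n)) (u (k n)) 0 tau'))"
      using nn[OF E(1)] by blast
    also have "liminf (\<lambda>n. ennreal (rint (X (k n)) (u (k n)) 0 tau')) = ennreal (v x - g (y tau'))"
      by (rule lim_imp_Liminf[OF sequentially_bot tendsto_ennrealI[OF sub[OF rint_lim]]])
    finally have "ennreal (rint x \<sigma> 0 tau') \<le> ennreal (v x - g (y tau'))" .
    moreover have "0 \<le> v x - g (y tau')"
    proof (rule LIMSEQ_le_const[OF rint_lim], intro exI allI impI)
      fix n
      have "0 \<le> r0 * (tau' - 0)" using tau'_in r0_pos by simp
      then show "0 \<le> rint (X n) (u n) 0 tau'" using rint_ge[OF E(1) order_refl, of tau' "X n" n] tau'_in by simp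
    qed
    ultimately show ?thesis by (simp add: ennreal_le_iff)
  qed
  then have "J x \<sigma> = v x" using cost_eq[OF \<sigma>(1) hit] v_le_J[OF \<sigma>(1) hit] yend by simp
  then show ?thesis unfolding transported_def
    using \<sigma>(1) hit \<xi>'_normal q'_superdiff Hl_end P_end adjP P0 yend by (metis (no_types, lifting))
qed

end

section \<open>Limits of gradients\<close>

context exit_problem
begin

text \<open>Arzela-Ascoli for the pairs of trajectory and frozen adjoint arc, which are
  equi-Lipschitz and bounded, followed by a subsequence for the exit times and terminal
  data.\<close>

lemma extremals_limit_transported:
  assumes ext: "\<And>n. extremal B (a n) (X n) (u n) (tau n) (q n) (\<xi> n) (p n)"
    and Jn: "\<And>n. J (X n) (u n) < v (X n) + \<epsilon> n"
    and \<epsilon>lim: "\<epsilon> \<longlonglongrightarrow> 0" and Xlim: "X \<longlonglongrightarrow> x" and plim: "(\<lambda>n. p n 0) \<longlonglongrightarrow> \<pi>" and alim: "a \<longlonglongrightarrow> lam"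
    and Vc: "continuous_on Reach V" and xr: "x \<in> Reach" and xS: "x \<notin> S"
    and nz: "\<pi> \<noteq> 0 \<or> lam \<noteq> 0"
    and hdiff: "\<And>z p. p \<noteq> 0 \<Longrightarrow> (\<lambda>(z, p). Hl lam z p) differentiable (at (z, p))"
  shows "transported lam x \<pi>"
proof -
  note E = ext_facts[OF ext]
  have B1: "1 \<le> B" using E(9) .
  define Q where "Q n t = (Y (X n) (u n) t, p n (min t (tau n)))" for n t
  define C where "C = N + L * (cP B + B) + 1"
  obtain XB where XB: "\<And>n. norm (X n) \<le> XB"
    using convergent_imp_bounded[OF Xlim] unfolding bounded_iff by auto
  have C: "C > 0" using N_pos L_pos const_pos(2)[OF B1] B1 by (simp add: C_def add_nonneg_pos)
  have lip: "norm (Q n s - Q n t) \<le> C * \<bar>s - t\<bar>" if "s \<in> {0..B}" "t \<in> {0..B}" for n s t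
  proof -
    have "norm (p n (min s (tau n)) - p n (min t (tau n))) \<le> (L * (cP B + B)) * \<bar>min s (tau n) - min t (tau n)\<bar>"
      by (rule ext_p_lip[OF ext]) (use that E(13)[of n] in auto)
    also have "\<dots> \<le> (L * (cP B + B)) * \<bar>s - t\<bar>"
      using L_pos const_pos(2)[OF B1] B1 by (intro mult_left_mono) auto
    finally have "norm (p n (min s (tau n)) - p n (min t (tau n))) \<le> (L * (cP B + B)) * \<bar>s - t\<bar>" .
    moreover have "norm (Y (X n) (u n) s - Y (X n) (u n) t) \<le> N * \<bar>s - t\<bar>"
      by (rule traj_lip[OF E(1)]) (use that in auto)
    moreover have "norm (Q n s - Q n t) \<le> norm (Y (X n) (u n) s - Y (X n) (u n) t) + norm (p n (min s (tau n)) - p n (min t (tau n)))"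
      using norm_Pair_le by (simp add: Q_def)
    ultimately show ?thesis unfolding C_def by (simp add: distrib_right) 
  qed
  obtain h k where k: "strict_mono (k :: nat \<Rightarrow> nat)"
    and conv: "\<And>e. 0 < e \<Longrightarrow> \<exists>M. \<forall>n x. n \<ge> M \<and> x \<in> {0..B} \<longrightarrow> norm (Q (k n) x - h x) < e"
  proof (rule Arzela_Ascoli[of "{0..B}" Q "XB + N * B + cP B"])
    show "norm (Q n t) \<le> XB + N * B + cP B" if t: "t \<in> {0..B}" for n t
    proof -
      have "norm (Y (X n) (u n) t - X n) \<le> N * t" by (rule traj_norm[OF E(1)]) (use t in auto)
      moreover have "N * t \<le> N * B" using t N_pos by simp
      moreover have "norm (p n (min t (tau n))) \<le> cP B" by (rule ext_p_bound[OF ext]) (use t E(13)[of n] in auto)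
      moreover have "norm (Q n t) \<le> norm (Y (X n) (u n) t) + norm (p n (min t (tau n)))" unfolding Q_def by (rule norm_Pair_le)
      moreover have "norm (Y (X n) (u n) t) \<le> norm (X n) + norm (Y (X n) (u n) t - X n)" by (rule norm_triangle_sub)
      ultimately show ?thesis using XB[of n] by linarith
    qed
    show "\<exists>d. 0 < d \<and> (\<forall>n y. y \<in> {0..B} \<and> norm (t - y) < d \<longrightarrow> norm (Q n t - Q n y) < e)" if "t \<in> {0..B}" "0 < e" for t e
    proof (intro exI[of _ "e / C"] conjI allI impI)
      show "0 < e / C" using that C by simp
      fix n s assume s: "s \<in> {0..B} \<and> norm (t - s) < e / C"
      have "norm (Q n t - Q n s) \<le> C * \<bar>t - s\<bar>" using lip s that by blast
      also have "\<dots> < e" using s C by (simp add: pos_less_divide_eq mult.commute)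
      finally show "norm (Q n t - Q n s) < e" .
    qed
  qed auto
  have Qlim: "(\<lambda>n. Q (k n) t) \<longlonglongrightarrow> h t" if "t \<in> {0..B}" for t
    unfolding LIMSEQ_iff using conv that by blast
  have "bounded (range (\<lambda>n. (tau (k n), q (k n), \<xi> (k n))))"
    unfolding bounded_iff
  proof (intro exI[of _ "B + (G + B)"] ballI, clarify)
    fix n
    have "norm (tau (k n), q (k n), \<xi> (k n)) \<le> norm (tau (k n)) + (norm (q (k n)) + norm (\<xi> (k n)))"
      by (rule order_trans[OF norm_Pair_le add_left_mono[OF norm_Pair_le]])
    then show "norm (tau (k n), q (k n), \<xi> (k n)) \<le> B + (G + B)"
      using E(8,10,12,13)[of "k n"] by simp
  qed
  then obtain l j where j: "strict_mono (j :: nat \<Rightarrow> nat)" and l: "((\<lambda>n. (tau (k n), q (k n), \<xi> (k n))) \<circ> j) \<longlonglongrightarrow> l"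
    by (rule bounded_subseq)
  obtain tau' q' \<xi>' where ll: "l = (tau', q', \<xi>')" by (cases l)
  have kj: "strict_mono (\<lambda>n. k (j n))" using strict_mono_o[OF k j] by (simp add: o_def)
  note sub = tendsto_subseq[OF kj]
  have Ql: "(\<lambda>n. Q (k (j n)) t) \<longlonglongrightarrow> h t" if "t \<in> {0..B}" for t
    using LIMSEQ_subseq_LIMSEQ[OF Qlim[OF that] j] by (simp add: o_def)
  interpret LP: limit_problem f r g U S N L r0 \<rho>0 G W B "\<lambda>n. a (k (j n))" "\<lambda>n. X (k (j n))" "\<lambda>n. u (k (j n))" "\<lambda>n. tau (k (j n))"
    "\<lambda>n. q (k (j n))" "\<lambda>n. \<xi> (k (j n))" "\<lambda>n. p (k (j n))" "\<lambda>n. \<epsilon> (k (j n))" x \<pi> q' \<xi>' lam tau' "\<lambda>t. fst (h t)" "\<lambda>t. snd (h t)"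
  proof (unfold_locales, goal_cases)
    case 1 show ?case by (rule ext)
  next
    case 2 show ?case by (rule Jn)
  next
    case 3 show ?case by (rule sub[OF \<epsilon>lim])
  next
    case 4 show ?case by (rule sub[OF Xlim])
  next
    case 5 show ?case by (rule sub[OF plim])
  next
    case 6 show ?case by (rule sub[OF alim])
  next
    case 7 show ?case using tendsto_fst[OF l] by (simp add: o_def ll)
  next
    case 8 show ?case using tendsto_fst[OF tendsto_snd[OF l]] by (simp add: o_def ll)
  next
    case 9 show ?case using tendsto_snd[OF tendsto_snd[OF l]] by (simp add: o_def ll)
  next
    case (10 t) then show ?case using tendsto_fst[OF Ql[of t]] by (simp add: Q_def)
  next
    case (11 t) then show ?case using tendsto_snd[OF Ql[of t]] by (simp add: Q_def)
  qed (use Vc xr xS nz hdiff in auto)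
  show ?thesis by (rule LP.limit_transported)
qed

text \<open>By positive homogeneity \<open>Hl lam\<close> with \<open>lam\<close> > 0 is a rescaling
  of \<open>Ham\<close> in the covector.\<close>

lemma Ham_C1_imp_differentiable:
  assumes C1: "C1_on (UNIV \<times> (UNIV - {0})) (\<lambda>(z, p). Ham f r U z p)" and lam: "lam > 0" and p: "p \<noteq> 0"
  shows "(\<lambda>(z, p). Hl lam z p) differentiable (at (z, p))"
proof -
  have eq: "(\<lambda>(z, p). Hl lam z p) = (\<lambda>zp. lam * (\<lambda>(z, p). Ham f r U z p) (fst zp, snd zp /\<^sub>R lam))"
  proof (rule ext)
    fix zp :: "(real^'d) \<times> (real^'d)"
    show "(\<lambda>(z, p). Hl lam z p) zp = lam * (\<lambda>(z, p). Ham f r U z p) (fst zp, snd zp /\<^sub>R lam)"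
      using Hl_scale[OF lam, of 1 "fst zp" "snd zp /\<^sub>R lam"] lam by (simp add: Ham_eq_Hl split_beta)
  qed
  obtain h' where h: "\<forall>zp\<in>UNIV \<times> (UNIV - {0}). GDERIV (\<lambda>(z, p). Ham f r U z p) zp :> h' zp"
    using C1 unfolding C1_on_def by blast
  have "(z, p /\<^sub>R lam) \<in> UNIV \<times> (UNIV - {0})" using p lam by simp
  note h' = bspec[OF h this]
  have 1: "((\<lambda>(z, p). Ham f r U z p) has_derivative (\<lambda>h. h \<bullet> h' (z, p /\<^sub>R lam))) (at ((\<lambda>zp. (fst zp, snd zp /\<^sub>R lam)) (z, p)))"
    using h' by (simp add: gderiv_def)
  have "((\<lambda>zp. (fst zp, snd zp /\<^sub>R lam)) has_derivative (\<lambda>zp. (fst zp, snd zp /\<^sub>R lam))) (at (z, p))"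
    by (intro derivative_intros)
  from has_derivative_mult_right[OF has_derivative_compose[OF this 1], of lam]
  show ?thesis unfolding eq differentiable_def by blast
qed

lemma Ham0_C1_imp_differentiable:
  assumes C1: "C1_on (UNIV \<times> (UNIV - {0})) (\<lambda>(z, p). Ham0 f U z p)" and p: "p \<noteq> 0"
  shows "(\<lambda>(z, p). Hl 0 z p) differentiable (at (z, p))"
proof -
  obtain h' where h: "\<forall>zp\<in>UNIV \<times> (UNIV - {0}). GDERIV (\<lambda>(z, p). Ham0 f U z p) zp :> h' zp"
    using C1 unfolding C1_on_def by blast
  have "(z, p) \<in> UNIV \<times> (UNIV - {0})" using p by simp
  from bspec[OF h this] show ?thesis unfolding gderiv_def differentiable_def Ham0_eq_Hl by blast
qed

text \<open>At \<open>X n\<close> the normal is a multiple \<open>mu n\<close> of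
  \<open>(P n, 1)\<close>, approximated by an arc with error 1 / (n + 1). The limit multiplier is
  known only after the subsequence is chosen, so the smoothness of its Hamiltonian appears as a
  premise inside the conclusion.\<close>

lemma gradient_extremals:
  assumes Vc: "continuous_on Reach V" and rb: "regular_ball x \<delta> B"
    and X: "\<And>n. X n \<in> ball x \<delta>" and D: "\<And>n. has_gradient_ereal V (X n) (P n)" and Xlim: "X \<longlonglongrightarrow> x"
  obtains k mu lam \<pi> where "strict_mono (k :: nat \<Rightarrow> nat)" "\<And>n. 0 < mu n" "\<And>n. mu n * norm (P n) \<le> cP B"
    "(\<lambda>n. mu (k n)) \<longlonglongrightarrow> lam" "(\<lambda>n. mu (k n) *\<^sub>R P (k n)) \<longlonglongrightarrow> \<pi>" "0 \<le> lam" "\<pi> \<noteq> 0 \<or> lam \<noteq> 0"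
    "(\<forall>z p. p \<noteq> 0 \<longrightarrow> (\<lambda>(z, p). Hl lam z p) differentiable (at (z, p))) \<longrightarrow> transported lam x \<pi>"
proof -
  define e where "e n = 1 / real (Suc n)" for n
  have e0: "e n > 0" for n by (simp add: e_def)
  have e: "e \<longlonglongrightarrow> 0" unfolding e_def by (rule LIMSEQ_inverse_real_of_nat[unfolded inverse_eq_divide])
  have "\<exists>mu lam' u tau q \<xi> p. (0 < mu \<and> 1 \<le> B * (mu * (norm (P n) + 1)) \<and> mu * norm (P n) \<le> cP B \<and> mu \<le> B) \<and>
     near_extremal B (e n) lam' (X n) u tau q \<xi> p \<and> norm (p 0 - mu *\<^sub>R P n) < e n \<and> \<bar>lam' - mu\<bar> < e n" for n
    by (rule normal_of_touching[OF rb X gradient_touches[OF D], of n]) (use e0 in blast)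
  then obtain mu lam' u tau q \<xi> p where mu: "\<And>n. 0 < mu n \<and> 1 \<le> B * (mu n * (norm (P n) + 1)) \<and> mu n * norm (P n) \<le> cP B \<and> mu n \<le> B"
    and ne: "\<And>n. near_extremal B (e n) (lam' n) (X n) (u n) (tau n) (q n) (\<xi> n) (p n)"
    and cl: "\<And>n. norm (p n 0 - mu n *\<^sub>R P n) < e n" "\<And>n. \<bar>lam' n - mu n\<bar> < e n"
    by metis
  have "bounded (range (\<lambda>n. (mu n, mu n *\<^sub>R P n)))"
    unfolding bounded_iff
  proof (intro exI[of _ "B + cP B"] ballI, clarify)
    fix n show "norm (mu n, mu n *\<^sub>R P n) \<le> B + cP B"
      by (rule order_trans[OF norm_Pair_le]) (use mu[of n] in auto)
  qed
  then obtain l k where k: "strict_mono (k :: nat \<Rightarrow> nat)" and l: "((\<lambda>n. (mu n, mu n *\<^sub>R P n)) \<circ> k) \<longlonglongrightarrow> l"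
    by (rule bounded_subseq)
  obtain lam \<pi> where ll: "l = (lam, \<pi>)" by (cases l)
  have ml: "(\<lambda>n. mu (k n)) \<longlonglongrightarrow> lam" and pl: "(\<lambda>n. mu (k n) *\<^sub>R P (k n)) \<longlonglongrightarrow> \<pi>"
    using tendsto_fst[OF l] tendsto_snd[OF l] by (simp_all add: o_def ll)
  note sub = tendsto_subseq[OF k]
  have lam0: "0 \<le> lam" using LIMSEQ_le_const[OF ml] mu less_imp_le by blast
  have nz: "\<pi> \<noteq> 0 \<or> lam \<noteq> 0"
  proof -
    have "(\<lambda>n. B * (norm (mu (k n) *\<^sub>R P (k n)) + mu (k n))) \<longlonglongrightarrow> B * (norm \<pi> + lam)" by (intro tendsto_intros ml pl)
    moreover have "1 \<le> B * (norm (mu (k n) *\<^sub>R P (k n)) + mu (k n))" for n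
      using mu[of "k n"] by (simp add: distrib_left)
    ultimately have "1 \<le> B * (norm \<pi> + lam)" using LIMSEQ_le_const by blast
    then show ?thesis by auto
  qed
  have "transported lam x \<pi>" if hd: "\<And>z p. p \<noteq> 0 \<Longrightarrow> (\<lambda>(z, p). Hl lam z p) differentiable (at (z, p))"
  proof (rule extremals_limit_transported[OF _ _ sub[OF e] sub[OF Xlim] _ _ Vc _ _ nz hd])
    show "extremal B (lam' (k n)) (X (k n)) (u (k n)) (tau (k n)) (q (k n)) (\<xi> (k n)) (p (k n))"
      "J (X (k n)) (u (k n)) < v (X (k n)) + e (k n)" for n
      using ne[of "k n"] by (simp_all add: near_extremal_def)
    have "(\<lambda>n. p (k n) 0 - mu (k n) *\<^sub>R P (k n)) \<longlonglongrightarrow> 0"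
      by (rule tendsto_zero_if_bounded[OF _ sub[OF e] refl]) (use cl less_imp_le in blast)
    from tendsto_add[OF this pl] show "(\<lambda>n. p (k n) 0) \<longlonglongrightarrow> \<pi>" by simp
    have "(\<lambda>n. lam' (k n) - mu (k n)) \<longlonglongrightarrow> 0"
      by (rule tendsto_zero_if_bounded[OF _ sub[OF e] refl]) (use cl less_imp_le in \<open>auto simp del: of_nat_Suc\<close>)
    from tendsto_add[OF this ml] show "(\<lambda>n. lam' (k n)) \<longlonglongrightarrow> lam" by simp
    have "x \<in> ball x \<delta>" using rb by (simp add: regular_ball_def)
    then show "x \<in> Reach" "x \<notin> S" using rb unfolding regular_ball_def by blast+
  qed auto
  then have "(\<forall>z p. p \<noteq> 0 \<longrightarrow> (\<lambda>(z, p). Hl lam z p) differentiable (at (z, p))) \<longrightarrow> transported lam x \<pi>" by blast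
  then show ?thesis using that[OF k _ _ ml pl lam0 nz] mu by blast
qed

lemma eventually_in_ball_shift:
  fixes X :: "nat \<Rightarrow> 'a::metric_space"
  assumes "X \<longlonglongrightarrow> x" "\<delta> > 0"
  obtains m where "\<And>n. X (n + m) \<in> ball x \<delta>"
proof -
  obtain m where "\<forall>n\<ge>m. dist (X n) x < \<delta>" using metric_LIMSEQ_D[OF assms] by blast
  then have "X (n + m) \<in> ball x \<delta>" for n by (simp add: dist_commute)
  then show ?thesis by (rule that)
qed

theorem limiting_gradient_transported:
  assumes Vc: "continuous_on Reach V" and x: "x \<in> interior Reach - S"
    and C1: "C1_on (UNIV \<times> (UNIV - {0})) (\<lambda>(z, p). Ham f r U z p)"
    and w: "w \<in> limiting_gradients V x"
  shows "transported 1 x w"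
proof -
  obtain \<delta> B where rb: "regular_ball x \<delta> B" by (rule regular_ball_exists[OF Vc x])
  then have \<delta>: "\<delta> > 0" by (simp add: regular_ball_def)
  obtain X P where XP: "\<And>n. has_gradient_ereal V (X n) (P n)" "X \<longlonglongrightarrow> x" "P \<longlonglongrightarrow> w"
    using w unfolding limiting_gradients_def by blast
  obtain m where m: "\<And>n. X (n + m) \<in> ball x \<delta>" using eventually_in_ball_shift[OF XP(2) \<delta>] by blast
  have Xl: "(\<lambda>n. X (n + m)) \<longlonglongrightarrow> x" and Pl: "(\<lambda>n. P (n + m)) \<longlonglongrightarrow> w"
    using LIMSEQ_ignore_initial_segment XP by blast+
  obtain k mu lam \<pi> where k: "strict_mono (k :: nat \<Rightarrow> nat)" and ml: "(\<lambda>n. mu (k n)) \<longlonglongrightarrow> lam"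
    and pl: "(\<lambda>n. mu (k n) *\<^sub>R P (k n + m)) \<longlonglongrightarrow> \<pi>" and lam: "0 \<le> lam" and nz: "\<pi> \<noteq> 0 \<or> lam \<noteq> 0"
    and tr: "(\<forall>z p. p \<noteq> 0 \<longrightarrow> (\<lambda>(z, p). Hl lam z p) differentiable (at (z, p))) \<longrightarrow> transported lam x \<pi>"
    by (rule gradient_extremals[OF Vc rb m XP(1) Xl]) blast
  have "(\<lambda>n. P (k n + m)) \<longlonglongrightarrow> w" using LIMSEQ_subseq_LIMSEQ[OF Pl k] by (simp add: o_def)
  from LIMSEQ_unique[OF tendsto_scaleR[OF ml this] pl] have \<pi>: "\<pi> = lam *\<^sub>R w" by simp
  \<comment> \<open>A zero multiplier would make \<pi> vanish too, against
    \<open>nz\<close>.\<close>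
  then have lp: "lam > 0" using lam nz by (cases "lam = 0") auto
  have "transported lam x (lam *\<^sub>R w)" using tr Ham_C1_imp_differentiable[OF C1 lp] unfolding \<pi> by blast
  from transported_scale[OF this, of "1 / lam"] show ?thesis using lp by simp
qed

text \<open>The products \<open>mu n * norm (P n)\<close> stay bounded while the gradients diverge,
  so the limit multiplier is 0 and \<pi> is nonzero. Its direction is that of \<open>w\<close>, and
  positive scaling adjusts its length.\<close>

theorem horizon_gradient_transported:
  assumes Vc: "continuous_on Reach V" and x: "x \<in> interior Reach - S"
    and C1: "C1_on (UNIV \<times> (UNIV - {0})) (\<lambda>(z, p). Ham0 f U z p)"
    and w: "w \<in> horizon_limiting_gradients V x"
  shows "transported 0 x w"
proof -
  obtain \<delta> B where rb: "regular_ball x \<delta> B" by (rule regular_ball_exists[OF Vc x])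
  then have \<delta>: "\<delta> > 0" by (simp add: regular_ball_def)
  obtain X P where w0: "w \<noteq> 0" and XP: "\<And>n. has_gradient_ereal V (X n) (P n)" "X \<longlonglongrightarrow> x"
    "(\<lambda>n. P n /\<^sub>R norm (P n)) \<longlonglongrightarrow> w /\<^sub>R norm w" "filterlim (\<lambda>n. norm (P n)) at_top sequentially"
    using w unfolding horizon_limiting_gradients_def by blast
  obtain m where m: "\<And>n. X (n + m) \<in> ball x \<delta>" using eventually_in_ball_shift[OF XP(2) \<delta>] by blast
  have Xl: "(\<lambda>n. X (n + m)) \<longlonglongrightarrow> x" using LIMSEQ_ignore_initial_segment XP by blast
  obtain k mu lam \<pi> where k: "strict_mono (k :: nat \<Rightarrow> nat)" and mu: "\<And>n. 0 < mu n" "\<And>n. mu n * norm (P (n + m)) \<le> cP B"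
    and ml: "(\<lambda>n. mu (k n)) \<longlonglongrightarrow> lam"
    and pl: "(\<lambda>n. mu (k n) *\<^sub>R P (k n + m)) \<longlonglongrightarrow> \<pi>" and lam: "0 \<le> lam" and nz: "\<pi> \<noteq> 0 \<or> lam \<noteq> 0"
    and tr: "(\<forall>z p. p \<noteq> 0 \<longrightarrow> (\<lambda>(z, p). Hl lam z p) differentiable (at (z, p))) \<longrightarrow> transported lam x \<pi>"
    by (rule gradient_extremals[OF Vc rb m XP(1) Xl]) blast
  have fl: "filterlim (\<lambda>n. k n + m) sequentially sequentially"
    using filterlim_subseq[OF k] by (rule filterlim_at_top_mono) auto
  have Pinf: "filterlim (\<lambda>n. norm (P (k n + m))) at_top sequentially" by (rule filterlim_compose[OF XP(4) fl])
  have dir: "(\<lambda>n. P (k n + m) /\<^sub>R norm (P (k n + m))) \<longlonglongrightarrow> w /\<^sub>R norm w" by (rule filterlim_compose[OF XP(3) fl])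
  have ev: "\<forall>\<^sub>F n in sequentially. 1 \<le> norm (P (k n + m))" using Pinf unfolding filterlim_at_top by blast
  have "(\<lambda>n. mu (k n)) \<longlonglongrightarrow> 0"
  proof (rule Lim_null_comparison)
    show "\<forall>\<^sub>F n in sequentially. norm (mu (k n)) \<le> cP B / norm (P (k n + m))"
      using ev
    proof eventually_elim
      case (elim n)
      then have "0 < norm (P (k n + m))" by linarith
      then show ?case using mu(1)[of "k n"] mu(2)[of "k n"] by (simp only: pos_le_divide_eq real_norm_def abs_of_pos)
    qed
    show "(\<lambda>n. cP B / norm (P (k n + m))) \<longlonglongrightarrow> 0"
      by (rule real_tendsto_divide_at_top[OF tendsto_const Pinf])
  qed
  from LIMSEQ_unique[OF ml this] have l0: "lam = 0" .
  then have \<pi>0: "\<pi> \<noteq> 0" using nz by simp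
  have lim: "(\<lambda>n. norm (mu (k n) *\<^sub>R P (k n + m)) *\<^sub>R (P (k n + m) /\<^sub>R norm (P (k n + m)))) \<longlonglongrightarrow> norm \<pi> *\<^sub>R (w /\<^sub>R norm w)"
    by (intro tendsto_intros pl dir)
  have eq: "norm (mu (k n) *\<^sub>R P (k n + m)) *\<^sub>R (P (k n + m) /\<^sub>R norm (P (k n + m))) = mu (k n) *\<^sub>R P (k n + m)" for n
    using mu(1)[of "k n"] by (cases "P (k n + m) = 0") (auto simp: abs_of_pos)
  have "(\<lambda>n. mu (k n) *\<^sub>R P (k n + m)) \<longlonglongrightarrow> norm \<pi> *\<^sub>R (w /\<^sub>R norm w)" using lim unfolding eq .
  from LIMSEQ_unique[OF pl this] have \<pi>: "\<pi> = (norm \<pi> / norm w) *\<^sub>R w" by (simp add: divide_inverse)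
  have "transported 0 x \<pi>" using tr Ham0_C1_imp_differentiable[OF C1] l0 by blast
  from transported_scale[OF this, of "norm w / norm \<pi>"]
  have "transported 0 x ((norm w / norm \<pi>) *\<^sub>R \<pi>)" using w0 \<pi>0 by simp
  moreover have "(norm w / norm \<pi>) *\<^sub>R \<pi> = (norm w / norm \<pi>) *\<^sub>R ((norm \<pi> / norm w) *\<^sub>R w)" by (subst \<pi>) simp
  then have "(norm w / norm \<pi>) *\<^sub>R \<pi> = w" using w0 \<pi>0 by simp
  ultimately show ?thesis by simp
qed

end

section \<open>The normal cone as generated by gradients\<close>

lemma proximal_normals_add:
  assumes "a \<in> proximal_normals Q y" "b \<in> proximal_normals Q y"
  shows "a + b \<in> proximal_normals Q y"
proof -
  obtain s t where st: "y \<in> Q" "s \<ge> 0" "t \<ge> 0" "\<And>z. z \<in> Q \<Longrightarrow> a \<bullet> (z - y) \<le> s * (norm (z - y))\<^sup>2"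
    "\<And>z. z \<in> Q \<Longrightarrow> b \<bullet> (z - y) \<le> t * (norm (z - y))\<^sup>2"
    using assms unfolding proximal_normals_def by blast
  have "(a + b) \<bullet> (z - y) \<le> (s + t) * (norm (z - y))\<^sup>2" if "z \<in> Q" for z
    using add_mono[OF st(4)[OF that] st(5)[OF that]] by (simp add: inner_add_left distrib_right)
  then show ?thesis using st(1-3) unfolding proximal_normals_def by (auto intro!: exI[of _ "s + t"])
qed

lemma convex_if_cone:
  assumes "\<And>a b. a \<in> C \<Longrightarrow> b \<in> C \<Longrightarrow> a + b \<in> C" "\<And>a c. a \<in> C \<Longrightarrow> (c::real) \<ge> 0 \<Longrightarrow> c *\<^sub>R a \<in> C"
  shows "convex C"
  unfolding convex_def using assms by blast

text \<open>A convex combination of nonzero members that vanishes would produce a nonzero member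
  whose negative is also a member. The purpose is that the convex hull of nonzero normals avoids
  0.\<close>

lemma pointed_diff_zero_convex:
  assumes add: "\<And>a b. a \<in> C \<Longrightarrow> b \<in> C \<Longrightarrow> a + b \<in> C" and sc: "\<And>a c. a \<in> C \<Longrightarrow> (c::real) \<ge> 0 \<Longrightarrow> c *\<^sub>R a \<in> C"
    and p: "pointed C"
  shows "convex (C - {0})"
  unfolding convex_def
proof (intro ballI allI impI)
  fix a b :: 'a and s t :: real
  assume a: "a \<in> C - {0}" and b: "b \<in> C - {0}" and st: "0 \<le> s" "0 \<le> t" "s + t = 1"
  have "s *\<^sub>R a + t *\<^sub>R b \<in> C" by (intro add sc) (use a b st in auto)
  moreover have "s *\<^sub>R a + t *\<^sub>R b \<noteq> 0"
  proof
    assume "s *\<^sub>R a + t *\<^sub>R b = 0"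
    then have e: "s *\<^sub>R a = - (t *\<^sub>R b)" by (simp add: eq_neg_iff_add_eq_0)
    moreover have "s *\<^sub>R a \<in> C" "t *\<^sub>R b \<in> C" by (intro sc; use a b st in auto)+
    ultimately have "s *\<^sub>R a \<in> C \<inter> uminus ` C" by auto
    then have "s *\<^sub>R a = 0" using p unfolding pointed_def by blast
    then have "s = 0" "t *\<^sub>R b = 0" using a e by auto
    then show False using b st by auto
  qed
  ultimately show "s *\<^sub>R a + t *\<^sub>R b \<in> C - {0}" by blast
qed

text \<open>The strict separation is stable under small perturbations of the functional, which allows
  its first component to be chosen different from 0.\<close>

lemma cone_separation:
  fixes K :: "('a::euclidean_space \<times> real) set"
  assumes K: "compact K" "convex K" "0 \<notin> K" and y: "y \<noteq> 0" and ny: "\<And>t e. t \<ge> 0 \<Longrightarrow> e \<in> K \<Longrightarrow> y \<noteq> t *\<^sub>R e"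
  obtains \<theta> \<eta> where "\<theta> \<noteq> 0" "(\<theta>, \<eta>) \<bullet> y > 0" "\<And>e. e \<in> K \<Longrightarrow> (\<theta>, \<eta>) \<bullet> e < 0"
proof -
  obtain C where C: "C > 0" "\<And>e. e \<in> K \<Longrightarrow> norm e \<le> C"
    using compact_imp_bounded[OF K(1)] unfolding bounded_pos by blast
  obtain a c where a: "a \<bullet> y > 0" "c > 0" "\<And>e. e \<in> K \<Longrightarrow> a \<bullet> e < - c"
  proof (cases "K = {}")
    case True
    then show ?thesis using that[of y 1] y by simp
  next
    case False
    define R where "R = (\<lambda>s. s *\<^sub>R y) ` {0..}"
    have "closed R" unfolding R_def using closed_injective_linear_image[of "{0::real..}" "\<lambda>s. s *\<^sub>R y"] y
      by (auto simp: inj_def)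
    moreover have "convex R" unfolding R_def by (intro convex_linear_image linear_scaleR_left) auto
    moreover have "K \<inter> R = {}"
    proof -
      have False if s: "s \<ge> 0" "s *\<^sub>R y \<in> K" for s
      proof -
        have "s \<noteq> 0" using s K(3) by auto
        then have "y = (1 / s) *\<^sub>R (s *\<^sub>R y)" by simp
        then show False using ny[of "1 / s", OF _ s(2)] s(1) by simp
      qed
      then show ?thesis by (auto simp: R_def)
    qed
    ultimately obtain a b where ab: "\<forall>e\<in>K. a \<bullet> e < b" "\<forall>z\<in>R. b < a \<bullet> z"
      using separating_hyperplane_compact_closed[OF K(2,1) False, of R] by blast
    have b: "b < 0" using ab(2) unfolding R_def by force
    have ay: "0 \<le> a \<bullet> y"
    proof (rule ccontr)
      assume n: "\<not> 0 \<le> a \<bullet> y"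
      then have "b / (a \<bullet> y) \<ge> 0" using b by (simp add: divide_nonpos_neg)
      then have "b < a \<bullet> ((b / (a \<bullet> y)) *\<^sub>R y)" using ab(2) unfolding R_def by blast
      then show False using n by simp
    qed
    \<comment> \<open>The separation yields only a nonnegative value at \<open>y\<close>. Adding a
      small multiple of \<open>y\<close> makes it positive and uses at most half of the margin on
      \<open>K\<close>.\<close>
    define k where "k = - b / (2 * (norm y * C))"
    have k: "k > 0" unfolding k_def using b y C by (intro divide_pos_pos) auto
    show ?thesis
    proof (rule that[of "a + k *\<^sub>R y" "- b / 2"])
      show "0 < (a + k *\<^sub>R y) \<bullet> y" using ay k y by (simp add: inner_add_left add_nonneg_pos)
      show "0 < - b / 2" using b by simp
      fix e assume e: "e \<in> K"
      have "y \<bullet> e \<le> norm y * C" using norm_cauchy_schwarz[of y e] mult_left_mono[OF C(2)[OF e] norm_ge_zero[of y]] by linarith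
      then have "k * (y \<bullet> e) \<le> k * (norm y * C)" using k by (intro mult_left_mono) auto
      also have "\<dots> = - b / 2" using y C by (simp add: k_def)
      finally show "(a + k *\<^sub>R y) \<bullet> e < - (- b / 2)" using ab(1) e by (simp add: inner_add_left) fastforce
    qed
  qed
  show ?thesis
  proof (cases "fst a = 0")
    case False
    then show ?thesis using that[of "fst a" "snd a"] a by force
  next
    case True
    obtain i :: 'a where i: "i \<in> Basis" using nonempty_Basis by blast
    \<comment> \<open>Small against the margin on \<open>K\<close> and against the value at
      \<open>y\<close>, so that both strict inequalities survive the perturbation.\<close>
    define k where "k = min (c / (2 * C)) (a \<bullet> y / (2 * norm y))"
    have k: "k > 0" using a C y by (simp add: k_def)
    have ne: "norm ((k *\<^sub>R i, 0) :: 'a \<times> real) = k" using i k by (simp add: norm_Pair)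
    have b: "\<bar>(k *\<^sub>R i, 0) \<bullet> e\<bar> \<le> k * norm e" for e :: "'a \<times> real"
      using Cauchy_Schwarz_ineq2[of "(k *\<^sub>R i, 0)" e] unfolding ne .
    have ai: "(k *\<^sub>R i, snd a) = a + (k *\<^sub>R i, 0)" using True by (simp add: prod_eq_iff)
    show ?thesis
    proof (rule that[of "k *\<^sub>R i" "snd a"])
      show "k *\<^sub>R i \<noteq> 0" using k i by auto
      have "k * norm y \<le> (a \<bullet> y / (2 * norm y)) * norm y" by (intro mult_right_mono) (auto simp: k_def)
      also have "\<dots> = a \<bullet> y / 2" using y by simp
      finally show "0 < (k *\<^sub>R i, snd a) \<bullet> y" using b[of y] a(1) unfolding ai inner_add_left by linarith
      fix e assume e: "e \<in> K"
      have "k * norm e \<le> (c / (2 * C)) * C" by (intro mult_mono C(2) e) (use a C in \<open>auto simp: k_def\<close>)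
      also have "\<dots> = c / 2" using C by simp
      finally show "(k *\<^sub>R i, snd a) \<bullet> e < 0" using b[of e] a(3)[OF e] a(2) unfolding ai inner_add_left by linarith
    qed
  qed
qed

text \<open>The squared positive part has a 2-Lipschitz derivative, hence an upper quadratic
  expansion although it is not twice differentiable. The one-sided penalty in
  \<open>mean_value\<close> needs exactly this.\<close>

lemma positive_part_square_le:
  fixes a b :: real
  shows "(max 0 a)\<^sup>2 \<le> (max 0 b)\<^sup>2 + 2 * max 0 b * (a - b) + (a - b)\<^sup>2"
proof (cases "b \<ge> 0")
  case True
  then have "(max 0 b)\<^sup>2 + 2 * max 0 b * (a - b) + (a - b)\<^sup>2 = a\<^sup>2" by (simp add: max_def power2_eq_square algebra_simps)
  moreover have "(max 0 a)\<^sup>2 \<le> a\<^sup>2" by (simp add: max_def)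
  ultimately show ?thesis by linarith
next
  case False
  then show ?thesis by (auto simp: max_def intro!: power_mono)
qed

section \<open>A mean value inequality\<close>

context exit_problem
begin

lemma touchesI:
  assumes d: "d > 0" and C: "C \<ge> 0" and XS: "\<And>z. norm (z - X) < d \<Longrightarrow> z \<in> Reach"
    and le: "\<And>z. norm (z - X) < d \<Longrightarrow> v X + \<zeta> \<bullet> (z - X) - C * (norm (z - X))\<^sup>2 \<le> v z"
  shows "touches X \<zeta>"
  unfolding touches_def
proof (intro allI impI)
  fix e :: real assume e: "e > 0"
  show "\<exists>d>0. \<forall>z. norm (z - X) < d \<longrightarrow> ereal (v X + \<zeta> \<bullet> (z - X) - e * norm (z - X)) \<le> V z"
  proof (intro exI[of _ "min d (e / (C + 1))"] conjI allI impI)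
    show "0 < min d (e / (C + 1))" using d e C by simp
    fix z assume z: "norm (z - X) < min d (e / (C + 1))"
    then have "norm (z - X) * (C + 1) < e" using C by (simp add: pos_less_divide_eq)
    moreover have "norm (z - X) * (C + 1) = C * norm (z - X) + norm (z - X)" by (simp add: algebra_simps)
    ultimately have "C * norm (z - X) \<le> e" using norm_ge_zero[of "z - X"] by linarith
    then have "C * (norm (z - X))\<^sup>2 \<le> e * norm (z - X)"
      unfolding power2_eq_square mult.assoc[symmetric] by (rule mult_right_mono) simp
    then have "v X + \<zeta> \<bullet> (z - X) - e * norm (z - X) \<le> v z" using le[of z] z by simp
    then show "ereal (v X + \<zeta> \<bullet> (z - X) - e * norm (z - X)) \<le> V z"
      using V_real[OF XS[of z]] z by (metis ereal_less_eq(3) min_less_iff_conj)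
  qed
qed

text \<open>A mean value inequality. If it failed, a penalized form of \<open>V\<close> would have an interior
  minimum in a thin tube around the segment; there \<open>V\<close> is touched from below, hence
  differentiable, with a directional derivative that is too small.\<close>

lemma mean_value:
  assumes Vc: "continuous_on Reach V" and rb: "regular_ball x \<delta> B" and \<theta>: "\<theta> \<noteq> 0"
    and \<rho>: "\<rho> \<le> \<delta>" and gr: "\<And>X \<zeta>. X \<noteq> x \<Longrightarrow> norm (X - x) < \<rho> \<Longrightarrow> has_gradient_ereal V X \<zeta> \<Longrightarrow> \<eta> < \<theta> \<bullet> \<zeta>"
    and t: "t > 0" "t * norm \<theta> < \<rho>"
  shows "v x + t * \<eta> \<le> v (x + t *\<^sub>R \<theta>)"
proof (rule ccontr)
  define m where "m = v x + t * \<eta> - v (x + t *\<^sub>R \<theta>)"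
  assume "\<not> ?thesis"
  then have m: "m > 0" by (simp add: m_def)
  have rch: "z \<in> Reach" if "norm (z - x) < \<rho>" for z
    using rb \<rho> that unfolding regular_ball_def by (auto simp: dist_norm norm_minus_commute)
  define n where "n = norm \<theta>"
  have n: "n > 0" using \<theta> by (simp add: n_def)
  define gap where "gap = \<rho> - t * n"
  have gap: "gap > 0" using t by (simp add: gap_def n_def)
  have \<rho>0: "\<rho> > 0" using t n unfolding n_def by (smt (verit) mult_pos_pos)
  have vcB: "continuous_on {z. norm (z - x) < \<rho>} v"
    by (rule continuous_on_subset[OF v_continuous[OF Vc]]) (use rch in auto)
  have vx: "isCont v x"
  proof -
    have "open {z. norm (z - x) < \<rho>}" using open_ball[of x \<rho>] by (simp add: ball_def dist_norm norm_minus_commute)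
    then show ?thesis using vcB \<rho>0 by (simp add: continuous_on_eq_continuous_at)
  qed
  obtain d where d: "d > 0" "\<And>z. norm (z - x) < d \<Longrightarrow> \<bar>v z - v x\<bar> < m"
    using vx m unfolding continuous_at_eps_delta dist_norm real_norm_def by metis
  \<comment> \<open>Tube radius and overshoot take a quarter of the gap each, so the tube stays
    within distance \<rho> of \<open>x\<close>. The bound by \<open>d\<close> keeps \<open>v\<close>
    within \<open>m\<close> of \<open>v x\<close> on the end disc through \<open>x\<close>, which
    excludes a minimum there.\<close>
  define \<rho>' where "\<rho>' = min (gap / 4) (d / 2)"
  define \<sigma> where "\<sigma> = gap / (4 * n)"
  have r': "\<rho>' > 0" "\<rho>' \<le> gap / 4" "\<rho>' < d" using gap d by (auto simp: \<rho>'_def)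
  have \<sigma>: "\<sigma> > 0" "\<sigma> * n = gap / 4" using gap n by (auto simp: \<sigma>_def)
  \<comment> \<open>\<open>s\<close> is the coordinate along \<theta>, equal to \<open>t\<close> at
    the far point, and \<open>w\<close> is the orthogonal component.\<close>
  define s where "s z = (\<theta> \<bullet> (z - x)) / n\<^sup>2" for z
  define w where "w z = z - x - s z *\<^sub>R \<theta>" for z
  have \<theta>\<theta>: "\<theta> \<bullet> \<theta> = n\<^sup>2" by (simp add: n_def power2_norm_eq_inner)
  have w\<theta>: "w z \<bullet> \<theta> = 0" for z
  proof -
    have "(z - x) \<bullet> \<theta> = s z * n\<^sup>2" using n by (simp add: s_def inner_commute)
    then show ?thesis unfolding w_def inner_diff_left[of "z - x"] inner_scaleR_left \<theta>\<theta> by simp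
  qed
  have sc: "continuous_on A s" for A unfolding s_def by (intro continuous_intros) (use n in auto)
  have wc: "continuous_on A w" for A unfolding w_def by (intro continuous_intros sc)
  define T where "T = {z. 0 \<le> s z \<and> s z \<le> t + \<sigma> \<and> norm (w z) \<le> \<rho>'}"
  have zx: "norm (z - x) \<le> s z * n + norm (w z)" if "0 \<le> s z" for z
  proof -
    have "z - x = s z *\<^sub>R \<theta> + w z" by (simp add: w_def)
    then have "norm (z - x) \<le> norm (s z *\<^sub>R \<theta>) + norm (w z)" by (metis norm_triangle_ineq)
    then show ?thesis using that by (simp add: n_def)
  qed
  have Tin: "norm (z - x) < \<rho>" if "z \<in> T" for z
  proof -
    have z: "0 \<le> s z" "s z \<le> t + \<sigma>" "norm (w z) \<le> \<rho>'" using that by (auto simp: T_def)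
    have "s z * n \<le> t * n + \<sigma> * n" using z(2) n by (simp add: distrib_right[symmetric])
    moreover have "t * n = \<rho> - gap" by (simp add: gap_def)
    ultimately show ?thesis using zx[OF z(1)] z(3) r'(2) \<sigma>(2) gap by linarith
  qed
  have Tc: "compact T"
  proof (rule compact_eq_bounded_closed[THEN iffD2], intro conjI)
    show "bounded T" unfolding bounded_def dist_norm
      by (intro exI[of _ x] exI[of _ \<rho>] ballI) (use Tin norm_minus_commute less_imp_le in metis)
    show "closed T" unfolding T_def
      by (intro closed_Collect_conj closed_Collect_le continuous_intros sc wc)
  qed
  have vT: "continuous_on T v" by (rule continuous_on_subset[OF vcB]) (use Tin in auto)
  define F0 where "F0 z = v z - v x - \<eta> * s z" for z
  have F0c: "continuous_on T F0" unfolding F0_def by (intro continuous_intros vT sc)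
  obtain M where M: "M > 0" "\<And>z. z \<in> T \<Longrightarrow> \<bar>F0 z\<bar> \<le> M"
    using compact_imp_bounded[OF compact_continuous_image[OF F0c Tc]] unfolding bounded_pos by auto
  \<comment> \<open>On the lateral boundary and at the overshoot end the penalty is
    \<open>M + 1\<close>, so the penalized function is positive there, whereas it is
    \<open>- m\<close> at the far point.\<close>
  define K1 where "K1 = (M + 1) / \<rho>'\<^sup>2"
  define K2 where "K2 = (M + 1) / \<sigma>\<^sup>2"
  have K: "K1 > 0" "K2 > 0" "K1 * \<rho>'\<^sup>2 = M + 1" "K2 * \<sigma>\<^sup>2 = M + 1"
    using M(1) r'(1) \<sigma>(1) by (auto simp: K1_def K2_def intro!: divide_pos_pos)
  \<comment> \<open>The longitudinal penalty acts only beyond \<open>t\<close>: it does not change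
    the value at the far point, and its derivative has a sign.\<close>
  define F where "F z = F0 z + K1 * (norm (w z))\<^sup>2 + K2 * (max 0 (s z - t))\<^sup>2" for z
  have Fc: "continuous_on T F" unfolding F_def by (intro continuous_intros F0c sc wc)
  have s1: "s (x + t *\<^sub>R \<theta>) = t" using n by (simp add: s_def \<theta>\<theta>)
  then have w1: "w (x + t *\<^sub>R \<theta>) = 0" by (simp add: w_def)
  have T1: "x + t *\<^sub>R \<theta> \<in> T" using t \<sigma> r' by (simp add: T_def s1 w1)
  have F1: "F (x + t *\<^sub>R \<theta>) = - m" by (simp add: F_def F0_def s1 w1 m_def)
  obtain z0 where z0: "z0 \<in> T" "\<And>z. z \<in> T \<Longrightarrow> F z0 \<le> F z"
    using continuous_attains_inf[OF Tc _ Fc] T1 by blast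
  have F0m: "F z0 \<le> - m" using z0(2)[OF T1] F1 by simp
  have pos: "0 \<le> K1 * (norm (w z0))\<^sup>2" "0 \<le> K2 * (max 0 (s z0 - t))\<^sup>2" using K by auto
  have FM: "- M \<le> F0 z0" using M(2)[OF z0(1)] by linarith
  have i1: "0 < s z0"
  proof (rule ccontr)
    assume "\<not> 0 < s z0"
    then have s0: "s z0 = 0" using z0(1) by (auto simp: T_def)
    then have "norm (z0 - x) < d" using zx[of z0] z0(1) r' by (auto simp: T_def)
    then have "- m < F0 z0" using d(2)[of z0] s0 by (simp add: F0_def)
    then show False using F0m pos unfolding F_def by linarith
  qed
  have i2: "s z0 < t + \<sigma>"
  proof (rule ccontr)
    assume "\<not> s z0 < t + \<sigma>"
    then have "s z0 - t = \<sigma>" using z0(1) by (auto simp: T_def)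
    then have "K2 * (max 0 (s z0 - t))\<^sup>2 = M + 1" using \<sigma> K by simp
    then show False using F0m pos FM m unfolding F_def by linarith
  qed
  have i3: "norm (w z0) < \<rho>'"
  proof (rule ccontr)
    assume "\<not> norm (w z0) < \<rho>'"
    then have "norm (w z0) = \<rho>'" using z0(1) by (auto simp: T_def)
    then have "K1 * (norm (w z0))\<^sup>2 = M + 1" using K by simp
    then show False using F0m pos FM m unfolding F_def by linarith
  qed
  define O' where "O' = {z. 0 < s z \<and> s z < t + \<sigma> \<and> norm (w z) < \<rho>'}"
  have "open O'" unfolding O'_def by (intro open_Collect_conj open_Collect_less continuous_intros sc wc)
  moreover have "z0 \<in> O'" using i1 i2 i3 by (simp add: O'_def)
  ultimately obtain e where e: "e > 0" "ball z0 e \<subseteq> O'" by (meson openE)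
  \<comment> \<open>The slope along \<theta> of the function that touches \<open>V\<close> at the
    minimum: \<eta> minus the derivative of the one-sided penalty, hence at most \<eta>.\<close>
  define \<mu> where "\<mu> = \<eta> - 2 * K2 * max 0 (s z0 - t)"
  define \<zeta> where "\<zeta> = (\<mu> / n\<^sup>2) *\<^sub>R \<theta> - (2 * K1) *\<^sub>R w z0"
  have \<zeta>\<theta>: "\<theta> \<bullet> \<zeta> = \<mu>" using n w\<theta>[of z0] by (simp add: \<zeta>_def inner_diff_right \<theta>\<theta> inner_commute)
  have tch: "touches z0 \<zeta>"
  proof (rule touchesI[OF e(1), where C="4 * K1 + K2 / n\<^sup>2"])
    show "0 \<le> 4 * K1 + K2 / n\<^sup>2" using K by simp
    fix z assume "norm (z - z0) < e"
    then have "z \<in> ball z0 e" by (simp add: dist_norm norm_minus_commute)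
    then have zO: "z \<in> O'" using e by blast
    then have zT: "z \<in> T" by (auto simp: O'_def T_def)
    then show "z \<in> Reach" using rch[OF Tin] by blast
    have ds: "s z - s z0 = (\<theta> \<bullet> (z - z0)) / n\<^sup>2" by (simp add: s_def inner_diff_right diff_divide_distrib[symmetric])
    have dw: "w z - w z0 = (z - z0) - (s z - s z0) *\<^sub>R \<theta>" by (simp add: w_def algebra_simps)
    have abs_s: "\<bar>s z - s z0\<bar> * n \<le> norm (z - z0)"
    proof -
      have "\<bar>\<theta> \<bullet> (z - z0)\<bar> \<le> n * norm (z - z0)" unfolding n_def by (rule Cauchy_Schwarz_ineq2)
      then have "\<bar>\<theta> \<bullet> (z - z0)\<bar> / n\<^sup>2 * n \<le> n * norm (z - z0) / n\<^sup>2 * n"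
        using n by (intro mult_right_mono divide_right_mono) auto
      then show ?thesis unfolding ds using n by (simp add: power2_eq_square)
    qed
    have s2: "(s z - s z0)\<^sup>2 \<le> (norm (z - z0))\<^sup>2 / n\<^sup>2"
    proof -
      have "(\<bar>s z - s z0\<bar> * n)\<^sup>2 \<le> (norm (z - z0))\<^sup>2" by (rule power_mono[OF abs_s]) (use n in auto)
      then show ?thesis using n by (simp add: power_mult_distrib pos_le_divide_eq)
    qed
    have "norm (w z - w z0) \<le> norm (z - z0) + \<bar>s z - s z0\<bar> * n"
      unfolding dw by (rule order_trans[OF norm_triangle_ineq4]) (simp add: n_def)
    then have "norm (w z - w z0) \<le> 2 * norm (z - z0)" using abs_s by linarith
    then have "(norm (w z - w z0))\<^sup>2 \<le> (2 * norm (z - z0))\<^sup>2" by (rule power_mono) simp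
    then have w2: "(norm (w z - w z0))\<^sup>2 \<le> 4 * (norm (z - z0))\<^sup>2" by (simp add: power_mult_distrib)
    have we: "(norm (w z))\<^sup>2 = (norm (w z0))\<^sup>2 + 2 * (w z0 \<bullet> (z - z0)) + (norm (w z - w z0))\<^sup>2"
    proof -
      have "(norm (w z))\<^sup>2 = (norm (w z0))\<^sup>2 + 2 * (w z0 \<bullet> (w z - w z0)) + (norm (w z - w z0))\<^sup>2"
        unfolding power2_norm_eq_inner by (simp add: inner_diff_left inner_diff_right inner_commute)
      also have "w z0 \<bullet> (w z - w z0) = w z0 \<bullet> (z - z0)" unfolding dw by (simp add: inner_diff_right w\<theta>)
      finally show ?thesis .
    qed
    have p1: "K2 * (max 0 (s z - t))\<^sup>2 \<le> K2 * (max 0 (s z0 - t))\<^sup>2 + 2 * K2 * max 0 (s z0 - t) * (s z - s z0) + K2 * ((norm (z - z0))\<^sup>2 / n\<^sup>2)"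
    proof -
      have "(max 0 (s z - t))\<^sup>2 \<le> (max 0 (s z0 - t))\<^sup>2 + 2 * max 0 (s z0 - t) * (s z - s z0) + (norm (z - z0))\<^sup>2 / n\<^sup>2"
        using positive_part_square_le[of "s z - t" "s z0 - t"] s2 by simp
      from mult_left_mono[OF this less_imp_le[OF K(2)]] show ?thesis by (simp add: algebra_simps)
    qed
    have p2: "K1 * (norm (w z))\<^sup>2 \<le> K1 * (norm (w z0))\<^sup>2 + 2 * K1 * (w z0 \<bullet> (z - z0)) + 4 * K1 * (norm (z - z0))\<^sup>2"
      using mult_left_mono[OF w2 less_imp_le[OF K(1)]] unfolding we by (simp add: algebra_simps)
    have "\<mu> * (s z - s z0) = (\<mu> / n\<^sup>2) * (\<theta> \<bullet> (z - z0))" unfolding ds by simp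
    moreover have "\<zeta> \<bullet> (z - z0) = (\<mu> / n\<^sup>2) * (\<theta> \<bullet> (z - z0)) - 2 * K1 * (w z0 \<bullet> (z - z0))"
      unfolding \<zeta>_def inner_diff_left[of "(\<mu> / n\<^sup>2) *\<^sub>R \<theta>"] inner_scaleR_left ..
    moreover have "\<mu> * (s z - s z0) = \<eta> * (s z - s z0) - 2 * K2 * max 0 (s z0 - t) * (s z - s z0)"
      unfolding \<mu>_def left_diff_distrib ..
    ultimately have \<zeta>z: "\<zeta> \<bullet> (z - z0) = \<eta> * (s z - s z0) - 2 * K2 * max 0 (s z0 - t) * (s z - s z0) - 2 * K1 * (w z0 \<bullet> (z - z0))"
      by linarith
    have "F z0 \<le> F z" by (rule z0(2)[OF zT])
    then have "v z0 + \<eta> * (s z - s z0) \<le> v z + (K1 * (norm (w z))\<^sup>2 - K1 * (norm (w z0))\<^sup>2) + (K2 * (max 0 (s z - t))\<^sup>2 - K2 * (max 0 (s z0 - t))\<^sup>2)"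
      unfolding F_def F0_def by (simp add: algebra_simps)
    moreover have "(4 * K1 + K2 / n\<^sup>2) * (norm (z - z0))\<^sup>2 = 4 * K1 * (norm (z - z0))\<^sup>2 + K2 * ((norm (z - z0))\<^sup>2 / n\<^sup>2)"
      by (simp add: distrib_right)
    ultimately show "v z0 + \<zeta> \<bullet> (z - z0) - (4 * K1 + K2 / n\<^sup>2) * (norm (z - z0))\<^sup>2 \<le> v z"
      using p1 p2 \<zeta>z by linarith
  qed
  have zr: "norm (z0 - x) < \<rho>" by (rule Tin[OF z0(1)])
  have "has_gradient_ereal V z0 \<zeta>"
    by (rule touching_imp_gradient[OF Vc rb _ tch]) (use zr \<rho> in \<open>simp add: dist_norm norm_minus_commute\<close>)
  moreover have "z0 \<noteq> x" using i1 by (auto simp: s_def)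
  ultimately have "\<eta> < \<theta> \<bullet> \<zeta>" using gr zr by blast
  then have "\<eta> < \<mu>" unfolding \<zeta>\<theta> .
  then show False using K(2) by (simp add: \<mu>_def) (smt (verit) mult_nonneg_nonneg)
qed

end

text \<open>The normal \<open>(- P, 1)\<close> scaled so that the norm of its first and its second
  component add up to 1. It stays bounded when the gradient diverges, and its second component tends
  to 0 exactly then.\<close>

definition unit_normal :: "'a::real_inner \<Rightarrow> 'a \<times> real" where
  "unit_normal P = (- (P /\<^sub>R (norm P + 1)), 1 / (norm P + 1))"

lemma unit_normal_sum: "norm (fst (unit_normal P)) + snd (unit_normal P) = 1"
proof -
  have "norm P + 1 > 0" using norm_ge_zero[of P] by linarith
  then show ?thesis by (simp add: unit_normal_def divide_inverse_commute[symmetric] add_divide_distrib[symmetric])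
qed

lemma unit_normal_pos: "0 < snd (unit_normal P)"
  using norm_ge_zero[of P] by (simp add: unit_normal_def add_nonneg_pos)

lemma unit_normal_norm: "norm (unit_normal P) \<le> 1"
  using norm_Pair_le[of "fst (unit_normal P)" "snd (unit_normal P)"] unit_normal_sum[of P] unit_normal_pos[of P] by simp

section \<open>Limits of gradient normals\<close>

context exit_problem
begin

definition "gradient_normals x \<rho> = {unit_normal P | X P. X \<noteq> x \<and> norm (X - x) < \<rho> \<and> has_gradient_ereal V X P}"

text \<open>The limits of \<open>unit_normal\<close> along gradients at points tending to
  \<open>x\<close>, written as an intersection of closures so that closedness is immediate.\<close>

definition "limit_normals x = (\<Inter>\<rho>\<in>{0<..}. closure (gradient_normals x \<rho>))"

lemma limit_normals_seq:
  assumes "e \<in> limit_normals x"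
  obtains X P where "\<And>n. X n \<noteq> x" "\<And>n. has_gradient_ereal V (X n) (P n)" "X \<longlonglongrightarrow> x" "(\<lambda>n. unit_normal (P n)) \<longlonglongrightarrow> e"
proof -
  define d where "d n = 1 / real (Suc n)" for n
  have "d \<longlonglongrightarrow> 0" unfolding d_def by (rule LIMSEQ_inverse_real_of_nat[unfolded inverse_eq_divide])
  moreover have "d n > 0" for n by (simp add: d_def)
  ultimately have d: "d \<longlonglongrightarrow> 0" "\<And>n. d n > 0" by blast+
  have "\<exists>X P. X \<noteq> x \<and> norm (X - x) < d n \<and> has_gradient_ereal V X P \<and> dist (unit_normal P) e < d n" for n
  proof -
    have "e \<in> closure (gradient_normals x (d n))" using assms d(2) by (simp add: limit_normals_def)
    then obtain y where "y \<in> gradient_normals x (d n)" "dist y e < d n"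
      using d(2) unfolding closure_approachable by blast
    then show ?thesis unfolding gradient_normals_def by blast
  qed
  then obtain X P where XP: "\<And>n. X n \<noteq> x \<and> norm (X n - x) < d n \<and> has_gradient_ereal V (X n) (P n) \<and> dist (unit_normal (P n)) e < d n"
    by metis
  have "(\<lambda>n. X n - x) \<longlonglongrightarrow> 0" by (rule tendsto_zero_if_bounded[OF _ d(1) refl]) (use XP less_imp_le in blast)
  moreover have "(\<lambda>n. unit_normal (P n) - e) \<longlonglongrightarrow> 0"
    by (rule tendsto_zero_if_bounded[OF _ d(1) refl]) (use XP less_imp_le in \<open>auto simp: dist_norm\<close>)
  ultimately show ?thesis using that[of X P] XP by (simp add: Lim_null[symmetric])
qed

lemma limit_normals_unit:
  assumes "e \<in> limit_normals x"
  shows "norm (fst e) + snd e = 1" "0 \<le> snd e"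
proof -
  obtain X P where l: "(\<lambda>n. unit_normal (P n)) \<longlonglongrightarrow> e" by (rule limit_normals_seq[OF assms]) blast
  have "(\<lambda>n. norm (fst (unit_normal (P n))) + snd (unit_normal (P n))) \<longlonglongrightarrow> norm (fst e) + snd e"
    by (intro tendsto_intros l)
  then show "norm (fst e) + snd e = 1" unfolding unit_normal_sum by (simp add: LIMSEQ_const_iff)
  show "0 \<le> snd e" using LIMSEQ_le_const[OF tendsto_snd[OF l]] unit_normal_pos less_imp_le by blast
qed

lemma limit_normals_compact: "compact (limit_normals x)"
proof (rule compact_eq_bounded_closed[THEN iffD2], intro conjI)
  have "limit_normals x \<subseteq> closure (gradient_normals x 1)" by (auto simp: limit_normals_def)
  also have "\<dots> \<subseteq> cball 0 1" by (rule closure_minimal) (auto simp: gradient_normals_def unit_normal_norm)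
  finally show "bounded (limit_normals x)" using bounded_subset bounded_cball by blast
  show "closed (limit_normals x)" by (auto simp: limit_normals_def)
qed

text \<open>The product of \<open>(\<theta>, \<eta>)\<close> with a gradient normal has the sign of
  \<eta> minus the directional derivative. By compactness of the unit normals, violations
  arbitrarily close to \<open>x\<close> would produce a limit normal with a nonnegative
  product.\<close>

lemma gradients_eventually_separated:
  assumes sep: "\<And>e. e \<in> limit_normals x \<Longrightarrow> (\<theta>, \<eta>) \<bullet> e < 0"
  shows "\<exists>\<rho>>0. \<forall>X P. X \<noteq> x \<longrightarrow> norm (X - x) < \<rho> \<longrightarrow> has_gradient_ereal V X P \<longrightarrow> \<eta> < \<theta> \<bullet> P"
proof (rule ccontr)
  define d where "d n = 1 / real (Suc n)" for n
  have "d \<longlonglongrightarrow> 0" unfolding d_def by (rule LIMSEQ_inverse_real_of_nat[unfolded inverse_eq_divide])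
  moreover have "d n > 0" for n by (simp add: d_def)
  ultimately have d: "d \<longlonglongrightarrow> 0" "\<And>n. d n > 0" by blast+
  assume "\<not> ?thesis"
  then have "\<forall>n. \<exists>X P. X \<noteq> x \<and> norm (X - x) < d n \<and> has_gradient_ereal V X P \<and> \<theta> \<bullet> P \<le> \<eta>"
    using d(2) by (meson not_less)
  then obtain X P where XP: "\<And>n. X n \<noteq> x \<and> norm (X n - x) < d n \<and> has_gradient_ereal V (X n) (P n) \<and> \<theta> \<bullet> P n \<le> \<eta>"
    by metis
  have "bounded (range (\<lambda>n. unit_normal (P n)))" unfolding bounded_iff using unit_normal_norm by blast
  then obtain e k where k: "strict_mono (k :: nat \<Rightarrow> nat)" and e: "((\<lambda>n. unit_normal (P n)) \<circ> k) \<longlonglongrightarrow> e"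
    by (rule bounded_subseq)
  have dk: "(\<lambda>n. d (k n)) \<longlonglongrightarrow> 0" using LIMSEQ_subseq_LIMSEQ[OF d(1) k] by (simp add: o_def)
  have "e \<in> closure (gradient_normals x \<rho>)" if \<rho>: "\<rho> > 0" for \<rho>
  proof (rule Lim_in_closed_set[OF closed_closure _ sequentially_bot e])
    show "\<forall>\<^sub>F n in sequentially. ((\<lambda>n. unit_normal (P n)) \<circ> k) n \<in> closure (gradient_normals x \<rho>)"
      using order_tendstoD(2)[OF dk \<rho>]
    proof eventually_elim
      case (elim n)
      have "unit_normal (P (k n)) \<in> gradient_normals x \<rho>"
        unfolding gradient_normals_def using XP[of "k n"] elim by force
      then show ?case using closure_subset by fastforce
    qed
  qed
  then have "e \<in> limit_normals x" by (simp add: limit_normals_def)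
  then have "(\<theta>, \<eta>) \<bullet> e < 0" by (rule sep)
  moreover have "0 \<le> (\<theta>, \<eta>) \<bullet> e"
  proof (rule LIMSEQ_le_const[OF tendsto_inner[OF tendsto_const e]], intro exI allI impI)
    fix n
    have "(\<theta>, \<eta>) \<bullet> unit_normal (P (k n)) = (\<eta> - \<theta> \<bullet> P (k n)) / (norm (P (k n)) + 1)"
      by (simp add: unit_normal_def divide_inverse algebra_simps)
    also have "\<dots> \<ge> 0" using XP[of "k n"] by (intro divide_nonneg_nonneg) auto
    finally show "0 \<le> (\<theta>, \<eta>) \<bullet> ((\<lambda>n. unit_normal (P n)) \<circ> k) n" by simp
  qed
  ultimately show False by simp
qed

lemma hypo_normals_add: "a \<in> hypo_normals S V x \<Longrightarrow> b \<in> hypo_normals S V x \<Longrightarrow> a + b \<in> hypo_normals S V x"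
  and hypo_normals_scale: "a \<in> hypo_normals S V x \<Longrightarrow> 0 \<le> c \<Longrightarrow> c *\<^sub>R a \<in> hypo_normals S V x"
  unfolding hypo_normals_def by (rule proximal_normals_add proximal_normals_scale; assumption)+

lemma transported_hypo_normal:
  assumes x: "x \<in> Reach" "x \<notin> S" and t: "transported lam x w" and lam: "0 \<le> lam"
  shows "(- w, lam) \<in> hypo_normals S V x"
proof -
  obtain K where "is_normal K x w lam" by (rule transported_is_normal[OF t x(2) lam])
  then show ?thesis unfolding hypo_normals_iff[OF x] using lam by auto
qed

lemma limit_normal_finite:
  assumes e: "e \<in> limit_normals x" and s: "snd e > 0"
  shows "(- fst e) /\<^sub>R snd e \<in> limiting_gradients V x"
proof -
  obtain X P where XP: "\<And>n. X n \<noteq> x" "\<And>n. has_gradient_ereal V (X n) (P n)" "X \<longlonglongrightarrow> x" "(\<lambda>n. unit_normal (P n)) \<longlonglongrightarrow> e"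
    by (rule limit_normals_seq[OF e]) blast
  have "(\<lambda>n. (- fst (unit_normal (P n))) /\<^sub>R snd (unit_normal (P n))) \<longlonglongrightarrow> (- fst e) /\<^sub>R snd e"
    by (intro tendsto_intros XP(4)) (use s in auto)
  moreover have "(- fst (unit_normal (P n))) /\<^sub>R snd (unit_normal (P n)) = P n" for n
  proof -
    have "norm (P n) + 1 \<noteq> 0" using norm_ge_zero[of "P n"] by linarith
    then show ?thesis by (simp add: unit_normal_def)
  qed
  ultimately have "P \<longlonglongrightarrow> (- fst e) /\<^sub>R snd e" by simp
  then show ?thesis unfolding limiting_gradients_def using XP by blast
qed

lemma limit_normal_horizon:
  assumes e: "e \<in> limit_normals x" and s: "snd e = 0"
  shows "- fst e \<in> horizon_limiting_gradients V x"
proof -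
  obtain X P where XP: "\<And>n. X n \<noteq> x" "\<And>n. has_gradient_ereal V (X n) (P n)" "X \<longlonglongrightarrow> x" "(\<lambda>n. unit_normal (P n)) \<longlonglongrightarrow> e"
    by (rule limit_normals_seq[OF e]) blast
  have n1: "norm (- fst e) = 1" using limit_normals_unit(1)[OF e] s by simp
  have sl: "(\<lambda>n. snd (unit_normal (P n))) \<longlonglongrightarrow> 0" using tendsto_snd[OF XP(4)] s by simp
  have "filterlim (\<lambda>n. norm (P n)) at_top sequentially"
    unfolding filterlim_at_top
  proof
    fix Z :: real
    have "0 < 1 / (\<bar>Z\<bar> + 1)" by (simp add: add_nonneg_pos)
    from order_tendstoD(2)[OF sl this] show "\<forall>\<^sub>F n in sequentially. Z \<le> norm (P n)"
    proof eventually_elim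
      case (elim n)
      have "\<bar>Z\<bar> + 1 < norm (P n) + 1"
        using elim norm_ge_zero[of "P n"] unfolding unit_normal_def snd_conv
        by (smt (verit) frac_le)
      then show ?case by linarith
    qed
  qed
  moreover have "(\<lambda>n. P n /\<^sub>R norm (P n)) \<longlonglongrightarrow> - fst e /\<^sub>R norm (- fst e)"
  proof -
    \<comment> \<open>One minus the second component is the norm of the first, so this quotient is
      the direction of the gradient.\<close>
    have "(\<lambda>n. (- fst (unit_normal (P n))) /\<^sub>R (1 - snd (unit_normal (P n)))) \<longlonglongrightarrow> (- fst e) /\<^sub>R (1 - 0)"
      by (intro tendsto_intros XP(4) sl) auto
    moreover have "(- fst (unit_normal (P n))) /\<^sub>R (1 - snd (unit_normal (P n))) = P n /\<^sub>R norm (P n)" for n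
    proof -
      have nz: "norm (P n) + 1 \<noteq> 0" using norm_ge_zero[of "P n"] by linarith
      then have "1 - 1 / (norm (P n) + 1) = norm (P n) / (norm (P n) + 1)" by (simp add: diff_divide_distrib[symmetric] divide_simps)
      then show ?thesis using nz by (simp add: unit_normal_def inverse_eq_divide)
    qed
    ultimately show ?thesis using n1 by simp
  qed
  moreover have "- fst e \<noteq> 0" using n1 by (metis norm_zero zero_neq_one)
  ultimately show ?thesis unfolding horizon_limiting_gradients_def using XP by blast
qed

section \<open>Generation of the normal cone and the two equalities\<close>

context
  fixes x
  assumes Vc: "continuous_on Reach V" and x: "x \<in> interior Reach - S"
begin

lemma x_reachable: "x \<in> Reach" "x \<notin> S"
  using x interior_subset by auto

text \<open>The constant in \<open>gradient_is_normal\<close> is the same for all points near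
  \<open>x\<close>, so the proximal inequality passes to the limit.\<close>

lemma limit_normals_normal:
  assumes e: "e \<in> limit_normals x"
  shows "e \<in> hypo_normals S V x"
proof -
  obtain \<delta> B where rb: "regular_ball x \<delta> B" by (rule regular_ball_exists[OF Vc x])
  then have \<delta>: "\<delta> > 0" and rs: "\<And>X. X \<in> ball x \<delta> \<Longrightarrow> X \<in> Reach" by (auto simp: regular_ball_def)
  obtain X P where XP: "\<And>n. has_gradient_ereal V (X n) (P n)" "X \<longlonglongrightarrow> x" "(\<lambda>n. unit_normal (P n)) \<longlonglongrightarrow> e"
    by (rule limit_normals_seq[OF e]) blast
  obtain m where m: "\<And>n. X (n + m) \<in> ball x \<delta>" using eventually_in_ball_shift[OF XP(2) \<delta>] by blast
  have Xl: "(\<lambda>n. X (n + m)) \<longlonglongrightarrow> x" and Pl: "(\<lambda>n. unit_normal (P (n + m))) \<longlonglongrightarrow> e"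
    using LIMSEQ_ignore_initial_segment XP by blast+
  have vl: "(\<lambda>n. v (X (n + m))) \<longlonglongrightarrow> v x"
    by (rule continuous_on_tendsto_compose[OF v_continuous[OF Vc] Xl x_reachable(1)]) (use m rs in auto)
  have "is_normal (cK B * B) x (- fst e) (snd e)"
    unfolding is_normal_def
  proof (intro allI impI)
    fix z \<beta> assume z: "z \<notin> S" "ereal \<beta> \<le> V z"
    have le: "fst (unit_normal (P (n + m))) \<bullet> (z - X (n + m)) + snd (unit_normal (P (n + m))) * (\<beta> - v (X (n + m))) \<le>
      cK B * B * ((norm (z - X (n + m)))\<^sup>2 + (\<beta> - v (X (n + m)))\<^sup>2)" for n
      using gradient_is_normal[OF rb m gradient_touches[OF XP(1)]] z
      unfolding is_normal_def unit_normal_def by (simp add: inner_minus_left)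
    show "- (- fst e \<bullet> (z - x)) + snd e * (\<beta> - v x) \<le> cK B * B * ((norm (z - x))\<^sup>2 + (\<beta> - v x)\<^sup>2)"
    proof (rule tendsto_le[OF sequentially_bot])
      show "(\<lambda>n. cK B * B * ((norm (z - X (n + m)))\<^sup>2 + (\<beta> - v (X (n + m)))\<^sup>2)) \<longlonglongrightarrow> cK B * B * ((norm (z - x))\<^sup>2 + (\<beta> - v x)\<^sup>2)"
        by (intro tendsto_intros Xl vl)
      have "(\<lambda>n. fst (unit_normal (P (n + m))) \<bullet> (z - X (n + m)) + snd (unit_normal (P (n + m))) * (\<beta> - v (X (n + m)))) \<longlonglongrightarrow>
        fst e \<bullet> (z - x) + snd e * (\<beta> - v x)" by (intro tendsto_intros Xl vl Pl)
      then show "(\<lambda>n. fst (unit_normal (P (n + m))) \<bullet> (z - X (n + m)) + snd (unit_normal (P (n + m))) * (\<beta> - v (X (n + m)))) \<longlonglongrightarrow>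
        - (- fst e \<bullet> (z - x)) + snd e * (\<beta> - v x)" by simp
    qed (intro always_eventually allI le)
  qed
  then have "(fst e, snd e) \<in> hypo_normals S V x"
    unfolding hypo_normals_iff[OF x_reachable] using limit_normals_unit(2)[OF e] by blast
  then show ?thesis by simp
qed

text \<open>Pointedness makes the cone without 0 convex, so the hull of the limit normals is compact
  and avoids 0 and can be strictly separated from the ray of \<open>y\<close>. Strictness is what
  turns separation of the limits into a bound for all gradients near \<open>x\<close>.\<close>

lemma hypo_normals_generated:
  assumes pt: "pointed (hypo_normals S V x)" and y: "y \<in> hypo_normals S V x" "y \<noteq> 0"
  shows "\<exists>t\<ge>0. \<exists>e\<in>convex hull (limit_normals x). y = t *\<^sub>R e"
proof (rule ccontr)
  assume n: "\<not> ?thesis"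
  obtain \<delta> B where rb: "regular_ball x \<delta> B" by (rule regular_ball_exists[OF Vc x])
  then have \<delta>: "\<delta> > 0" and rs: "\<And>X. X \<in> ball x \<delta> \<Longrightarrow> X \<in> Reach \<and> X \<notin> S" by (auto simp: regular_ball_def)
  have "limit_normals x \<subseteq> hypo_normals S V x - {0}"
    using limit_normals_normal limit_normals_unit(1)[of _ x] by fastforce
  then have sub: "convex hull (limit_normals x) \<subseteq> hypo_normals S V x - {0}"
    by (rule hull_minimal) (rule pointed_diff_zero_convex[OF hypo_normals_add hypo_normals_scale pt])
  obtain \<theta> \<eta> where \<theta>: "\<theta> \<noteq> 0" "(\<theta>, \<eta>) \<bullet> y > 0" "\<And>e. e \<in> convex hull (limit_normals x) \<Longrightarrow> (\<theta>, \<eta>) \<bullet> e < 0"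
    by (rule cone_separation[OF compact_convex_hull[OF limit_normals_compact] convex_convex_hull _ y(2)]) (use sub n in auto)
  obtain \<rho> where \<rho>: "\<rho> > 0" "\<And>X P. X \<noteq> x \<Longrightarrow> norm (X - x) < \<rho> \<Longrightarrow> has_gradient_ereal V X P \<Longrightarrow> \<eta> < \<theta> \<bullet> P"
    using gradients_eventually_separated[of x \<theta> \<eta>] \<theta>(3) hull_inc by metis
  obtain K where K: "is_normal K x (- fst y) (snd y)" using hypo_normals_iff[OF x_reachable, of "fst y" "snd y"] y(1) by auto
  define C where "C = \<bar>K\<bar> * ((norm \<theta>)\<^sup>2 + \<eta>\<^sup>2)"
  have C: "C \<ge> 0" by (simp add: C_def)
  \<comment> \<open>Short enough for the mean value inequality, and such that the quadratic term
    uses at most half of the product with \<open>y\<close>.\<close>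
  define t where "t = min (min \<rho> \<delta> / (2 * norm \<theta>)) ((\<theta>, \<eta>) \<bullet> y / (2 * (C + 1)))"
  have t0: "t > 0" unfolding t_def using \<rho> \<delta> \<theta> C by (auto intro!: divide_pos_pos)
  have "t * norm \<theta> \<le> min \<rho> \<delta> / (2 * norm \<theta>) * norm \<theta>" unfolding t_def by (intro mult_right_mono) auto
  also have "\<dots> = min \<rho> \<delta> / 2" using \<theta>(1) by simp
  also have "\<dots> < min \<rho> \<delta>" using \<rho>(1) \<delta> by auto
  finally have t1: "t * norm \<theta> < min \<rho> \<delta>" .
  \<comment> \<open>Hence the point reached from \<open>(x, v x)\<close> by \<open>t\<close> times
    \<open>(\<theta>, \<eta>)\<close> lies in the hypograph, and \<open>y\<close> gains a
    first-order amount on it.\<close>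
  have mv: "v x + t * \<eta> \<le> v (x + t *\<^sub>R \<theta>)"
    by (rule mean_value[OF Vc rb \<theta>(1), of "min \<rho> \<delta>"]) (use \<rho>(2) t0 t1 in auto)
  have zr: "x + t *\<^sub>R \<theta> \<in> ball x \<delta>" using t0 t1 by (simp add: dist_norm)
  have "ereal (v x + t * \<eta>) \<le> V (x + t *\<^sub>R \<theta>)"
    using mv V_real[of "x + t *\<^sub>R \<theta>"] rs[OF zr] by (metis ereal_less_eq(3))
  then have "- (- fst y \<bullet> (x + t *\<^sub>R \<theta> - x)) + snd y * (v x + t * \<eta> - v x) \<le>
    K * ((norm (x + t *\<^sub>R \<theta> - x))\<^sup>2 + (v x + t * \<eta> - v x)\<^sup>2)"
    using K rs[OF zr] unfolding is_normal_def by blast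
  then have "t * ((\<theta>, \<eta>) \<bullet> y) \<le> K * (t\<^sup>2 * ((norm \<theta>)\<^sup>2 + \<eta>\<^sup>2))"
    using t0 by (simp add: inner_prod_def inner_commute power_mult_distrib algebra_simps)
  also have "\<dots> \<le> \<bar>K\<bar> * (t\<^sup>2 * ((norm \<theta>)\<^sup>2 + \<eta>\<^sup>2))" by (intro mult_right_mono) auto
  also have "\<dots> = t * (t * C)" by (simp add: C_def power2_eq_square algebra_simps)
  finally have "(\<theta>, \<eta>) \<bullet> y \<le> t * C" using t0 by simp
  also have "\<dots> \<le> ((\<theta>, \<eta>) \<bullet> y / (2 * (C + 1))) * (C + 1)"
    using C t0 \<theta>(2) by (intro mult_mono) (auto simp: t_def)
  also have "\<dots> = (\<theta>, \<eta>) \<bullet> y / 2"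
  proof -
    have "C + 1 \<noteq> 0" using C by linarith
    moreover have "k / (2 * c) * c = k / 2" if "c \<noteq> 0" for k c :: real using that by simp
    ultimately show ?thesis by blast
  qed
  finally show False using \<theta>(2) by linarith
qed

text \<open>To bound the normal cone by a convex cone \<open>D\<close> it is enough to check the
  limit normals, and \<open>D\<close> need not be closed.\<close>

lemma hypo_normals_subset_cone:
  assumes pt: "pointed (hypo_normals S V x)"
    and add: "\<And>a b. a \<in> D \<Longrightarrow> b \<in> D \<Longrightarrow> a + b \<in> D" and sc: "\<And>a c. a \<in> D \<Longrightarrow> c \<ge> 0 \<Longrightarrow> c *\<^sub>R a \<in> D" and z: "0 \<in> D"
    and E: "limit_normals x \<subseteq> D" and y: "y \<in> hypo_normals S V x"
  shows "y \<in> D"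
proof (cases "y = 0")
  case False
  obtain t e where "t \<ge> 0" "e \<in> convex hull (limit_normals x)" "y = t *\<^sub>R e"
    using hypo_normals_generated[OF pt y False] by blast
  moreover have "convex hull (limit_normals x) \<subseteq> D" by (intro hull_minimal E convex_if_cone add sc)
  ultimately show ?thesis using sc by blast
qed (use z in simp)

theorem prox_superdiff_eq:
  assumes C1: "C1_on (UNIV \<times> (UNIV - {0})) (\<lambda>(z, p). Ham f r U z p)"
    and pt: "pointed (hypo_normals S V x)"
  shows "prox_superdiff S V x = horizon_superdiff S V x + convex hull (transported_normals1 f r g U S x)"
proof -
  let ?H = "hypo_normals S V x" and ?T = "convex hull (transported_normals1 f r g U S x)"
  note add = hypo_normals_add[of _ x] and sc = hypo_normals_scale[of _ x]
  have H0: "0 \<in> ?H" using pt by (auto simp: pointed_def)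
  have T: "?T \<subseteq> {c. (- c, 1) \<in> ?H}"
  proof (rule hull_minimal)
    show "transported_normals1 f r g U S x \<subseteq> {c. (- c, 1) \<in> ?H}"
      using transported_hypo_normal[OF x_reachable, of 1] transported_normals1_iff[OF x_reachable] by auto
    show "convex {c. (- c, 1) \<in> ?H}"
      unfolding convex_def
    proof (intro ballI allI impI)
      fix a b :: "real^'d" and s t :: real
      assume "a \<in> {c. (- c, 1) \<in> ?H}" "b \<in> {c. (- c, 1) \<in> ?H}" "0 \<le> s" "0 \<le> t" and st: "s + t = 1"
      then have "s *\<^sub>R (- a, 1) + t *\<^sub>R (- b, 1) \<in> ?H" by (intro add sc) auto
      then show "s *\<^sub>R a + t *\<^sub>R b \<in> {c. (- c, 1) \<in> ?H}" using st by (simp add: algebra_simps)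
    qed
  qed
  \<comment> \<open>The sum of the horizontal normals and the cone over the hull of
    \<open>transported_normals1\<close> placed at height 1. At height 0 the second part is only its
    vertex, so the slice at height 1 is the right side of the claim.\<close>
  define D where "D = {(- (h + w), s) | h w s. (- h, 0) \<in> ?H \<and> (s = 0 \<and> w = 0 \<or> s > 0 \<and> w /\<^sub>R s \<in> ?T)}"
  have DI: "(- (h + w), s) \<in> D" if "(- h, 0) \<in> ?H" "s = 0 \<and> w = 0 \<or> s > 0 \<and> w /\<^sub>R s \<in> ?T" for h w s
    unfolding D_def using that by blast
  have D0: "0 \<in> D" using DI[of 0 0 0] H0 by (simp add: zero_prod_def)
  have Dadd: "a + b \<in> D" if ab: "a \<in> D" "b \<in> D" for a b
  proof -
    obtain h w s where 1: "a = (- (h + w), s)" "(- h, 0) \<in> ?H" "s = 0 \<and> w = 0 \<or> s > 0 \<and> w /\<^sub>R s \<in> ?T"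
      using ab(1) unfolding D_def by blast
    obtain h' w' s' where 2: "b = (- (h' + w'), s')" "(- h', 0) \<in> ?H" "s' = 0 \<and> w' = 0 \<or> s' > 0 \<and> w' /\<^sub>R s' \<in> ?T"
      using ab(2) unfolding D_def by blast
    have "(- (h + h' + (w + w')), s + s') \<in> D"
    proof (rule DI)
      show "(- (h + h'), 0) \<in> ?H" using add[OF 1(2) 2(2)] by (simp add: algebra_simps)
      show "s + s' = 0 \<and> w + w' = 0 \<or> s + s' > 0 \<and> (w + w') /\<^sub>R (s + s') \<in> ?T"
      proof (cases "s > 0 \<and> s' > 0")
        case True
        then have w: "w /\<^sub>R s \<in> ?T" "w' /\<^sub>R s' \<in> ?T" using 1 2 by auto
        have "(s / (s + s')) *\<^sub>R (w /\<^sub>R s) + (s' / (s + s')) *\<^sub>R (w' /\<^sub>R s') \<in> ?T"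
          by (rule convexD[OF convex_convex_hull w]) (use True in \<open>auto simp: add_divide_distrib[symmetric]\<close>)
        moreover have "(s / (s + s')) *\<^sub>R (w /\<^sub>R s) + (s' / (s + s')) *\<^sub>R (w' /\<^sub>R s') = (w + w') /\<^sub>R (s + s')"
        proof -
          have "s / (s + s') * inverse s = inverse (s + s')" "s' / (s + s') * inverse s' = inverse (s + s')"
            using True by (auto simp: divide_inverse)
          then show ?thesis unfolding scaleR_scaleR scaleR_add_right by simp
        qed
        ultimately show ?thesis using True by simp
      next
        case False
        then show ?thesis using 1(3) 2(3) by auto
      qed
    qed
    then show ?thesis unfolding 1(1) 2(1) by (simp add: algebra_simps)
  qed
  have Dsc: "c *\<^sub>R a \<in> D" if a: "a \<in> D" and c: "c \<ge> 0" for a and c :: real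
  proof (cases "c = 0")
    case True
    then show ?thesis using D0 by simp
  next
    case False
    obtain h w s where 1: "a = (- (h + w), s)" "(- h, 0) \<in> ?H" "s = 0 \<and> w = 0 \<or> s > 0 \<and> w /\<^sub>R s \<in> ?T"
      using a unfolding D_def by blast
    have "(- (c *\<^sub>R h + c *\<^sub>R w), c * s) \<in> D"
    proof (rule DI)
      show "(- (c *\<^sub>R h), 0) \<in> ?H" using sc[OF 1(2) c] by simp
      show "c * s = 0 \<and> c *\<^sub>R w = 0 \<or> c * s > 0 \<and> (c *\<^sub>R w) /\<^sub>R (c * s) \<in> ?T"
      proof -
        have "(c *\<^sub>R w) /\<^sub>R (c * s) = w /\<^sub>R s" using False by (simp add: mult.commute mult.left_commute)
        moreover have "c * s > 0 \<longleftrightarrow> s > 0" using False c by (simp add: zero_less_mult_iff)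
        ultimately show ?thesis using 1(3) by (metis mult_zero_right scaleR_zero_right)
      qed
    qed
    then show ?thesis unfolding 1(1) by (simp add: scaleR_add_right scaleR_diff_right)
  qed
  have DE: "limit_normals x \<subseteq> D"
  proof
    fix e assume e: "e \<in> limit_normals x"
    show "e \<in> D"
    proof (cases "snd e = 0")
      case True
      then have ee: "e = (- (- fst e + 0), 0)" by (simp add: prod_eq_iff)
      have "(- (- fst e), 0) \<in> ?H" using limit_normals_normal[OF e] ee by simp
      then show ?thesis by (subst ee) (rule DI, auto)
    next
      case False
      then have s: "snd e > 0" using limit_normals_unit(2)[OF e] by simp
      have "(- fst e) /\<^sub>R snd e \<in> ?T"
        using limiting_gradient_transported[OF Vc x C1 limit_normal_finite[OF e s]] transported_normals1_iff[OF x_reachable]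
        by (intro hull_inc) blast
      then have "(- (0 + - fst e), snd e) \<in> D" by (intro DI) (use s H0 in \<open>auto simp: zero_prod_def\<close>)
      then show ?thesis by simp
    qed
  qed
  show ?thesis
  proof (intro equalityI subsetI)
    fix w assume "w \<in> prox_superdiff S V x"
    then have wH: "(- w, 1) \<in> ?H" by (simp add: prox_superdiff_def)
    have "(- w, 1) \<in> D" by (rule hypo_normals_subset_cone[OF pt Dadd Dsc D0 DE wH])
    then obtain h w' s where e: "(- w, 1) = (- (h + w'), s)" and h: "(- h, 0) \<in> ?H" and w': "s = 0 \<and> w' = 0 \<or> s > 0 \<and> w' /\<^sub>R s \<in> ?T"
      unfolding D_def by blast
    have w: "w = h + w'" and "s = 1" using arg_cong[OF e, of fst] arg_cong[OF e, of snd] unfolding fst_conv snd_conv neg_equal_iff_equal by auto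
    then have "w' \<in> ?T" using w' by simp
    then show "w \<in> horizon_superdiff S V x + ?T" unfolding w by (intro set_plus_intro) (simp_all add: horizon_superdiff_def h)
  next
    fix w assume "w \<in> horizon_superdiff S V x + ?T"
    then obtain h c where hc: "w = h + c" "(- h, 0) \<in> ?H" "c \<in> ?T" by (auto simp: set_plus_def horizon_superdiff_def)
    then have "(- h, 0) + (- c, 1) \<in> ?H" using T by (intro add) auto
    then show "w \<in> prox_superdiff S V x" by (simp add: prox_superdiff_def hc(1))
  qed
qed

theorem horizon_superdiff_eq:
  assumes C1: "C1_on (UNIV \<times> (UNIV - {0})) (\<lambda>(z, p). Ham0 f U z p)"
    and pt: "pointed (hypo_normals S V x)"
  shows "horizon_superdiff S V x = convex hull (transported_normals0 f r g U S x \<union> {0})"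
proof -
  let ?H = "hypo_normals S V x" and ?N = "transported_normals0 f r g U S x \<union> {0}"
  note add = hypo_normals_add[of _ x] and sc = hypo_normals_scale[of _ x]
  have H0: "0 \<in> ?H" using pt by (auto simp: pointed_def)
  have sup: "convex hull ?N \<subseteq> horizon_superdiff S V x"
  proof (rule hull_minimal)
    show "?N \<subseteq> horizon_superdiff S V x"
      using transported_hypo_normal[OF x_reachable, of 0] transported_normals0_iff[OF x_reachable] H0
      by (auto simp: horizon_superdiff_def zero_prod_def)
    show "convex (horizon_superdiff S V x)"
    proof (rule convex_if_cone)
      fix a b assume "a \<in> horizon_superdiff S V x" "b \<in> horizon_superdiff S V x"
      then have "(- a, 0) + (- b, 0) \<in> ?H" by (intro add) (auto simp: horizon_superdiff_def)
      then show "a + b \<in> horizon_superdiff S V x" by (simp add: horizon_superdiff_def algebra_simps)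
    next
      fix a and c :: real assume "a \<in> horizon_superdiff S V x" "0 \<le> c"
      then have "c *\<^sub>R (- a, 0) \<in> ?H" by (intro sc) (auto simp: horizon_superdiff_def)
      then show "c *\<^sub>R a \<in> horizon_superdiff S V x" by (simp add: horizon_superdiff_def)
    qed
  qed
  \<comment> \<open>The generating set is closed under positive scaling, so its convex hull is a
    convex cone.\<close>
  have Tsc: "c *\<^sub>R w \<in> convex hull ?N" if w: "w \<in> convex hull ?N" and c: "c \<ge> 0" for w and c :: real
  proof (cases "c = 0")
    case True
    then show ?thesis by (simp add: hull_inc)
  next
    case False
    then have cp: "c > 0" using c by simp
    have "(\<lambda>w. c *\<^sub>R w) ` ?N \<subseteq> ?N"
    proof
      fix z assume "z \<in> (\<lambda>w. c *\<^sub>R w) ` ?N"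
      then obtain w where z: "z = c *\<^sub>R w" and w: "w \<in> ?N" by blast
      show "z \<in> ?N"
      proof (cases "w = 0")
        case False
        then have "transported 0 x w" using w transported_normals0_iff[OF x_reachable] by auto
        from transported_scale[OF this cp] show ?thesis unfolding z using False cp transported_normals0_iff[OF x_reachable] by simp
      qed (simp add: z)
    qed
    then have "convex hull ((\<lambda>w. c *\<^sub>R w) ` ?N) \<subseteq> convex hull ?N" by (rule hull_mono)
    then show ?thesis using w unfolding convex_hull_scaling by blast
  qed
  have Tadd: "a + b \<in> convex hull ?N" if "a \<in> convex hull ?N" "b \<in> convex hull ?N" for a b
  proof -
    have "(1/2) *\<^sub>R a + (1/2) *\<^sub>R b \<in> convex hull ?N" by (rule convexD[OF convex_convex_hull that]) auto
    from Tsc[OF this, of 2] show ?thesis by (simp add: scaleR_add_right)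
  qed
  \<comment> \<open>Only the slice at height 0 is constrained. This is a convex cone because
    nonnegative heights with sum 0 are both 0, and therefore smoothness of \<open>Ham0\<close> alone
    suffices here.\<close>
  define D :: "((real^'d) \<times> real) set" where "D = {e. 0 \<le> snd e \<and> (snd e = 0 \<longrightarrow> - fst e \<in> convex hull ?N)}"
  have "horizon_superdiff S V x \<subseteq> convex hull ?N"
  proof
    fix w assume "w \<in> horizon_superdiff S V x"
    then have wH: "(- w, 0) \<in> ?H" by (simp add: horizon_superdiff_def)
    have "(- w, 0) \<in> D"
    proof (rule hypo_normals_subset_cone[OF pt _ _ _ _ wH])
      show "a + b \<in> D" if ab: "a \<in> D" "b \<in> D" for a b
      proof -
        have "- fst (a + b) \<in> convex hull ?N" if "snd (a + b) = 0"
        proof -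
          have "snd a = 0" "snd b = 0" using ab that by (auto simp: D_def)
          then have "- fst a + - fst b \<in> convex hull ?N" using ab unfolding D_def by (intro Tadd) blast+
          then show ?thesis by simp
        qed
        then show ?thesis using ab by (auto simp: D_def)
      qed
      show "c *\<^sub>R a \<in> D" if a: "a \<in> D" and c: "c \<ge> 0" for a c
      proof -
        have "- fst (c *\<^sub>R a) \<in> convex hull ?N" if z: "snd (c *\<^sub>R a) = 0"
        proof (cases "c = 0")
          case False
          then have "- fst a \<in> convex hull ?N" using a z by (auto simp: D_def)
          from Tsc[OF this c] show ?thesis by simp
        qed (simp add: hull_inc)
        then show ?thesis using a c by (auto simp: D_def)
      qed
      show "0 \<in> D" by (simp add: D_def hull_inc)
      show "limit_normals x \<subseteq> D"
      proof
        fix e assume e: "e \<in> limit_normals x"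
        have "- fst e \<in> convex hull ?N" if s: "snd e = 0"
        proof (rule hull_inc)
          have h: "- fst e \<in> horizon_limiting_gradients V x" by (rule limit_normal_horizon[OF e s])
          then have "- fst e \<noteq> 0" by (auto simp: horizon_limiting_gradients_def)
          then show "- fst e \<in> ?N"
            using horizon_gradient_transported[OF Vc x C1 h] transported_normals0_iff[OF x_reachable] by blast
        qed
        then show "e \<in> D" using limit_normals_unit(2)[OF e] by (simp add: D_def)
      qed
    qed
    then show "w \<in> convex hull ?N" by (simp add: D_def)
  qed
  with sup show ?thesis by blast
qed

end

end

theorem theorem3p4:
  fixes f :: "real^'d \<Rightarrow> real^'m \<Rightarrow> real^'d"
    and r :: "real^'d \<Rightarrow> real^'m \<Rightarrow> real"
    and g :: "real^'d \<Rightarrow> real"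
    and U :: "(real^'m) set"
    and S :: "(real^'d) set"
    and N L r0 \<rho>0 :: real
    and x :: "real^'d"
  defines "V \<equiv> value_fun f r g U S"
  assumes "U \<noteq> {}" and "compact U"
    and "S \<noteq> {}" and "closed S"
    and "N > 0" and "L > 0" and "r0 > 0" and "\<rho>0 > 0"
    and "convexity_assm f r U"
    and "dynamics_assm f U N L"
    and "running_cost_assm r U L r0"
    and "terminal_cost_assm g S N r0"
    and "inner_ball_assm S \<rho>0"
    and "locally_semiconcave g"
    and "continuous_on (reachable f U S) V"
    and "x \<in> interior (reachable f U S) - S"
  shows "(C1_on (UNIV \<times> (UNIV - {0})) (\<lambda>(z, p). Ham f r U z p) \<longrightarrow>
           limiting_gradients V x \<subseteq> transported_normals1 f r g U S x \<and>
           (pointed (hypo_normals S V x) \<longrightarrow>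
             prox_superdiff S V x =
               horizon_superdiff S V x + convex hull (transported_normals1 f r g U S x))) \<and>
         (C1_on (UNIV \<times> (UNIV - {0})) (\<lambda>(z, p). Ham0 f U z p) \<longrightarrow>
           horizon_limiting_gradients V x \<subseteq> transported_normals0 f r g U S x \<and>
           (pointed (hypo_normals S V x) \<longrightarrow>
             horizon_superdiff S V x =
               convex hull (transported_normals0 f r g U S x \<union> {0})))"
proof -
  obtain W G where W: "open W" "frontier S \<subseteq> W" "0 \<le> G" "G < r0 / N" "\<And>x y. x \<in> W \<Longrightarrow> y \<in> W \<Longrightarrow> \<bar>g y - g x\<bar> \<le> G * norm (y - x)"
    using assms unfolding terminal_cost_assm_def by blast
  interpret exit_problem f r g U S N L r0 \<rho>0 G W
    by (rule exit_problem.intro) (use assms W in auto)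
  have Vc: "continuous_on (reachable f U S) (value_fun f r g U S)" and x: "x \<in> interior (reachable f U S) - S"
    using assms by auto
  have xr: "x \<in> reachable f U S" "x \<notin> S" using x interior_subset by auto
  show ?thesis
    unfolding V_def
  proof (intro conjI impI subsetI)
    fix w assume "C1_on (UNIV \<times> (UNIV - {0})) (\<lambda>(z, p). Ham f r U z p)" "w \<in> limiting_gradients (value_fun f r g U S) x"
    then show "w \<in> transported_normals1 f r g U S x"
      using limiting_gradient_transported[OF Vc x] transported_normals1_iff[OF xr] by blast
  next
    fix w assume "C1_on (UNIV \<times> (UNIV - {0})) (\<lambda>(z, p). Ham0 f U z p)" and w: "w \<in> horizon_limiting_gradients (value_fun f r g U S) x"
    moreover have "w \<noteq> 0" using w by (simp add: horizon_limiting_gradients_def)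
    ultimately show "w \<in> transported_normals0 f r g U S x"
      using horizon_gradient_transported[OF Vc x] transported_normals0_iff[OF xr] by blast
  qed (rule prox_superdiff_eq[OF Vc x] horizon_superdiff_eq[OF Vc x]; assumption)+
qed

end
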